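(* Let $(W,\omega)$ be a real symplectic vector space of dimension $2n$. (1) Two Jacobi curves $\Gamma=\Gamma(t)$ and $\overline\Gamma=\overline\Gamma(t)$ in $\mathscr{L}(W)$ parametrized by geometric arc are $CSp$-equivalent if and only if they have equivalent reduced Cartan matrices. (2) Two Jacobi curves $\Gamma=\Gamma(t)$ and $\overline\Gamma=\overline\Gamma(t)$ in $\mathscr{L}(W)$ are $CSp$-equivalent if and only if $ds_\Gamma(t)=ds_{\overline\Gamma}(t)$ and their reduced Cartan matrices are equivalent. (3) Fix a reduced Cartan matrix $C(t)=\begin{pmatrix}\Sigma_t&K_t\\ \mathrm{Id}&\Sigma_t\end{pmatrix}$, $t\in I\subset\mathbb{R}$, depending smoothly on $t$ ($\Sigma_t\in\mathbb{R}^{n\times n}$ skew-symmetric, $K_t\in\mathbb{R}^{n\times n}$ diagonal with diagonal elements $k_1,\dots,k_n$), with $k_1<\cdots<k_n$ and $\prod_{i=1}^n|k_i-\bar k|=1$, where $\bar k=\frac1n\sum_{j}k_j$, and a $1$-form $ds(t)\neq0$ for all $t$. Then there exists a Jacobi curve $\Gamma(t)$ such that $C_\Gamma(t)=C(t)$ and $ds_\Gamma(t)=ds(t)$. Moreover this curve is unique up to transformations by the conformal symplectic group $CSp$.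
   Context: $(u|v):=\omega(u,v)$. $CSp=CSp(W)$ is the conformal symplectic group: invertible linear maps $c\colon W\to W$ with $(c(u)|c(v))=\lambda_c(u|v)$ for some $\lambda_c\neq0$. $\mathscr{L}(W)$ is the Lagrangian Grassmannian; $\Lambda^{\pitchfork}$ is the set of Lagrangian subspaces transverse to $\Lambda$. A symplectic basis for $\omega$ is a basis $(e_1,\dots,e_n,\bar e_1,\dots,\bar e_n)$ with $(e_i|e_j)=(\bar e_i|\bar e_j)=0$, $(e_i|\bar e_j)=\delta_{ij}$. $CSp$-equivalence: two Jacobi curves $\Gamma$ and $\tilde\Gamma$ are $CSp$-equivalent if there are a change of parameter $t=\varphi(\tilde t)$ and an element $a\in CSp$ such that $a\,\Gamma(\varphi(\tilde t))=\tilde\Gamma(\tilde t)$ for all $\tilde t$. Affine structure: for $\Gamma_0\in\Delta^{\pitchfork}$, each $\Gamma\in\Delta^{\pitchfork}$ is the graph of a unique linear map $\Gamma_0\to\Delta$, and this identifies $\Delta^{\pitchfork}$ with the vector space of linear maps $A\colon\Gamma_0\to\Delta$ with $(Au|v)+(u|Av)=0$; the affine structure on $\Delta^{\pitchfork}$ is independent of the origin $\Gamma_0$. For a smooth curve $\Gamma(t)$ in $\mathscr{L}(W)$, $\dot\Gamma(t_0)$ is the quadratic form on $\Gamma(t_0)$ given by $\dot\Gamma(t_0)(v_0)=\omega(v_0,v'(t_0))$, with $v(t)\in\Gamma(t)$ any smooth curve with $v(t_0)=v_0$. Derivative curve: if $\dot\Gamma$ is nondegenerate, for each $\tau$ there is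 a unique $\Delta_\tau\in\Gamma(\tau)^{\pitchfork}$ such that $\Gamma$, viewed for $t$ near $\tau$ as a curve $\Gamma_{\Delta_\tau}$ in the affine space $\Delta_\tau^{\pitchfork}$, satisfies $\Gamma''_{\Delta_\tau}(\tau)=0$. With $\Gamma(\tau)$ as origin, $\Gamma'_{\Delta_\tau}(\tau)$ and $\Gamma'''_{\Delta_\tau}(\tau)$ are linear maps $\Gamma(\tau)\to\Delta_\tau$, the first invertible; the Ricci curvature operator is $R_\Gamma(\tau)=(\Gamma'_{\Delta_\tau}(\tau))^{-1}\circ\Gamma'''_{\Delta_\tau}(\tau)\colon\Gamma(\tau)\to\Gamma(\tau)$. Jacobi curves here are smooth curves $\Gamma$ in $\mathscr{L}(W)$, defined on an open interval, with $\dot\Gamma(t)$ definite, $R_\Gamma(t)$ having $n$ distinct real eigenvalues, and $\det(R_\Gamma(t)-\frac1n\mathrm{tr}(R_\Gamma(t))\mathrm{Id})\neq0$ for all $t$. Geometric arc: $ds_\Gamma(t)=\zeta_\Gamma(t)\,dt$ with $\zeta_\Gamma(t)=\bigl|\det(R_\Gamma(t)-\frac1n\mathrm{tr}(R_\Gamma(t))\mathrm{Id})\bigr|^{1/(2n)}$. $\Gamma$ is parametrized by geometric arc if $\zeta_\Gamma\equiv1$. Reduced Cartan matrix: suppose first that $\Gamma=\Gamma(\tau)$ is parametrized by geometric arc. If $\dot\Gamma$ is negative definite, replace $\omega$ by $-\omega$, so that $\dot\Gamma$ is positive definite. A symplectic Frenet frame is a smooth family of symplectic bases $F(\tau)=(\mathbf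 f(\tau),\overline{\mathbf f}(\tau))$ such that $\mathbf f(\tau)=(f_1,\dots,f_n)$ is a $\dot\Gamma(\tau)$-orthonormal basis of $\Gamma(\tau)$ consisting of eigenvectors of $R_\Gamma(\tau)$ and $\overline{\mathbf f}(\tau)$ is a basis of $\Delta_\tau$. The reduced Cartan matrix $C_\Gamma(\tau)$ is defined by $\frac{d}{d\tau}(\mathbf f,\overline{\mathbf f})=(\mathbf f,\overline{\mathbf f})C_\Gamma(\tau)$ (bases as row vectors); it has the form $\begin{pmatrix}\Sigma&K\\ \mathrm{Id}&\Sigma\end{pmatrix}$ with $\Sigma$ skew-symmetric and $K$ diagonal, with diagonal elements denoted $k_1,\dots,k_n$; the frame is ordered so that $k_1<\cdots<k_n$. For a Jacobi curve in an arbitrary parameter $t$, choose $\varphi$ with $\varphi'(t)=\zeta_\Gamma(t)$; then $C_\Gamma(t)$ is the reduced Cartan matrix, at $\tau=\varphi(t)$, of the reparametrized curve $\tau\mapsto\Gamma(\varphi^{-1}(\tau))$, which is parametrized by geometric arc. Two reduced Cartan matrices with blocks $(\Sigma,K)$ and $(\overline\Sigma,\overline K)$ are equivalent if there is a diagonal matrix $P$ with diagonal entries $\pm1$ such that $\overline K=PKP$ and $\overline\Sigma=P\Sigma P$.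
   Formalization: In (3) the normalization is ∏|2(k_i−k̄)|=1, since R_Γ=−2K makes the printed ∏|k_i−k̄|=1 impossible, and ds_Γ equals |ds|; in (1) and (2) the invariants are compared after a change of parameter of Γ (and at equal t for equivalence by CSp alone). *)

theory Defs
  imports "HOL-Analysis.Analysis"
begin

section \<open>Smooth functions of one real variable\<close>

definition vderiv :: "(real \<Rightarrow> 'a::real_normed_vector) \<Rightarrow> real \<Rightarrow> 'a" where
  "vderiv f t = vector_derivative f (at t)"

text \<open>Meant for open \<^term>\<open>S\<close>: all iterated derivatives exist.\<close>

definition smooth_on_line :: "(real \<Rightarrow> 'a::real_normed_vector) \<Rightarrow> real set \<Rightarrow> bool" where
  "smooth_on_line f S \<longleftrightarrow> (\<forall>k. \<forall>t\<in>S. (vderiv ^^ k) f differentiable (at t))"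

definition open_interval :: "real set \<Rightarrow> bool" where
  "open_interval I \<longleftrightarrow> open I \<and> is_interval I \<and> I \<noteq> {}"

definition change_of_parameter :: "(real \<Rightarrow> real) \<Rightarrow> real set \<Rightarrow> real set \<Rightarrow> bool" where
  "change_of_parameter \<phi> J I \<longleftrightarrow>
     bij_betw \<phi> J I \<and> smooth_on_line \<phi> J \<and> (\<forall>t\<in>J. vderiv \<phi> t \<noteq> 0)"

section \<open>Operators on subspaces\<close>

definition basis_of :: "('i::finite \<Rightarrow> 'w::real_vector) \<Rightarrow> 'w set \<Rightarrow> bool" where
  "basis_of b V \<longleftrightarrow> inj b \<and> independent (range b) \<and> span (range b) = V"

definition matrix_in :: "('i::finite \<Rightarrow> 'w::real_vector) \<Rightarrow> ('w \<Rightarrow> 'w) \<Rightarrow> real^'i^'i" where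
  "matrix_in b T = (\<chi> i j. representation (range b) (T (b j)) (b i))"

text \<open>Trace and determinant of an endomorphism \<^term>\<open>T\<close> of a subspace \<^term>\<open>V\<close> whose dimension
  is the cardinality of the index type \<^typ>\<open>'n\<close>; they do not depend on the basis chosen.\<close>

definition op_trace :: "'n::finite itself \<Rightarrow> 'w::real_vector set \<Rightarrow> ('w \<Rightarrow> 'w) \<Rightarrow> real" where
  "op_trace _ V T = trace (matrix_in (SOME b :: 'n \<Rightarrow> 'w. basis_of b V) T)"

definition op_det :: "'n::finite itself \<Rightarrow> 'w::real_vector set \<Rightarrow> ('w \<Rightarrow> 'w) \<Rightarrow> real" where
  "op_det _ V T = det (matrix_in (SOME b :: 'n \<Rightarrow> 'w. basis_of b V) T)"

definition eigenvalues_on :: "'w::real_vector set \<Rightarrow> ('w \<Rightarrow> 'w) \<Rightarrow> real set" where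
  "eigenvalues_on V T = {l. \<exists>u\<in>V. u \<noteq> 0 \<and> T u = l *\<^sub>R u}"

section \<open>Symplectic linear algebra\<close>

definition symplectic_form :: "('w::euclidean_space \<Rightarrow> 'w \<Rightarrow> real) \<Rightarrow> bool" where
  "symplectic_form \<omega> \<longleftrightarrow>
     bilinear \<omega> \<and> (\<forall>u. \<omega> u u = 0) \<and> (\<forall>u. (\<forall>v. \<omega> u v = 0) \<longrightarrow> u = 0)"

definition CSp :: "('w::euclidean_space \<Rightarrow> 'w \<Rightarrow> real) \<Rightarrow> ('w \<Rightarrow> 'w) set" where
  "CSp \<omega> = {c. linear c \<and> bij c \<and> (\<exists>l. l \<noteq> 0 \<and> (\<forall>u v. \<omega> (c u) (c v) = l * \<omega> u v))}"

definition lagrangian :: "('w::euclidean_space \<Rightarrow> 'w \<Rightarrow> real) \<Rightarrow> 'w set \<Rightarrow> bool" where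
  "lagrangian \<omega> L \<longleftrightarrow>
     subspace L \<and> (\<forall>u\<in>L. \<forall>v\<in>L. \<omega> u v = 0) \<and> 2 * dim L = DIM('w)"

definition transverse :: "'w::euclidean_space set \<Rightarrow> 'w set \<Rightarrow> bool" where
  "transverse L M \<longleftrightarrow> L \<inter> M = {0}"

text \<open>A symplectic basis is indexed by the sum type: \<^term>\<open>Inl i\<close> for $e_i$, \<^term>\<open>Inr i\<close>
  for $\bar e_i$.\<close>

definition symplectic_basis ::
    "('w::euclidean_space \<Rightarrow> 'w \<Rightarrow> real) \<Rightarrow> ('n::finite + 'n \<Rightarrow> 'w) \<Rightarrow> bool" where
  "symplectic_basis \<omega> e \<longleftrightarrow> basis_of e UNIV \<and>
     (\<forall>i j. \<omega> (e (Inl i)) (e (Inl j)) = 0 \<and> \<omega> (e (Inr i)) (e (Inr j)) = 0 \<and>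
            \<omega> (e (Inl i)) (e (Inr j)) = (if i = j then 1 else 0))"

section \<open>Curves in the Lagrangian Grassmannian\<close>

text \<open>For \<^term>\<open>L\<close> transverse to \<^term>\<open>D\<close>, the linear map \<^term>\<open>L0\<close> to \<^term>\<open>D\<close> whose graph
  is \<^term>\<open>L\<close>; only its values on \<^term>\<open>L0\<close> are meaningful.\<close>

definition graph_map :: "'w::euclidean_space set \<Rightarrow> 'w set \<Rightarrow> 'w set \<Rightarrow> 'w \<Rightarrow> 'w" where
  "graph_map L0 D L u = (THE w. w \<in> D \<and> u + w \<in> L)"

text \<open>Smoothness is taken in the affine charts of the Grassmannian. A curve of linear maps is
  differentiated pointwise, which in finite dimension is the same as in the space of maps.\<close>

definition smooth_lagrangian_curve ::
    "('w::euclidean_space \<Rightarrow> 'w \<Rightarrow> real) \<Rightarrow> (real \<Rightarrow> 'w set) \<Rightarrow> real set \<Rightarrow> bool" where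
  "smooth_lagrangian_curve \<omega> \<Gamma> I \<longleftrightarrow>
     (\<forall>t\<in>I. lagrangian \<omega> (\<Gamma> t)) \<and>
     (\<forall>t0\<in>I. \<exists>D e. e > 0 \<and> ball t0 e \<subseteq> I \<and> lagrangian \<omega> D \<and>
        (\<forall>t\<in>ball t0 e. transverse (\<Gamma> t) D) \<and>
        (\<forall>u\<in>\<Gamma> t0. smooth_on_line (\<lambda>t. graph_map (\<Gamma> t0) D (\<Gamma> t) u) (ball t0 e)))"

definition velocity_form ::
    "('w::euclidean_space \<Rightarrow> 'w \<Rightarrow> real) \<Rightarrow> (real \<Rightarrow> 'w set) \<Rightarrow> real \<Rightarrow> 'w \<Rightarrow> real" where
  "velocity_form \<omega> \<Gamma> t0 v0 = (THE q. \<exists>v e. e > 0 \<and> smooth_on_line v (ball t0 e) \<and>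
     (\<forall>t\<in>ball t0 e. v t \<in> \<Gamma> t) \<and> v t0 = v0 \<and> q = \<omega> v0 (vderiv v t0))"

definition positive_definite_on :: "'w::real_vector set \<Rightarrow> ('w \<Rightarrow> real) \<Rightarrow> bool" where
  "positive_definite_on V q \<longleftrightarrow> (\<forall>v\<in>V. v \<noteq> 0 \<longrightarrow> q v > 0)"

definition negative_definite_on :: "'w::real_vector set \<Rightarrow> ('w \<Rightarrow> real) \<Rightarrow> bool" where
  "negative_definite_on V q \<longleftrightarrow> (\<forall>v\<in>V. v \<noteq> 0 \<longrightarrow> q v < 0)"

definition polar_form :: "('w::real_vector \<Rightarrow> real) \<Rightarrow> 'w \<Rightarrow> 'w \<Rightarrow> real" where
  "polar_form q u v = (q (u + v) - q u - q v) / 2"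

text \<open>The \<^term>\<open>k\<close>-th derivative at \<^term>\<open>\<tau>\<close> of the curve read in the affine space of
  complements of \<^term>\<open>D\<close>, with origin \<^term>\<open>\<Gamma> \<tau>\<close>.\<close>

definition affine_deriv ::
    "nat \<Rightarrow> (real \<Rightarrow> 'w::euclidean_space set) \<Rightarrow> 'w set \<Rightarrow> real \<Rightarrow> 'w \<Rightarrow> 'w" where
  "affine_deriv k \<Gamma> D \<tau> u = (vderiv ^^ k) (\<lambda>t. graph_map (\<Gamma> \<tau>) D (\<Gamma> t) u) \<tau>"

definition derivative_curve ::
    "('w::euclidean_space \<Rightarrow> 'w \<Rightarrow> real) \<Rightarrow> (real \<Rightarrow> 'w set) \<Rightarrow> real \<Rightarrow> 'w set" where
  "derivative_curve \<omega> \<Gamma> \<tau> = (THE D. lagrangian \<omega> D \<and> transverse D (\<Gamma> \<tau>) \<and>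
     (\<forall>u\<in>\<Gamma> \<tau>. affine_deriv 2 \<Gamma> D \<tau> u = 0))"

definition ricci ::
    "('w::euclidean_space \<Rightarrow> 'w \<Rightarrow> real) \<Rightarrow> (real \<Rightarrow> 'w set) \<Rightarrow> real \<Rightarrow> 'w \<Rightarrow> 'w" where
  "ricci \<omega> \<Gamma> \<tau> u = (THE w. w \<in> \<Gamma> \<tau> \<and>
     affine_deriv 1 \<Gamma> (derivative_curve \<omega> \<Gamma> \<tau>) \<tau> w =
     affine_deriv 3 \<Gamma> (derivative_curve \<omega> \<Gamma> \<tau>) \<tau> u)"

definition traceless_ricci_det ::
    "'n::finite itself \<Rightarrow> ('w::euclidean_space \<Rightarrow> 'w \<Rightarrow> real) \<Rightarrow> (real \<Rightarrow> 'w set) \<Rightarrow> real \<Rightarrow> real" where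
  "traceless_ricci_det N \<omega> \<Gamma> t = op_det N (\<Gamma> t)
     (\<lambda>u. ricci \<omega> \<Gamma> t u - (op_trace N (\<Gamma> t) (ricci \<omega> \<Gamma> t) / real CARD('n)) *\<^sub>R u)"

definition jacobi_curve ::
    "'n::finite itself \<Rightarrow> ('w::euclidean_space \<Rightarrow> 'w \<Rightarrow> real) \<Rightarrow> (real \<Rightarrow> 'w set) \<Rightarrow> real set \<Rightarrow> bool"
  where
  "jacobi_curve N \<omega> \<Gamma> I \<longleftrightarrow> open_interval I \<and> smooth_lagrangian_curve \<omega> \<Gamma> I \<and>
     (\<forall>t\<in>I. (positive_definite_on (\<Gamma> t) (velocity_form \<omega> \<Gamma> t) \<or>
             negative_definite_on (\<Gamma> t) (velocity_form \<omega> \<Gamma> t)) \<and>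
            card (eigenvalues_on (\<Gamma> t) (ricci \<omega> \<Gamma> t)) = CARD('n) \<and>
            traceless_ricci_det N \<omega> \<Gamma> t \<noteq> 0)"

text \<open>The coefficient $\zeta_\Gamma$ of the geometric arc element $ds_\Gamma = \zeta_\Gamma\,dt$.\<close>

definition arc_density ::
    "'n::finite itself \<Rightarrow> ('w::euclidean_space \<Rightarrow> 'w \<Rightarrow> real) \<Rightarrow> (real \<Rightarrow> 'w set) \<Rightarrow> real \<Rightarrow> real" where
  "arc_density N \<omega> \<Gamma> t = \<bar>traceless_ricci_det N \<omega> \<Gamma> t\<bar> powr (1 / (2 * real CARD('n)))"

definition geometric_arc ::
    "'n::finite itself \<Rightarrow> ('w::euclidean_space \<Rightarrow> 'w \<Rightarrow> real) \<Rightarrow> (real \<Rightarrow> 'w set) \<Rightarrow> real set \<Rightarrow> bool"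
  where
  "geometric_arc N \<omega> \<Gamma> I \<longleftrightarrow> (\<forall>t\<in>I. arc_density N \<omega> \<Gamma> t = 1)"

section \<open>Frenet frames and reduced Cartan matrices\<close>

definition oriented_form ::
    "('w::euclidean_space \<Rightarrow> 'w \<Rightarrow> real) \<Rightarrow> (real \<Rightarrow> 'w set) \<Rightarrow> real set \<Rightarrow> 'w \<Rightarrow> 'w \<Rightarrow> real" where
  "oriented_form \<omega> \<Gamma> I =
     (if \<forall>t\<in>I. negative_definite_on (\<Gamma> t) (velocity_form \<omega> \<Gamma> t) then (\<lambda>u v. - \<omega> u v) else \<omega>)"

definition frenet_frame ::
    "('w::euclidean_space \<Rightarrow> 'w \<Rightarrow> real) \<Rightarrow> (real \<Rightarrow> 'w set) \<Rightarrow> real set \<Rightarrow>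
     (real \<Rightarrow> 'n::finite + 'n \<Rightarrow> 'w) \<Rightarrow> bool" where
  "frenet_frame \<omega> \<Gamma> I F \<longleftrightarrow>
     (\<forall>i. smooth_on_line (\<lambda>\<tau>. F \<tau> i) I) \<and>
     (\<forall>\<tau>\<in>I. symplectic_basis \<omega> (F \<tau>) \<and>
        basis_of (\<lambda>i. F \<tau> (Inl i)) (\<Gamma> \<tau>) \<and>
        (\<forall>i j. polar_form (velocity_form \<omega> \<Gamma> \<tau>) (F \<tau> (Inl i)) (F \<tau> (Inl j)) =
               (if i = j then 1 else 0)) \<and>
        (\<forall>i. \<exists>l. ricci \<omega> \<Gamma> \<tau> (F \<tau> (Inl i)) = l *\<^sub>R F \<tau> (Inl i)) \<and>
        basis_of (\<lambda>i. F \<tau> (Inr i)) (derivative_curve \<omega> \<Gamma> \<tau>))"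

text \<open>The frame is determined up to constant signs of the pairs $(f_i, \bar f_i)$, so the reduced
  Cartan matrix of a curve is a relation rather than a function. In the equation $F' = F C$ frames
  are row vectors; the entry at \<^term>\<open>Inl i\<close>, \<^term>\<open>Inr i\<close> is $k_i$.\<close>

definition arc_cartan_matrix ::
    "('w::euclidean_space \<Rightarrow> 'w \<Rightarrow> real) \<Rightarrow> (real \<Rightarrow> 'w set) \<Rightarrow> real set \<Rightarrow>
     (real \<Rightarrow> real^('n::{finite,linorder} + 'n)^('n + 'n)) \<Rightarrow> bool" where
  "arc_cartan_matrix \<omega> \<Gamma> I C \<longleftrightarrow> (\<exists>F. frenet_frame (oriented_form \<omega> \<Gamma> I) \<Gamma> I F \<and>
     (\<forall>\<tau>\<in>I. (\<forall>j. ((\<lambda>s. F s j) has_vector_derivative (\<Sum>i\<in>UNIV. C \<tau> $ i $ j *\<^sub>R F \<tau> i)) (at \<tau>)) \<and>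
             (\<forall>i j. i < j \<longrightarrow> C \<tau> $ Inl i $ Inr i < C \<tau> $ Inl j $ Inr j)))"

definition reduced_cartan_matrix ::
    "('w::euclidean_space \<Rightarrow> 'w \<Rightarrow> real) \<Rightarrow> (real \<Rightarrow> 'w set) \<Rightarrow> real set \<Rightarrow>
     (real \<Rightarrow> real^('n::{finite,linorder} + 'n)^('n + 'n)) \<Rightarrow> bool" where
  "reduced_cartan_matrix \<omega> \<Gamma> I C \<longleftrightarrow>
     (\<exists>\<phi>. (\<forall>t\<in>I. (\<phi> has_real_derivative arc_density TYPE('n) \<omega> \<Gamma> t) (at t)) \<and>
          arc_cartan_matrix \<omega> (\<Gamma> \<circ> inv_into I \<phi>) (\<phi> ` I) (C \<circ> inv_into I \<phi>))"

definition cartan_block :: "real^'n^'n \<Rightarrow> real^'n^'n \<Rightarrow> real^('n::finite + 'n)^('n + 'n)" where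
  "cartan_block S K = (\<chi> i j. case i of
       Inl a \<Rightarrow> (case j of Inl b \<Rightarrow> S $ a $ b | Inr b \<Rightarrow> K $ a $ b)
     | Inr a \<Rightarrow> (case j of Inl b \<Rightarrow> mat 1 $ a $ b | Inr b \<Rightarrow> S $ a $ b))"

definition diagonal_matrix :: "real^'n^'n::finite \<Rightarrow> bool" where
  "diagonal_matrix A \<longleftrightarrow> (\<forall>i j. i \<noteq> j \<longrightarrow> A $ i $ j = 0)"

text \<open>The sign matrix \<^term>\<open>P\<close> is one and the same for all parameter values.\<close>

definition cartan_equivalent ::
    "real set \<Rightarrow> (real \<Rightarrow> real^('n::finite + 'n)^('n + 'n)) \<Rightarrow>
     (real \<Rightarrow> real^('n + 'n)^('n + 'n)) \<Rightarrow> bool" where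
  "cartan_equivalent I C C' \<longleftrightarrow> (\<exists>P S K S' K'.
     diagonal_matrix P \<and> (\<forall>i. P $ i $ i = 1 \<or> P $ i $ i = -1) \<and>
     (\<forall>t\<in>I. C t = cartan_block (S t) (K t) \<and> C' t = cartan_block (S' t) (K' t) \<and>
            K' t = P ** K t ** P \<and> S' t = P ** S t ** P))"

definition equivalent_cartan_matrices ::
    "'n::{finite,linorder} itself \<Rightarrow> ('w::euclidean_space \<Rightarrow> 'w \<Rightarrow> real) \<Rightarrow>
     (real \<Rightarrow> 'w set) \<Rightarrow> (real \<Rightarrow> 'w set) \<Rightarrow> real set \<Rightarrow> bool" where
  "equivalent_cartan_matrices _ \<omega> \<Gamma> \<Gamma>' I \<longleftrightarrow>
     (\<exists>C C' :: real \<Rightarrow> real^('n + 'n)^('n + 'n).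
        reduced_cartan_matrix \<omega> \<Gamma> I C \<and> reduced_cartan_matrix \<omega> \<Gamma>' I C' \<and>
        cartan_equivalent I C C')"

section \<open>Equivalence of curves\<close>

definition CSp_congruent ::
    "('w::euclidean_space \<Rightarrow> 'w \<Rightarrow> real) \<Rightarrow> (real \<Rightarrow> 'w set) \<Rightarrow> (real \<Rightarrow> 'w set) \<Rightarrow> real set \<Rightarrow> bool"
  where
  "CSp_congruent \<omega> \<Gamma> \<Gamma>' I \<longleftrightarrow> (\<exists>a\<in>CSp \<omega>. \<forall>t\<in>I. a ` \<Gamma> t = \<Gamma>' t)"

definition CSp_equivalent ::
    "('w::euclidean_space \<Rightarrow> 'w \<Rightarrow> real) \<Rightarrow> (real \<Rightarrow> 'w set) \<Rightarrow> real set \<Rightarrow>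
     (real \<Rightarrow> 'w set) \<Rightarrow> real set \<Rightarrow> bool" where
  "CSp_equivalent \<omega> \<Gamma> I \<Gamma>' J \<longleftrightarrow>
     (\<exists>\<phi>. change_of_parameter \<phi> J I \<and> CSp_congruent \<omega> (\<Gamma> \<circ> \<phi>) \<Gamma>' J)"

end

theory Submission
  imports Defs
begin

text \<open>Call a moving frame (f, h) with f spanning \<open>\<Gamma>\<close> and f' = f S + h, h' = f K + h S a Cartan
  frame. Writing a section of \<open>\<Gamma>\<close> as f c, the covariant derivative c' + S c of its coordinates
  vanishes at a point exactly when the section moves in the direction of h there; differentiating
  three times shows that the derivative curve is spanned by h and that the Ricci operator is
  -2 K in the basis f. A symplectic Cartan frame with K diagonal is a Frenet frame, and a change
  of parameter \<open>\<phi>\<close> acts on K by \<open>\<phi>'\<^sup>2\<close> K plus a multiple of the identity, so the geometric arc is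
  invariant.

  Every curve with definite velocity has a Cartan frame with S = 0. The endomorphism V of W
  which kills \<open>\<Gamma>\<close> and maps the velocity of a section to the section depends smoothly on t, its
  derivative is a reflection with axis \<open>\<Gamma>\<close>, and the solutions of e' = - V'' e / 2 that start in
  \<open>\<Gamma>\<close> stay in \<open>\<Gamma>\<close> with e'' in \<open>\<Gamma>\<close>. Diagonalising K smoothly, which is possible because its
  eigenvalues are simple, gives the Frenet frame.

  Two frames with the same structure equations differ by a constant linear map, which gives
  the equivalence; conversely the linear equation F' = F C preserves the symplectic relations,
  which gives the existence.\<close>

section \<open>Calculus of smooth functions of one real variable\<close>

text \<open>Local frames of \<Gamma> exist only near a point and eigenvectors are determined only up
  to sign, so neither can be picked smoothly on the whole interval. Both times an operator field
  that involves no choice (the endomorphism V, respectively the eigenprojections of K) is shown to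
  be smooth, and linear transport along it produces a global frame. The generator -V''/2 is forced:
  if V' e = -e and V' e' = e', then differentiating the first relation gives V'' e = -2 e'. A sign
  \<sigma> accompanies the form throughout. Negative velocity, a decreasing parameter and a
  conformal factor l < 0 each turn \<omega> into -\<omega>, so frames are symplectic for \<sigma>
  \<omega> and the signs multiply. The Ricci operator -2 K is where the factor 2 in the normalising
  product of part (3) comes from.\<close>

lemma vderiv_eqI: "(f has_vector_derivative f') (at t) \<Longrightarrow> vderiv f t = f'"
  unfolding vderiv_def by (rule vector_derivative_at)

lemma has_vector_derivative_vderiv:
  "f differentiable (at t) \<Longrightarrow> (f has_vector_derivative vderiv f t) (at t)"
  unfolding vderiv_def by (simp add: vector_derivative_works)

text \<open>Smoothness to finite order is the induction variable of the closure properties: rules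
  such as Leibniz express the derivative of a compound through functions that are known to order k
  only.\<close>

definition ksmooth :: "nat \<Rightarrow> (real \<Rightarrow> 'a::real_normed_vector) \<Rightarrow> real set \<Rightarrow> bool" where
  "ksmooth k f S \<longleftrightarrow> (\<forall>j<k. \<forall>t\<in>S. (vderiv ^^ j) f differentiable (at t))"

lemma smooth_iff_ksmooth: "smooth_on_line f S \<longleftrightarrow> (\<forall>k. ksmooth k f S)"
  unfolding smooth_on_line_def ksmooth_def by blast

lemma ksmooth_0 [simp]: "ksmooth 0 f S"
  by (simp add: ksmooth_def)

lemma ksmooth_Suc:
  "ksmooth (Suc k) f S \<longleftrightarrow> (\<forall>t\<in>S. f differentiable (at t)) \<and> ksmooth k (vderiv f) S"
proof -
  have "(vderiv ^^ Suc j) f = (vderiv ^^ j) (vderiv f)" for j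
    by (simp add: funpow_swap1)
  then show ?thesis
    unfolding ksmooth_def by (auto simp: less_Suc_eq_0_disj simp del: funpow.simps(2))
qed

lemma ksmooth_mono: "ksmooth k f S \<Longrightarrow> j \<le> k \<Longrightarrow> ksmooth j f S"
  unfolding ksmooth_def by auto

lemma ksmooth_cong:
  assumes "open S" "\<And>t. t \<in> S \<Longrightarrow> f t = g t" "ksmooth k f S"
  shows "ksmooth k g S"
  using assms(2,3)
proof (induction k arbitrary: f g)
  case (Suc k)
  have d: "(g has_vector_derivative vderiv f t) (at t)" if "t \<in> S" for t
    using has_vector_derivative_transform_within_open[OF has_vector_derivative_vderiv \<open>open S\<close> that]
      Suc.prems that by (auto simp: ksmooth_Suc)
  have "ksmooth k (vderiv g) S"
    using Suc.IH[of "vderiv f" "vderiv g"] Suc.prems(2) vderiv_eqI[OF d] by (auto simp: ksmooth_Suc)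
  then show ?case using d by (auto simp: ksmooth_Suc intro: differentiableI_vector)
qed simp

lemma ksmooth_SucI:
  assumes "open S" "\<And>t. t \<in> S \<Longrightarrow> (f has_vector_derivative f' t) (at t)" "ksmooth k f' S"
  shows "ksmooth (Suc k) f S"
  using assms ksmooth_cong[of S f' "vderiv f" k] vderiv_eqI[OF assms(2)]
  by (auto simp: ksmooth_Suc intro: differentiableI_vector)

lemma ksmooth_SucD:
  assumes "ksmooth (Suc k) f S"
  shows "\<And>t. t \<in> S \<Longrightarrow> (f has_vector_derivative vderiv f t) (at t)"
    "ksmooth k (vderiv f) S" "ksmooth k f S"
  using assms ksmooth_mono[OF assms, of k] by (auto simp: ksmooth_Suc has_vector_derivative_vderiv)

lemma ksmooth_const: "open S \<Longrightarrow> ksmooth k (\<lambda>t. c) S"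
proof (induction k arbitrary: c)
  case (Suc k)
  then show ?case by (intro ksmooth_SucI[where f' = "\<lambda>t. 0"]) auto
qed simp

lemma ksmooth_add:
  assumes "open S" "ksmooth k f S" "ksmooth k g S"
  shows "ksmooth k (\<lambda>t. f t + g t) S"
  using assms(2,3)
proof (induction k arbitrary: f g)
  case (Suc k)
  show ?case
    by (rule ksmooth_SucI[where f' = "\<lambda>t. vderiv f t + vderiv g t"])
       (use assms(1) Suc ksmooth_SucD[OF Suc.prems(1)] ksmooth_SucD[OF Suc.prems(2)] in
         \<open>auto intro!: has_vector_derivative_add\<close>)
qed simp

lemma ksmooth_bilinear:
  assumes "bounded_bilinear b" "open S" "ksmooth k f S" "ksmooth k g S"
  shows "ksmooth k (\<lambda>t. b (f t) (g t)) S"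
  using assms(3,4)
proof (induction k arbitrary: f g)
  case (Suc k)
  note f = ksmooth_SucD[OF Suc.prems(1)] and g = ksmooth_SucD[OF Suc.prems(2)]
  show ?case
  proof (rule ksmooth_SucI[OF assms(2)])
    show "((\<lambda>t. b (f t) (g t)) has_vector_derivative b (f t) (vderiv g t) + b (vderiv f t) (g t)) (at t)"
      if "t \<in> S" for t
      by (intro bounded_bilinear.has_vector_derivative[OF assms(1)] f g that)
    show "ksmooth k (\<lambda>t. b (f t) (vderiv g t) + b (vderiv f t) (g t)) S"
      by (intro ksmooth_add assms(2) Suc.IH f g)
  qed
qed simp

lemma ksmooth_linear:
  assumes "bounded_linear l" "open S" "ksmooth k f S"
  shows "ksmooth k (\<lambda>t. l (f t)) S"
  using assms(3)
proof (induction k arbitrary: f)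
  case (Suc k)
  show ?case
    by (rule ksmooth_SucI[where f' = "\<lambda>t. l (vderiv f t)"])
       (use assms(2) Suc ksmooth_SucD[OF Suc.prems] bounded_linear.has_vector_derivative[OF assms(1)]
         in auto)
qed simp

lemma ksmooth_compose:
  assumes "open I" "open J" "\<And>t. t \<in> J \<Longrightarrow> p t \<in> I" "ksmooth k f I" "ksmooth k p J"
  shows "ksmooth k (\<lambda>t. f (p t)) J"
  using assms(4,5)
proof (induction k arbitrary: f)
  case (Suc k)
  note f = ksmooth_SucD[OF Suc.prems(1)] and p = ksmooth_SucD[OF Suc.prems(2)]
  show ?case
  proof (rule ksmooth_SucI[OF assms(2)])
    show "((\<lambda>t. f (p t)) has_vector_derivative vderiv p t *\<^sub>R vderiv f (p t)) (at t)"
      if "t \<in> J" for t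
      using vector_diff_chain_at[OF p(1)[OF that] f(1)[OF assms(3)[OF that]]] by (simp add: o_def)
    show "ksmooth k (\<lambda>t. vderiv p t *\<^sub>R vderiv f (p t)) J"
      by (intro ksmooth_bilinear[OF bounded_bilinear_scaleR assms(2)] Suc.IH f p)
  qed
qed simp

text \<open>The derivative of 1/f is made of f' and 1/f itself, so order k for 1/f gives order k +
  1. The same self-reference proves smoothness of powers, of inverse functions and of solutions of
  linear differential equations.\<close>

lemma ksmooth_inverse:
  fixes f :: "real \<Rightarrow> real"
  assumes "open S" "\<And>t. t \<in> S \<Longrightarrow> f t \<noteq> 0" "ksmooth k f S"
  shows "ksmooth k (\<lambda>t. inverse (f t)) S"
  using assms(3)
proof (induction k)
  case (Suc k)
  note f = ksmooth_SucD[OF Suc.prems]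
  show ?case
  proof (rule ksmooth_SucI[OF assms(1)])
    show "((\<lambda>t. inverse (f t)) has_vector_derivative (-1) *\<^sub>R (vderiv f t * (inverse (f t) * inverse (f t)))) (at t)"
      if "t \<in> S" for t
      using f(1)[OF that] assms(2)[OF that] unfolding has_real_derivative_iff_has_vector_derivative[symmetric]
      by (auto intro!: derivative_eq_intros simp: power2_eq_square field_simps)
    show "ksmooth k (\<lambda>t. (-1) *\<^sub>R (vderiv f t * (inverse (f t) * inverse (f t)))) S"
      by (intro ksmooth_bilinear[OF bounded_bilinear_scaleR assms(1)]
          ksmooth_bilinear[OF bounded_bilinear_mult assms(1)] Suc.IH f ksmooth_const assms(1))
  qed
qed simp

lemma ksmooth_powr:
  fixes f :: "real \<Rightarrow> real"
  assumes "open S" "\<And>t. t \<in> S \<Longrightarrow> f t > 0" "ksmooth k f S"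
  shows "ksmooth k (\<lambda>t. f t powr a) S"
  using assms(3)
proof (induction k)
  case (Suc k)
  note f = ksmooth_SucD[OF Suc.prems]
  show ?case
  proof (rule ksmooth_SucI[OF assms(1)])
    show "((\<lambda>t. f t powr a) has_vector_derivative a *\<^sub>R ((f t powr a) * (vderiv f t * inverse (f t)))) (at t)"
      if "t \<in> S" for t
      using f(1)[OF that] assms(2)[OF that] unfolding has_real_derivative_iff_has_vector_derivative[symmetric]
      by (auto intro!: derivative_eq_intros simp: powr_diff field_simps)
    show "ksmooth k (\<lambda>t. a *\<^sub>R ((f t powr a) * (vderiv f t * inverse (f t)))) S"
      by (intro ksmooth_bilinear[OF bounded_bilinear_scaleR assms(1)] Suc.IH f ksmooth_inverse
          ksmooth_bilinear[OF bounded_bilinear_mult assms(1)]  ksmooth_const assms(1))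
         (use assms(2) in force)
  qed
qed simp

section \<open>Closure properties of smooth functions\<close>

lemma smooth_D:
  assumes "smooth_on_line f S"
  shows "\<And>t. t \<in> S \<Longrightarrow> (f has_vector_derivative vderiv f t) (at t)"
    "smooth_on_line (vderiv f) S"
  using assms ksmooth_SucD[of _ f S] unfolding smooth_iff_ksmooth by blast+

lemma smooth_continuous_on: "smooth_on_line f S \<Longrightarrow> continuous_on S f"
  by (meson continuous_at_imp_continuous_on has_vector_derivative_continuous smooth_D(1))

lemma smooth_subset: "smooth_on_line f S \<Longrightarrow> T \<subseteq> S \<Longrightarrow> smooth_on_line f T"
  unfolding smooth_on_line_def by auto

lemma smooth_cong:
  "open S \<Longrightarrow> (\<And>t. t \<in> S \<Longrightarrow> f t = g t) \<Longrightarrow> smooth_on_line f S \<Longrightarrow> smooth_on_line g S"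
  unfolding smooth_iff_ksmooth using ksmooth_cong by blast

lemma smooth_locally:
  assumes "\<And>t. t \<in> S \<Longrightarrow> \<exists>e>0. smooth_on_line f (ball t e)"
  shows "smooth_on_line f S"
  unfolding smooth_on_line_def by (meson assms centre_in_ball smooth_on_line_def)

lemma smooth_const: "open S \<Longrightarrow> smooth_on_line (\<lambda>t. c) S"
  unfolding smooth_iff_ksmooth using ksmooth_const by blast

lemma smooth_add:
  "open S \<Longrightarrow> smooth_on_line f S \<Longrightarrow> smooth_on_line g S \<Longrightarrow> smooth_on_line (\<lambda>t. f t + g t) S"
  unfolding smooth_iff_ksmooth using ksmooth_add by blast

lemma smooth_bilinear:
  "bounded_bilinear b \<Longrightarrow> open S \<Longrightarrow> smooth_on_line f S \<Longrightarrow> smooth_on_line g S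
    \<Longrightarrow> smooth_on_line (\<lambda>t. b (f t) (g t)) S"
  unfolding smooth_iff_ksmooth using ksmooth_bilinear by blast

lemmas smooth_scaleR = smooth_bilinear[OF bounded_bilinear_scaleR]
lemmas smooth_mult = smooth_bilinear[OF bounded_bilinear_mult]

lemma smooth_linear:
  "bounded_linear l \<Longrightarrow> open S \<Longrightarrow> smooth_on_line f S \<Longrightarrow> smooth_on_line (\<lambda>t. l (f t)) S"
  unfolding smooth_iff_ksmooth using ksmooth_linear by blast

lemma smooth_diff:
  "open S \<Longrightarrow> smooth_on_line f S \<Longrightarrow> smooth_on_line g S \<Longrightarrow> smooth_on_line (\<lambda>t. f t - g t) S"
  using smooth_add[of S f "\<lambda>t. - g t"] smooth_linear[OF bounded_linear_minus[OF bounded_linear_ident]]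
  by auto

lemma smooth_compose:
  "open I \<Longrightarrow> open J \<Longrightarrow> (\<And>t. t \<in> J \<Longrightarrow> p t \<in> I) \<Longrightarrow> smooth_on_line f I \<Longrightarrow> smooth_on_line p J
    \<Longrightarrow> smooth_on_line (\<lambda>t. f (p t)) J"
  unfolding smooth_iff_ksmooth using ksmooth_compose[of I J p] by blast

lemma smooth_inverse:
  fixes f :: "real \<Rightarrow> real"
  shows "open S \<Longrightarrow> (\<And>t. t \<in> S \<Longrightarrow> f t \<noteq> 0) \<Longrightarrow> smooth_on_line f S \<Longrightarrow> smooth_on_line (\<lambda>t. inverse (f t)) S"
  unfolding smooth_iff_ksmooth using ksmooth_inverse by blast

lemma smooth_powr:
  fixes f :: "real \<Rightarrow> real"
  shows "open S \<Longrightarrow> (\<And>t. t \<in> S \<Longrightarrow> f t > 0) \<Longrightarrow> smooth_on_line f S \<Longrightarrow> smooth_on_line (\<lambda>t. f t powr a) S"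
  unfolding smooth_iff_ksmooth using ksmooth_powr by blast

lemma smooth_sum:
  assumes "open S" "\<And>i. i \<in> A \<Longrightarrow> smooth_on_line (f i) S"
  shows "smooth_on_line (\<lambda>t. \<Sum>i\<in>A. f i t) S"
  using assms(2) by (induction A rule: infinite_finite_induct) (auto intro: smooth_const smooth_add assms(1))

lemma ksmooth_sum:
  assumes "open S" "\<And>i. i \<in> A \<Longrightarrow> ksmooth k (f i) S"
  shows "ksmooth k (\<lambda>t. \<Sum>i\<in>A. f i t) S"
  using assms(2) by (induction A rule: infinite_finite_induct) (auto intro: ksmooth_const ksmooth_add assms(1))

lemma smooth_prod:
  fixes f :: "'i \<Rightarrow> real \<Rightarrow> real"
  assumes "open S" "\<And>i. i \<in> A \<Longrightarrow> smooth_on_line (f i) S"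
  shows "smooth_on_line (\<lambda>t. \<Prod>i\<in>A. f i t) S"
  using assms(2) by (induction A rule: infinite_finite_induct) (auto intro: smooth_const smooth_mult assms(1))

lemma smooth_vec_nth:
  "open S \<Longrightarrow> smooth_on_line f S \<Longrightarrow> smooth_on_line (\<lambda>t. f t $ i) S"
  by (rule smooth_linear[OF bounded_linear_vec_nth])

lemma bounded_linear_axis: "bounded_linear (axis i :: 'a::euclidean_space \<Rightarrow> 'a^'n)"
  unfolding linear_conv_bounded_linear[symmetric]
  by (rule linearI) (auto simp: axis_def vec_eq_iff)

lemma smooth_vec_lambda:
  fixes f :: "real \<Rightarrow> 'n::finite \<Rightarrow> 'a::euclidean_space"
  assumes "open S" "\<And>i. smooth_on_line (\<lambda>t. f t i) S"
  shows "smooth_on_line (\<lambda>t. \<chi> i. f t i) S"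
proof -
  have "(\<chi> i. f t i) = (\<Sum>i\<in>UNIV. axis i (f t i))" for t
    by (simp add: vec_eq_iff axis_def if_distrib[of "\<lambda>x. x $ _"] cong: if_cong)
  then show ?thesis
    using smooth_sum[OF assms(1), of UNIV "\<lambda>i t. axis i (f t i)"]
      smooth_linear[OF bounded_linear_axis assms(1) assms(2)] by auto
qed

lemma smooth_det:
  fixes A :: "real \<Rightarrow> real^'n^'n"
  assumes "open S" "\<And>i j. smooth_on_line (\<lambda>t. A t $ i $ j) S"
  shows "smooth_on_line (\<lambda>t. det (A t)) S"
  unfolding det_def by (intro smooth_sum smooth_mult smooth_prod smooth_const assms)

text \<open>Cramer's rule writes the solution as quotients of determinants, that is, as a rational
  expression in the smooth data.\<close>

lemma smooth_linear_solve:
  fixes A :: "real \<Rightarrow> real^'n^'n" and b :: "real \<Rightarrow> real^'n"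
  assumes "open S" "smooth_on_line A S" "smooth_on_line b S"
    and inv: "\<And>t. t \<in> S \<Longrightarrow> det (A t) \<noteq> 0"
  obtains c where "smooth_on_line c S" "\<And>t. t \<in> S \<Longrightarrow> A t *v c t = b t"
proof
  let ?d = "\<lambda>k t. det (\<chi> i j. if j = k then b t $ i else A t $ i $ j)"
  let ?c = "\<lambda>t. \<chi> k. ?d k t * inverse (det (A t))"
  show "A t *v ?c t = b t" if "t \<in> S" for t
    using cramer[OF inv[OF that], of "?c t" "b t"] by (simp add: divide_inverse)
  have d: "smooth_on_line (\<lambda>t. ?d k t) S" for k
  proof (rule smooth_det[OF assms(1)])
    show "smooth_on_line (\<lambda>t. (\<chi> i j. if j = k then b t $ i else A t $ i $ j) $ i $ j) S" for i j
      by (cases "j = k") (auto intro!: smooth_vec_nth assms)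
  qed
  show "smooth_on_line ?c S"
    by (intro smooth_vec_lambda smooth_mult[OF _ d] smooth_inverse smooth_det smooth_vec_nth assms inv)
qed


section \<open>Antiderivatives and inverse functions on open intervals\<close>

text \<open>Both points become interior points of one compact interval: continuous coefficients are
  bounded there, and one-sided derivatives at the two points are two-sided.\<close>

lemma open_interval_compact_subinterval:
  fixes I :: "real set"
  assumes "open I" "is_interval I" "s \<in> I" "t \<in> I"
  obtains a b where "a < s" "s < b" "a < t" "t < b" "{a..b} \<subseteq> I"
proof -
  obtain d where d: "d > 0" "cball s d \<subseteq> I" using assms open_contains_cball by metis
  obtain e where e: "e > 0" "cball t e \<subseteq> I" using assms open_contains_cball by metis
  let ?a = "min (s - d) (t - e)" and ?b = "max (s + d) (t + e)"
  have "s - d \<in> I" "s + d \<in> I" "t - e \<in> I" "t + e \<in> I"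
    using d e by (auto simp: cball_def dist_real_def subset_eq)
  then have "?a \<in> I" "?b \<in> I" by (auto simp: min_def max_def)
  then have "{?a..?b} \<subseteq> I" using assms(2) unfolding is_interval_1 by fastforce
  then show ?thesis using d e by (intro that[of ?a ?b]) auto
qed

lemma antiderivative_open_interval:
  fixes f :: "real \<Rightarrow> 'a::banach"
  assumes "open I" "is_interval I" "continuous_on I f" "t0 \<in> I"
  obtains F where "F t0 = 0" "\<And>t. t \<in> I \<Longrightarrow> (F has_vector_derivative f t) (at t)"
proof -
  \<comment> \<open>The integral over \<open>{t0..t}\<close> is 0 for t < t0, so to the left of t0
    the oriented integral has to be written out.\<close>
  let ?F = "\<lambda>t. if t0 \<le> t then integral {t0..t} f else - integral {t..t0} f"
  have "(?F has_vector_derivative f s) (at s)" if "s \<in> I" for s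
  proof -
    obtain a b where ab: "a < s" "s < b" "a < t0" "t0 < b" "{a..b} \<subseteq> I"
      using open_interval_compact_subinterval[OF assms(1,2) \<open>s \<in> I\<close> assms(4)] .
    have cont: "continuous_on {a..b} f" using assms(3) ab(5) continuous_on_subset by blast
    \<comment> \<open>Measured from a common left end a, both branches of F become the same function
      minus a constant, and one derivative rule covers them.\<close>
    have "((\<lambda>t. integral {a..t} f - integral {a..t0} f) has_vector_derivative f s - 0) (at s within {a..b})"
      by (intro has_vector_derivative_diff integral_has_vector_derivative cont has_vector_derivative_const)
         (use ab in auto)
    then have "((\<lambda>t. integral {a..t} f - integral {a..t0} f) has_vector_derivative f s) (at s)"
      using ab by (simp add: at_within_Icc_at)
    then show ?thesis
    proof (rule has_vector_derivative_transform_within_open[where S = "{a<..<b}"])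
      fix t assume t: "t \<in> {a<..<b}"
      have "f integrable_on {a..c}" if "c \<le> b" for c
        using cont continuous_on_subset[of "{a..b}" f "{a..c}"] that by (intro integrable_continuous_real) auto
      then show "integral {a..t} f - integral {a..t0} f = ?F t"
        using t ab Henstock_Kurzweil_Integration.integral_combine[of a t0 t f]
          Henstock_Kurzweil_Integration.integral_combine[of a t t0 f] by (auto simp: algebra_simps)
    qed (use ab in auto)
  qed
  then show ?thesis by (intro that[of ?F]) auto
qed

lemma has_vector_derivative_zero_imp_eq:
  fixes f :: "real \<Rightarrow> 'a::real_normed_vector"
  assumes "is_interval I" "\<And>t. t \<in> I \<Longrightarrow> (f has_vector_derivative 0) (at t)" "s \<in> I" "t \<in> I"
  shows "f s = f t"
proof -
  have "\<exists>c. \<forall>x\<in>I. f x = c"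
    by (rule has_derivative_zero_constant)
       (use assms is_interval_convex in \<open>auto simp: has_vector_derivative_def intro: has_derivative_at_withinI\<close>)
  then show ?thesis using assms by auto
qed

lemma nonzero_continuous_sign:
  fixes f :: "real \<Rightarrow> real"
  assumes "is_interval I" "continuous_on I f" "\<And>t. t \<in> I \<Longrightarrow> f t \<noteq> 0"
  obtains \<sigma> where "\<sigma> = 1 \<or> \<sigma> = -1" "\<And>t. t \<in> I \<Longrightarrow> \<sigma> * f t > 0"
proof (cases "\<exists>t\<in>I. f t > 0")
  case True
  then obtain a where a: "a \<in> I" "f a > 0" by blast
  have "f t > 0" if "t \<in> I" for t
  proof (rule ccontr)
    assume "\<not> f t > 0"
    have "connected (f ` I)"
      using assms(1,2) connected_continuous_image is_interval_connected by blast
    then have "0 \<in> f ` I"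
      using a that \<open>\<not> f t > 0\<close> unfolding connected_iff_interval by (meson imageI less_imp_le linorder_not_less)
    then show False using assms(3) by auto
  qed
  then show ?thesis by (intro that[of 1]) auto
next
  case False
  then have "f t < 0" if "t \<in> I" for t using assms(3) that by (metis linorder_neqE_linordered_idom)
  then show ?thesis by (intro that[of "-1"]) auto
qed

text \<open>Invariance of domain in dimension 1 makes the image open and the inverse continuous; the
  derivative of the inverse is then 1/\<phi>' evaluated at the inverse, which raises its order of
  smoothness step by step.\<close>

lemma smooth_inv_into:
  fixes \<phi> :: "real \<Rightarrow> real"
  assumes I: "open I" and sm: "smooth_on_line \<phi> I" and inj: "inj_on \<phi> I"
    and nz: "\<And>t. t \<in> I \<Longrightarrow> vderiv \<phi> t \<noteq> 0"
  shows "open (\<phi> ` I)" "smooth_on_line (inv_into I \<phi>) (\<phi> ` I)"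
    "\<And>t. t \<in> I \<Longrightarrow> vderiv (inv_into I \<phi>) (\<phi> t) = inverse (vderiv \<phi> t)"
proof -
  let ?\<psi> = "inv_into I \<phi>"
  have cont: "continuous_on I \<phi>" using sm by (rule smooth_continuous_on)
  show op: "open (\<phi> ` I)" using injective_into_1d_imp_open_map_UNIV[OF I cont inj] by simp
  have cinv: "continuous_on (\<phi> ` I) ?\<psi>"
    by (rule continuous_on_inverse_open[OF I cont]) (use inj in auto)
  have d: "(?\<psi> has_vector_derivative inverse (vderiv \<phi> (?\<psi> y))) (at y)" if y: "y \<in> \<phi> ` I" for y
  proof -
    obtain e where e: "e > 0" "ball y e \<subseteq> \<phi> ` I" using op y open_contains_ball by metis
    have "DERIV \<phi> (?\<psi> y) :> vderiv \<phi> (?\<psi> y)"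
      using smooth_D(1)[OF sm inv_into_into[OF y]] by (simp add: has_real_derivative_iff_has_vector_derivative)
    then have "DERIV ?\<psi> y :> inverse (vderiv \<phi> (?\<psi> y))"
    proof (rule DERIV_inverse_function[where a = "y - e" and b = "y + e"])
      show "\<phi> (?\<psi> z) = z" if "y - e < z" "z < y + e" for z
        using e(2) that by (intro f_inv_into_f) (auto simp: ball_def dist_real_def subset_eq)
      show "isCont ?\<psi> y" using cinv op y continuous_on_eq_continuous_at by blast
    qed (use nz y e(1) in \<open>auto simp: inv_into_into\<close>)
    then show ?thesis by (simp add: has_real_derivative_iff_has_vector_derivative)
  qed
  show "vderiv ?\<psi> (\<phi> t) = inverse (vderiv \<phi> t)" if "t \<in> I" for t
    using vderiv_eqI[OF d[of "\<phi> t"]] inj that by auto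
  have "ksmooth k ?\<psi> (\<phi> ` I)" for k
  proof (induction k)
    case (Suc k)
    have "ksmooth k (vderiv \<phi>) I" using smooth_D(2)[OF sm] smooth_iff_ksmooth by blast
    then show ?case
      by (intro ksmooth_SucI[OF op d] ksmooth_inverse[OF op] ksmooth_compose[OF I op _ _ Suc])
         (use nz in \<open>auto simp: inv_into_into\<close>)
  qed simp
  then show "smooth_on_line ?\<psi> (\<phi> ` I)" using smooth_iff_ksmooth by blast
qed

section \<open>Linear differential equations\<close>

text \<open>One Picard step gains a factor |t - t0| / (k + 1), the source of the factorial in the
  convergence estimate. The segment is parametrised over [0,1] from t0 to t, so that t < t0 needs no
  separate argument.\<close>

lemma norm_le_integrated_power:
  fixes f :: "real \<Rightarrow> 'a::real_normed_vector"
  assumes d: "\<And>s. s \<in> closed_segment t0 t \<Longrightarrow> (f has_vector_derivative f' s) (at s)"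
    and b: "\<And>s. s \<in> closed_segment t0 t \<Longrightarrow> norm (f' s) \<le> C * \<bar>s - t0\<bar> ^ k"
  shows "norm (f t - f t0) \<le> C * \<bar>t - t0\<bar> ^ Suc k / real (Suc k)"
proof -
  let ?h = "\<lambda>r. t0 + r * (t - t0)"
  have seg: "?h r \<in> closed_segment t0 t" if "0 \<le> r" "r \<le> 1" for r
    using that by (auto simp: closed_segment_def algebra_simps intro!: exI[of _ r])
  have g: "((\<lambda>r. f (?h r)) has_vector_derivative (t - t0) *\<^sub>R f' (?h r)) (at r)"
    if "0 \<le> r" "r \<le> 1" for r
  proof -
    have "(?h has_vector_derivative (t - t0)) (at r)"
      unfolding has_real_derivative_iff_has_vector_derivative[symmetric]
      by (auto intro!: derivative_eq_intros)
    from vector_diff_chain_at[OF this d[OF seg[OF that]]] show ?thesis by (simp add: o_def)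
  qed
  have "norm ((\<lambda>r. f (?h r)) 1 - (\<lambda>r. f (?h r)) 0) \<le>
      (\<lambda>r. C * \<bar>t - t0\<bar> ^ Suc k * r ^ Suc k / real (Suc k)) 1 - (\<lambda>r. C * \<bar>t - t0\<bar> ^ Suc k * r ^ Suc k / real (Suc k)) 0"
  proof (rule differentiable_bound_general)
    show "continuous_on {0..1} (\<lambda>r. f (?h r))"
      by (intro continuous_at_imp_continuous_on ballI has_vector_derivative_continuous[OF g]) auto
    show "continuous_on {0..1} (\<lambda>r. C * \<bar>t - t0\<bar> ^ Suc k * r ^ Suc k / real (Suc k))"
      by (intro continuous_intros) auto
    fix r :: real assume r: "0 < r" "r < 1"
    show "((\<lambda>r. f (?h r)) has_vector_derivative (t - t0) *\<^sub>R f' (?h r)) (at r)" using g r by simp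
    have "((\<lambda>r. r ^ Suc k / real (Suc k)) has_real_derivative real (Suc k) * r ^ k / real (Suc k)) (at r)"
      by (intro derivative_eq_intros refl) auto
    then have "((\<lambda>r. C * \<bar>t - t0\<bar> ^ Suc k * (r ^ Suc k / real (Suc k))) has_real_derivative
       C * \<bar>t - t0\<bar> ^ Suc k * (real (Suc k) * r ^ k / real (Suc k))) (at r)"
      by (rule DERIV_cmult)
    then show "((\<lambda>r. C * \<bar>t - t0\<bar> ^ Suc k * r ^ Suc k / real (Suc k)) has_vector_derivative
        C * \<bar>t - t0\<bar> ^ Suc k * r ^ k) (at r)"
      by (simp add: has_real_derivative_iff_has_vector_derivative del: power_Suc of_nat_Suc)
    have "norm ((t - t0) *\<^sub>R f' (?h r)) \<le> \<bar>t - t0\<bar> * (C * \<bar>?h r - t0\<bar> ^ k)"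
      using b[OF seg, of r] r by (auto intro!: mult_left_mono)
    also have "\<dots> = C * \<bar>t - t0\<bar> ^ Suc k * r ^ k"
      using r by (simp add: abs_mult power_mult_distrib)
    finally show "norm ((t - t0) *\<^sub>R f' (?h r)) \<le> C * \<bar>t - t0\<bar> ^ Suc k * r ^ k" .
  qed simp
  then show ?thesis by simp
qed

lemma continuous_on_blinfun_bound:
  fixes A :: "real \<Rightarrow> 'a::real_normed_vector \<Rightarrow>\<^sub>L 'b::real_normed_vector"
  assumes "continuous_on {a..b} A"
  obtains M where "M \<ge> 0" "\<And>t. t \<in> {a..b} \<Longrightarrow> norm (A t) \<le> M"
proof -
  have "bounded (A ` {a..b})"
    by (intro compact_imp_bounded compact_continuous_image assms compact_Icc)
  then obtain M where "\<forall>x\<in>A ` {a..b}. norm x \<le> M" using bounded_iff by blast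
  then show ?thesis by (intro that[of "max M 0"]) (auto simp: le_max_iff_disj)
qed

text \<open>The solution is the sum of the Picard iteration.\<close>

lemma linear_ode_existence:
  fixes A :: "real \<Rightarrow> 'a::banach \<Rightarrow>\<^sub>L 'a"
  assumes I: "open I" "is_interval I" and t0: "t0 \<in> I" and cA: "continuous_on I A"
  obtains x where "x t0 = x0" "\<And>t. t \<in> I \<Longrightarrow> (x has_vector_derivative A t (x t)) (at t)"
proof -
  \<comment> \<open>Antiderivatives are fixed on all of I, so every iterate is a global function and
    only the estimates are local.\<close>
  define anti :: "(real \<Rightarrow> 'a) \<Rightarrow> real \<Rightarrow> 'a" where
    "anti g = (SOME F. F t0 = 0 \<and> (\<forall>t\<in>I. (F has_vector_derivative g t) (at t)))" for g
  have anti: "anti g t0 = 0 \<and> (\<forall>t\<in>I. (anti g has_vector_derivative g t) (at t))"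
    if "continuous_on I g" for g
    unfolding anti_def
  proof (rule someI_ex[where P = "\<lambda>F. F t0 = 0 \<and> (\<forall>t\<in>I. (F has_vector_derivative g t) (at t))"])
    show "\<exists>F. F t0 = 0 \<and> (\<forall>t\<in>I. (F has_vector_derivative g t) (at t))"
      by (rule antiderivative_open_interval[OF I that t0]) blast
  qed
  \<comment> \<open>X k is the k-th summand of the Picard series, not its partial sum; the solution
    will be the sum over k.\<close>
  define X :: "nat \<Rightarrow> real \<Rightarrow> 'a" where "X = rec_nat (\<lambda>t. x0) (\<lambda>k y. anti (\<lambda>t. A t (y t)))"
  \<comment> \<open>The derivative of summand k + 1 is A applied to summand k. The differentiated
    series is therefore A applied to the series itself, shifted by one place, with leading term
    0.\<close>
  define DX where "DX = (\<lambda>k t. case k of 0 \<Rightarrow> 0 | Suc j \<Rightarrow> A t (X j t))"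
  have X0: "X 0 = (\<lambda>t. x0)" and XS: "X (Suc k) = anti (\<lambda>t. A t (X k t))" for k
    by (auto simp: X_def)
  have cX: "continuous_on I (X k)" for k
  proof (induction k)
    case (Suc k)
    have "continuous_on I (\<lambda>t. A t (X k t))" by (intro continuous_intros cA Suc)
    from anti[OF this] show ?case unfolding XS
      by (meson continuous_at_imp_continuous_on has_vector_derivative_continuous)
  qed (simp add: X0)
  have cAX: "continuous_on I (\<lambda>t. A t (X k t))" for k by (intro continuous_intros cA cX)
  have XS0: "X (Suc k) t0 = 0" for k using anti[OF cAX] XS by simp
  have dX: "(X k has_vector_derivative DX k t) (at t)" if "t \<in> I" for k t
    using anti[OF cAX] that by (cases k) (auto simp: X0 XS DX_def)
  have local: "summable (\<lambda>k. X k t) \<and> ((\<lambda>t. \<Sum>k. X k t) has_vector_derivative A t (\<Sum>k. X k t)) (at t)"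
    if t: "t \<in> I" for t
  proof -
    obtain a b where ab: "a < t" "t < b" "a < t0" "t0 < b" "{a..b} \<subseteq> I"
      using open_interval_compact_subinterval[OF I t t0] .
    obtain M where M: "M \<ge> 0" "\<And>s. s \<in> {a..b} \<Longrightarrow> norm (A s) \<le> M"
      using continuous_on_blinfun_bound continuous_on_subset[OF cA ab(5)] by metis
    have bnd: "norm (X k s) \<le> norm x0 * M ^ k / fact k * \<bar>s - t0\<bar> ^ k" if "s \<in> {a..b}" for k s
      using that
    proof (induction k arbitrary: s)
      case (Suc k)
      have seg: "closed_segment t0 s \<subseteq> {a..b}"
        using Suc.prems ab by (auto simp: closed_segment_eq_real_ivl split: if_splits)
      have "norm (X (Suc k) s - X (Suc k) t0) \<le> (M * (norm x0 * M ^ k / fact k)) * \<bar>s - t0\<bar> ^ Suc k / real (Suc k)"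
      proof (rule norm_le_integrated_power)
        fix r assume r: "r \<in> closed_segment t0 s"
        show "(X (Suc k) has_vector_derivative A r (X k r)) (at r)"
          using dX[of r "Suc k"] r seg ab(5) by (auto simp: DX_def)
        have "norm (A r (X k r)) \<le> norm (A r) * norm (X k r)" by (rule norm_blinfun)
        also have "\<dots> \<le> M * (norm x0 * M ^ k / fact k * \<bar>r - t0\<bar> ^ k)"
          using r seg by (intro mult_mono M Suc.IH) auto
        finally show "norm (A r (X k r)) \<le> M * (norm x0 * M ^ k / fact k) * \<bar>r - t0\<bar> ^ k" by simp
      qed
      also have "\<dots> = norm x0 * M ^ Suc k / fact (Suc k) * \<bar>s - t0\<bar> ^ Suc k"
        by (simp add: field_simps)
      finally show ?case by (simp add: XS0)
    qed (simp add: X0)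
    define B where "B k = norm x0 * ((M * (b - a)) ^ k / fact k)" for k
    have B: "norm (X k s) \<le> B k" if "s \<in> {a..b}" for k s
    proof -
      have "norm x0 * M ^ k / fact k * \<bar>s - t0\<bar> ^ k \<le> norm x0 * M ^ k / fact k * (b - a) ^ k"
        using that ab M by (intro mult_left_mono power_mono) auto
      then show ?thesis using bnd[OF that, of k] by (simp add: B_def power_mult_distrib)
    qed
    have sumB: "summable B"
      unfolding B_def by (intro summable_mult) (use summable_exp[of "M * (b - a)"] in \<open>simp add: field_simps\<close>)
    have sumX: "summable (\<lambda>k. X k s)" if "s \<in> {a..b}" for s
      by (rule summable_comparison_test'[OF sumB, of 0]) (use B that in auto)
    \<comment> \<open>For k = 0 the truncated difference k - 1 is 0; the bound still holds because
      the leading derivative is 0.\<close>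
    have DXB: "norm (DX k s) \<le> M * B (k - 1)" if "s \<in> {a..b}" for k s
    proof (cases k)
      case 0
      have "0 \<le> B 0" by (simp add: B_def)
      then show ?thesis using 0 M by (simp add: DX_def)
    next
      case (Suc j)
      have "norm (A s (X j s)) \<le> norm (A s) * norm (X j s)" by (rule norm_blinfun)
      also have "\<dots> \<le> M * B j" using that by (intro mult_mono M B) (auto intro: M)
      finally show ?thesis using Suc by (simp add: DX_def)
    qed
    have sumMB: "summable (\<lambda>k. M * B (k - 1))"
      using summable_Suc_iff[of "\<lambda>k. M * B (k - 1)"] summable_mult[OF sumB, of M] by simp
    have ul: "uniform_limit {a..b} (\<lambda>n s. \<Sum>i<n. DX i s) (\<lambda>s. \<Sum>i. DX i s) sequentially"
      by (rule Weierstrass_m_test[OF DXB sumMB])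
    have sDX: "(\<Sum>i. DX i s) = A s (\<Sum>k. X k s)" if "s \<in> {a..b}" for s
    proof -
      have "(\<lambda>i. DX (Suc i) s) sums A s (\<Sum>k. X k s)"
        unfolding DX_def using bounded_linear.sums[OF blinfun.bounded_linear_right summable_sums[OF sumX[OF that]]]
        by simp
      then have "(\<lambda>i. DX i s) sums A s (\<Sum>k. X k s)" using sums_Suc_iff[of "\<lambda>i. DX i s"] by (simp add: DX_def)
      then show ?thesis by (simp add: sums_iff)
    qed
    have "\<exists>g. \<forall>s\<in>{a..b}. (\<lambda>n. X n s) sums g s \<and>
        (g has_derivative (\<lambda>h. h *\<^sub>R A s (\<Sum>k. X k s))) (at s within {a..b})"
    proof (rule has_derivative_series[where f' = "\<lambda>n s h. h *\<^sub>R DX n s"])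
      show "(X n has_derivative (\<lambda>h. h *\<^sub>R DX n s)) (at s within {a..b})" if "s \<in> {a..b}" for n s
        using has_vector_derivative_at_within[OF dX[of s n]] that ab(5) unfolding has_vector_derivative_def
        by blast
      fix e :: real assume "e > 0"
      then have "\<forall>\<^sub>F n in sequentially. \<forall>s\<in>{a..b}. dist (\<Sum>i<n. DX i s) (\<Sum>i. DX i s) < e"
        using ul by (simp add: uniform_limit_iff)
      then show "\<forall>\<^sub>F n in sequentially. \<forall>s\<in>{a..b}. \<forall>h.
          norm ((\<Sum>i<n. h *\<^sub>R DX i s) - h *\<^sub>R A s (\<Sum>k. X k s)) \<le> e * norm h"
      proof eventually_elim
        case (elim n)
        show ?case
        proof (intro ballI allI)
          fix s h assume s: "s \<in> {a..b}"
          have "norm ((\<Sum>i<n. h *\<^sub>R DX i s) - h *\<^sub>R A s (\<Sum>k. X k s)) = \<bar>h\<bar> * norm ((\<Sum>i<n. DX i s) - (\<Sum>i. DX i s))"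
            by (simp add: sDX[OF s] scaleR_sum_right[symmetric] scaleR_diff_right[symmetric])
          also have "\<dots> \<le> \<bar>h\<bar> * e" using elim s by (intro mult_left_mono) (auto simp: dist_norm less_imp_le)
          finally show "norm ((\<Sum>i<n. h *\<^sub>R DX i s) - h *\<^sub>R A s (\<Sum>k. X k s)) \<le> e * norm h"
            by (simp add: mult.commute)
        qed
      qed
    next
      show "(\<lambda>n. X n t) sums (\<Sum>k. X k t)" using sumX ab by (auto intro: summable_sums)
    qed (use ab in auto)
    then obtain g where g: "\<And>s. s \<in> {a..b} \<Longrightarrow> (\<lambda>n. X n s) sums g s"
       "\<And>s. s \<in> {a..b} \<Longrightarrow> (g has_vector_derivative A s (\<Sum>k. X k s)) (at s within {a..b})"
      unfolding has_vector_derivative_def by blast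
    have "(g has_vector_derivative A t (\<Sum>k. X k t)) (at t)"
      using g(2)[of t] ab by (simp add: at_within_Icc_at)
    then have "((\<lambda>t. \<Sum>k. X k t) has_vector_derivative A t (\<Sum>k. X k t)) (at t)"
      by (rule has_vector_derivative_transform_within_open[where S = "{a<..<b}"])
         (use ab g(1) in \<open>auto simp: sums_iff\<close>)
    then show ?thesis using sumX ab by auto
  qed
  have "(\<lambda>k. X k t0) sums x0"
    using sums_finite[of "{0::nat}" "\<lambda>k. X k t0"] X0 XS0 gr0_conv_Suc by auto
  then have "(\<Sum>k. X k t0) = x0" by (simp add: sums_iff)
  then show ?thesis using that[of "\<lambda>t. \<Sum>k. X k t"] local by auto
qed

text \<open>A Gronwall argument: along the segment from t0 to t the function |z|^2 exp(-L r) does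
  not increase, and it starts at 0. The lemma carries algebraic relations from one point to the
  whole interval, since their defects satisfy homogeneous linear equations.\<close>

lemma linear_ode_zero:
  fixes A :: "real \<Rightarrow> 'a::real_inner \<Rightarrow>\<^sub>L 'a"
  assumes I: "open I" "is_interval I" and t0: "t0 \<in> I" and cA: "continuous_on I A"
    and z0: "z t0 = 0" and dz: "\<And>t. t \<in> I \<Longrightarrow> (z has_vector_derivative A t (z t)) (at t)"
    and t: "t \<in> I"
  shows "z t = 0"
proof -
  obtain a b where ab: "a < t" "t < b" "a < t0" "t0 < b" "{a..b} \<subseteq> I"
    using open_interval_compact_subinterval[OF I t t0] .
  obtain M where M: "M \<ge> 0" "\<And>s. s \<in> {a..b} \<Longrightarrow> norm (A s) \<le> M"
    using continuous_on_blinfun_bound continuous_on_subset[OF cA ab(5)] by metis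
  let ?h = "\<lambda>r. t0 + r * (t - t0)"
  \<comment> \<open>The derivative of |z|^2 along the segment is at most 2 |t - t0| M |z|^2, which
    the exponential with this rate compensates.\<close>
  define L where "L = 2 * \<bar>t - t0\<bar> * M"
  let ?q = "\<lambda>r. (z (?h r) \<bullet> z (?h r)) * exp (- L * r)"
  have seg: "?h r \<in> {a..b}" if "0 \<le> r" "r \<le> 1" for r
  proof -
    have "?h r \<in> closed_segment t0 t"
      using that by (auto simp: closed_segment_def algebra_simps intro!: exI[of _ r])
    then show ?thesis using ab by (auto simp: closed_segment_eq_real_ivl split: if_splits)
  qed
  have "?q 1 \<le> ?q 0"
  proof (rule DERIV_nonpos_imp_nonincreasing[where f = ?q])
    fix r :: real assume r: "0 \<le> r" "r \<le> 1"
    have "(?h has_vector_derivative (t - t0)) (at r)"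
      unfolding has_real_derivative_iff_has_vector_derivative[symmetric]
      by (auto intro!: derivative_eq_intros)
    from vector_diff_chain_at[OF this dz] seg[OF r] ab(5)
    have g: "((\<lambda>r. z (?h r)) has_vector_derivative (t - t0) *\<^sub>R A (?h r) (z (?h r))) (at r)"
      by (auto simp: o_def)
    let ?z = "z (?h r)" and ?w = "(t - t0) *\<^sub>R A (?h r) (z (?h r))"
    have "((\<lambda>r. z (?h r) \<bullet> z (?h r)) has_vector_derivative (?z \<bullet> ?w + ?w \<bullet> ?z)) (at r)"
      by (rule bounded_bilinear.has_vector_derivative[OF bounded_bilinear_inner g g])
    then have "((\<lambda>r. z (?h r) \<bullet> z (?h r)) has_real_derivative (2 * (?z \<bullet> ?w))) (at r)"
      by (simp add: has_real_derivative_iff_has_vector_derivative inner_commute)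
    then have D: "DERIV ?q r :> (2 * (?z \<bullet> ?w)) * exp (- L * r) + (?z \<bullet> ?z) * (exp (- L * r) * (- L))"
      by (auto intro!: derivative_eq_intros)
    have "?z \<bullet> ?w \<le> norm ?z * norm ?w" by (rule norm_cauchy_schwarz)
    also have "\<dots> = \<bar>t - t0\<bar> * norm ?z * norm (A (?h r) ?z)" by simp
    also have "\<dots> \<le> \<bar>t - t0\<bar> * norm ?z * (norm (A (?h r)) * norm ?z)"
      by (intro mult_left_mono norm_blinfun) auto
    also have "\<dots> \<le> \<bar>t - t0\<bar> * norm ?z * (M * norm ?z)"
      by (intro mult_left_mono mult_right_mono M seg r) auto
    also have "\<dots> = \<bar>t - t0\<bar> * M * (?z \<bullet> ?z)" by (simp add: dot_square_norm power2_eq_square)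
    finally have "2 * (?z \<bullet> ?w) \<le> L * (?z \<bullet> ?z)" by (simp add: L_def)
    then have "(2 * (?z \<bullet> ?w)) * exp (- L * r) + (?z \<bullet> ?z) * (exp (- L * r) * (- L)) \<le> 0"
      using mult_right_mono[of "2 * (?z \<bullet> ?w)" "L * (?z \<bullet> ?z)" "exp (- L * r)"] by (simp add: algebra_simps)
    then show "\<exists>y. DERIV ?q r :> y \<and> y \<le> 0" using D by blast
  qed simp
  then have "(z t \<bullet> z t) * exp (- L) \<le> 0" using z0 by simp
  then have "z t \<bullet> z t \<le> 0" by (simp add: mult_le_0_iff not_le[symmetric])
  then show ?thesis using inner_ge_zero[of "z t"] by (metis inner_eq_zero_iff order_antisym)
qed

lemma linear_ode_smooth:
  fixes A :: "real \<Rightarrow> 'a::real_normed_vector \<Rightarrow>\<^sub>L 'a"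
  assumes "open I" "smooth_on_line A I" "\<And>t. t \<in> I \<Longrightarrow> (x has_vector_derivative A t (x t)) (at t)"
  shows "smooth_on_line x I"
proof -
  have "ksmooth k x I" for k
  proof (induction k)
    case (Suc k)
    show ?case
      by (rule ksmooth_SucI[OF assms(1,3)])
         (use assms Suc in \<open>auto simp: smooth_iff_ksmooth intro!: ksmooth_bilinear[OF bounded_bilinear_blinfun_apply]\<close>)
  qed simp
  then show ?thesis by (simp add: smooth_iff_ksmooth)
qed


section \<open>Smooth diagonalisation of self-adjoint operators\<close>

text \<open>The least moved point M can only be moved up, and its preimage can only lie above M;
  together this contradicts monotonicity.\<close>

lemma strict_mono_finite_id:
  fixes f :: "'n::{finite,linorder} \<Rightarrow> 'n"
  assumes "strict_mono f"
  shows "f i = i"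
proof (rule ccontr)
  assume "f i \<noteq> i"
  let ?M = "Min {i. f i \<noteq> i}"
  have M: "f ?M \<noteq> ?M" using Min_in[of "{i. f i \<noteq> i}"] \<open>f i \<noteq> i\<close> by auto
  have below: "f j = j" if "j < ?M" for j using that Min_le[of "{i. f i \<noteq> i}" j] by fastforce
  have inj: "inj f" using assms strict_mono_imp_inj_on by blast
  have "?M < f ?M" using M below[of "f ?M"] injD[OF inj, of "f ?M" ?M] by (metis linorder_neqE)
  moreover obtain m where m: "f m = ?M" using inj finite_UNIV_inj_surj[of f] by (metis surjD finite_class.finite_UNIV)
  ultimately show False
    using below[of m] strict_monoD[OF assms, of ?M m] M by (metis less_asym linorder_neqE order_less_irrefl)
qed

lemma finite_strict_mono_enumeration:
  fixes E :: "real set"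
  assumes "card E = CARD('n::{finite,linorder})"
  obtains k :: "'n::{finite,linorder} \<Rightarrow> real" where "strict_mono k" "range k = E"
proof -
  have fin: "finite E" using assms by (intro card_ge_0_finite) simp
  define es where "es = sorted_list_of_set E"
  \<comment> \<open>The number of indices below i is the position of i counted from 0, as indexing
    of lists requires.\<close>
  define k where "k i = es ! card {..<i}" for i :: 'n
  have len: "length es = CARD('n)" using assms by (simp add: es_def)
  have lt: "card {..<i} < length es" for i :: 'n
    unfolding len by (rule psubset_card_mono) auto
  have "strict_mono k"
  proof (rule strict_monoI)
    fix i j :: 'n assume "i < j"
    then have "card {..<i} < card {..<j}" by (intro psubset_card_mono) auto
    moreover have "sorted_wrt (<) es" by (simp add: es_def)
    ultimately show "k i < k j" unfolding k_def using sorted_wrt_nth_less lt by blast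
  qed
  moreover have "range k = E"
  proof (rule card_subset_eq[OF fin])
    show "range k \<subseteq> E" using nth_mem[OF lt] fin by (auto simp: k_def es_def)
    show "card (range k) = card E"
      using card_image[OF strict_mono_imp_inj_on[OF \<open>strict_mono k\<close>]] assms by simp
  qed
  ultimately show ?thesis using that by blast
qed

text \<open>Needed where a derivative is found as a limit of difference quotients: for
  eigenprojections, and for curves inside a closed subspace.\<close>

lemma has_vector_derivative_iff_tendsto:
  "(f has_vector_derivative D) (at t) \<longleftrightarrow> ((\<lambda>s. (f s - f t) /\<^sub>R (s - t)) \<longlongrightarrow> D) (at t)"
proof -
  have eq: "norm ((f s - f t) - (s - t) *\<^sub>R D) / norm (s - t) = norm ((f s - f t) /\<^sub>R (s - t) - D)"
    if "s \<noteq> t" for s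
  proof -
    have "(f s - f t) /\<^sub>R (s - t) - D = inverse (s - t) *\<^sub>R ((f s - f t) - (s - t) *\<^sub>R D)"
      using that by (simp add: scaleR_diff_right)
    then show ?thesis by (simp add: divide_inverse)
  qed
  have "(f has_vector_derivative D) (at t) \<longleftrightarrow>
      ((\<lambda>s. norm ((f s - f t) - (s - t) *\<^sub>R D) / norm (s - t)) \<longlongrightarrow> 0) (at t)"
    unfolding has_vector_derivative_def has_derivative_iff_norm by (simp add: bounded_linear_scaleR_left)
  also have "\<dots> \<longleftrightarrow> ((\<lambda>s. norm ((f s - f t) /\<^sub>R (s - t) - D)) \<longlongrightarrow> 0) (at t)"
    by (rule filterlim_cong[OF refl refl]) (simp add: eventually_at_filter eq del: real_norm_def)
  also have "\<dots> \<longleftrightarrow> ((\<lambda>s. (f s - f t) /\<^sub>R (s - t)) \<longlongrightarrow> D) (at t)"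
    by (simp only: tendsto_norm_zero_iff LIM_zero_iff)
  finally show ?thesis .
qed

lemma orthonormal_expansion:
  fixes v :: "'n::finite \<Rightarrow> real^'n"
  assumes on: "\<And>i j. v i \<bullet> v j = (if i = j then 1 else 0)"
  shows "x = (\<Sum>i\<in>UNIV. (v i \<bullet> x) *\<^sub>R v i)"
proof -
  have inj: "inj v" by (rule injI) (metis on zero_neq_one)
  have "independent (range v)"
  proof (rule pairwise_orthogonal_independent)
    show "pairwise orthogonal (range v)"
      using on unfolding pairwise_def orthogonal_def by (metis imageE)
    show "0 \<notin> range v" using on by (metis imageE inner_zero_left zero_neq_one)
  qed
  moreover have "card (range v) = DIM(real^'n)" using card_image[OF inj] by simp
  ultimately have sp: "span (range v) = UNIV"
    by (metis dim_UNIV indep_card_eq_dim_span independent_imp_finite card_eq_dim subset_UNIV top_le order_refl)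
  let ?y = "x - (\<Sum>i\<in>UNIV. (v i \<bullet> x) *\<^sub>R v i)"
  have "orthogonal ?y z" if "z \<in> range v" for z
    using that by (auto simp: orthogonal_def inner_diff_left inner_sum_left on inner_commute[of x] if_distrib cong: if_cong)
  then have "orthogonal ?y ?y"
    using orthogonal_to_span[of ?y "range v" ?y] sp by auto
  then show ?thesis by (simp add: orthogonal_def)
qed

lemma orthonormal_Parseval:
  fixes v :: "'n::finite \<Rightarrow> real^'n"
  assumes on: "\<And>i j. v i \<bullet> v j = (if i = j then 1 else 0)"
  shows "x \<bullet> x = (\<Sum>i\<in>UNIV. (v i \<bullet> x)\<^sup>2)"
proof -
  have "x \<bullet> x = x \<bullet> (\<Sum>i\<in>UNIV. (v i \<bullet> x) *\<^sub>R v i)" using orthonormal_expansion[OF on] by metis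
  then show ?thesis by (simp add: inner_sum_right power2_eq_square inner_commute)
qed

text \<open>In the eigenbasis, the squared length of Q x - l x is the sum of (k j - l)^2 (v j
  \<bullet> x)^2. If every |k j - l| exceeded d, this sum would exceed d^2.\<close>

lemma approximate_eigenvalue:
  fixes v :: "'n::finite \<Rightarrow> real^'n" and Q :: "(real^'n) \<Rightarrow>\<^sub>L (real^'n)"
  assumes on: "\<And>i j. v i \<bullet> v j = (if i = j then 1 else 0)"
    and adj: "\<And>x y. Q x \<bullet> y = x \<bullet> Q y" and ev: "\<And>i. Q (v i) = k i *\<^sub>R v i"
    and x: "x \<bullet> x = 1" and d: "norm (Q x - l *\<^sub>R x) \<le> d"
  shows "\<exists>j. \<bar>k j - l\<bar> \<le> d"
proof (rule ccontr)
  assume "\<nexists>j. \<bar>k j - l\<bar> \<le> d"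
  then have gt: "\<bar>k j - l\<bar> > d" for j by (simp add: not_le)
  have d0: "d \<ge> 0" using d norm_ge_zero order_trans by blast
  then have sq: "(k j - l)\<^sup>2 > d\<^sup>2" for j
    using gt[of j] power_strict_mono[of d "\<bar>k j - l\<bar>" 2] by simp
  have comp: "v j \<bullet> (Q x - l *\<^sub>R x) = (k j - l) * (v j \<bullet> x)" for j
    using adj[of "v j" x] ev[of j] by (simp add: inner_diff_right algebra_simps)
  have "(\<Sum>j\<in>UNIV. d\<^sup>2 * (v j \<bullet> x)\<^sup>2) < (\<Sum>j\<in>UNIV. (k j - l)\<^sup>2 * (v j \<bullet> x)\<^sup>2)"
  proof -
    have "\<exists>j. v j \<bullet> x \<noteq> 0"
    proof (rule ccontr)
      assume "\<nexists>j. v j \<bullet> x \<noteq> 0"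
      then have "x \<bullet> x = 0" using orthonormal_Parseval[OF on, of x] by simp
      then show False using x by simp
    qed
    then obtain j0 where "v j0 \<bullet> x \<noteq> 0" by blast
    then show ?thesis
      using mult_right_mono[OF less_imp_le[OF sq]] sq by (intro sum_strict_mono_ex1 bexI[of _ j0]) auto
  qed
  also have "\<dots> = (norm (Q x - l *\<^sub>R x))\<^sup>2"
    unfolding power2_norm_eq_inner orthonormal_Parseval[OF on, of "Q x - l *\<^sub>R x"] comp
    by (simp add: power_mult_distrib)
  also have "\<dots> \<le> d\<^sup>2" using d by (intro power_mono) auto
  also have "\<dots> = (\<Sum>j\<in>UNIV. d\<^sup>2 * (v j \<bullet> x)\<^sup>2)"
    using orthonormal_Parseval[OF on, of x] x by (simp add: sum_distrib_left[symmetric])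
  finally show False by simp
qed

lemma self_adjoint_eigenbasis:
  fixes Q :: "(real^('n::{finite,linorder})) \<Rightarrow>\<^sub>L (real^('n::{finite,linorder}))"
  assumes adj: "\<And>x y. Q x \<bullet> y = x \<bullet> Q y"
    and card: "card {l. \<exists>u. u \<noteq> 0 \<and> Q u = l *\<^sub>R u} = CARD('n::{finite,linorder})"
  obtains k :: "'n::{finite,linorder} \<Rightarrow> real" and v where "strict_mono k" "\<And>i. Q (v i) = k i *\<^sub>R v i"
    "\<And>i j. v i \<bullet> v j = (if i = j then 1 else 0)"
proof -
  obtain k :: "'n \<Rightarrow> real" where k: "strict_mono k" "range k = {l. \<exists>u. u \<noteq> 0 \<and> Q u = l *\<^sub>R u}"
    using finite_strict_mono_enumeration[OF card] .
  then have "\<forall>i. \<exists>u. u \<noteq> 0 \<and> Q u = k i *\<^sub>R u" by blast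
  then obtain u where u: "\<And>i. u i \<noteq> 0" "\<And>i. Q (u i) = k i *\<^sub>R u i" by metis
  define v where "v i = u i /\<^sub>R norm (u i)" for i
  have ev: "Q (v i) = k i *\<^sub>R v i" for i by (simp add: v_def blinfun.scaleR_right u)
  have "v i \<bullet> v j = 0" if "i \<noteq> j" for i j
  proof -
    have "k i * (v i \<bullet> v j) = k j * (v i \<bullet> v j)" using adj[of "v i" "v j"] by (simp add: ev)
    moreover have "k i \<noteq> k j" using that k(1) strict_mono_eq by blast
    ultimately show ?thesis by simp
  qed
  moreover have "v i \<bullet> v i = 1" for i
    using u(1)[of i] by (simp add: v_def dot_square_norm power2_eq_square)
  ultimately show ?thesis using k(1) ev by (intro that[of k v]) auto
qed

text \<open>The orthogonal projection to the line of a unit vector v. It is unchanged under v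
  \<mapsto> -v, so the arbitrary signs of pointwise chosen eigenvectors disappear.\<close>

definition outer :: "'a::euclidean_space \<Rightarrow> 'a \<Rightarrow>\<^sub>L 'a" where
  "outer v = Blinfun (\<lambda>x. (v \<bullet> x) *\<^sub>R v)"

lemma outer_apply [simp]: "outer v x = (v \<bullet> x) *\<^sub>R v"
proof -
  have "bounded_linear (\<lambda>x. (v \<bullet> x) *\<^sub>R v)"
    by (intro bounded_linear_scaleR_const bounded_linear_inner_right)
  then show ?thesis by (simp add: outer_def bounded_linear_Blinfun_apply)
qed

lemma norm_outer_le: "norm v = 1 \<Longrightarrow> norm (outer v) \<le> 1"
  using Cauchy_Schwarz_ineq2[of v] by (intro norm_blinfun_bound) auto

text \<open>The eigenvectors supplied at each t come without any continuity. The projections to the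
  eigenlines are smooth nevertheless, because the eigenvalues stay apart; transporting unit vectors
  along these projections then gives smooth eigenvectors.\<close>

lemma smooth_diagonalisation:
  fixes Q :: "real \<Rightarrow> (real^('n::{finite,linorder})) \<Rightarrow>\<^sub>L (real^('n::{finite,linorder}))"
  assumes I: "open I" "is_interval I" "I \<noteq> {}" and sQ: "smooth_on_line Q I"
    and adj: "\<And>t x y. t \<in> I \<Longrightarrow> Q t x \<bullet> y = x \<bullet> Q t y"
    and card: "\<And>t. t \<in> I \<Longrightarrow> card {l. \<exists>u. u \<noteq> 0 \<and> Q t u = l *\<^sub>R u} = CARD('n::{finite,linorder})"
  obtains k :: "real \<Rightarrow> 'n::{finite,linorder} \<Rightarrow> real" and w :: "real \<Rightarrow> 'n::{finite,linorder} \<Rightarrow> real^('n::{finite,linorder})" where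
    "\<And>i. smooth_on_line (\<lambda>t. k t i) I" "\<And>i. smooth_on_line (\<lambda>t. w t i) I"
    "\<And>t. t \<in> I \<Longrightarrow> strict_mono (k t)" "\<And>t i. t \<in> I \<Longrightarrow> Q t (w t i) = k t i *\<^sub>R w t i"
    "\<And>t i j. t \<in> I \<Longrightarrow> w t i \<bullet> w t j = (if i = j then 1 else 0)"
proof -
  have "\<forall>t. \<exists>k v. t \<in> I \<longrightarrow> strict_mono (k :: 'n \<Rightarrow> real) \<and> (\<forall>i. Q t (v i) = k i *\<^sub>R v i) \<and>
      (\<forall>i j. v i \<bullet> v j = (if i = j then 1 else (0::real)))"
    using self_adjoint_eigenbasis[OF adj card] by metis
  then obtain k :: "real \<Rightarrow> 'n \<Rightarrow> real" and v :: "real \<Rightarrow> 'n \<Rightarrow> _" where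
    mono: "\<And>t. t \<in> I \<Longrightarrow> strict_mono (k t)" and ev: "\<And>t i. t \<in> I \<Longrightarrow> Q t (v t i) = k t i *\<^sub>R v t i"
    and on: "\<And>t i j. t \<in> I \<Longrightarrow> v t i \<bullet> v t j = (if i = j then 1 else 0)"
    by metis
  define P where "P i t = outer (v t i)" for i t
  have kneq: "k t i \<noteq> k t j" if "t \<in> I" "i \<noteq> j" for t i j using mono that strict_mono_eq by blast
  have nP: "norm (P i t) \<le> 1" if "t \<in> I" for i t
    unfolding P_def by (rule norm_outer_le) (use on[OF that, of i i] in \<open>simp add: norm_eq_sqrt_inner\<close>)
  have PP: "P i t o\<^sub>L P j t = (if i = j then P i t else 0)" if "t \<in> I" for i j t
    by (rule blinfun_eqI) (use on[OF that] in \<open>auto simp: P_def\<close>)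
  have sumP: "(\<Sum>i\<in>UNIV. P i t) = id_blinfun" if "t \<in> I" for t
    by (rule blinfun_eqI)
       (use orthonormal_expansion[OF on[OF that], symmetric] in \<open>simp add: P_def blinfun.sum_left\<close>)
  have QP: "Q t o\<^sub>L P i t = k t i *\<^sub>R P i t" if "t \<in> I" for i t
    by (rule blinfun_eqI) (use ev[OF that] in \<open>simp add: P_def blinfun.bilinear_simps\<close>)
  have PQ: "P i t o\<^sub>L Q t = k t i *\<^sub>R P i t" if "t \<in> I" for i t
  proof (rule blinfun_eqI)
    fix x
    have "v t i \<bullet> Q t x = k t i * (v t i \<bullet> x)" using adj[OF that, of "v t i" x] ev[OF that, of i] by simp
    then show "(P i t o\<^sub>L Q t) x = (k t i *\<^sub>R P i t) x" by (simp add: P_def blinfun.bilinear_simps)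
  qed
  \<comment> \<open>The basic perturbation identity: for i \<noteq> j the product P_j(t) P_i(s) is
    small with Q s - Q t, since the factor on the left stays away from 0.\<close>
  have key: "(k s i - k t j) *\<^sub>R (P j t o\<^sub>L P i s) = P j t o\<^sub>L (Q s - Q t) o\<^sub>L P i s"
    if "s \<in> I" "t \<in> I" for s t i j
  proof -
    have "P j t o\<^sub>L (Q s - Q t) o\<^sub>L P i s = (P j t o\<^sub>L (Q s o\<^sub>L P i s)) - ((P j t o\<^sub>L Q t) o\<^sub>L P i s)"
      by (rule blinfun_eqI) (simp add: blinfun.bilinear_simps)
    also have "\<dots> = (k s i - k t j) *\<^sub>R (P j t o\<^sub>L P i s)"
      unfolding QP[OF that(1)] PQ[OF that(2)] by (rule blinfun_eqI) (simp add: blinfun.bilinear_simps algebra_simps)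
    finally show ?thesis by simp
  qed
  \<comment> \<open>The identity is resolved by the projections at t to the left of P_i(s), and by
    those at s to the right of P_i(t). The terms with j = i cancel, and only products controlled by
    \<open>key\<close> remain.\<close>
  have Pdiff: "P i s - P i t = (\<Sum>j\<in>UNIV - {i}. (P j t o\<^sub>L P i s) - (P i t o\<^sub>L P j s))"
    if "s \<in> I" "t \<in> I" for i s t
  proof -
    have "P i s - P i t = ((\<Sum>j\<in>UNIV. P j t) o\<^sub>L P i s) - (P i t o\<^sub>L (\<Sum>j\<in>UNIV. P j s))"
      unfolding sumP[OF that(1)] sumP[OF that(2)]
      by (rule blinfun_eqI) (simp add: blinfun.bilinear_simps)
    also have "\<dots> = (\<Sum>j\<in>UNIV. (P j t o\<^sub>L P i s) - (P i t o\<^sub>L P j s))"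
      by (rule blinfun_eqI) (simp add: blinfun.bilinear_simps sum_subtractf blinfun.sum_left blinfun.sum_right)
    also have "\<dots> = (\<Sum>j\<in>UNIV - {i}. (P j t o\<^sub>L P i s) - (P i t o\<^sub>L P j s))"
      by (subst sum.remove[of UNIV i]) auto
    finally show ?thesis .
  qed
  have evI: "\<forall>\<^sub>F s in at t. s \<in> I" if "t \<in> I" for t
    using I(1) that by (rule eventually_at_in_open')
  have cQ: "(Q \<longlongrightarrow> Q t) (at t)" if "t \<in> I" for t
    using smooth_D(1)[OF sQ that] has_vector_derivative_continuous continuous_within by blast
  have Q0: "((\<lambda>s. norm (Q s - Q t)) \<longlongrightarrow> 0) (at t)" if "t \<in> I" for t
    using cQ[OF that] by (simp add: LIM_zero tendsto_norm_zero)
  \<comment> \<open>Each eigenvalue of Q t has an eigenvalue of Q s nearby, with some index m i.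
    When the error is below half the smallest gap, m is strictly increasing and hence the
    identity.\<close>
  have kcont: "((\<lambda>s. k s i) \<longlongrightarrow> k t i) (at t)" if t: "t \<in> I" for t i
  proof -
    \<comment> \<open>The extra element 1 keeps the set of gaps nonempty when there is only one
      eigenvalue.\<close>
    define G where "G = insert 1 ((\<lambda>(i,j). \<bar>k t i - k t j\<bar>) ` {(i,j). i \<noteq> j})"
    have finG: "finite G" unfolding G_def by simp
    have posG: "Min G > 0" using finG kneq[OF t] by (auto simp: G_def)
    have gap: "Min G \<le> k t j - k t i" if "i < j" for i j
    proof -
      have "\<bar>k t i - k t j\<bar> \<in> G" using that by (auto simp: G_def intro!: image_eqI[where x = "(i,j)"])
      moreover have "k t i < k t j" using mono[OF t] that strict_monoD by blast
      ultimately show ?thesis using Min_le[OF finG] by fastforce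
    qed
    have "\<forall>\<^sub>F s in at t. norm (Q s - Q t) < Min G / 2"
      using order_tendstoD(2)[OF Q0[OF t], of "Min G / 2"] posG by simp
    then have "\<forall>\<^sub>F s in at t. norm (k s i - k t i) \<le> norm (Q s - Q t)"
      using evI[OF t]
    proof eventually_elim
      case (elim s)
      have "\<exists>j. \<bar>k s j - k t i\<bar> \<le> norm (Q s - Q t)" for i
      proof (rule approximate_eigenvalue[OF on[OF elim(2)] adj[OF elim(2)] ev[OF elim(2)]])
        show "v t i \<bullet> v t i = 1" using on[OF t] by simp
        have "Q s (v t i) - k t i *\<^sub>R v t i = (Q s - Q t) (v t i)"
          using ev[OF t, of i] by (simp add: blinfun.diff_left)
        then show "norm (Q s (v t i) - k t i *\<^sub>R v t i) \<le> norm (Q s - Q t)"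
          using norm_blinfun[of "Q s - Q t" "v t i"] on[OF t, of i i] by (simp add: norm_eq_sqrt_inner)
      qed
      then obtain m where m: "\<And>i. \<bar>k s (m i) - k t i\<bar> \<le> norm (Q s - Q t)" by metis
      have "strict_mono m"
      proof (rule strict_monoI)
        fix i j :: 'n assume "i < j"
        then have "k s (m i) < k s (m j)" using gap[of i j] m[of i] m[of j] elim(1) by linarith
        then show "m i < m j" using mono[OF elim(2)] strict_mono_less by blast
      qed
      then show ?case using m[of i] strict_mono_finite_id[of m i] by simp
    qed
    from Lim_null_comparison[OF this Q0[OF t]] show ?thesis by (rule LIM_zero_cancel)
  qed
  have kinv: "((\<lambda>s. inverse (k s i - k t j)) \<longlongrightarrow> inverse (k t i - k t j)) (at t)"
    if "t \<in> I" "i \<noteq> j" for t i j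
    by (intro tendsto_intros kcont that) (use kneq that in auto)
  have R: "\<forall>\<^sub>F s in at t. P j t o\<^sub>L P i s = inverse (k s i - k t j) *\<^sub>R (P j t o\<^sub>L (Q s - Q t) o\<^sub>L P i s)"
    if "t \<in> I" "i \<noteq> j" for t i j
  proof -
    have "\<forall>\<^sub>F s in at t. k s i \<noteq> k t j"
      using tendsto_imp_eventually_ne[OF kcont[OF that(1)], of i "k t j"] kneq[OF that] by simp
    then show ?thesis using evI[OF that(1)]
      by eventually_elim (use key that in \<open>auto simp: key[symmetric]\<close>)
  qed
  have R0: "((\<lambda>s. P j t o\<^sub>L P i s) \<longlongrightarrow> 0) (at t)" if t: "t \<in> I" and ij: "i \<noteq> j" for t i j
  proof (rule Lim_null_comparison)
    show "\<forall>\<^sub>F s in at t. norm (P j t o\<^sub>L P i s) \<le> \<bar>inverse (k s i - k t j)\<bar> * norm (Q s - Q t)"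
      using R[OF t ij] evI[OF t]
    proof eventually_elim
      case (elim s)
      have "norm (P j t o\<^sub>L (Q s - Q t) o\<^sub>L P i s) \<le> norm (P j t o\<^sub>L (Q s - Q t)) * norm (P i s)"
        by (rule norm_blinfun_compose)
      also have "\<dots> \<le> (norm (P j t) * norm (Q s - Q t)) * 1"
        by (intro mult_mono norm_blinfun_compose nP elim) auto
      also have "\<dots> \<le> 1 * norm (Q s - Q t)" using nP[OF t, of j] mult_right_mono[of "norm (P j t)" 1 "norm (Q s - Q t)"] by simp
      finally show ?case unfolding elim(1) by (simp add: mult_left_mono)
    qed
    show "((\<lambda>s. \<bar>inverse (k s i - k t j)\<bar> * norm (Q s - Q t)) \<longlongrightarrow> 0) (at t)"
      using tendsto_mult[OF tendsto_rabs[OF kinv[OF t ij]] Q0[OF t]] by simp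
  qed
  have Pcont: "((\<lambda>s. P i s) \<longlongrightarrow> P i t) (at t)" if t: "t \<in> I" for t i
  proof -
    have "((\<lambda>s. \<Sum>j\<in>UNIV - {i}. (P j t o\<^sub>L P i s) - (P i t o\<^sub>L P j s)) \<longlongrightarrow> (\<Sum>j\<in>UNIV - {i}. 0 - 0)) (at t)"
      by (intro tendsto_sum tendsto_diff R0 t) auto
    then have "((\<lambda>s. P i s - P i t) \<longlongrightarrow> 0) (at t)"
      unfolding diff_self sum.neutral_const by (rule Lim_transform_eventually) (use evI[OF t] Pdiff[OF _ t] in \<open>auto elim!: eventually_mono\<close>)
    then show ?thesis by (rule LIM_zero_cancel)
  qed
  \<comment> \<open>The limit of P_j(t) P_i(s) / (s - t) as s tends to t, read off from
    \<open>key\<close> divided by s - t.\<close>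
  define W where "W i j t = inverse (k t i - k t j) *\<^sub>R (P j t o\<^sub>L vderiv Q t o\<^sub>L P i t)" for i j t
  have Rd: "((\<lambda>s. inverse (s - t) *\<^sub>R (P j t o\<^sub>L P i s)) \<longlongrightarrow> W i j t) (at t)"
    if t: "t \<in> I" and ij: "i \<noteq> j" for t i j
  proof -
    have q: "((\<lambda>s. (Q s - Q t) /\<^sub>R (s - t)) \<longlongrightarrow> vderiv Q t) (at t)"
      using smooth_D(1)[OF sQ t] by (simp add: has_vector_derivative_iff_tendsto)
    have "((\<lambda>s. inverse (k s i - k t j) *\<^sub>R (P j t o\<^sub>L ((Q s - Q t) /\<^sub>R (s - t)) o\<^sub>L P i s)) \<longlongrightarrow> W i j t) (at t)"
      unfolding W_def
      by (intro tendsto_scaleR kinv t ij bounded_bilinear.tendsto[OF bounded_bilinear_blinfun_compose]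
          tendsto_const q Pcont)
    then show ?thesis
    proof (rule Lim_transform_eventually)
      show "\<forall>\<^sub>F s in at t. inverse (k s i - k t j) *\<^sub>R (P j t o\<^sub>L ((Q s - Q t) /\<^sub>R (s - t)) o\<^sub>L P i s) =
         inverse (s - t) *\<^sub>R (P j t o\<^sub>L P i s)"
        using R[OF t ij]
      proof eventually_elim
        case (elim s)
        show ?case unfolding elim
          by (rule blinfun_eqI) (simp add: blinfun.bilinear_simps)
      qed
    qed
  qed
  have dP: "(P i has_vector_derivative (\<Sum>j\<in>UNIV - {i}. W i j t - W j i t)) (at t)" if t: "t \<in> I" for i t
    unfolding has_vector_derivative_iff_tendsto
  proof (rule Lim_transform_eventually)
    show "((\<lambda>s. \<Sum>j\<in>UNIV - {i}. inverse (s - t) *\<^sub>R (P j t o\<^sub>L P i s) - inverse (s - t) *\<^sub>R (P i t o\<^sub>L P j s)) \<longlongrightarrow>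
        (\<Sum>j\<in>UNIV - {i}. W i j t - W j i t)) (at t)"
      by (intro tendsto_sum tendsto_diff Rd t) auto
    show "\<forall>\<^sub>F s in at t. (\<Sum>j\<in>UNIV - {i}. inverse (s - t) *\<^sub>R (P j t o\<^sub>L P i s) - inverse (s - t) *\<^sub>R (P i t o\<^sub>L P j s)) =
        (P i s - P i t) /\<^sub>R (s - t)"
      using evI[OF t]
      by eventually_elim (simp add: Pdiff[OF _ t] scaleR_sum_right scaleR_diff_right)
  qed
  \<comment> \<open>The eigenvalue is the trace of Q P_i, so its smoothness follows from that of Q
    and P_i.\<close>
  have ktrace: "k t i = (\<Sum>b\<in>Basis. b \<bullet> (Q t o\<^sub>L P i t) b)" if "t \<in> I" for t i
  proof -
    have "(\<Sum>b\<in>Basis. b \<bullet> (Q t o\<^sub>L P i t) b) = k t i * (\<Sum>b\<in>Basis. (v t i \<bullet> b) * (v t i \<bullet> b))"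
      unfolding QP[OF that] by (simp add: P_def blinfun.bilinear_simps sum_distrib_left inner_commute mult_ac)
    also have "\<dots> = k t i * (v t i \<bullet> v t i)" by (simp add: euclidean_inner[of "v t i" "v t i"])
    finally show ?thesis using on[OF that, of i i] by simp
  qed
  have smk: "ksmooth m (\<lambda>t. k t i) I" if "\<forall>i. ksmooth m (P i) I" for m i
  proof (rule ksmooth_cong[OF I(1)])
    show "(\<Sum>b\<in>Basis. b \<bullet> (Q t o\<^sub>L P i t) b) = k t i" if "t \<in> I" for t using ktrace[OF that] by simp
    have "bounded_linear (\<lambda>T :: (real^'n::{finite,linorder}) \<Rightarrow>\<^sub>L (real^'n::{finite,linorder}). b \<bullet> T b)" for b
      by (intro bounded_linear_inner_right_comp blinfun.bounded_linear_left)
    then show "ksmooth m (\<lambda>t. \<Sum>b\<in>Basis. b \<bullet> (Q t o\<^sub>L P i t) b) I"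
      by (intro ksmooth_sum I(1) ksmooth_linear[where l = "\<lambda>T. _ \<bullet> blinfun_apply T _"]
          ksmooth_bilinear[OF bounded_bilinear_blinfun_compose])
         (use that sQ in \<open>auto simp: smooth_iff_ksmooth\<close>)
  qed
  have sWW: "ksmooth m (W i j) I" if m: "\<forall>i. ksmooth m (P i) I" and "i \<noteq> j" for m i j
    unfolding W_def
    by (intro ksmooth_bilinear[OF bounded_bilinear_scaleR I(1)] ksmooth_inverse I(1)
        ksmooth_bilinear[OF bounded_bilinear_blinfun_compose I(1)])
       (use that smk[OF m] smooth_D(2)[OF sQ] kneq ksmooth_const[OF I(1)]
          ksmooth_add[OF I(1) smk[OF m, of i] ksmooth_linear[OF bounded_linear_minus[OF bounded_linear_ident] I(1) smk[OF m, of j]]]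
         in \<open>auto simp: smooth_iff_ksmooth\<close>)
  \<comment> \<open>By \<open>dP\<close> the derivative of the projections is an expression in the
    projections, Q' and inverse eigenvalue differences, so all orders follow from each
    other.\<close>
  have smP: "\<forall>i. ksmooth m (P i) I" for m
  proof (induction m)
    case (Suc m)
    have "ksmooth m (\<lambda>t. \<Sum>j\<in>UNIV - {i}. W i j t - W j i t) I" for i
    proof (rule ksmooth_sum[OF I(1)])
      fix j assume "j \<in> UNIV - {i}"
      then show "ksmooth m (\<lambda>t. W i j t - W j i t) I"
        using ksmooth_add[OF I(1) sWW[OF Suc, of i j]
            ksmooth_linear[OF bounded_linear_minus[OF bounded_linear_ident] I(1) sWW[OF Suc, of j i]]]
        by auto
    qed
    then show ?case using ksmooth_SucI[OF I(1) dP] by blast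
  qed simp
  have sP: "smooth_on_line (P i) I" for i using smP by (simp add: smooth_iff_ksmooth)
  have sk: "smooth_on_line (\<lambda>t. k t i) I" for i using smk smP by (simp add: smooth_iff_ksmooth)
  \<comment> \<open>Differentiation of P^2 = P; multiplied by P on both sides it yields P P' P =
    0.\<close>
  have PD: "(P i t o\<^sub>L vderiv (P i) t) + (vderiv (P i) t o\<^sub>L P i t) = vderiv (P i) t" if "t \<in> I" for i t
  proof -
    have "((\<lambda>s. P i s o\<^sub>L P i s) has_vector_derivative
        (P i t o\<^sub>L vderiv (P i) t) + (vderiv (P i) t o\<^sub>L P i t)) (at t)"
      by (intro bounded_bilinear.has_vector_derivative[OF bounded_bilinear_blinfun_compose] smooth_D(1)[OF sP that])
    then have "(P i has_vector_derivative (P i t o\<^sub>L vderiv (P i) t) + (vderiv (P i) t o\<^sub>L P i t)) (at t)"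
      by (rule has_vector_derivative_transform_within_open[OF _ I(1) that]) (simp add: PP)
    then show ?thesis using vderiv_eqI by metis
  qed
  have PDP: "P i t (vderiv (P i) t (P i t x)) = 0" if "t \<in> I" for i t x
  proof -
    have "P i t (P i t y) = P i t y" for y using PP[OF that, of i i] by (metis blinfun_apply_blinfun_compose)
    moreover have "P i t (vderiv (P i) t (P i t x)) =
        P i t (P i t (vderiv (P i) t (P i t x)) + vderiv (P i) t (P i t (P i t x)))"
      using PD[OF that, of i] by (metis blinfun_apply_blinfun_compose plus_blinfun.rep_eq)
    ultimately show ?thesis by (simp add: blinfun.add_right)
  qed
  obtain t0 where t0: "t0 \<in> I" using I(3) by blast
  \<comment> \<open>Transport by w' = P' w. For a unit vector in the moving line, P w = w and P P' P
    = 0 show that the derivative is orthogonal to the line.\<close>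
  have "\<forall>i. \<exists>w. w t0 = v t0 i \<and> (\<forall>t\<in>I. (w has_vector_derivative vderiv (P i) t (w t)) (at t))"
  proof
    fix i
    show "\<exists>w. w t0 = v t0 i \<and> (\<forall>t\<in>I. (w has_vector_derivative vderiv (P i) t (w t)) (at t))"
      by (rule linear_ode_existence[OF I(1,2) t0, of "vderiv (P i)" "v t0 i"])
         (use smooth_continuous_on[OF smooth_D(2)[OF sP]] in blast)+
  qed
  then obtain w where w0: "\<And>i. w i t0 = v t0 i"
    and dw: "\<And>i t. t \<in> I \<Longrightarrow> (w i has_vector_derivative vderiv (P i) t (w i t)) (at t)"
    by metis
  have sw: "smooth_on_line (w i) I" for i
    by (rule linear_ode_smooth[OF I(1) smooth_D(2)[OF sP] dw])
  have Pw: "P i t (w i t) = w i t" if t: "t \<in> I" for i t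
  proof -
    \<comment> \<open>The defect z = P w - w has derivative P P' w, and this equals -P P' z because
      P P' P = 0.\<close>
    have "P i t (w i t) - w i t = 0"
    proof (rule linear_ode_zero[OF I(1,2) t0, where A = "\<lambda>t. - (P i t o\<^sub>L vderiv (P i) t)"])
      show "continuous_on I (\<lambda>t. - (P i t o\<^sub>L vderiv (P i) t))"
        by (intro continuous_on_minus bounded_bilinear.continuous_on[OF bounded_bilinear_blinfun_compose]
            smooth_continuous_on smooth_D(2) sP)
      show "P i t0 (w i t0) - w i t0 = 0" using on[OF t0, of i i] by (simp add: w0 P_def)
      fix t assume t: "t \<in> I"
      have "((\<lambda>t. P i t (w i t) - w i t) has_vector_derivative
         (P i t (vderiv (P i) t (w i t)) + vderiv (P i) t (w i t)) - vderiv (P i) t (w i t)) (at t)"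
        by (intro has_vector_derivative_diff bounded_bilinear.has_vector_derivative[OF bounded_bilinear_blinfun_apply]
            dw t smooth_D(1)[OF sP])
      moreover have "(P i t (vderiv (P i) t (w i t)) + vderiv (P i) t (w i t)) - vderiv (P i) t (w i t) =
         (- (P i t o\<^sub>L vderiv (P i) t)) (P i t (w i t) - w i t)"
        by (simp add: blinfun.bilinear_simps PDP[OF t])
      ultimately show "((\<lambda>t. P i t (w i t) - w i t) has_vector_derivative
         (- (P i t o\<^sub>L vderiv (P i) t)) (P i t (w i t) - w i t)) (at t)" by metis
    qed (rule t)
    then show ?thesis by simp
  qed
  have adjP: "P i t x \<bullet> y = x \<bullet> P i t y" for i t x y by (simp add: P_def inner_commute)
  have nw: "w i t \<bullet> w i t = 1" if t: "t \<in> I" for i t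
  proof -
    have "w i t \<bullet> w i t = w i t0 \<bullet> w i t0"
    proof (rule has_vector_derivative_zero_imp_eq[OF I(2) _ t t0])
      fix t assume t: "t \<in> I"
      have "w i t \<bullet> vderiv (P i) t (w i t) = P i t (w i t) \<bullet> vderiv (P i) t (P i t (w i t))"
        by (simp add: Pw[OF t])
      also have "\<dots> = 0" by (simp add: adjP PDP[OF t])
      finally have "w i t \<bullet> vderiv (P i) t (w i t) = 0" .
      moreover have "((\<lambda>t. w i t \<bullet> w i t) has_vector_derivative
          w i t \<bullet> vderiv (P i) t (w i t) + vderiv (P i) t (w i t) \<bullet> w i t) (at t)"
        by (intro bounded_bilinear.has_vector_derivative[OF bounded_bilinear_inner] dw t)
      ultimately show "((\<lambda>t. w i t \<bullet> w i t) has_vector_derivative 0) (at t)" by (simp add: inner_commute)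
    qed
    then show ?thesis using on[OF t0, of i i] by (simp add: w0)
  qed
  show ?thesis
  proof (rule that[of k "\<lambda>t i. w i t"])
    show "Q t (w i t) = k t i *\<^sub>R w i t" if "t \<in> I" for t i
      using QP[OF that, of i] Pw[OF that, of i] by (metis blinfun_apply_blinfun_compose scaleR_blinfun.rep_eq)
    show "w i t \<bullet> w j t = (if i = j then 1 else 0)" if "t \<in> I" for t i j
    proof (cases "i = j")
      case False
      have "w i t \<bullet> w j t = P i t (w i t) \<bullet> P j t (w j t)" by (simp add: Pw that)
      also have "\<dots> = w i t \<bullet> (P i t o\<^sub>L P j t) (w j t)" by (simp add: adjP)
      finally show ?thesis using False PP[OF that] by simp
    qed (simp add: nw that)
  qed (use sk sw mono in auto)
qed


section \<open>Bases indexed by a finite type\<close>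

definition lincomb :: "('i::finite \<Rightarrow> 'w::real_vector) \<Rightarrow> real^'i \<Rightarrow> 'w" where
  "lincomb b c = (\<Sum>i\<in>UNIV. c $ i *\<^sub>R b i)"

lemma lincomb_linear:
  "lincomb b (c + d) = lincomb b c + lincomb b d" "lincomb b (c - d) = lincomb b c - lincomb b d"
  "lincomb b (r *\<^sub>R c) = r *\<^sub>R lincomb b c" "lincomb b 0 = 0" "lincomb b (- c) = - lincomb b c"
  by (simp_all add: lincomb_def scaleR_add_left scaleR_diff_left sum.distrib sum_subtractf scaleR_sum_right
      sum_negf)

lemma lincomb_axis [simp]: "lincomb b (axis i 1) = b i"
  by (simp add: lincomb_def axis_def if_distrib[of "\<lambda>x. x *\<^sub>R _"] cong: if_cong)

lemma lincomb_in_span: "lincomb b c \<in> span (range b)"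
  unfolding lincomb_def by (intro span_sum span_scale span_base) auto

lemma span_range_lincomb: "span (range b) = range (lincomb b)"
proof
  show "range (lincomb b) \<subseteq> span (range b)" using lincomb_in_span by auto
  have "subspace (range (lincomb b))"
    unfolding subspace_def
    by (auto simp: lincomb_linear(1,3)[symmetric]) (metis lincomb_linear(4) rangeI)
  moreover have "range b \<subseteq> range (lincomb b)"
  proof safe
    show "b i \<in> range (lincomb b)" for i by (rule range_eqI[of _ _ "axis i 1"]) simp
  qed
  ultimately show "span (range b) \<subseteq> range (lincomb b)" by (simp add: span_minimal)
qed

lemma lincomb_image: "linear a \<Longrightarrow> a (lincomb b c) = lincomb (\<lambda>i. a (b i)) c"
  by (simp add: lincomb_def linear_sum linear_scale)

lemma family_independentI:
  fixes b :: "'i::finite \<Rightarrow> 'w::real_vector"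
  assumes "\<And>c. lincomb b c = 0 \<Longrightarrow> c = 0"
  shows "inj b" "independent (range b)"
proof -
  show inj: "inj b"
  proof (rule injI, rule ccontr)
    fix i j assume "b i = b j" "i \<noteq> j"
    have "lincomb b (axis i 1 - axis j 1) = 0" by (simp add: lincomb_linear \<open>b i = b j\<close>)
    then have "axis i 1 - axis j (1::real) = 0" using assms by blast
    then have "(axis i 1 - axis j (1::real)) $ i = 0" by simp
    then show False using \<open>i \<noteq> j\<close> by (simp add: axis_def)
  qed
  show "independent (range b)"
  proof
    assume "dependent (range b)"
    then obtain u i where u: "u (b i) \<noteq> 0" "(\<Sum>v\<in>range b. u v *\<^sub>R v) = 0"
      unfolding dependent_finite[OF finite_imageI[OF finite]] by blast
    have "lincomb b (\<chi> i. u (b i)) = 0"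
      using u(2) unfolding lincomb_def sum.reindex[OF inj] by simp
    then have "(\<chi> i. u (b i)) = 0" using assms by blast
    then show False using u(1) by (metis vec_lambda_beta zero_index)
  qed
qed

lemma basis_of_lincomb_zero:
  assumes "basis_of b V" "lincomb b c = 0"
  shows "c = 0"
proof (rule ccontr)
  assume "c \<noteq> 0"
  then obtain i where i: "c $ i \<noteq> 0" by (metis vec_eq_iff zero_index)
  have inj: "inj b" and ind: "independent (range b)" using assms(1) by (auto simp: basis_of_def)
  let ?u = "\<lambda>v. c $ inv b v"
  have "(\<Sum>v\<in>range b. ?u v *\<^sub>R v) = 0"
    using assms(2) inj unfolding sum.reindex[OF inj] lincomb_def by simp
  moreover have "?u (b i) \<noteq> 0" using i inj by simp
  ultimately have "\<exists>u. (\<exists>v\<in>range b. u v \<noteq> 0) \<and> (\<Sum>v\<in>range b. u v *\<^sub>R v) = 0"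
    by (intro exI[of _ ?u] conjI bexI[of _ "b i"]) auto
  then have "dependent (range b)" unfolding dependent_finite[OF finite_imageI[OF finite]] .
  then show False using ind by simp
qed

lemma basis_of_lincomb_eq:
  assumes "basis_of b V" "lincomb b c = lincomb b d"
  shows "c = d"
  using basis_of_lincomb_zero[OF assms(1), of "c - d"] assms(2) by (simp add: lincomb_linear)

lemma basis_of_span: "basis_of b V \<Longrightarrow> V = range (lincomb b)"
  by (metis basis_of_def span_range_lincomb)

lemma basis_of_coords: "basis_of b V \<Longrightarrow> v \<in> V \<Longrightarrow> \<exists>c. v = lincomb b c"
  using basis_of_span by blast

lemma basis_of_in: "basis_of b V \<Longrightarrow> b i \<in> V" "basis_of b V \<Longrightarrow> lincomb b c \<in> V"
  unfolding basis_of_def by (auto intro: span_base) (use lincomb_in_span in blast)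

lemma basis_of_subspace: "basis_of b V \<Longrightarrow> subspace V"
  unfolding basis_of_def by auto

lemma basis_of_dim:
  fixes b :: "'i::finite \<Rightarrow> 'w::euclidean_space"
  assumes "basis_of b V" shows "dim V = CARD('i)"
proof -
  have "card (range b) = CARD('i)" using assms by (intro card_image) (auto simp: basis_of_def)
  then show ?thesis using assms indep_card_eq_dim_span by (metis basis_of_def)
qed

lemma basis_ofI:
  fixes b :: "'i::finite \<Rightarrow> 'w::euclidean_space"
  assumes "\<And>c. lincomb b c = 0 \<Longrightarrow> c = 0" "\<And>i. b i \<in> V" "subspace V" "dim V = CARD('i)"
  shows "basis_of b V"
proof -
  note ind = family_independentI[OF assms(1)]
  have "card (range b) = dim V" using card_image[OF ind(1)] assms(4) by simp
  then have "V \<subseteq> span (range b)" using assms(2) ind(2) by (intro card_ge_dim_independent) auto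
  moreover have "span (range b) \<subseteq> V" using assms(2,3) by (intro span_minimal) auto
  ultimately show ?thesis using ind unfolding basis_of_def by blast
qed

lemma basis_of_spanI:
  fixes b :: "'i::finite \<Rightarrow> 'w::euclidean_space"
  assumes "\<And>c. lincomb b c = 0 \<Longrightarrow> c = 0"
  shows "basis_of b (span (range b))"
  using family_independentI[of b, OF assms] by (simp add: basis_of_def)

lemma basis_of_exists:
  fixes V :: "'w::euclidean_space set"
  assumes "subspace V" "dim V = CARD('i::finite)"
  obtains b :: "'i::finite \<Rightarrow> 'w" where "basis_of b V"
proof -
  obtain B where B: "B \<subseteq> V" "independent B" "V \<subseteq> span B" "card B = dim V" by (rule basis_exists)
  have "finite B" using B(2) by (rule independent_imp_finite)
  then obtain b :: "'i \<Rightarrow> 'w" where b: "bij_betw b UNIV B"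
    using finite_same_card_bij[of "UNIV :: 'i set" B] B(4) assms(2) by auto
  then have "inj b" "range b = B" by (auto simp: bij_betw_def)
  moreover have "span B = V" using B(1,3) assms(1) span_minimal by blast
  ultimately show ?thesis using B(2) that[of b] by (simp add: basis_of_def)
qed

lemma lincomb_sum_type:
  "lincomb e c = lincomb (\<lambda>i. e (Inl i)) (\<chi> i. c $ Inl i) + lincomb (\<lambda>i. e (Inr i)) (\<chi> i. c $ Inr i)"
  unfolding lincomb_def by (subst UNIV_Plus_UNIV[symmetric], subst sum.Plus) (auto simp: o_def)

lemma basis_of_sum_typeD:
  fixes e :: "'n::finite + 'n \<Rightarrow> 'w::euclidean_space"
  assumes e: "basis_of e V" and eq: "lincomb (\<lambda>i. e (Inl i)) a + lincomb (\<lambda>i. e (Inr i)) b = 0"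
  shows "a = 0" "b = 0"
proof -
  let ?c = "(\<chi> x. case x of Inl i \<Rightarrow> a $ i | Inr i \<Rightarrow> b $ i) :: real^('n + 'n)"
  have "lincomb e ?c = 0" using eq by (simp add: lincomb_sum_type[of e])
  then have "?c = 0" using basis_of_lincomb_zero[OF e] by blast
  then have "?c $ Inl i = 0" "?c $ Inr i = 0" for i by simp_all
  then show "a = 0" "b = 0" by (simp_all add: vec_eq_iff)
qed

section \<open>Trace and determinant in an eigenbasis\<close>

lemma matrix_in_eqI:
  assumes b: "basis_of b V" and eq: "\<And>j. T (b j) = lincomb b (\<chi> i. A $ i $ j)"
  shows "matrix_in b T = A"
proof -
  have inj: "inj b" and ind: "independent (range b)" using b by (auto simp: basis_of_def)
  have "representation (range b) (T (b j)) (b i) = A $ i $ j" for i j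
  proof -
    have "T (b j) \<in> span (range b)" unfolding eq by (rule lincomb_in_span)
    then have "(\<Sum>v\<in>range b. representation (range b) (T (b j)) v *\<^sub>R v) = T (b j)"
      by (intro real_vector.sum_representation_eq ind) auto
    then have "lincomb b (\<chi> i. representation (range b) (T (b j)) (b i)) = lincomb b (\<chi> i. A $ i $ j)"
      unfolding eq[symmetric] unfolding lincomb_def sum.reindex[OF inj] by simp
    from basis_of_lincomb_eq[OF b this] show ?thesis by (simp add: vec_eq_iff)
  qed
  then show ?thesis by (simp add: matrix_in_def vec_eq_iff)
qed

text \<open>\<open>op_det\<close> and \<open>op_trace\<close> use a basis picked by
  \<open>SOME\<close>, of which nothing else is known; the matrix of T in it is therefore compared
  with the diagonal matrix through the two transition matrices.\<close>

lemma eigenbasis_matrix_similar: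
  fixes b b0 :: "'n::finite \<Rightarrow> 'w::euclidean_space"
  assumes b: "basis_of b V" and b0: "basis_of b0 V"
    and T: "\<And>c. T (lincomb b0 c) = lincomb b0 (\<chi> i. l i * c $ i)"
  obtains A B :: "real^'n^'n" where "A ** B = mat 1"
    "matrix_in b T = B ** (\<chi> i j. if i = j then l i else 0) ** A"
proof -
  have "\<exists>A :: real^'n^'n. \<forall>j. b j = lincomb b0 (\<chi> i. A $ i $ j)"
  proof -
    obtain c where c: "\<And>j. b j = lincomb b0 (c j)"
      using basis_of_coords[OF b0 basis_of_in(1)[OF b]] by metis
    then show ?thesis by (intro exI[of _ "\<chi> i j. c j $ i"]) simp
  qed
  then obtain A :: "real^'n^'n" where A: "\<And>j. b j = lincomb b0 (\<chi> i. A $ i $ j)" by blast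
  have "\<exists>B :: real^'n^'n. \<forall>j. b0 j = lincomb b (\<chi> i. B $ i $ j)"
  proof -
    obtain c where c: "\<And>j. b0 j = lincomb b (c j)"
      using basis_of_coords[OF b basis_of_in(1)[OF b0]] by metis
    then show ?thesis by (intro exI[of _ "\<chi> i j. c j $ i"]) simp
  qed
  then obtain B :: "real^'n^'n" where B: "\<And>j. b0 j = lincomb b (\<chi> i. B $ i $ j)" by blast
  have tr: "lincomb b0 c = lincomb b (B *v c)" for c
    unfolding lincomb_def[of b0] B
    by (simp add: lincomb_def matrix_vector_mult_def scaleR_sum_right scaleR_sum_left mult.commute)
       (rule sum.swap)
  have tr': "lincomb b c = lincomb b0 (A *v c)" for c
    unfolding lincomb_def[of b] A
    by (simp add: lincomb_def matrix_vector_mult_def scaleR_sum_right scaleR_sum_left mult.commute)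
       (rule sum.swap)
  have "(A ** B) *v c = c" for c
    using basis_of_lincomb_eq[OF b0, of "A *v (B *v c)" c] tr tr' by (metis matrix_vector_mul_assoc)
  then have AB: "A ** B = mat 1" by (simp add: matrix_eq)
  let ?D = "(\<chi> i j. if i = j then l i else 0) :: real^'n^'n"
  have D: "(\<chi> i. l i * c $ i) = ?D *v c" for c
    by (simp add: vec_eq_iff matrix_vector_mult_def if_distrib[of "\<lambda>x. x * _"] cong: if_cong)
  have "matrix_in b T = B ** ?D ** A"
  proof (rule matrix_in_eqI[OF b])
    fix j
    have col: "(\<chi> i. M $ i $ j) = M *v axis j 1" for M :: "real^'n^'n"
      by (simp add: vec_eq_iff matrix_vector_mult_def axis_def if_distrib cong: if_cong)
    show "T (b j) = lincomb b (\<chi> i. (B ** ?D ** A) $ i $ j)"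
    proof -
      have "T (b j) = T (lincomb b0 (A *v axis j 1))" by (subst A[of j]) (simp only: col)
      also have "\<dots> = lincomb b0 (?D *v (A *v axis j 1))" by (simp only: T D)
      also have "\<dots> = lincomb b (B *v (?D *v (A *v axis j 1)))" by (rule tr)
      also have "\<dots> = lincomb b (\<chi> i. (B ** ?D ** A) $ i $ j)"
        by (simp only: col matrix_vector_mul_assoc matrix_mul_assoc)
      finally show ?thesis .
    qed
  qed
  then show ?thesis using that AB by blast
qed

lemma op_det_trace_eigenbasis:
  fixes b0 :: "'n::finite \<Rightarrow> 'w::euclidean_space"
  assumes b0: "basis_of b0 V" and T: "\<And>c. T (lincomb b0 c) = lincomb b0 (\<chi> i. l i * c $ i)"
  shows "op_det TYPE('n) V T = (\<Prod>i\<in>UNIV. l i)" "op_trace TYPE('n) V T = (\<Sum>i\<in>UNIV. l i)"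
proof -
  let ?b = "SOME b :: 'n \<Rightarrow> 'w. basis_of b V"
  have b: "basis_of ?b V" by (rule someI[where P = "\<lambda>b. basis_of b V", OF b0])
  let ?D = "(\<chi> i j. if i = j then l i else 0) :: real^'n^'n"
  obtain A B :: "real^'n^'n" where AB: "A ** B = mat 1" "matrix_in ?b T = B ** ?D ** A"
    using eigenbasis_matrix_similar[OF b b0 T] .
  have "det B * det A = 1" using AB(1) det_mul[of A B] by (simp add: mult.commute)
  moreover have "det ?D = (\<Prod>i\<in>UNIV. l i)" by (subst det_diagonal) auto
  ultimately show "op_det TYPE('n) V T = (\<Prod>i\<in>UNIV. l i)"
    unfolding op_det_def AB(2) det_mul by (simp add: mult_ac)
  have "trace (B ** ?D ** A) = trace (A ** (B ** ?D))" by (rule trace_mul_sym)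
  also have "\<dots> = trace ?D" by (simp add: matrix_mul_assoc AB(1))
  finally show "op_trace TYPE('n) V T = (\<Sum>i\<in>UNIV. l i)"
    unfolding op_trace_def AB(2) by (simp add: trace_def)
qed

section \<open>Symplectic linear algebra\<close>

lemma symplectic_bilinear: "symplectic_form \<omega> \<Longrightarrow> bounded_bilinear \<omega>"
  by (simp add: symplectic_form_def bilinear_conv_bounded_bilinear)

lemma symplectic_skew:
  assumes "symplectic_form \<omega>" shows "\<omega> u v = - \<omega> v u"
proof -
  interpret bounded_bilinear \<omega> by (rule symplectic_bilinear[OF assms])
  have "\<omega> (u + v) (u + v) = 0" "\<omega> u u = 0" "\<omega> v v = 0" using assms by (auto simp: symplectic_form_def)
  then show ?thesis by (simp add: add_left add_right)
qed

lemma symplectic_scale: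
  assumes "symplectic_form \<omega>" "\<sigma> \<noteq> (0::real)"
  shows "symplectic_form (\<lambda>u v. \<sigma> * \<omega> u v)"
proof -
  have "bilinear \<omega>" using assms(1) by (simp add: symplectic_form_def)
  then have "bilinear (\<lambda>u v. \<sigma> * \<omega> u v)"
    unfolding bilinear_def linear_iff by (simp add: algebra_simps)
  then show ?thesis using assms by (auto simp: symplectic_form_def)
qed

lemma bilinear_lincomb:
  fixes \<omega> :: "'w::real_normed_vector \<Rightarrow> 'w \<Rightarrow> real"
  assumes "bounded_bilinear \<omega>"
  shows "\<omega> (lincomb f a) v = (\<Sum>i\<in>UNIV. a $ i * \<omega> (f i) v)"
    "\<omega> v (lincomb f a) = (\<Sum>i\<in>UNIV. a $ i * \<omega> v (f i))"
proof -
  interpret bounded_bilinear \<omega> by (rule assms)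
  show "\<omega> (lincomb f a) v = (\<Sum>i\<in>UNIV. a $ i * \<omega> (f i) v)"
    "\<omega> v (lincomb f a) = (\<Sum>i\<in>UNIV. a $ i * \<omega> v (f i))"
    by (simp_all add: lincomb_def sum_left sum_right scaleR_left scaleR_right)
qed

lemma lagrangian_scale:
  "\<sigma> \<noteq> (0::real) \<Longrightarrow> lagrangian (\<lambda>u v. \<sigma> * \<omega> u v) L \<longleftrightarrow> lagrangian \<omega> L"
  by (simp add: lagrangian_def)

text \<open>A Lagrangian subspace is its own \<omega>-complement. Writing \<omega> x v = x \<bullet>
  J v with J injective turns the complement of L into the Euclidean complement of J L, whose
  dimension is again that of L.\<close>

lemma lagrangian_maximal:
  fixes \<omega> :: "'w::euclidean_space \<Rightarrow> 'w \<Rightarrow> real"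
  assumes \<omega>: "symplectic_form \<omega>" and L: "lagrangian \<omega> L" and x: "\<And>d. d \<in> L \<Longrightarrow> \<omega> x d = 0"
  shows "x \<in> L"
proof -
  interpret bounded_bilinear \<omega> by (rule symplectic_bilinear[OF \<omega>])
  define J where "J v = (\<Sum>b\<in>Basis. \<omega> b v *\<^sub>R b)" for v
  have xJ: "x \<bullet> J v = \<omega> x v" for x v
  proof -
    have "\<omega> x v = \<omega> (\<Sum>b\<in>Basis. (x \<bullet> b) *\<^sub>R b) v" by (simp add: euclidean_representation)
    then show ?thesis
      by (simp only: sum_left scaleR_left) (simp add: J_def inner_sum_right mult.commute)
  qed
  have linJ: "linear J"
    by (rule linearI) (auto simp: J_def add_right scaleR_right scaleR_add_left sum.distrib scaleR_sum_right)
  have "J v = 0 \<Longrightarrow> v = 0" for v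
    using xJ[of _ v] \<omega> symplectic_skew[OF \<omega>, of v] by (simp add: symplectic_form_def)
  then have injJ: "inj J" using linJ linear_injective_0 by blast
  have subL: "subspace L" and dimL: "2 * dim L = DIM('w)" and iso: "\<And>u v. u \<in> L \<Longrightarrow> v \<in> L \<Longrightarrow> \<omega> u v = 0"
    using L by (auto simp: lagrangian_def)
  let ?K = "{y \<in> UNIV. \<forall>x\<in>J ` L. orthogonal x y}"
  have "dim ?K + dim (J ` L) = dim (UNIV :: 'w set)"
    by (rule dim_subspace_orthogonal_to_vectors) (use linJ subL in \<open>auto intro: linear_subspace_image\<close>)
  moreover have "dim (J ` L) = dim L"
    by (rule dim_image_eq[OF linJ]) (use injJ in \<open>auto intro: inj_on_subset\<close>)
  ultimately have "dim ?K \<le> dim L" using dimL by simp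
  moreover have "L \<subseteq> ?K"
    using iso by (auto simp: orthogonal_def inner_commute[of "J _"] xJ)
  moreover have "subspace ?K"
    by (auto simp: subspace_def orthogonal_def inner_add_right)
  ultimately have "L = ?K" using subL by (intro subspace_dim_equal)
  moreover have "x \<in> ?K" using x by (auto simp: orthogonal_def inner_commute[of "J _"] xJ)
  ultimately show ?thesis by blast
qed

lemma transverse_decomposition:
  fixes L D :: "'w::euclidean_space set"
  assumes "subspace L" "subspace D" "dim L + dim D = DIM('w)" "L \<inter> D = {0}"
  obtains a b where "a \<in> L" "b \<in> D" "x = a + b"
proof -
  have sub: "subspace {x + y |x y. x \<in> L \<and> y \<in> D}" using assms(1,2) by (rule subspace_sums)
  have "dim {x + y |x y. x \<in> L \<and> y \<in> D} = DIM('w)"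
    using dim_sums_Int[OF assms(1,2)] assms(3,4) by simp
  then have "span {x + y |x y. x \<in> L \<and> y \<in> D} = UNIV" by (simp only: dim_eq_full)
  then have "{x + y |x y. x \<in> L \<and> y \<in> D} = UNIV" using span_eq_iff[THEN iffD2, OF sub] by simp
  then have "x \<in> {x + y |x y. x \<in> L \<and> y \<in> D}" by simp
  then show ?thesis using that by blast
qed

lemma graph_map_eqI:
  assumes "subspace D" "subspace L" "L \<inter> D = {0}" "w \<in> D" "u + w \<in> L"
  shows "graph_map L0 D L u = w"
  unfolding graph_map_def
proof (rule the_equality)
  fix w' assume w': "w' \<in> D \<and> u + w' \<in> L"
  have "w' - w \<in> D" using assms w' by (simp add: subspace_diff)
  moreover have "w' - w \<in> L" using subspace_diff[OF assms(2), of "u + w'" "u + w"] assms w' by simp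
  ultimately have "w' - w \<in> {0}" using assms(3) by blast
  then show "w' = w" by simp
qed (use assms in auto)

text \<open>Pairing with one half of the basis reads off the coordinates in the other half, with a
  sign for the second half.\<close>

lemma symplectic_coords:
  assumes \<omega>: "symplectic_form \<omega>"
    and rel: "\<And>i j. \<omega> (e (Inl i)) (e (Inl j)) = 0" "\<And>i j. \<omega> (e (Inr i)) (e (Inr j)) = 0"
      "\<And>i j. \<omega> (e (Inl i)) (e (Inr j)) = (if i = j then 1 else 0)"
  shows "\<omega> (lincomb (\<lambda>i. e (Inl i)) a + lincomb (\<lambda>i. e (Inr i)) b) (e (Inr j)) = a $ j"
    "\<omega> (lincomb (\<lambda>i. e (Inl i)) a + lincomb (\<lambda>i. e (Inr i)) b) (e (Inl j)) = - b $ j"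
proof -
  interpret bounded_bilinear \<omega> by (rule symplectic_bilinear[OF \<omega>])
  have r: "\<omega> (e (Inr i)) (e (Inl j)) = - (if i = j then 1 else 0)" for i j
    using symplectic_skew[OF \<omega>, of "e (Inr i)" "e (Inl j)"] rel(3)[of j i] by auto
  show "\<omega> (lincomb (\<lambda>i. e (Inl i)) a + lincomb (\<lambda>i. e (Inr i)) b) (e (Inr j)) = a $ j"
    "\<omega> (lincomb (\<lambda>i. e (Inl i)) a + lincomb (\<lambda>i. e (Inr i)) b) (e (Inl j)) = - b $ j"
    by (simp_all add: add_left bilinear_lincomb[OF symplectic_bilinear[OF \<omega>]] rel r sum_negf
        if_distrib[of "\<lambda>x. _ * x"] cong: if_cong)
qed

text \<open>The relations already imply linear independence, because pairings recover all
  coordinates; counting dimensions does the rest.\<close>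

lemma symplectic_basisI:
  fixes e :: "'n::finite + 'n \<Rightarrow> 'w::euclidean_space"
  assumes \<omega>: "symplectic_form \<omega>" and dim: "DIM('w) = 2 * CARD('n)"
    and rel: "\<And>i j. \<omega> (e (Inl i)) (e (Inl j)) = 0" "\<And>i j. \<omega> (e (Inr i)) (e (Inr j)) = 0"
      "\<And>i j. \<omega> (e (Inl i)) (e (Inr j)) = (if i = j then 1 else 0)"
  shows "symplectic_basis \<omega> e"
proof -
  interpret bounded_bilinear \<omega> by (rule symplectic_bilinear[OF \<omega>])
  have "basis_of e UNIV"
  proof (rule basis_ofI)
    fix c assume c: "lincomb e c = 0"
    have "c $ Inl i = 0" "c $ Inr i = 0" for i
      using symplectic_coords[OF \<omega>, of e "\<chi> i. c $ Inl i" "\<chi> i. c $ Inr i" i, folded lincomb_sum_type] rel c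
      by (simp_all add: zero_left)
    then show "c = 0" by (metis sum.exhaust_sel vec_eq_iff zero_index)
  qed (use dim in auto)
  then show ?thesis using rel by (simp add: symplectic_basis_def)
qed

lemma symplectic_basisD:
  assumes "symplectic_basis \<omega> e"
  shows "basis_of e UNIV" "\<omega> (e (Inl i)) (e (Inl j)) = 0" "\<omega> (e (Inr i)) (e (Inr j)) = 0"
    "\<omega> (e (Inl i)) (e (Inr j)) = (if i = j then 1 else 0)"
  using assms by (auto simp: symplectic_basis_def)

lemma basis_of_sum_type_halves:
  fixes e :: "'n::finite + 'n \<Rightarrow> 'w::euclidean_space"
  assumes "basis_of e UNIV"
  shows "basis_of (\<lambda>i. e (Inl i)) (span (range (\<lambda>i. e (Inl i))))"
    "basis_of (\<lambda>i. e (Inr i)) (span (range (\<lambda>i. e (Inr i))))"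
proof -
  show "basis_of (\<lambda>i. e (Inl i)) (span (range (\<lambda>i. e (Inl i))))"
    by (rule basis_of_spanI) (use basis_of_sum_typeD(1)[OF assms, of _ 0] in \<open>simp add: lincomb_linear\<close>)
  show "basis_of (\<lambda>i. e (Inr i)) (span (range (\<lambda>i. e (Inr i))))"
    by (rule basis_of_spanI) (use basis_of_sum_typeD(2)[OF assms, of 0] in \<open>simp add: lincomb_linear\<close>)
qed

lemma symplectic_basis_lagrangian:
  fixes e :: "'n::finite + 'n \<Rightarrow> 'w::euclidean_space"
  assumes \<omega>: "symplectic_form \<omega>" and e: "symplectic_basis \<omega> e"
  shows "lagrangian \<omega> (span (range (\<lambda>i. e (Inl i))))" "lagrangian \<omega> (span (range (\<lambda>i. e (Inr i))))"
proof -
  note e' = symplectic_basisD[OF e] and bil = bilinear_lincomb[OF symplectic_bilinear[OF \<omega>]]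
  note h = basis_of_sum_type_halves[OF e'(1)]
  have dim: "DIM('w) = CARD('n + 'n)" using basis_of_dim[OF e'(1)] by simp
  show "lagrangian \<omega> (span (range (\<lambda>i. e (Inl i))))"
    unfolding lagrangian_def using basis_of_dim[OF h(1)] dim basis_of_subspace[OF h(1)]
    by (auto simp: span_range_lincomb bil e' card_UNIV_sum)
  show "lagrangian \<omega> (span (range (\<lambda>i. e (Inr i))))"
    unfolding lagrangian_def using basis_of_dim[OF h(2)] dim basis_of_subspace[OF h(2)]
    by (auto simp: span_range_lincomb bil e' card_UNIV_sum)
qed

text \<open>Symplectic Gram-Schmidt, one pair (f k, h k) at a time: fewer than n pairs do not span,
  and nondegeneracy provides a partner for a vector outside their span.\<close>

lemma symplectic_basis_exists:
  fixes \<omega> :: "'w::euclidean_space \<Rightarrow> 'w \<Rightarrow> real"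
  assumes \<omega>: "symplectic_form \<omega>" and dim: "DIM('w) = 2 * CARD('n::finite)"
  obtains e :: "'n::finite + 'n::finite \<Rightarrow> 'w" where "symplectic_basis \<omega> e"
proof -
  interpret bounded_bilinear \<omega> by (rule symplectic_bilinear[OF \<omega>])
  note skew = symplectic_skew[OF \<omega>]
  have self: "\<omega> z z = 0" for z using \<omega> by (simp add: symplectic_form_def)
  have "finite A \<Longrightarrow> \<exists>(f :: 'n \<Rightarrow> 'w) h. \<forall>i\<in>A. \<forall>j\<in>A. \<omega> (f i) (f j) = 0 \<and> \<omega> (h i) (h j) = 0 \<and>
      \<omega> (f i) (h j) = (if i = j then 1 else 0)" for A :: "'n set"
  proof (induction A rule: finite_induct)
    case (insert k A)
    then obtain f h :: "'n \<Rightarrow> 'w" where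
      r: "\<And>i j. i \<in> A \<Longrightarrow> j \<in> A \<Longrightarrow> \<omega> (f i) (f j) = 0" "\<And>i j. i \<in> A \<Longrightarrow> j \<in> A \<Longrightarrow> \<omega> (h i) (h j) = 0"
         "\<And>i j. i \<in> A \<Longrightarrow> j \<in> A \<Longrightarrow> \<omega> (f i) (h j) = (if i = j then 1 else 0)" by blast
    have r4: "\<omega> (h i) (f j) = (if i = j then -1 else 0)" if "i \<in> A" "j \<in> A" for i j
      using skew[of "h i" "f j"] r(3)[OF that(2,1)] by auto
    \<comment> \<open>Projection to the \<omega>-complement of the pairs found so far.\<close>
    define p where "p z = z - (\<Sum>i\<in>A. \<omega> z (h i) *\<^sub>R f i - \<omega> z (f i) *\<^sub>R h i)" for z
    have pf: "\<omega> (p z) (f j) = 0" and ph: "\<omega> (p z) (h j) = 0" if "j \<in> A" for z j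
      using that insert.hyps(1)
      by (simp_all add: p_def diff_left sum_left scaleR_left r r4 if_distrib[of "\<lambda>x. _ * x"] sum_negf cong: if_cong)
    have fp: "\<omega> (f j) (p z) = 0" and hp: "\<omega> (h j) (p z) = 0" if "j \<in> A" for z j
      using pf[OF that] ph[OF that] skew[of "f j" "p z"] skew[of "h j" "p z"] by auto
    let ?U = "f ` A \<union> h ` A"
    have "dim ?U \<le> card ?U" using insert.hyps(1) by (intro dim_le_card') auto
    also have "\<dots> \<le> card A + card A"
      using card_Un_le[of "f ` A" "h ` A"] card_image_le[OF insert.hyps(1), of f] card_image_le[OF insert.hyps(1), of h]
      by linarith
    also have "\<dots> < DIM('w)"
    proof -
      have "card A < CARD('n)" using insert.hyps(2) by (intro psubset_card_mono) auto
      then show ?thesis using dim by simp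
    qed
    finally have "span ?U \<noteq> UNIV" using dim_eq_full by (metis less_irrefl)
    then obtain x where x: "x \<notin> span ?U" by blast
    have "p x \<noteq> 0"
    proof
      assume "p x = 0"
      then have "x = (\<Sum>i\<in>A. \<omega> x (h i) *\<^sub>R f i - \<omega> x (f i) *\<^sub>R h i)" by (simp add: p_def)
      moreover have "\<dots> \<in> span ?U" by (intro span_sum span_diff span_scale span_base) auto
      ultimately show False using x by simp
    qed
    then obtain y where y: "\<omega> (p x) y \<noteq> 0" using \<omega> by (auto simp: symplectic_form_def)
    \<comment> \<open>The scaling makes the pairing with p x equal to 1. Projecting the partner
      afterwards keeps this value, since p x pairs to 0 with all earlier vectors.\<close>
    let ?y = "p (y /\<^sub>R \<omega> (p x) y)"
    have xy: "\<omega> (p x) ?y = 1"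
      using y insert.hyps(1) by (subst p_def) (simp add: diff_right sum_right scaleR_right pf ph)
    show ?case
      by (rule exI[of _ "f(k := p x)"], rule exI[of _ "h(k := ?y)"])
         (use insert.hyps(2) r pf ph fp hp xy self in auto)
  qed auto
  from this[of UNIV] obtain f h :: "'n \<Rightarrow> 'w" where
    r: "\<And>i j. \<omega> (f i) (f j) = 0" "\<And>i j. \<omega> (h i) (h j) = 0" "\<And>i j. \<omega> (f i) (h j) = (if i = j then 1 else 0)"
    by auto
  show ?thesis
    by (rule that[of "case_sum f h"], rule symplectic_basisI[OF \<omega> dim]) (use r in auto)
qed

lemma orthonormal_family_exists:
  fixes B :: "real^'n \<Rightarrow> real^'n \<Rightarrow> real"
  assumes bil: "bounded_bilinear B" and sym: "\<And>x y. B x y = B y x" and pos: "\<And>x. x \<noteq> 0 \<Longrightarrow> B x x > 0"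
  obtains u :: "'n::finite \<Rightarrow> real^'n" where "\<And>i j. B (u i) (u j) = (if i = j then 1 else 0)"
proof -
  interpret bounded_bilinear B by (rule bil)
  have "finite A \<Longrightarrow> \<exists>u :: 'n \<Rightarrow> real^'n. \<forall>i\<in>A. \<forall>j\<in>A. B (u i) (u j) = (if i = j then 1 else 0)" for A
  proof (induction A rule: finite_induct)
    case (insert k A)
    then obtain u :: "'n \<Rightarrow> real^'n" where
      u: "\<And>i j. i \<in> A \<Longrightarrow> j \<in> A \<Longrightarrow> B (u i) (u j) = (if i = j then 1 else 0)" by blast
    have "dim (u ` A) \<le> card (u ` A)" using insert.hyps(1) by (intro dim_le_card') auto
    also have "\<dots> \<le> card A" by (rule card_image_le[OF insert.hyps(1)])
    also have "\<dots> < DIM(real^'n)" using insert.hyps(2) by (simp, intro psubset_card_mono) auto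
    finally have "span (u ` A) \<noteq> UNIV" using dim_eq_full by (metis less_irrefl)
    then obtain x where x: "x \<notin> span (u ` A)" by blast
    define p where "p = x - (\<Sum>i\<in>A. B x (u i) *\<^sub>R u i)"
    have "p \<noteq> 0"
    proof
      assume "p = 0"
      then have "x = (\<Sum>i\<in>A. B x (u i) *\<^sub>R u i)" by (simp add: p_def)
      moreover have "\<dots> \<in> span (u ` A)" by (intro span_sum span_scale span_base) auto
      ultimately show False using x by simp
    qed
    then have pp: "B p p > 0" by (rule pos)
    have pu: "B p (u j) = 0" if "j \<in> A" for j
      using that insert.hyps(1)
      by (simp add: p_def diff_left sum_left scaleR_left u if_distrib[of "\<lambda>x. _ * x"] cong: if_cong)
    let ?q = "p /\<^sub>R sqrt (B p p)"
    have "B ?q ?q = 1" using pp by (simp add: scaleR_left scaleR_right) (simp add: field_simps)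
    moreover have "B ?q (u j) = 0" "B (u j) ?q = 0" if "j \<in> A" for j
      using pu[OF that] sym[of "u j" p] by (simp_all add: scaleR_left scaleR_right)
    ultimately show ?case
      by (intro exI[of _ "u(k := ?q)"]) (use insert.hyps(2) u in auto)
  qed auto
  from this[of UNIV] show ?thesis using that by auto
qed


section \<open>Local frames and the velocity form\<close>

lemma smooth_lincomb:
  fixes b :: "real \<Rightarrow> 'i::finite \<Rightarrow> 'w::real_normed_vector"
  assumes "open S" "\<And>i. smooth_on_line (\<lambda>t. b t i) S" "smooth_on_line c S"
  shows "smooth_on_line (\<lambda>t. lincomb (b t) (c t)) S"
  unfolding lincomb_def by (intro smooth_sum smooth_scaleR smooth_vec_nth assms)

lemma has_vector_derivative_lincomb:
  fixes b :: "real \<Rightarrow> 'i::finite \<Rightarrow> 'w::real_normed_vector"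
  assumes "\<And>i. ((\<lambda>s. b s i) has_vector_derivative b' i) (at t)" "(c has_vector_derivative c') (at t)"
  shows "((\<lambda>s. lincomb (b s) (c s)) has_vector_derivative lincomb b' (c t) + lincomb (b t) c') (at t)"
proof -
  have "((\<lambda>s. c s $ i) has_vector_derivative c' $ i) (at t)" for i
    by (rule bounded_linear.has_vector_derivative[OF bounded_linear_vec_nth assms(2)])
  then have "((\<lambda>s. \<Sum>i\<in>UNIV. c s $ i *\<^sub>R b s i) has_vector_derivative
      (\<Sum>i\<in>UNIV. c t $ i *\<^sub>R b' i + c' $ i *\<^sub>R b t i)) (at t)"
    by (intro has_vector_derivative_sum has_vector_derivative_scaleR assms)
       (simp add: has_real_derivative_iff_has_vector_derivative)
  then show ?thesis by (simp add: lincomb_def sum.distrib)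
qed

lemma det_nonzero_iff_kernel:
  fixes A :: "real^'n^'n"
  shows "det A \<noteq> 0 \<longleftrightarrow> (\<forall>c. A *v c = 0 \<longrightarrow> c = 0)"
  by (simp add: invertible_det_nz[symmetric] invertible_left_inverse matrix_left_invertible_ker)

text \<open>Differentiating \<omega> (v t) (f t j) = 0 shows that \<omega> (v \<tau>) (v' \<tau>)
  depends on the value v \<tau> alone. This makes the definite description in
  \<open>velocity_form\<close> meaningful and computes it at once.\<close>

lemma velocity_form_frame:
  fixes \<omega> :: "'w::euclidean_space \<Rightarrow> 'w \<Rightarrow> real" and f :: "real \<Rightarrow> 'n::finite \<Rightarrow> 'w"
  assumes \<omega>: "symplectic_form \<omega>" and e: "e > 0"
    and sm: "\<And>i. smooth_on_line (\<lambda>t. f t i) (ball \<tau> e)"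
    and iso: "\<And>t u v. t \<in> ball \<tau> e \<Longrightarrow> u \<in> \<Gamma> t \<Longrightarrow> v \<in> \<Gamma> t \<Longrightarrow> \<omega> u v = 0"
    and f: "\<And>t. t \<in> ball \<tau> e \<Longrightarrow> span (range (f t)) = \<Gamma> t"
  shows "velocity_form \<omega> \<Gamma> \<tau> (lincomb (f \<tau>) c) =
    (\<Sum>j\<in>UNIV. c $ j * \<omega> (lincomb (f \<tau>) c) (vderiv (\<lambda>t. f t j) \<tau>))" (is "_ = ?q")
proof -
  interpret bounded_bilinear \<omega> by (rule symplectic_bilinear[OF \<omega>])
  let ?z = "lincomb (f \<tau>) c"
  have fin: "f t j \<in> \<Gamma> t" if "t \<in> ball \<tau> e" for t j using f[OF that] by (metis rangeI span_base)
  have uniq: "\<omega> ?z (vderiv v \<tau>) = ?q"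
    if v: "d > 0" "smooth_on_line v (ball \<tau> d)" "\<And>t. t \<in> ball \<tau> d \<Longrightarrow> v t \<in> \<Gamma> t" "v \<tau> = ?z" for v d
  proof -
    have "\<omega> (f \<tau> j) (vderiv v \<tau>) = \<omega> ?z (vderiv (\<lambda>t. f t j) \<tau>)" for j
    proof -
      have "((\<lambda>t. \<omega> (v t) (f t j)) has_vector_derivative
          \<omega> (v \<tau>) (vderiv (\<lambda>t. f t j) \<tau>) + \<omega> (vderiv v \<tau>) (f \<tau> j)) (at \<tau>)"
        by (intro has_vector_derivative smooth_D(1)[OF v(2)] smooth_D(1)[OF sm]) (use e v(1) in auto)
      moreover have "((\<lambda>t. \<omega> (v t) (f t j)) has_vector_derivative 0) (at \<tau>)"
        by (rule has_vector_derivative_transform_within_open[OF has_vector_derivative_const, of "ball \<tau> (min d e)"])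
           (use e v iso fin in auto)
      ultimately have "\<omega> (v \<tau>) (vderiv (\<lambda>t. f t j) \<tau>) + \<omega> (vderiv v \<tau>) (f \<tau> j) = 0"
        by (rule vector_derivative_unique_at)
      then show ?thesis using symplectic_skew[OF \<omega>, of "f \<tau> j"] v(4) by simp
    qed
    then show ?thesis by (simp add: bilinear_lincomb(1)[OF symplectic_bilinear[OF \<omega>], of "f \<tau>" c "vderiv v \<tau>"])
  qed
  let ?v = "\<lambda>t. lincomb (f t) c"
  have sv: "smooth_on_line ?v (ball \<tau> e)" by (intro smooth_lincomb sm smooth_const) auto
  have vin: "?v t \<in> \<Gamma> t" if "t \<in> ball \<tau> e" for t using f[OF that] lincomb_in_span by blast
  show ?thesis unfolding velocity_form_def
  proof (rule the_equality)
    show "\<exists>v d. d > 0 \<and> smooth_on_line v (ball \<tau> d) \<and> (\<forall>t\<in>ball \<tau> d. v t \<in> \<Gamma> t) \<and> v \<tau> = ?z \<and>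
        ?q = \<omega> ?z (vderiv v \<tau>)"
      using uniq[OF e sv vin] e sv vin by (intro exI[of _ ?v] exI[of _ e]) auto
  qed (use uniq in blast)
qed

section \<open>Cartan frames\<close>

text \<open>S is not required to be skew nor K to be diagonal, so that normal frames (S = 0), Frenet
  frames and the frames of reparametrised curves are all covered.\<close>

definition cartan_frame ::
    "('w::euclidean_space \<Rightarrow> 'w \<Rightarrow> real) \<Rightarrow> (real \<Rightarrow> 'w set) \<Rightarrow> real set \<Rightarrow> (real \<Rightarrow> 'n::finite + 'n \<Rightarrow> 'w) \<Rightarrow>
     (real \<Rightarrow> real^'n^'n) \<Rightarrow> (real \<Rightarrow> real^'n^'n) \<Rightarrow> bool" where
  "cartan_frame \<omega> \<Gamma> I F S K \<longleftrightarrow> open I \<and> (\<forall>x. smooth_on_line (\<lambda>t. F t x) I) \<and>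
     smooth_on_line S I \<and> smooth_on_line K I \<and>
     (\<forall>t\<in>I. symplectic_basis \<omega> (F t) \<and> span (range (\<lambda>i. F t (Inl i))) = \<Gamma> t \<and>
        (\<forall>i. ((\<lambda>s. F s (Inl i)) has_vector_derivative
               F t (Inr i) + lincomb (\<lambda>j. F t (Inl j)) (column i (S t))) (at t)) \<and>
        (\<forall>i. ((\<lambda>s. F s (Inr i)) has_vector_derivative
               lincomb (\<lambda>j. F t (Inl j)) (column i (K t)) + lincomb (\<lambda>j. F t (Inr j)) (column i (S t))) (at t)))"

lemma lincomb_columns: "lincomb (\<lambda>i. lincomb b (column i A)) c = lincomb b (A *v c)"
  unfolding lincomb_def
  by (simp add: column_def matrix_vector_mult_def scaleR_sum_right scaleR_sum_left mult.commute) (rule sum.swap)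

lemma lincomb_add_family: "lincomb (\<lambda>i. a i + b i) c = lincomb a c + lincomb b c"
  by (simp add: lincomb_def scaleR_add_right sum.distrib)

lemma bounded_bilinear_matrix_vector: "bounded_bilinear ((*v) :: real^'n^'m \<Rightarrow> real^'n \<Rightarrow> real^'m)"
  unfolding bilinear_conv_bounded_bilinear[symmetric] bilinear_def
  by (auto intro!: linearI simp: matrix_vector_mult_add_rdistrib matrix_vector_right_distrib
      matrix_vector_mult_scaleR scaleR_matrix_vector_assoc)

lemma has_vector_derivative_in_subspace:
  fixes V :: "'w::euclidean_space set"
  assumes "subspace V" "open T" "t \<in> T" "\<And>s. s \<in> T \<Longrightarrow> g s \<in> V" "(g has_vector_derivative g') (at t)"
  shows "g' \<in> V"
proof (rule Lim_in_closed_set)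
  show "closed V" using assms(1) by (rule closed_subspace)
  show "((\<lambda>s. (g s - g t) /\<^sub>R (s - t)) \<longlongrightarrow> g') (at t)"
    using assms(5) by (simp add: has_vector_derivative_iff_tendsto)
  show "\<forall>\<^sub>F s in at t. (g s - g t) /\<^sub>R (s - t) \<in> V"
    using eventually_at_in_open'[OF assms(2,3)]
    by eventually_elim (use assms in \<open>auto intro!: subspace_scale subspace_diff\<close>)
qed simp

context
  fixes \<omega> :: "'w::euclidean_space \<Rightarrow> 'w \<Rightarrow> real" and \<Gamma> :: "real \<Rightarrow> 'w set" and I :: "real set"
    and F :: "real \<Rightarrow> 'n::finite + 'n \<Rightarrow> 'w" and S K :: "real \<Rightarrow> real^'n^'n"
  assumes \<omega>: "symplectic_form \<omega>" and fr: "cartan_frame \<omega> \<Gamma> I F S K"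
begin

abbreviation (input) "ff t \<equiv> (\<lambda>i. F t (Inl i))"
abbreviation (input) "hh t \<equiv> (\<lambda>i. F t (Inr i))"

lemma frame_open: "open I"
  and frame_smooth: "smooth_on_line (\<lambda>t. F t x) I" "smooth_on_line S I" "smooth_on_line K I"
  and frame_basis: "t \<in> I \<Longrightarrow> symplectic_basis \<omega> (F t)"
  and frame_span: "t \<in> I \<Longrightarrow> span (range (ff t)) = \<Gamma> t"
  and frame_deriv: "t \<in> I \<Longrightarrow> ((\<lambda>s. F s (Inl i)) has_vector_derivative
               F t (Inr i) + lincomb (ff t) (column i (S t))) (at t)"
    "t \<in> I \<Longrightarrow> ((\<lambda>s. F s (Inr i)) has_vector_derivative
               lincomb (ff t) (column i (K t)) + lincomb (hh t) (column i (S t))) (at t)"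
  using fr by (auto simp: cartan_frame_def)

lemma frame_basis_of:
  assumes "t \<in> I" shows "basis_of (ff t) (\<Gamma> t)"
  using basis_of_sum_type_halves(1)[OF symplectic_basisD(1)[OF frame_basis[OF assms]]]
  by (simp add: frame_span[OF assms])

lemma frame_lagrangian:
  assumes "t \<in> I" shows "lagrangian \<omega> (\<Gamma> t)"
  using symplectic_basis_lagrangian(1)[OF \<omega> frame_basis[OF assms]] by (simp add: frame_span[OF assms])

text \<open>Both coordinate vectors are differentiated covariantly, by c' + S c. The cross terms are
  a, because f' contains h, and K b, because h' contains f K.\<close>

lemma frame_derivative_rule:
  assumes t: "t \<in> I" and a: "(a has_vector_derivative a') (at t)" and b: "(b has_vector_derivative b') (at t)"
  shows "((\<lambda>s. lincomb (ff s) (a s) + lincomb (hh s) (b s)) has_vector_derivative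
     lincomb (ff t) (a' + S t *v a t + K t *v b t) + lincomb (hh t) (b' + S t *v b t + a t)) (at t)"
proof -
  have "((\<lambda>s. lincomb (ff s) (a s) + lincomb (hh s) (b s)) has_vector_derivative
     (lincomb (\<lambda>i. F t (Inr i) + lincomb (ff t) (column i (S t))) (a t) + lincomb (ff t) a') +
     (lincomb (\<lambda>i. lincomb (ff t) (column i (K t)) + lincomb (hh t) (column i (S t))) (b t) + lincomb (hh t) b')) (at t)"
    by (intro has_vector_derivative_add has_vector_derivative_lincomb frame_deriv t a b)
  then show ?thesis by (simp add: lincomb_add_family lincomb_columns lincomb_linear ac_simps)
qed

text \<open>Since D is its own \<omega>-complement, f c - u lies in D exactly when c solves a square
  linear system. Its determinant is nonzero at \<tau> by transversality, hence nearby, and the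
  solution is smooth. The result holds for every \<open>L0\<close> because the value of
  \<open>graph_map\<close> does not depend on it.\<close>

lemma frame_chart:
  assumes \<tau>: "\<tau> \<in> I" and D: "lagrangian \<omega> D" and tr: "D \<inter> \<Gamma> \<tau> = {0}"
  obtains e where "e > 0" "ball \<tau> e \<subseteq> I" "\<And>t. t \<in> ball \<tau> e \<Longrightarrow> \<Gamma> t \<inter> D = {0}"
    "\<And>u. \<exists>c. smooth_on_line c (ball \<tau> e) \<and> (\<forall>t\<in>ball \<tau> e. lincomb (ff t) (c t) - u \<in> D \<and>
        (\<forall>L0. graph_map L0 D (\<Gamma> t) u = lincomb (ff t) (c t) - u))"
proof -
  interpret bounded_bilinear \<omega> by (rule symplectic_bilinear[OF \<omega>])
  note bil = bilinear_lincomb[OF symplectic_bilinear[OF \<omega>]]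
  have subD: "subspace D" and isoD: "\<And>u v. u \<in> D \<Longrightarrow> v \<in> D \<Longrightarrow> \<omega> u v = 0"
    using D by (auto simp: lagrangian_def)
  have "dim D = CARD('n)"
    using D basis_of_dim[OF frame_basis_of[OF \<tau>]] frame_lagrangian[OF \<tau>] by (simp add: lagrangian_def)
  then obtain d :: "'n \<Rightarrow> 'w" where d: "basis_of d D" using basis_of_exists[OF subD] by metis
  have inD: "x \<in> D" if "\<And>i. \<omega> x (d i) = 0" for x
  proof (rule lagrangian_maximal[OF \<omega> D])
    fix y assume "y \<in> D"
    then obtain a where "y = lincomb d a" using basis_of_coords[OF d] by blast
    then show "\<omega> x y = 0" using that by (simp add: bil)
  qed
  \<comment> \<open>The matrix of pairings between the moving frame of \<Gamma> and a fixed basis of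
    D; its kernel describes the intersection of \<Gamma> t with D.\<close>
  define M :: "real \<Rightarrow> real^'n^'n" where "M t = (\<chi> i j. \<omega> (F t (Inl j)) (d i))" for t
  have Mv: "(M t *v c) $ i = \<omega> (lincomb (ff t) c) (d i)" for t c i
    by (simp add: M_def matrix_vector_mult_def bil mult.commute)
  have sM: "smooth_on_line M I" unfolding M_def
    by (intro smooth_vec_lambda frame_open smooth_linear[OF bounded_linear_left] frame_smooth)
  have "det (M \<tau>) \<noteq> 0"
  proof
    assume "det (M \<tau>) = 0"
    then obtain c where c: "c \<noteq> 0" "M \<tau> *v c = 0" using det_nonzero_iff_kernel[of "M \<tau>"] by blast
    have "lincomb (ff \<tau>) c \<in> D" by (rule inD) (use c(2) Mv[of \<tau> c] in simp)
    moreover have "lincomb (ff \<tau>) c \<in> \<Gamma> \<tau>" by (rule basis_of_in(2)[OF frame_basis_of[OF \<tau>]])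
    ultimately have "lincomb (ff \<tau>) c = 0" using tr by blast
    then show False using c(1) basis_of_lincomb_zero[OF frame_basis_of[OF \<tau>]] by blast
  qed
  moreover have "isCont (\<lambda>t. det (M t)) \<tau>"
    using smooth_continuous_on[OF smooth_det[OF frame_open smooth_vec_nth[OF frame_open smooth_vec_nth[OF frame_open sM]]]]
      frame_open \<tau> continuous_on_eq_continuous_at by blast
  ultimately obtain e1 where e1: "e1 > 0" "\<And>t. dist \<tau> t < e1 \<Longrightarrow> det (M t) \<noteq> 0"
    using continuous_at_avoid[of \<tau> "\<lambda>t. det (M t)" 0] by auto
  obtain e2 where e2: "e2 > 0" "ball \<tau> e2 \<subseteq> I" using frame_open \<tau> open_contains_ball by metis
  define e where "e = min e1 e2"
  have e: "e > 0" "ball \<tau> e \<subseteq> I" "\<And>t. t \<in> ball \<tau> e \<Longrightarrow> det (M t) \<noteq> 0"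
    using e1 e2 by (auto simp: e_def)
  have tr': "\<Gamma> t \<inter> D = {0}" if t: "t \<in> ball \<tau> e" for t
  proof -
    have tI: "t \<in> I" using e(2) t by blast
    have "x = 0" if x: "x \<in> \<Gamma> t" "x \<in> D" for x
    proof -
      obtain c where c: "x = lincomb (ff t) c" using basis_of_coords[OF frame_basis_of[OF tI] x(1)] by blast
      have "M t *v c = 0" using Mv[of t c] isoD[OF x(2) basis_of_in(1)[OF d]] c by (simp add: vec_eq_iff)
      then have "c = 0" using e(3)[OF t] det_nonzero_iff_kernel[of "M t"] by blast
      then show ?thesis using c by (simp add: lincomb_linear)
    qed
    then show ?thesis using subspace_0[OF subD] subspace_0[OF basis_of_subspace[OF frame_basis_of[OF tI]]] by blast
  qed
  show ?thesis
  proof (rule that[OF e(1,2) tr'])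
    fix u
    obtain c where c: "smooth_on_line c (ball \<tau> e)" "\<And>t. t \<in> ball \<tau> e \<Longrightarrow> M t *v c t = (\<chi> i. \<omega> u (d i))"
      using smooth_linear_solve[OF open_ball smooth_subset[OF sM e(2)] smooth_const[OF open_ball] e(3)] by metis
    have "lincomb (ff t) (c t) - u \<in> D \<and> (\<forall>L0. graph_map L0 D (\<Gamma> t) u = lincomb (ff t) (c t) - u)"
      if t: "t \<in> ball \<tau> e" for t
    proof -
      have tI: "t \<in> I" using e(2) t by blast
      have w: "lincomb (ff t) (c t) - u \<in> D"
        by (rule inD) (use Mv[of t "c t"] c(2)[OF t] in \<open>simp add: diff_left\<close>)
      then show ?thesis
        using graph_map_eqI[OF subD basis_of_subspace[OF frame_basis_of[OF tI]] tr'[OF t] w]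
          basis_of_in(2)[OF frame_basis_of[OF tI]] by simp
    qed
    then show "\<exists>c. smooth_on_line c (ball \<tau> e) \<and> (\<forall>t\<in>ball \<tau> e. lincomb (ff t) (c t) - u \<in> D \<and>
        (\<forall>L0. graph_map L0 D (\<Gamma> t) u = lincomb (ff t) (c t) - u))" using c(1) by blast
  qed auto
qed

lemma frame_halves_transverse:
  assumes "t \<in> I" shows "span (range (hh t)) \<inter> \<Gamma> t = {0}"
proof -
  have "x = 0" if x: "x \<in> span (range (hh t))" "x \<in> \<Gamma> t" for x
  proof -
    obtain a where a: "x = lincomb (ff t) a" using basis_of_coords[OF frame_basis_of[OF assms] x(2)] by blast
    obtain b where b: "x = lincomb (hh t) b" using x(1) unfolding span_range_lincomb by blast
    have "lincomb (ff t) a + lincomb (hh t) (- b) = 0" using a b by (simp add: lincomb_linear)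
    then have "a = 0" by (rule basis_of_sum_typeD(1)[OF symplectic_basisD(1)[OF frame_basis[OF assms]]])
    then show ?thesis using a by (simp add: lincomb_linear)
  qed
  then show ?thesis using subspace_0[OF basis_of_subspace[OF frame_basis_of[OF assms]]] span_zero by blast
qed

lemma frame_smooth_curve: "smooth_lagrangian_curve \<omega> \<Gamma> I"
  unfolding smooth_lagrangian_curve_def
proof (intro conjI ballI)
  fix t0 assume t0: "t0 \<in> I"
  let ?D = "span (range (hh t0))"
  have D: "lagrangian \<omega> ?D" by (rule symplectic_basis_lagrangian(2)[OF \<omega> frame_basis[OF t0]])
  obtain e where e: "e > 0" "ball t0 e \<subseteq> I" "\<And>t. t \<in> ball t0 e \<Longrightarrow> \<Gamma> t \<inter> ?D = {0}"
    "\<And>u. \<exists>c. smooth_on_line c (ball t0 e) \<and> (\<forall>t\<in>ball t0 e. lincomb (ff t) (c t) - u \<in> ?D \<and>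
        (\<forall>L0. graph_map L0 ?D (\<Gamma> t) u = lincomb (ff t) (c t) - u))"
    using frame_chart[OF t0 D frame_halves_transverse[OF t0]] by blast
  have "smooth_on_line (\<lambda>t. graph_map (\<Gamma> t0) ?D (\<Gamma> t) u) (ball t0 e)" for u
  proof -
    obtain c where c: "smooth_on_line c (ball t0 e)"
      "\<And>t. t \<in> ball t0 e \<Longrightarrow> graph_map (\<Gamma> t0) ?D (\<Gamma> t) u = lincomb (ff t) (c t) - u"
      using e(4)[of u] by blast
    have "smooth_on_line (\<lambda>t. lincomb (ff t) (c t) - u) (ball t0 e)"
      by (intro smooth_diff smooth_lincomb smooth_const c smooth_subset[OF frame_smooth(1) e(2)]) auto
    then show ?thesis by (rule smooth_cong[OF open_ball, rotated]) (use c(2) in auto)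
  qed
  then show "\<exists>D e. e > 0 \<and> ball t0 e \<subseteq> I \<and> lagrangian \<omega> D \<and> (\<forall>t\<in>ball t0 e. transverse (\<Gamma> t) D) \<and>
      (\<forall>u\<in>\<Gamma> t0. smooth_on_line (\<lambda>t. graph_map (\<Gamma> t0) D (\<Gamma> t) u) (ball t0 e))"
    using e(1-3) D unfolding transverse_def by blast
qed (rule frame_lagrangian)

text \<open>In the chart of D the curve is f x - u with smooth x, and c1, c2 are the first and
  second covariant derivatives of x at \<tau>. As D is a closed subspace, all derivatives stay in D;
  for a particular D this turns into equations for c1 and c2.\<close>

lemma frame_affine_derivs:
  assumes \<tau>: "\<tau> \<in> I" and D: "lagrangian \<omega> D" and tr: "D \<inter> \<Gamma> \<tau> = {0}"
  obtains c1 c2 X where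
    "affine_deriv 1 \<Gamma> D \<tau> (lincomb (ff \<tau>) c) = lincomb (ff \<tau>) c1 + lincomb (hh \<tau>) c"
    "affine_deriv 2 \<Gamma> D \<tau> (lincomb (ff \<tau>) c) = lincomb (ff \<tau>) (c2 + K \<tau> *v c) + lincomb (hh \<tau>) (2 *\<^sub>R c1)"
    "affine_deriv 3 \<Gamma> D \<tau> (lincomb (ff \<tau>) c) = lincomb (ff \<tau>) X + lincomb (hh \<tau>) (3 *\<^sub>R c2 + K \<tau> *v c)"
    "affine_deriv 1 \<Gamma> D \<tau> (lincomb (ff \<tau>) c) \<in> D" "affine_deriv 2 \<Gamma> D \<tau> (lincomb (ff \<tau>) c) \<in> D"
    "affine_deriv 3 \<Gamma> D \<tau> (lincomb (ff \<tau>) c) \<in> D"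
proof -
  let ?u = "lincomb (ff \<tau>) c" and ?G = "\<lambda>t. graph_map (\<Gamma> \<tau>) D (\<Gamma> t) (lincomb (ff \<tau>) c)"
  have subD: "subspace D" using D by (simp add: lagrangian_def)
  obtain e where e: "e > 0" "ball \<tau> e \<subseteq> I" and
    "\<And>t. t \<in> ball \<tau> e \<Longrightarrow> \<Gamma> t \<inter> D = {0}" and
    ex: "\<And>u. \<exists>c. smooth_on_line c (ball \<tau> e) \<and> (\<forall>t\<in>ball \<tau> e. lincomb (ff t) (c t) - u \<in> D \<and>
        (\<forall>L0. graph_map L0 D (\<Gamma> t) u = lincomb (ff t) (c t) - u))"
    by (rule frame_chart[OF \<tau> D tr], rule that)
  let ?B = "ball \<tau> e"
  have \<tau>B: "\<tau> \<in> ?B" using e(1) by simp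
  obtain x where sx: "smooth_on_line x ?B" and xD: "\<And>t. t \<in> ?B \<Longrightarrow> lincomb (ff t) (x t) - ?u \<in> D"
    and G: "\<And>t. t \<in> ?B \<Longrightarrow> ?G t = lincomb (ff t) (x t) - ?u"
    using ex[of ?u] by blast
  have "lincomb (ff \<tau>) (x \<tau>) - ?u \<in> \<Gamma> \<tau>"
    using basis_of_in(2)[OF frame_basis_of[OF \<tau>], of "x \<tau> - c"] by (simp add: lincomb_linear)
  then have "lincomb (ff \<tau>) (x \<tau>) - ?u = 0" using tr xD[OF \<tau>B] by blast
  \<comment> \<open>The chart takes the value 0 at \<tau>, because that value lies in both \<Gamma>
    \<tau> and D.\<close>
  then have x\<tau>: "x \<tau> = c" using basis_of_lincomb_eq[OF frame_basis_of[OF \<tau>]] by simp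
  have sS: "smooth_on_line S ?B" and sK: "smooth_on_line K ?B"
    using frame_smooth(2,3) e(2) smooth_subset by blast+
  note smv = smooth_bilinear[OF bounded_bilinear_matrix_vector open_ball]
  define x1 where "x1 t = vderiv x t + S t *v x t" for t
  have s1: "smooth_on_line x1 ?B" unfolding x1_def by (intro smooth_add smv sx smooth_D(2) sS open_ball)
  define x2 where "x2 t = vderiv x1 t + S t *v x1 t" for t
  have s2: "smooth_on_line x2 ?B" unfolding x2_def by (intro smooth_add smv s1 smooth_D(2) sS open_ball)
  have sz: "smooth_on_line (\<lambda>t. x2 t + K t *v x t) ?B" by (intro smooth_add smv s2 sx sK open_ball)
  have d1: "(?G has_vector_derivative lincomb (ff t) (x1 t) + lincomb (hh t) (x t)) (at t)" if t: "t \<in> ?B" for t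
  proof -
    have tI: "t \<in> I" using t e(2) by blast
    have "((\<lambda>s. (lincomb (ff s) (x s) + lincomb (hh s) 0) - ?u) has_vector_derivative
       (lincomb (ff t) (vderiv x t + S t *v x t + K t *v 0) + lincomb (hh t) (0 + S t *v 0 + x t)) - 0) (at t)"
      by (intro has_vector_derivative_diff has_vector_derivative_const
          frame_derivative_rule[OF tI smooth_D(1)[OF sx t] has_vector_derivative_const])
    then have "((\<lambda>s. lincomb (ff s) (x s) - ?u) has_vector_derivative
       lincomb (ff t) (x1 t) + lincomb (hh t) (x t)) (at t)" by (simp add: lincomb_linear x1_def)
    then show ?thesis by (rule has_vector_derivative_transform_within_open[OF _ open_ball t]) (simp add: G)
  qed
  have D1: "lincomb (ff t) (x1 t) + lincomb (hh t) (x t) \<in> D" if t: "t \<in> ?B" for t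
    by (rule has_vector_derivative_in_subspace[OF subD open_ball t _ d1[OF t]]) (simp add: G xD)
  have d2: "(vderiv ?G has_vector_derivative lincomb (ff t) (x2 t + K t *v x t) + lincomb (hh t) (2 *\<^sub>R x1 t)) (at t)"
    if t: "t \<in> ?B" for t
  proof -
    have tI: "t \<in> I" using t e(2) by blast
    have "((\<lambda>s. lincomb (ff s) (x1 s) + lincomb (hh s) (x s)) has_vector_derivative
       lincomb (ff t) (vderiv x1 t + S t *v x1 t + K t *v x t) + lincomb (hh t) (vderiv x t + S t *v x t + x1 t)) (at t)"
      by (rule frame_derivative_rule[OF tI smooth_D(1)[OF s1 t] smooth_D(1)[OF sx t]])
    then have "((\<lambda>s. lincomb (ff s) (x1 s) + lincomb (hh s) (x s)) has_vector_derivative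
       lincomb (ff t) (x2 t + K t *v x t) + lincomb (hh t) (2 *\<^sub>R x1 t)) (at t)"
      by (simp add: x1_def[symmetric] x2_def scaleR_2)
    then show ?thesis
      by (rule has_vector_derivative_transform_within_open[OF _ open_ball t]) (simp add: vderiv_eqI[OF d1])
  qed
  have D2: "lincomb (ff t) (x2 t + K t *v x t) + lincomb (hh t) (2 *\<^sub>R x1 t) \<in> D" if t: "t \<in> ?B" for t
    by (rule has_vector_derivative_in_subspace[OF subD open_ball t _ d2[OF t]]) (simp add: vderiv_eqI[OF d1] D1)
  obtain X where d3: "(vderiv (vderiv ?G) has_vector_derivative lincomb (ff \<tau>) X + lincomb (hh \<tau>) (3 *\<^sub>R x2 \<tau> + K \<tau> *v x \<tau>)) (at \<tau>)"
  proof -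
    have two: "((\<lambda>t. 2 *\<^sub>R x1 t) has_vector_derivative 2 *\<^sub>R vderiv x1 \<tau>) (at \<tau>)"
      by (rule bounded_linear.has_vector_derivative[OF bounded_linear_scaleR_right smooth_D(1)[OF s1 \<tau>B]])
    let ?X = "vderiv (\<lambda>t. x2 t + K t *v x t) \<tau> + S \<tau> *v (x2 \<tau> + K \<tau> *v x \<tau>) + K \<tau> *v (2 *\<^sub>R x1 \<tau>)"
    have "((\<lambda>s. lincomb (ff s) (x2 s + K s *v x s) + lincomb (hh s) (2 *\<^sub>R x1 s)) has_vector_derivative
       lincomb (ff \<tau>) ?X + lincomb (hh \<tau>) (2 *\<^sub>R vderiv x1 \<tau> + S \<tau> *v (2 *\<^sub>R x1 \<tau>) + (x2 \<tau> + K \<tau> *v x \<tau>))) (at \<tau>)"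
      by (rule frame_derivative_rule[OF \<tau> smooth_D(1)[OF sz \<tau>B] two])
    \<comment> \<open>The h-part collects 2 x2 from differentiating 2 x1 covariantly, and x2 + K x
      from the f-part of the second derivative.\<close>
    moreover have "2 *\<^sub>R vderiv x1 \<tau> + S \<tau> *v (2 *\<^sub>R x1 \<tau>) + (x2 \<tau> + K \<tau> *v x \<tau>) = 3 *\<^sub>R x2 \<tau> + K \<tau> *v x \<tau>"
    proof -
      have "2 *\<^sub>R vderiv x1 \<tau> + S \<tau> *v (2 *\<^sub>R x1 \<tau>) = 2 *\<^sub>R x2 \<tau>"
        by (simp add: x2_def scaleR_add_right matrix_vector_mult_scaleR)
      moreover have "2 *\<^sub>R x2 \<tau> + x2 \<tau> = 3 *\<^sub>R x2 \<tau>"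
        using scaleR_add_left[of 2 1 "x2 \<tau>"] by simp
      ultimately show ?thesis by (metis add.assoc)
    qed
    ultimately have "((\<lambda>s. lincomb (ff s) (x2 s + K s *v x s) + lincomb (hh s) (2 *\<^sub>R x1 s)) has_vector_derivative
       lincomb (ff \<tau>) ?X + lincomb (hh \<tau>) (3 *\<^sub>R x2 \<tau> + K \<tau> *v x \<tau>)) (at \<tau>)" by metis
    then have "(vderiv (vderiv ?G) has_vector_derivative lincomb (ff \<tau>) ?X + lincomb (hh \<tau>) (3 *\<^sub>R x2 \<tau> + K \<tau> *v x \<tau>)) (at \<tau>)"
      by (rule has_vector_derivative_transform_within_open[OF _ open_ball \<tau>B]) (simp add: vderiv_eqI[OF d2])
    then show ?thesis by (rule that)
  qed
  have D3: "lincomb (ff \<tau>) X + lincomb (hh \<tau>) (3 *\<^sub>R x2 \<tau> + K \<tau> *v x \<tau>) \<in> D"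
    by (rule has_vector_derivative_in_subspace[OF subD open_ball \<tau>B _ d3]) (simp add: vderiv_eqI[OF d2] D2)
  show ?thesis
    by (rule that[of "x1 \<tau>" "x2 \<tau>" X])
       (use D1[OF \<tau>B] D2[OF \<tau>B] D3 in
         \<open>simp_all add: affine_deriv_def numeral_2_eq_2 numeral_3_eq_3 vderiv_eqI[OF d1[OF \<tau>B]]
           vderiv_eqI[OF d2[OF \<tau>B]] vderiv_eqI[OF d3] x\<tau>\<close>)
qed

text \<open>For D = span h the first derivative lies in D only if c1 = 0, and then the second
  derivative has neither an f-part nor an h-part. Conversely, a vanishing second derivative forces
  c1 = 0, so the first derivative is h c itself; thus D' contains span h, and the dimensions
  agree.\<close>

lemma frame_derivative_curve:
  assumes \<tau>: "\<tau> \<in> I" shows "derivative_curve \<omega> \<Gamma> \<tau> = span (range (hh \<tau>))"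
  unfolding derivative_curve_def
proof (rule the_equality)
  let ?D = "span (range (hh \<tau>))"
  note B = symplectic_basisD(1)[OF frame_basis[OF \<tau>]]
  have D: "lagrangian \<omega> ?D" by (rule symplectic_basis_lagrangian(2)[OF \<omega> frame_basis[OF \<tau>]])
  have "affine_deriv 2 \<Gamma> ?D \<tau> u = 0" if u: "u \<in> \<Gamma> \<tau>" for u
  proof -
    obtain c where c: "u = lincomb (ff \<tau>) c" using basis_of_coords[OF frame_basis_of[OF \<tau>] u] by blast
    obtain c1 c2 X where
      a1: "affine_deriv 1 \<Gamma> ?D \<tau> u = lincomb (ff \<tau>) c1 + lincomb (hh \<tau>) c" and
      a2: "affine_deriv 2 \<Gamma> ?D \<tau> u = lincomb (ff \<tau>) (c2 + K \<tau> *v c) + lincomb (hh \<tau>) (2 *\<^sub>R c1)" and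
      in1: "affine_deriv 1 \<Gamma> ?D \<tau> u \<in> ?D" and in2: "affine_deriv 2 \<Gamma> ?D \<tau> u \<in> ?D"
      unfolding c by (rule frame_affine_derivs[OF \<tau> D frame_halves_transverse[OF \<tau>], of c])
    have z: "a = 0" if ab: "lincomb (ff \<tau>) a + lincomb (hh \<tau>) b \<in> ?D" for a b
    proof -
      obtain b' where "lincomb (ff \<tau>) a + lincomb (hh \<tau>) b = lincomb (hh \<tau>) b'"
        using ab unfolding span_range_lincomb by blast
      then have "lincomb (ff \<tau>) a + lincomb (hh \<tau>) (b - b') = 0" by (simp add: lincomb_linear add_diff_eq)
      then show ?thesis by (rule basis_of_sum_typeD(1)[OF B])
    qed
    show ?thesis using z[OF in1[unfolded a1]] z[OF in2[unfolded a2]] a2 by (simp add: lincomb_linear)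
  qed
  then show "lagrangian \<omega> ?D \<and> transverse ?D (\<Gamma> \<tau>) \<and> (\<forall>u\<in>\<Gamma> \<tau>. affine_deriv 2 \<Gamma> ?D \<tau> u = 0)"
    using D frame_halves_transverse[OF \<tau>] by (simp add: transverse_def)
  fix D' assume D': "lagrangian \<omega> D' \<and> transverse D' (\<Gamma> \<tau>) \<and> (\<forall>u\<in>\<Gamma> \<tau>. affine_deriv 2 \<Gamma> D' \<tau> u = 0)"
  have L': "lagrangian \<omega> D'" and tr': "D' \<inter> \<Gamma> \<tau> = {0}" using D' by (auto simp: transverse_def)
  have "lincomb (hh \<tau>) c \<in> D'" for c
  proof -
    let ?u = "lincomb (ff \<tau>) c"
    obtain c1 c2 X where
      a1: "affine_deriv 1 \<Gamma> D' \<tau> ?u = lincomb (ff \<tau>) c1 + lincomb (hh \<tau>) c" and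
      a2: "affine_deriv 2 \<Gamma> D' \<tau> ?u = lincomb (ff \<tau>) (c2 + K \<tau> *v c) + lincomb (hh \<tau>) (2 *\<^sub>R c1)" and
      in1: "affine_deriv 1 \<Gamma> D' \<tau> ?u \<in> D'"
      by (rule frame_affine_derivs[OF \<tau> L' tr', of c])
    have "affine_deriv 2 \<Gamma> D' \<tau> ?u = 0" using D' basis_of_in(2)[OF frame_basis_of[OF \<tau>]] by blast
    then have "2 *\<^sub>R c1 = 0" unfolding a2 by (rule basis_of_sum_typeD(2)[OF B])
    then show ?thesis using in1 a1 by (simp add: lincomb_linear)
  qed
  then have "?D \<subseteq> D'" unfolding span_range_lincomb by blast
  moreover have "dim D' \<le> dim ?D" using D L' by (simp add: lagrangian_def)
  ultimately show "D' = ?D"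
    using L' subspace_dim_equal[of ?D D'] by (auto simp: lagrangian_def)
qed

text \<open>In the chart of span h the f-part of the second derivative vanishes, so c2 = -K c. The
  third derivative is then h (3 c2 + K c) = h (-2 K c), while the first is h c; this is the origin
  of the constant -2.\<close>

lemma frame_ricci:
  assumes \<tau>: "\<tau> \<in> I" shows "ricci \<omega> \<Gamma> \<tau> (lincomb (ff \<tau>) c) = lincomb (ff \<tau>) ((-2) *\<^sub>R (K \<tau> *v c))"
  unfolding ricci_def frame_derivative_curve[OF \<tau>]
proof (rule the_equality)
  let ?D = "span (range (hh \<tau>))"
  note B = symplectic_basisD(1)[OF frame_basis[OF \<tau>]]
  have D: "lagrangian \<omega> ?D" by (rule symplectic_basis_lagrangian(2)[OF \<omega> frame_basis[OF \<tau>]])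
  have z: "a = 0" if ab: "lincomb (ff \<tau>) a + lincomb (hh \<tau>) b \<in> ?D" for a b
  proof -
    obtain b' where "lincomb (ff \<tau>) a + lincomb (hh \<tau>) b = lincomb (hh \<tau>) b'"
      using ab unfolding span_range_lincomb by blast
    then have "lincomb (ff \<tau>) a + lincomb (hh \<tau>) (b - b') = 0" by (simp add: lincomb_linear add_diff_eq)
    then show ?thesis by (rule basis_of_sum_typeD(1)[OF B])
  qed
  have A: "affine_deriv 1 \<Gamma> ?D \<tau> (lincomb (ff \<tau>) c) = lincomb (hh \<tau>) c \<and>
     affine_deriv 3 \<Gamma> ?D \<tau> (lincomb (ff \<tau>) c) = lincomb (hh \<tau>) ((-2) *\<^sub>R (K \<tau> *v c))" for c
  proof -
    let ?u = "lincomb (ff \<tau>) c"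
    obtain c1 c2 X where
      a1: "affine_deriv 1 \<Gamma> ?D \<tau> ?u = lincomb (ff \<tau>) c1 + lincomb (hh \<tau>) c" and
      a2: "affine_deriv 2 \<Gamma> ?D \<tau> ?u = lincomb (ff \<tau>) (c2 + K \<tau> *v c) + lincomb (hh \<tau>) (2 *\<^sub>R c1)" and
      a3: "affine_deriv 3 \<Gamma> ?D \<tau> ?u = lincomb (ff \<tau>) X + lincomb (hh \<tau>) (3 *\<^sub>R c2 + K \<tau> *v c)" and
      in1: "affine_deriv 1 \<Gamma> ?D \<tau> ?u \<in> ?D" and in2: "affine_deriv 2 \<Gamma> ?D \<tau> ?u \<in> ?D"
      and in3: "affine_deriv 3 \<Gamma> ?D \<tau> ?u \<in> ?D"
      by (rule frame_affine_derivs[OF \<tau> D frame_halves_transverse[OF \<tau>], of c])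
    have "c2 = - (K \<tau> *v c)" using z[OF in2[unfolded a2]] by (simp add: eq_neg_iff_add_eq_0)
    then have "3 *\<^sub>R c2 + K \<tau> *v c = (-2) *\<^sub>R (K \<tau> *v c)" by (simp add: vec_eq_iff)
    then show ?thesis using z[OF in1[unfolded a1]] z[OF in3[unfolded a3]] a1 a3 by (simp add: lincomb_linear)
  qed
  show "lincomb (ff \<tau>) ((-2) *\<^sub>R (K \<tau> *v c)) \<in> \<Gamma> \<tau> \<and>
     affine_deriv 1 \<Gamma> ?D \<tau> (lincomb (ff \<tau>) ((-2) *\<^sub>R (K \<tau> *v c))) = affine_deriv 3 \<Gamma> ?D \<tau> (lincomb (ff \<tau>) c)"
    using A basis_of_in(2)[OF frame_basis_of[OF \<tau>]] by simp
  fix w assume w: "w \<in> \<Gamma> \<tau> \<and> affine_deriv 1 \<Gamma> ?D \<tau> w = affine_deriv 3 \<Gamma> ?D \<tau> (lincomb (ff \<tau>) c)"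
  then obtain b where b: "w = lincomb (ff \<tau>) b" using basis_of_coords[OF frame_basis_of[OF \<tau>]] by blast
  have "lincomb (hh \<tau>) b = lincomb (hh \<tau>) ((-2) *\<^sub>R (K \<tau> *v c))" using w A unfolding b by metis
  then have "b = (-2) *\<^sub>R (K \<tau> *v c)"
    by (rule basis_of_lincomb_eq[OF basis_of_sum_type_halves(2)[OF B]])
  then show "w = lincomb (ff \<tau>) ((-2) *\<^sub>R (K \<tau> *v c))" using b by simp
qed

lemma frame_velocity:
  assumes \<tau>: "\<tau> \<in> I" shows "velocity_form \<omega> \<Gamma> \<tau> (lincomb (ff \<tau>) c) = c \<bullet> c"
proof -
  interpret bounded_bilinear \<omega> by (rule symplectic_bilinear[OF \<omega>])
  obtain e where e: "e > 0" "ball \<tau> e \<subseteq> I" using frame_open \<tau> open_contains_ball by metis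
  note sb = symplectic_basisD[OF frame_basis[OF \<tau>]]
  have "velocity_form \<omega> \<Gamma> \<tau> (lincomb (ff \<tau>) c) =
      (\<Sum>j\<in>UNIV. c $ j * \<omega> (lincomb (ff \<tau>) c) (vderiv (\<lambda>t. F t (Inl j)) \<tau>))"
  proof (rule velocity_form_frame[OF \<omega> e(1)])
    show "smooth_on_line (\<lambda>t. F t (Inl i)) (ball \<tau> e)" for i using frame_smooth(1) e(2) smooth_subset by blast
    show "\<omega> u v = 0" if "t \<in> ball \<tau> e" "u \<in> \<Gamma> t" "v \<in> \<Gamma> t" for t u v
      using frame_lagrangian[of t] that e(2) by (auto simp: lagrangian_def)
    show "span (range (ff t)) = \<Gamma> t" if "t \<in> ball \<tau> e" for t using frame_span that e(2) by blast
  qed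
  also have "\<dots> = (\<Sum>j\<in>UNIV. c $ j * c $ j)"
  proof (rule sum.cong[OF refl])
    fix j
    have "\<omega> (lincomb (ff \<tau>) c) (lincomb (ff \<tau>) b) = 0" for b
      by (simp add: bilinear_lincomb[OF symplectic_bilinear[OF \<omega>]] sb)
    moreover have "\<omega> (lincomb (ff \<tau>) c) (F \<tau> (Inr j)) = c $ j"
      by (simp add: bilinear_lincomb[OF symplectic_bilinear[OF \<omega>]] sb if_distrib[of "\<lambda>x. _ * x"] cong: if_cong)
    ultimately show "c $ j * \<omega> (lincomb (ff \<tau>) c) (vderiv (\<lambda>t. F t (Inl j)) \<tau>) = c $ j * c $ j"
      by (simp add: vderiv_eqI[OF frame_deriv(1)[OF \<tau>]] add_right)
  qed
  finally show ?thesis by (simp add: inner_vec_def)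
qed

end


section \<open>Change of sign of the symplectic form\<close>

lemma derivative_curve_scale:
  "\<sigma> \<noteq> (0::real) \<Longrightarrow> derivative_curve (\<lambda>u v. \<sigma> * \<omega> u v) \<Gamma> = derivative_curve \<omega> \<Gamma>"
  by (simp add: fun_eq_iff derivative_curve_def lagrangian_scale)

lemma ricci_scale: "\<sigma> \<noteq> (0::real) \<Longrightarrow> ricci (\<lambda>u v. \<sigma> * \<omega> u v) \<Gamma> = ricci \<omega> \<Gamma>"
  by (simp add: fun_eq_iff ricci_def derivative_curve_scale)

lemma smooth_lagrangian_curve_scale:
  "\<sigma> \<noteq> (0::real) \<Longrightarrow> smooth_lagrangian_curve (\<lambda>u v. \<sigma> * \<omega> u v) \<Gamma> I \<longleftrightarrow> smooth_lagrangian_curve \<omega> \<Gamma> I"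
  by (simp add: smooth_lagrangian_curve_def lagrangian_scale)

text \<open>\<open>velocity_form\<close> is a definite description, so the factor \<sigma> is pulled
  out only after the forms for \<omega> and \<sigma> \<omega> have been evaluated in one smooth
  frame; then 1/\<sigma> = \<sigma>.\<close>

lemma frame_velocity_scaled:
  fixes F :: "real \<Rightarrow> 'n::finite + 'n \<Rightarrow> 'w::euclidean_space"
  assumes \<omega>: "symplectic_form \<omega>" and \<sigma>: "\<sigma> = 1 \<or> \<sigma> = -1"
    and fr: "cartan_frame (\<lambda>u v. \<sigma> * \<omega> u v) \<Gamma> I F S K" and \<tau>: "\<tau> \<in> I"
  shows "velocity_form \<omega> \<Gamma> \<tau> (lincomb (\<lambda>i. F \<tau> (Inl i)) c) = \<sigma> * (c \<bullet> c)"
proof -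
  let ?w = "\<lambda>u v. \<sigma> * \<omega> u v" and ?u = "lincomb (\<lambda>i. F \<tau> (Inl i)) c"
  have nz: "\<sigma> \<noteq> 0" using \<sigma> by auto
  note w = symplectic_scale[OF \<omega> nz]
  obtain e where e: "e > 0" "ball \<tau> e \<subseteq> I" using frame_open[OF w fr] \<tau> open_contains_ball by metis
  have sm: "smooth_on_line (\<lambda>t. F t (Inl i)) (ball \<tau> e)" for i
    using frame_smooth(1)[OF w fr] e(2) smooth_subset by blast
  have iso: "\<omega> u v = 0" if "t \<in> ball \<tau> e" "u \<in> \<Gamma> t" "v \<in> \<Gamma> t" for t u v
    using frame_lagrangian[OF w fr, of t] that e(2) nz by (auto simp: lagrangian_def)
  have sp: "span (range (\<lambda>i. F t (Inl i))) = \<Gamma> t" if "t \<in> ball \<tau> e" for t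
    using frame_span[OF w fr] that e(2) by blast
  let ?g = "\<lambda>j. vderiv (\<lambda>t. F t (Inl j)) \<tau>"
  have "velocity_form \<omega> \<Gamma> \<tau> ?u = (\<Sum>j\<in>UNIV. c $ j * \<omega> ?u (?g j))"
    by (rule velocity_form_frame[OF \<omega> e(1) sm]) (use iso sp in auto)
  moreover have "velocity_form ?w \<Gamma> \<tau> ?u = (\<Sum>j\<in>UNIV. c $ j * ?w ?u (?g j))"
    by (rule velocity_form_frame[OF w e(1) sm]) (use iso sp in auto)
  ultimately have "velocity_form ?w \<Gamma> \<tau> ?u = \<sigma> * velocity_form \<omega> \<Gamma> \<tau> ?u"
    by (simp add: sum_distrib_left mult_ac)
  then show ?thesis using frame_velocity[OF w fr \<tau>, of c] \<sigma> by auto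
qed

section \<open>Frenet frames with diagonal curvature\<close>

definition diagonal_frame ::
    "('w::euclidean_space \<Rightarrow> 'w \<Rightarrow> real) \<Rightarrow> (real \<Rightarrow> 'w set) \<Rightarrow> real set \<Rightarrow>
     (real \<Rightarrow> 'n::{finite,linorder} + 'n \<Rightarrow> 'w) \<Rightarrow>
     (real \<Rightarrow> real^('n::{finite,linorder})^('n::{finite,linorder})) \<Rightarrow> (real \<Rightarrow> real^('n::{finite,linorder})^('n::{finite,linorder})) \<Rightarrow> bool" where
  "diagonal_frame \<omega> \<Gamma> I F S K \<longleftrightarrow> cartan_frame \<omega> \<Gamma> I F S K \<and>
     (\<forall>t\<in>I. diagonal_matrix (K t) \<and> (\<forall>i j. i < j \<longrightarrow> K t $ i $ i < K t $ j $ j))"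

text \<open>For diagonal K, the determinant of the traceless part of the operator 2 K. The Ricci
  operator is -2 K, whence the factor 2.\<close>

definition deviation_product :: "real^'n^'n \<Rightarrow> real" where
  "deviation_product A = (\<Prod>i\<in>UNIV. 2 * (A $ i $ i - (\<Sum>j\<in>UNIV. A $ j $ j) / real CARD('n)))"

lemma diagonal_matrix_mult_vector: "diagonal_matrix A \<Longrightarrow> (A *v c) $ i = A $ i $ i * c $ i"
proof -
  assume "diagonal_matrix A"
  then have "(\<Sum>j\<in>UNIV. A $ i $ j * c $ j) = (\<Sum>j\<in>UNIV. if j = i then A $ i $ i * c $ i else 0)"
    by (intro sum.cong) (auto simp: diagonal_matrix_def)
  then show ?thesis unfolding matrix_vector_mult_def by simp
qed

context
  fixes \<omega> :: "'w::euclidean_space \<Rightarrow> 'w \<Rightarrow> real" and \<Gamma> :: "real \<Rightarrow> 'w set" and I :: "real set"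
    and F :: "real \<Rightarrow> 'n::{finite,linorder} + 'n \<Rightarrow> 'w"
    and S K :: "real \<Rightarrow> real^('n::{finite,linorder})^('n::{finite,linorder})" and \<sigma> :: real
  assumes \<omega>: "symplectic_form \<omega>" and \<sigma>: "\<sigma> = 1 \<or> \<sigma> = -1"
    and df: "diagonal_frame (\<lambda>u v. \<sigma> * \<omega> u v) \<Gamma> I F S K"
begin

lemma diagonal_frame_symplectic: "symplectic_form (\<lambda>u v. \<sigma> * \<omega> u v)"
  using symplectic_scale[OF \<omega>, of \<sigma>] \<sigma> by auto

lemma diagonal_frame_cartan: "cartan_frame (\<lambda>u v. \<sigma> * \<omega> u v) \<Gamma> I F S K"
  using df by (simp add: diagonal_frame_def)

lemma diagonal_frame_ricci:
  assumes t: "t \<in> I"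
  shows "ricci \<omega> \<Gamma> t (lincomb (\<lambda>i. F t (Inl i)) c) = lincomb (\<lambda>i. F t (Inl i)) (\<chi> i. (-2 * K t $ i $ i) * c $ i)"
proof -
  have "(-2) *\<^sub>R (K t *v c) = (\<chi> i. (-2 * K t $ i $ i) * c $ i)"
    using df t diagonal_matrix_mult_vector[of "K t" c] by (simp add: diagonal_frame_def vec_eq_iff)
  then show ?thesis
    using frame_ricci[OF diagonal_frame_symplectic diagonal_frame_cartan t, of c] ricci_scale[of \<sigma> \<omega> \<Gamma>] \<sigma> by auto
qed

lemma diagonal_frame_basis: "t \<in> I \<Longrightarrow> basis_of (\<lambda>i. F t (Inl i)) (\<Gamma> t)"
  by (rule frame_basis_of[OF diagonal_frame_symplectic diagonal_frame_cartan])

text \<open>Passing from -2 K to 2 K changes the sign of every factor, so equality holds for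
  absolute values, which are all that enters \<open>arc_density\<close>.\<close>

lemma diagonal_frame_traceless_det:
  assumes t: "t \<in> I"
  shows "\<bar>traceless_ricci_det TYPE('n) \<omega> \<Gamma> t\<bar> = \<bar>deviation_product (K t)\<bar>"
proof -
  note b = diagonal_frame_basis[OF t]
  let ?T = "\<Sum>i\<in>UNIV. -2 * K t $ i $ i"
  have tr: "op_trace TYPE('n) (\<Gamma> t) (ricci \<omega> \<Gamma> t) = ?T"
    by (rule op_det_trace_eigenbasis(2)[OF b]) (rule diagonal_frame_ricci[OF t])
  have "traceless_ricci_det TYPE('n) \<omega> \<Gamma> t = (\<Prod>i\<in>UNIV. -2 * K t $ i $ i - ?T / real CARD('n))"
    unfolding traceless_ricci_det_def tr
  proof (rule op_det_trace_eigenbasis(1)[OF b])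
    fix c
    have E: "(\<chi> i. (-2 * K t $ i $ i) * c $ i) - (?T / real CARD('n)) *\<^sub>R c =
       (\<chi> i. (-2 * K t $ i $ i - ?T / real CARD('n)) * c $ i)"
      by (simp add: vec_eq_iff algebra_simps)
    show "ricci \<omega> \<Gamma> t (lincomb (\<lambda>i. F t (Inl i)) c) - (?T / real CARD('n)) *\<^sub>R lincomb (\<lambda>i. F t (Inl i)) c =
       lincomb (\<lambda>i. F t (Inl i)) (\<chi> i. (-2 * K t $ i $ i - ?T / real CARD('n)) * c $ i)"
      unfolding diagonal_frame_ricci[OF t] by (simp only: E lincomb_linear(2,3)[symmetric])
  qed
  moreover have "\<bar>-2 * K t $ i $ i - ?T / real CARD('n)\<bar> = \<bar>2 * (K t $ i $ i - (\<Sum>j\<in>UNIV. K t $ j $ j) / real CARD('n))\<bar>" for i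
  proof -
    have E2: "-2 * K t $ i $ i - ?T / real CARD('n) = - (2 * (K t $ i $ i - (\<Sum>j\<in>UNIV. K t $ j $ j) / real CARD('n)))"
      by (simp add: sum_distrib_left[symmetric] sum_negf algebra_simps)
    show ?thesis by (simp only: E2 abs_minus_cancel)
  qed
  ultimately show ?thesis by (simp only: deviation_product_def abs_prod)
qed

lemma diagonal_frame_arc_density:
  "t \<in> I \<Longrightarrow> arc_density TYPE('n) \<omega> \<Gamma> t = \<bar>deviation_product (K t)\<bar> powr (1 / (2 * real CARD('n)))"
  by (simp add: arc_density_def diagonal_frame_traceless_det)

lemma diagonal_frame_eigenvalues:
  assumes t: "t \<in> I" shows "card (eigenvalues_on (\<Gamma> t) (ricci \<omega> \<Gamma> t)) = CARD('n)"
proof -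
  note b = diagonal_frame_basis[OF t]
  have "eigenvalues_on (\<Gamma> t) (ricci \<omega> \<Gamma> t) = range (\<lambda>i. -2 * K t $ i $ i)"
  proof (intro equalityI subsetI)
    fix l assume "l \<in> eigenvalues_on (\<Gamma> t) (ricci \<omega> \<Gamma> t)"
    then obtain u where u: "u \<in> \<Gamma> t" "u \<noteq> 0" "ricci \<omega> \<Gamma> t u = l *\<^sub>R u" by (auto simp: eigenvalues_on_def)
    obtain c where c: "u = lincomb (\<lambda>i. F t (Inl i)) c" using basis_of_coords[OF b u(1)] by blast
    have "c \<noteq> 0" using u(2) c by (auto simp: lincomb_linear)
    then obtain i where i: "c $ i \<noteq> 0" by (metis vec_eq_iff zero_index)
    have "lincomb (\<lambda>i. F t (Inl i)) (\<chi> i. (-2 * K t $ i $ i) * c $ i) = lincomb (\<lambda>i. F t (Inl i)) (l *\<^sub>R c)"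
      using u(3) unfolding c diagonal_frame_ricci[OF t] by (simp add: lincomb_linear)
    then have "(\<chi> i. (-2 * K t $ i $ i) * c $ i) = l *\<^sub>R c" by (rule basis_of_lincomb_eq[OF b])
    then have "(\<chi> i. (-2 * K t $ i $ i) * c $ i) $ i = (l *\<^sub>R c) $ i" by simp
    then have "(-2 * K t $ i $ i) * c $ i = l * c $ i" by simp
    then have "l = -2 * K t $ i $ i" using i by (metis mult_right_cancel)
    then show "l \<in> range (\<lambda>i. -2 * K t $ i $ i)" by blast
  next
    fix l assume "l \<in> range (\<lambda>i. -2 * K t $ i $ i)"
    then obtain i where i: "l = -2 * K t $ i $ i" by blast
    have "(\<chi> j. (-2 * K t $ j $ j) * axis i 1 $ j) = l *\<^sub>R axis i 1" by (auto simp: vec_eq_iff axis_def i)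
    then have "ricci \<omega> \<Gamma> t (F t (Inl i)) = l *\<^sub>R F t (Inl i)"
      using diagonal_frame_ricci[OF t, of "axis i 1"] by (simp add: lincomb_linear)
    moreover have "F t (Inl i) \<noteq> 0"
      using basis_of_lincomb_zero[OF b, of "axis i 1"] by (auto simp: axis_eq_0_iff)
    ultimately show "l \<in> eigenvalues_on (\<Gamma> t) (ricci \<omega> \<Gamma> t)"
      using basis_of_in(1)[OF b, of i] by (auto simp: eigenvalues_on_def)
  qed
  moreover have "inj (\<lambda>i. -2 * K t $ i $ i)"
  proof (rule injI)
    fix i j assume "-2 * K t $ i $ i = -2 * K t $ j $ j"
    then have eq: "K t $ i $ i = K t $ j $ j" by simp
    have less: "\<And>i j. i < j \<Longrightarrow> K t $ i $ i < K t $ j $ j" using df t by (simp add: diagonal_frame_def)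
    show "i = j" using less[of i j] less[of j i] eq by (cases i j rule: linorder_cases) auto
  qed
  ultimately show ?thesis by (simp add: card_image)
qed

lemma diagonal_frame_definite:
  assumes t: "t \<in> I"
  shows "\<sigma> = 1 \<Longrightarrow> positive_definite_on (\<Gamma> t) (velocity_form \<omega> \<Gamma> t)"
    "\<sigma> = -1 \<Longrightarrow> negative_definite_on (\<Gamma> t) (velocity_form \<omega> \<Gamma> t)"
proof -
  note b = diagonal_frame_basis[OF t]
  have v: "\<exists>r>0. velocity_form \<omega> \<Gamma> t u = \<sigma> * r" if u: "u \<in> \<Gamma> t" "u \<noteq> 0" for u
  proof -
    obtain c where c: "u = lincomb (\<lambda>i. F t (Inl i)) c" using basis_of_coords[OF b u(1)] by blast
    have "c \<noteq> 0" using u(2) c by (auto simp: lincomb_linear)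
    then show ?thesis
      using c frame_velocity_scaled[OF \<omega> \<sigma> diagonal_frame_cartan t, of c] by (intro exI[of _ "c \<bullet> c"]) auto
  qed
  show "\<sigma> = 1 \<Longrightarrow> positive_definite_on (\<Gamma> t) (velocity_form \<omega> \<Gamma> t)"
    "\<sigma> = -1 \<Longrightarrow> negative_definite_on (\<Gamma> t) (velocity_form \<omega> \<Gamma> t)"
    unfolding positive_definite_on_def negative_definite_on_def using v by force+
qed

lemma diagonal_frame_jacobi:
  assumes "open_interval I" "\<And>t. t \<in> I \<Longrightarrow> deviation_product (K t) \<noteq> 0"
  shows "jacobi_curve TYPE('n) \<omega> \<Gamma> I"
  unfolding jacobi_curve_def
proof (intro conjI ballI assms(1))
  show "smooth_lagrangian_curve \<omega> \<Gamma> I"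
    using frame_smooth_curve[OF diagonal_frame_symplectic diagonal_frame_cartan]
      smooth_lagrangian_curve_scale[of \<sigma> \<omega> \<Gamma> I] \<sigma> by auto
  fix t assume t: "t \<in> I"
  show "positive_definite_on (\<Gamma> t) (velocity_form \<omega> \<Gamma> t) \<or> negative_definite_on (\<Gamma> t) (velocity_form \<omega> \<Gamma> t)"
    using diagonal_frame_definite[OF t] \<sigma> by blast
  show "card (eigenvalues_on (\<Gamma> t) (ricci \<omega> \<Gamma> t)) = CARD('n)" by (rule diagonal_frame_eigenvalues[OF t])
  show "traceless_ricci_det TYPE('n) \<omega> \<Gamma> t \<noteq> 0"
    using diagonal_frame_traceless_det[OF t] assms(2)[OF t] by auto
qed

text \<open>On an empty set the test for negative velocity in \<open>oriented_form\<close> would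
  succeed vacuously and select -\<omega> whatever \<sigma> is; one frame vector at one point settles
  the sign.\<close>

lemma diagonal_frame_oriented:
  assumes "I \<noteq> {}" shows "oriented_form \<omega> \<Gamma> I = (\<lambda>u v. \<sigma> * \<omega> u v)"
proof (cases "\<sigma> = 1")
  case True
  obtain t where t: "t \<in> I" using assms by blast
  have "F t (Inl i) \<noteq> 0" for i
    using basis_of_lincomb_zero[OF diagonal_frame_basis[OF t], of "axis i 1"] by (auto simp: axis_eq_0_iff)
  moreover have "F t (Inl i) \<in> \<Gamma> t" for i by (rule basis_of_in(1)[OF diagonal_frame_basis[OF t]])
  ultimately have "\<not> negative_definite_on (\<Gamma> t) (velocity_form \<omega> \<Gamma> t)"
    using diagonal_frame_definite(1)[OF t True] unfolding positive_definite_on_def negative_definite_on_def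
    by (meson less_asym)
  then show ?thesis using True t by (auto simp: oriented_form_def)
next
  case False
  then have "\<sigma> = -1" using \<sigma> by blast
  then show ?thesis using diagonal_frame_definite(2) by (auto simp: oriented_form_def)
qed

lemma diagonal_frame_frenet: "frenet_frame (\<lambda>u v. \<sigma> * \<omega> u v) \<Gamma> I F"
  unfolding frenet_frame_def
proof (intro conjI ballI allI)
  note w = diagonal_frame_symplectic and fr = diagonal_frame_cartan
  let ?w = "\<lambda>u v. \<sigma> * \<omega> u v"
  show "smooth_on_line (\<lambda>\<tau>. F \<tau> i) I" for i by (rule frame_smooth(1)[OF w fr])
  fix \<tau> assume \<tau>: "\<tau> \<in> I"
  show "symplectic_basis ?w (F \<tau>)" by (rule frame_basis[OF w fr \<tau>])
  show "basis_of (\<lambda>i. F \<tau> (Inl i)) (\<Gamma> \<tau>)" by (rule diagonal_frame_basis[OF \<tau>])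
  show "basis_of (\<lambda>i. F \<tau> (Inr i)) (derivative_curve ?w \<Gamma> \<tau>)"
    unfolding frame_derivative_curve[OF w fr \<tau>]
    by (rule basis_of_sum_type_halves(2)[OF symplectic_basisD(1)[OF frame_basis[OF w fr \<tau>]]])
  show "polar_form (velocity_form ?w \<Gamma> \<tau>) (F \<tau> (Inl i)) (F \<tau> (Inl j)) = (if i = j then 1 else 0)" for i j
  proof -
    let ?q = "velocity_form ?w \<Gamma> \<tau>" and ?l = "lincomb (\<lambda>i. F \<tau> (Inl i))"
    have "polar_form ?q (?l a) (?l b) = a \<bullet> b" for a b
    proof -
      have "?q (?l a + ?l b) = (a + b) \<bullet> (a + b)"
        using frame_velocity[OF w fr \<tau>, of "a + b"] by (simp only: lincomb_linear)
      then show ?thesis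
        using frame_velocity[OF w fr \<tau>, of a] frame_velocity[OF w fr \<tau>, of b]
        by (simp add: polar_form_def inner_add_left inner_add_right inner_commute)
    qed
    from this[of "axis i 1" "axis j 1"] show ?thesis by (simp add: inner_axis_axis)
  qed
  show "\<exists>l. ricci ?w \<Gamma> \<tau> (F \<tau> (Inl i)) = l *\<^sub>R F \<tau> (Inl i)" for i
  proof -
    have "(\<chi> j. (-2 * K \<tau> $ j $ j) * axis i 1 $ j) = (-2 * K \<tau> $ i $ i) *\<^sub>R axis i 1"
      by (auto simp: vec_eq_iff axis_def)
    then have "ricci \<omega> \<Gamma> \<tau> (F \<tau> (Inl i)) = (-2 * K \<tau> $ i $ i) *\<^sub>R F \<tau> (Inl i)"
      using diagonal_frame_ricci[OF \<tau>, of "axis i 1"] by (simp add: lincomb_linear)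
    moreover have "ricci ?w \<Gamma> = ricci \<omega> \<Gamma>" by (rule ricci_scale) (use \<sigma> in auto)
    ultimately show ?thesis by metis
  qed
qed

lemma diagonal_frame_arc_cartan_matrix:
  assumes "I \<noteq> {}" and C: "\<And>t. t \<in> I \<Longrightarrow> C t = cartan_block (S t) (K t)"
  shows "arc_cartan_matrix \<omega> \<Gamma> I C"
  unfolding arc_cartan_matrix_def diagonal_frame_oriented[OF assms(1)]
proof (intro exI[of _ F] conjI ballI diagonal_frame_frenet)
  fix \<tau> assume \<tau>: "\<tau> \<in> I"
  note d = frame_deriv[OF diagonal_frame_symplectic diagonal_frame_cartan \<tau>]
  have sum: "(\<Sum>i\<in>UNIV. C \<tau> $ i $ j *\<^sub>R F \<tau> i) = lincomb (F \<tau>) (column j (C \<tau>))" for j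
    by (simp add: lincomb_def column_def)
  show "\<forall>j. ((\<lambda>s. F s j) has_vector_derivative (\<Sum>i\<in>UNIV. C \<tau> $ i $ j *\<^sub>R F \<tau> i)) (at \<tau>)"
  proof
    fix j
    show "((\<lambda>s. F s j) has_vector_derivative (\<Sum>i\<in>UNIV. C \<tau> $ i $ j *\<^sub>R F \<tau> i)) (at \<tau>)"
    proof (cases j)
      case (Inl i)
      have "(\<chi> k. column j (C \<tau>) $ Inl k) = column i (S \<tau>)" "(\<chi> k. column j (C \<tau>) $ Inr k) = axis i 1"
        by (auto simp: Inl column_def C[OF \<tau>] cartan_block_def vec_eq_iff mat_def axis_def)
      then show ?thesis using d(1)[of i] unfolding sum lincomb_sum_type[of "F \<tau>"] by (simp add: Inl add.commute)
    next
      case (Inr i)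
      have "(\<chi> k. column j (C \<tau>) $ Inl k) = column i (K \<tau>)" "(\<chi> k. column j (C \<tau>) $ Inr k) = column i (S \<tau>)"
        by (auto simp: Inr column_def C[OF \<tau>] cartan_block_def vec_eq_iff)
      then show ?thesis using d(2)[of i] unfolding sum lincomb_sum_type[of "F \<tau>"] by (simp add: Inr)
    qed
  qed
  show "\<forall>i j. i < j \<longrightarrow> C \<tau> $ Inl i $ Inr i < C \<tau> $ Inl j $ Inr j"
    using df \<tau> by (simp add: C[OF \<tau>] cartan_block_def diagonal_frame_def)
qed

end

section \<open>Reparametrisation and conformal images\<close>

lemma column_linear: "column i (A + B) = column i A + column i B" "column i (r *\<^sub>R A) = r *\<^sub>R column i A"
  "column i (mat 1 :: real^'n^'n) = axis i 1"
  by (auto simp: column_def vec_eq_iff mat_def axis_def)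

lemma lincomb_scale_family: "lincomb (\<lambda>i. r *\<^sub>R b i) c = r *\<^sub>R lincomb b c"
  by (simp add: lincomb_def scaleR_sum_right mult.commute)

text \<open>The factor g = \<open>|\<phi>'|\<^sup>-\<^sup>1\<^sup>/\<^sup>2\<close> solves 2 g' \<open>\<phi>'\<close> + g \<open>\<phi>''\<close> = 0, so that the
  summands with h itself cancel in the derivative of the new h.\<close>

lemma cartan_frame_reparam:
  fixes F :: "real \<Rightarrow> 'n::finite + 'n \<Rightarrow> 'w::euclidean_space"
  assumes \<omega>: "symplectic_form \<omega>" and dim: "DIM('w) = 2 * CARD('n)" and fr: "cartan_frame \<omega> \<Gamma> I F S K"
    and J: "open J" and \<phi>: "smooth_on_line \<phi> J" "\<And>t. t \<in> J \<Longrightarrow> \<phi> t \<in> I"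
    and \<sigma>: "\<sigma> = 1 \<or> \<sigma> = -1" "\<And>t. t \<in> J \<Longrightarrow> \<sigma> * vderiv \<phi> t > 0"
  obtains F' \<rho> where "cartan_frame (\<lambda>u v. \<sigma> * \<omega> u v) (\<Gamma> \<circ> \<phi>) J F' (\<lambda>t. vderiv \<phi> t *\<^sub>R S (\<phi> t))
    (\<lambda>t. (vderiv \<phi> t)\<^sup>2 *\<^sub>R K (\<phi> t) + \<rho> t *\<^sub>R mat 1)"
proof -
  interpret bounded_bilinear \<omega> by (rule symplectic_bilinear[OF \<omega>])
  have nz: "\<sigma> \<noteq> 0" "\<sigma> * \<sigma> = 1" using \<sigma>(1) by auto
  note I = frame_open[OF \<omega> fr]
  let ?d = "vderiv \<phi>"
  have sd: "smooth_on_line ?d J" by (rule smooth_D(2)[OF \<phi>(1)])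
  define g where "g t = (\<sigma> * ?d t) powr (-1/2)" for t
  have sg: "smooth_on_line g J" unfolding g_def
    by (intro smooth_powr J \<sigma>(2) smooth_mult smooth_const sd)
  have g0: "g t > 0" if "t \<in> J" for t using \<sigma>(2)[OF that] unfolding g_def powr_gt_zero by linarith
  \<comment> \<open>The vectors f are scaled by g, and the h-parts by g \<phi>', so the symplectic
    relation for \<sigma> \<omega> requires \<sigma> g^2 \<phi>' = 1. Differentiating this gives
    \<open>geq\<close>.\<close>
  have g2: "\<sigma> * (g t * (g t * ?d t)) = 1" if "t \<in> J" for t
  proof -
    have "x powr (-1/2) * x powr (-1/2) = inverse x" if "x > 0" for x :: real
      unfolding powr_add[symmetric] using that powr_minus[of x 1] by simp
    then have "g t * g t = inverse (\<sigma> * ?d t)" using \<sigma>(2)[OF that] by (simp only: g_def)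
    then have "(g t * g t) * (\<sigma> * ?d t) = 1" using \<sigma>(2)[OF that] by (metis left_inverse less_irrefl)
    then show ?thesis by (simp add: mult_ac)
  qed
  have gd: "(g has_real_derivative vderiv g t) (at t)" if "t \<in> J" for t
    using smooth_D(1)[OF sg that] by (simp add: has_real_derivative_iff_has_vector_derivative)
  have dd: "(?d has_real_derivative vderiv ?d t) (at t)" if "t \<in> J" for t
    using smooth_D(1)[OF sd that] by (simp add: has_real_derivative_iff_has_vector_derivative)
  have geq: "2 * (vderiv g t * ?d t) + g t * vderiv ?d t = 0" if t: "t \<in> J" for t
  proof -
    have "((\<lambda>t. \<sigma> * (g t * (g t * ?d t))) has_real_derivative
        \<sigma> * (vderiv g t * (g t * ?d t) + (vderiv g t * ?d t + vderiv ?d t * g t) * g t)) (at t)"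
      by (intro DERIV_cmult DERIV_mult gd dd t)
    moreover have "((\<lambda>t. \<sigma> * (g t * (g t * ?d t))) has_real_derivative 0) (at t)"
      by (rule has_field_derivative_transform_within_open[OF DERIV_const J t]) (use g2 in auto)
    ultimately have "\<sigma> * (vderiv g t * (g t * ?d t) + (vderiv g t * ?d t + vderiv ?d t * g t) * g t) = 0"
      by (rule DERIV_unique)
    then have "g t * (2 * (vderiv g t * ?d t) + g t * vderiv ?d t) = 0"
      using nz(1) unfolding mult_eq_0_iff[of \<sigma>] by (simp add: algebra_simps)
    then show ?thesis using g0[OF t] by simp
  qed
  \<comment> \<open>This quotient g''/g is minus one half of the Schwarzian derivative of
    \<phi>.\<close>
  define \<rho> where "\<rho> t = vderiv (vderiv g) t * inverse (g t)" for t
  \<comment> \<open>With new f equal to g f(\<phi>), the new h must be what remains of its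
    derivative once the multiple \<phi>' S of the new f is removed.\<close>
  define F' where "F' t x = (case x of Inl i \<Rightarrow> g t *\<^sub>R F (\<phi> t) (Inl i)
      | Inr i \<Rightarrow> (g t * ?d t) *\<^sub>R F (\<phi> t) (Inr i) + vderiv g t *\<^sub>R F (\<phi> t) (Inl i))" for t x
  let ?S = "\<lambda>t. ?d t *\<^sub>R S (\<phi> t)" and ?K = "\<lambda>t. (?d t)\<^sup>2 *\<^sub>R K (\<phi> t) + \<rho> t *\<^sub>R mat 1"
  have sF: "smooth_on_line (\<lambda>t. F (\<phi> t) x) J" for x
    by (rule smooth_compose[OF I J \<phi>(2) frame_smooth(1)[OF \<omega> fr] \<phi>(1)])
  have chain: "((\<lambda>s. F (\<phi> s) x) has_vector_derivative ?d t *\<^sub>R D) (at t)"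
    if "t \<in> J" "((\<lambda>s. F s x) has_vector_derivative D) (at (\<phi> t))" for t x D
    using vector_diff_chain_at[OF smooth_D(1)[OF \<phi>(1) that(1)] that(2)] by (simp add: o_def)
  have "cartan_frame (\<lambda>u v. \<sigma> * \<omega> u v) (\<Gamma> \<circ> \<phi>) J F' ?S ?K"
    unfolding cartan_frame_def
  proof (intro conjI ballI allI J)
    show "smooth_on_line (\<lambda>t. F' t x) J" for x
    proof (cases x)
      case (Inl i)
      then show ?thesis by (simp add: F'_def smooth_scaleR[OF J sg sF])
    next
      case (Inr i)
      show ?thesis unfolding F'_def Inr sum.case
        by (rule smooth_add[OF J smooth_scaleR[OF J smooth_mult[OF J sg sd] sF] smooth_scaleR[OF J smooth_D(2)[OF sg] sF]])
    qed
    show "smooth_on_line ?S J"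
      by (intro smooth_scaleR J sd smooth_compose[OF I J \<phi>(2) frame_smooth(2)[OF \<omega> fr] \<phi>(1)])
    have "smooth_on_line (\<lambda>t. inverse (g t)) J" by (rule smooth_inverse[OF J _ sg]) (use g0 in force)
    then show "smooth_on_line ?K J" unfolding \<rho>_def power2_eq_square
      by (intro smooth_add[OF J] smooth_scaleR[OF J] smooth_mult[OF J] sd smooth_const[OF J] smooth_D(2) sg
          smooth_compose[OF I J \<phi>(2) frame_smooth(3)[OF \<omega> fr] \<phi>(1)])
    fix t assume t: "t \<in> J"
    note sb = symplectic_basisD[OF frame_basis[OF \<omega> fr \<phi>(2)[OF t]]]
    have sb5: "\<omega> (F (\<phi> t) (Inr i)) (F (\<phi> t) (Inl j)) = - (if i = j then 1 else 0)" for i j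
      using symplectic_skew[OF \<omega>, of "F (\<phi> t) (Inr i)" "F (\<phi> t) (Inl j)"] sb(4)[of j i] by auto
    show "symplectic_basis (\<lambda>u v. \<sigma> * \<omega> u v) (F' t)"
    proof (rule symplectic_basisI[OF symplectic_scale[OF \<omega> nz(1)] dim])
      show "\<sigma> * \<omega> (F' t (Inl i)) (F' t (Inl j)) = 0" for i j
        by (simp add: F'_def scaleR_left scaleR_right sb)
      show "\<sigma> * \<omega> (F' t (Inr i)) (F' t (Inr j)) = 0" for i j
        by (simp add: F'_def add_left add_right scaleR_left scaleR_right sb sb5)
      show "\<sigma> * \<omega> (F' t (Inl i)) (F' t (Inr j)) = (if i = j then 1 else 0)" for i j
        using g2[OF t] by (simp add: F'_def add_right scaleR_left scaleR_right sb mult_ac)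
    qed
    show "span (range (\<lambda>i. F' t (Inl i))) = (\<Gamma> \<circ> \<phi>) t"
    proof -
      have "range (lincomb (\<lambda>i. F' t (Inl i))) = range (lincomb (\<lambda>i. F (\<phi> t) (Inl i)))"
      proof (intro equalityI subsetI)
        fix x assume "x \<in> range (lincomb (\<lambda>i. F' t (Inl i)))"
        then show "x \<in> range (lincomb (\<lambda>i. F (\<phi> t) (Inl i)))"
          by (auto simp: F'_def lincomb_scale_family lincomb_linear(3)[symmetric])
      next
        fix x assume "x \<in> range (lincomb (\<lambda>i. F (\<phi> t) (Inl i)))"
        then obtain c where c: "x = lincomb (\<lambda>i. F (\<phi> t) (Inl i)) c" by blast
        have "x = lincomb (\<lambda>i. F' t (Inl i)) (inverse (g t) *\<^sub>R c)"
          using g0[OF t] by (simp add: c F'_def lincomb_scale_family lincomb_linear)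
        then show "x \<in> range (lincomb (\<lambda>i. F' t (Inl i)))" by blast
      qed
      then show ?thesis
        using frame_span[OF \<omega> fr \<phi>(2)[OF t]] unfolding span_range_lincomb by simp
    qed
    fix i
    let ?f = "\<lambda>j. F (\<phi> t) (Inl j)" and ?h = "\<lambda>j. F (\<phi> t) (Inr j)"
    note df = chain[OF t frame_deriv(1)[OF \<omega> fr \<phi>(2)[OF t]]] and dh = chain[OF t frame_deriv(2)[OF \<omega> fr \<phi>(2)[OF t]]]
    have lF: "lincomb (\<lambda>j. F' t (Inl j)) c = g t *\<^sub>R lincomb ?f c" for c
      by (simp add: F'_def lincomb_scale_family)
    have lH: "lincomb (\<lambda>j. F' t (Inr j)) c = (g t * ?d t) *\<^sub>R lincomb ?h c + vderiv g t *\<^sub>R lincomb ?f c" for c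
      by (simp add: F'_def lincomb_add_family lincomb_scale_family)
    have "((\<lambda>s. g s *\<^sub>R F (\<phi> s) (Inl i)) has_vector_derivative
        g t *\<^sub>R (?d t *\<^sub>R (?h i + lincomb ?f (column i (S (\<phi> t))))) + vderiv g t *\<^sub>R ?f i) (at t)"
      by (intro has_vector_derivative_scaleR gd t df)
    then show "((\<lambda>s. F' s (Inl i)) has_vector_derivative
        F' t (Inr i) + lincomb (\<lambda>j. F' t (Inl j)) (column i (?S t))) (at t)"
      unfolding lF by (simp add: F'_def column_linear lincomb_linear scaleR_add_right ac_simps)
    have gdd: "((\<lambda>s. g s * ?d s) has_real_derivative g t * vderiv ?d t + vderiv g t * ?d t) (at t)"
      using DERIV_mult[OF gd[OF t] dd[OF t]] by (simp add: ac_simps)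
    have gdv: "(vderiv g has_real_derivative vderiv (vderiv g) t) (at t)"
      using smooth_D(1)[OF smooth_D(2)[OF sg] t] by (simp add: has_real_derivative_iff_has_vector_derivative)
    have "((\<lambda>s. (g s * ?d s) *\<^sub>R F (\<phi> s) (Inr i) + vderiv g s *\<^sub>R F (\<phi> s) (Inl i)) has_vector_derivative
       ((g t * ?d t) *\<^sub>R (?d t *\<^sub>R (lincomb ?f (column i (K (\<phi> t))) + lincomb ?h (column i (S (\<phi> t)))))
          + (g t * vderiv ?d t + vderiv g t * ?d t) *\<^sub>R ?h i) +
       (vderiv g t *\<^sub>R (?d t *\<^sub>R (?h i + lincomb ?f (column i (S (\<phi> t))))) + vderiv (vderiv g) t *\<^sub>R ?f i)) (at t)"
      (is "(_ has_vector_derivative ?D) _")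
      by (intro has_vector_derivative_add has_vector_derivative_scaleR gdd gdv df dh)
    moreover have "?D = lincomb (\<lambda>j. F' t (Inl j)) (column i (?K t)) + lincomb (\<lambda>j. F' t (Inr j)) (column i (?S t))"
    proof -
      have 1: "(g t * vderiv ?d t + vderiv g t * ?d t) *\<^sub>R ?h i + (vderiv g t * ?d t) *\<^sub>R ?h i = 0"
        unfolding scaleR_add_left[symmetric] using geq[OF t] by (simp add: algebra_simps)
      have 2: "g t * \<rho> t = vderiv (vderiv g) t" using g0[OF t] by (simp add: \<rho>_def)
      have "?D = (g t * (?d t)\<^sup>2) *\<^sub>R lincomb ?f (column i (K (\<phi> t))) + (g t * (?d t)\<^sup>2) *\<^sub>R lincomb ?h (column i (S (\<phi> t)))
         + (vderiv g t * ?d t) *\<^sub>R lincomb ?f (column i (S (\<phi> t))) + vderiv (vderiv g) t *\<^sub>R ?f i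
         + ((g t * vderiv ?d t + vderiv g t * ?d t) *\<^sub>R ?h i + (vderiv g t * ?d t) *\<^sub>R ?h i)"
        by (simp add: scaleR_add_right power2_eq_square algebra_simps)
      also have "\<dots> = lincomb (\<lambda>j. F' t (Inl j)) (column i (?K t)) + lincomb (\<lambda>j. F' t (Inr j)) (column i (?S t))"
        unfolding 1 lF lH column_linear lincomb_linear lincomb_axis 2[symmetric]
        by (simp add: scaleR_add_right power2_eq_square algebra_simps)
      finally show ?thesis .
    qed
    ultimately show "((\<lambda>s. F' s (Inr i)) has_vector_derivative
        lincomb (\<lambda>j. F' t (Inl j)) (column i (?K t)) + lincomb (\<lambda>j. F' t (Inr j)) (column i (?S t))) (at t)"
      by (simp add: F'_def)
  qed
  then show ?thesis by (rule that)
qed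

text \<open>A conformal map multiplies pairings by l. Dividing the frame by sqrt |l| removes the
  modulus, and the sign of l passes into the form; S and K are untouched because the map is
  constant.\<close>

lemma cartan_frame_image:
  fixes F :: "real \<Rightarrow> 'n::finite + 'n \<Rightarrow> 'w::euclidean_space"
  assumes \<omega>: "symplectic_form \<omega>" and dim: "DIM('w) = 2 * CARD('n)"
    and \<sigma>: "\<sigma> = 1 \<or> \<sigma> = -1" and fr: "cartan_frame (\<lambda>u v. \<sigma> * \<omega> u v) \<Gamma> I F S K"
    and a: "linear a" and l: "l \<noteq> 0" "\<And>u v. \<omega> (a u) (a v) = l * \<omega> u v"
    and \<Gamma>': "\<And>t. t \<in> I \<Longrightarrow> \<Gamma>' t = a ` \<Gamma> t"
  shows "cartan_frame (\<lambda>u v. \<sigma> * sgn l * \<omega> u v) \<Gamma>' I (\<lambda>t x. (1 / sqrt \<bar>l\<bar>) *\<^sub>R a (F t x)) S K"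
proof -
  interpret bounded_bilinear \<omega> by (rule symplectic_bilinear[OF \<omega>])
  have nz: "\<sigma> \<noteq> 0" "\<sigma> * sgn l \<noteq> 0" using \<sigma> l by (auto simp: sgn_if)
  note w = symplectic_scale[OF \<omega> nz(1)]
  let ?r = "1 / sqrt \<bar>l\<bar>" and ?b = "\<lambda>v. (1 / sqrt \<bar>l\<bar>) *\<^sub>R a v"
  have r0: "?r > 0" using l by simp
  have lb: "linear ?b" using a by (intro linear_compose_scale_right)
  then have blb: "bounded_linear ?b" by (simp add: linear_conv_bounded_linear)
  have wb: "\<sigma> * sgn l * \<omega> (?b u) (?b v) = \<sigma> * \<omega> u v" for u v
  proof -
    have r: "sgn l * (?r * (?r * l)) = 1" using l(1) by (auto simp: sgn_if field_simps)
    have "\<sigma> * sgn l * \<omega> (?b u) (?b v) = \<sigma> * sgn l * (?r * (?r * (l * \<omega> u v)))"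
      by (simp only: scaleR_left scaleR_right l(2) real_scaleR_def)
    also have "\<dots> = \<sigma> * (sgn l * (?r * (?r * l))) * \<omega> u v" by (simp only: mult.assoc)
    finally show ?thesis by (simp only: r mult_1_right)
  qed
  have li: "lincomb (\<lambda>i. ?b (v i)) c = ?b (lincomb v c)" for v :: "'n \<Rightarrow> 'w" and c
    using lincomb_image[OF lb, of v c] by simp
  show ?thesis unfolding cartan_frame_def
  proof (intro conjI ballI allI frame_open[OF w fr] frame_smooth(2,3)[OF w fr])
    show "smooth_on_line (\<lambda>t. ?b (F t x)) I" for x
      by (rule smooth_linear[OF blb frame_open[OF w fr] frame_smooth(1)[OF w fr]])
    fix t assume t: "t \<in> I"
    note sb = symplectic_basisD[OF frame_basis[OF w fr t]]
    show "symplectic_basis (\<lambda>u v. \<sigma> * sgn l * \<omega> u v) (\<lambda>x. ?b (F t x))"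
      by (rule symplectic_basisI[OF symplectic_scale[OF \<omega> nz(2)] dim]) (simp_all only: wb sb)
    show "span (range (\<lambda>i. ?b (F t (Inl i)))) = \<Gamma>' t"
    proof -
      have "\<Gamma>' t = range (\<lambda>c. a (lincomb (\<lambda>i. F t (Inl i)) c))"
        unfolding \<Gamma>'[OF t] frame_span[OF w fr t, symmetric] span_range_lincomb by auto
      also have "\<dots> = range (\<lambda>c. ?b (lincomb (\<lambda>i. F t (Inl i)) c))"
      proof (intro equalityI subsetI)
        fix x assume "x \<in> range (\<lambda>c. a (lincomb (\<lambda>i. F t (Inl i)) c))"
        then obtain c where c: "x = a (lincomb (\<lambda>i. F t (Inl i)) c)" by blast
        have "x = ?b (lincomb (\<lambda>i. F t (Inl i)) (inverse ?r *\<^sub>R c))"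
          using r0 by (simp add: c lincomb_linear linear_scale[OF a])
        then show "x \<in> range (\<lambda>c. ?b (lincomb (\<lambda>i. F t (Inl i)) c))" by blast
      next
        fix x assume "x \<in> range (\<lambda>c. ?b (lincomb (\<lambda>i. F t (Inl i)) c))"
        then obtain c where c: "x = ?b (lincomb (\<lambda>i. F t (Inl i)) c)" by blast
        have "x = a (lincomb (\<lambda>i. F t (Inl i)) (?r *\<^sub>R c))" by (simp add: c lincomb_linear linear_scale[OF a])
        then show "x \<in> range (\<lambda>c. a (lincomb (\<lambda>i. F t (Inl i)) c))" by blast
      qed
      finally show ?thesis unfolding span_range_lincomb li by simp
    qed
    fix i
    have e: "?b (x + y) = ?b x + ?b y" for x y using linear_add[OF lb] by simp
    show "((\<lambda>s. ?b (F s (Inl i))) has_vector_derivative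
        ?b (F t (Inr i)) + lincomb (\<lambda>j. ?b (F t (Inl j))) (column i (S t))) (at t)"
      unfolding li e[symmetric] by (rule bounded_linear.has_vector_derivative[OF blb frame_deriv(1)[OF w fr t]])
    show "((\<lambda>s. ?b (F s (Inr i))) has_vector_derivative
        lincomb (\<lambda>j. ?b (F t (Inl j))) (column i (K t)) + lincomb (\<lambda>j. ?b (F t (Inr j))) (column i (S t))) (at t)"
      unfolding li e[symmetric] by (rule bounded_linear.has_vector_derivative[OF blb frame_deriv(2)[OF w fr t]])
  qed
qed


section \<open>Normal frames\<close>

text \<open>Near t0 the curve consists of graphs over \<Gamma> t0 with values in D. A basis lifted
  to these graphs is smooth by the definition of the charts, and a relation among the lifts would
  give a vector common to \<Gamma> t0 and D.\<close>

lemma smooth_curve_local_frame: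
  fixes \<omega> :: "'w::euclidean_space \<Rightarrow> 'w \<Rightarrow> real"
  assumes dim: "DIM('w) = 2 * CARD('n::finite)"
    and sm: "smooth_lagrangian_curve \<omega> \<Gamma> I" and t0: "t0 \<in> I"
  obtains e and f :: "real \<Rightarrow> 'n::finite \<Rightarrow> 'w" where "e > 0" "ball t0 e \<subseteq> I"
    "\<And>i. smooth_on_line (\<lambda>t. f t i) (ball t0 e)" "\<And>t. t \<in> ball t0 e \<Longrightarrow> basis_of (f t) (\<Gamma> t)"
proof -
  have lag: "\<And>t. t \<in> I \<Longrightarrow> lagrangian \<omega> (\<Gamma> t)" using sm by (simp add: smooth_lagrangian_curve_def)
  obtain D e where e: "e > 0" "ball t0 e \<subseteq> I" and D: "lagrangian \<omega> D"
    and tr: "\<And>t. t \<in> ball t0 e \<Longrightarrow> \<Gamma> t \<inter> D = {0}"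
    and sg: "\<And>u. u \<in> \<Gamma> t0 \<Longrightarrow> smooth_on_line (\<lambda>t. graph_map (\<Gamma> t0) D (\<Gamma> t) u) (ball t0 e)"
    using sm t0 unfolding smooth_lagrangian_curve_def transverse_def by metis
  have subD: "subspace D" using D by (simp add: lagrangian_def)
  have sub: "subspace (\<Gamma> t)" and dimG: "dim (\<Gamma> t) = CARD('n)" if "t \<in> I" for t
    using lag[OF that] dim by (auto simp: lagrangian_def)
  have dimD: "dim D = CARD('n)" using D dim by (simp add: lagrangian_def)
  obtain u :: "'n \<Rightarrow> 'w" where u: "basis_of u (\<Gamma> t0)" using basis_of_exists[OF sub[OF t0] dimG[OF t0]] .
  define f where "f t i = u i + graph_map (\<Gamma> t0) D (\<Gamma> t) (u i)" for t i
  have gm: "graph_map (\<Gamma> t0) D (\<Gamma> t) x \<in> D \<and> x + graph_map (\<Gamma> t0) D (\<Gamma> t) x \<in> \<Gamma> t"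
    if t: "t \<in> ball t0 e" for t x
  proof -
    have tI: "t \<in> I" using e(2) t by blast
    obtain a b where ab: "a \<in> \<Gamma> t" "b \<in> D" "x = a + b"
      using transverse_decomposition[OF sub[OF tI] subD _ tr[OF t], of x] dimG[OF tI] dimD dim by auto
    have "graph_map (\<Gamma> t0) D (\<Gamma> t) x = - b"
      by (rule graph_map_eqI[OF subD sub[OF tI] tr[OF t]]) (use ab subspace_neg[OF subD] in auto)
    then show ?thesis using ab subspace_neg[OF subD] by simp
  qed
  show ?thesis
  proof (rule that[OF e])
    show "smooth_on_line (\<lambda>t. f t i) (ball t0 e)" for i
      unfolding f_def by (intro smooth_add smooth_const sg basis_of_in(1)[OF u]) auto
    fix t assume t: "t \<in> ball t0 e"
    have tI: "t \<in> I" using e(2) t by blast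
    show "basis_of (f t) (\<Gamma> t)"
    proof (rule basis_ofI)
      fix c assume c: "lincomb (f t) c = 0"
      have "lincomb (f t) c = lincomb u c + lincomb (\<lambda>i. graph_map (\<Gamma> t0) D (\<Gamma> t) (u i)) c"
        unfolding lincomb_add_family[symmetric] f_def by simp
      then have "lincomb u c = - lincomb (\<lambda>i. graph_map (\<Gamma> t0) D (\<Gamma> t) (u i)) c"
        using c by (simp add: eq_neg_iff_add_eq_0)
      moreover have "lincomb (\<lambda>i. graph_map (\<Gamma> t0) D (\<Gamma> t) (u i)) c \<in> D"
        unfolding lincomb_def by (intro subspace_sum subD subspace_scale) (use gm[OF t] in blast)
      ultimately have "lincomb u c \<in> D" using subspace_neg[OF subD] by simp
      moreover have "lincomb u c \<in> \<Gamma> t0" by (rule basis_of_in(2)[OF u])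
      ultimately have "lincomb u c = 0" using tr[of t0] e(1) by auto
      then show "c = 0" by (rule basis_of_lincomb_zero[OF u])
    next
      show "f t i \<in> \<Gamma> t" for i using gm[OF t] by (simp add: f_def)
    qed (use sub[OF tI] dimG[OF tI] in auto)
  qed
qed

definition local_section :: "(real \<Rightarrow> 'w::real_normed_vector set) \<Rightarrow> real \<Rightarrow> (real \<Rightarrow> 'w) \<Rightarrow> bool" where
  "local_section \<Gamma> t v \<longleftrightarrow> (\<exists>d>0. smooth_on_line v (ball t d) \<and> (\<forall>s\<in>ball t d. v s \<in> \<Gamma> s))"

text \<open>The analogue of the vertical endomorphism of a second order differential equation. Its
  derivative is the reflection with eigenspaces \<open>\<Gamma> t\<close> (for -1) and the derivative curve (for 1).\<close>

definition vertical_endo :: "(real \<Rightarrow> 'w::real_normed_vector set) \<Rightarrow> real \<Rightarrow> ('w \<Rightarrow>\<^sub>L 'w) \<Rightarrow> bool" where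
  "vertical_endo \<Gamma> t T \<longleftrightarrow> (\<forall>u\<in>\<Gamma> t. T u = 0) \<and> (\<forall>v. local_section \<Gamma> t v \<longrightarrow> T (vderiv v t) = v t)"

lemma bounded_linear_Blinfun_of_bilinear:
  fixes b :: "'a::euclidean_space \<Rightarrow> 'b::real_normed_vector \<Rightarrow> 'c::real_normed_vector"
  assumes "bounded_bilinear b"
  shows "bounded_linear (\<lambda>x. Blinfun (b x))" "blinfun_apply (Blinfun (b x)) = b x"
proof -
  interpret bounded_bilinear b by (rule assms)
  show ap: "blinfun_apply (Blinfun (b x)) = b x" for x
    by (rule bounded_linear_Blinfun_apply[OF bounded_linear_right])
  have "linear (\<lambda>x. Blinfun (b x))"
    by (rule linearI; rule blinfun_eqI) (simp_all add: ap blinfun.bilinear_simps add_left scaleR_left)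
  then show "bounded_linear (\<lambda>x. Blinfun (b x))" by (simp add: linear_conv_bounded_linear)
qed

section \<open>The vertical endomorphism of a curve with definite velocity\<close>

context
  fixes \<omega> :: "'w::euclidean_space \<Rightarrow> 'w \<Rightarrow> real" and \<Gamma> :: "real \<Rightarrow> 'w set" and I :: "real set"
  assumes \<omega>: "symplectic_form \<omega>" and dim: "DIM('w) = 2 * CARD('n::finite)"
    and sm: "smooth_lagrangian_curve \<omega> \<Gamma> I"
    and definite: "\<forall>t\<in>I. positive_definite_on (\<Gamma> t) (velocity_form \<omega> \<Gamma> t) \<or>
             negative_definite_on (\<Gamma> t) (velocity_form \<omega> \<Gamma> t)"
begin

lemma curve_lagrangian: "t \<in> I \<Longrightarrow> lagrangian \<omega> (\<Gamma> t)"
  using sm by (simp add: smooth_lagrangian_curve_def)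

text \<open>Differentiate \<omega> (v s) (w s) = 0. This is the symmetry of the bilinear form behind
  the velocity form.\<close>

lemma section_pairing:
  assumes t: "t \<in> I" and v: "local_section \<Gamma> t v" "local_section \<Gamma> t w" and I: "open I"
  shows "\<omega> (w t) (vderiv v t) = \<omega> (v t) (vderiv w t)"
proof -
  interpret bounded_bilinear \<omega> by (rule symplectic_bilinear[OF \<omega>])
  obtain d where d: "d > 0" "smooth_on_line v (ball t d)" "\<forall>s\<in>ball t d. v s \<in> \<Gamma> s"
    using v(1) by (auto simp: local_section_def)
  obtain d' where d': "d' > 0" "smooth_on_line w (ball t d')" "\<forall>s\<in>ball t d'. w s \<in> \<Gamma> s"
    using v(2) by (auto simp: local_section_def)
  have "((\<lambda>s. \<omega> (v s) (w s)) has_vector_derivative \<omega> (v t) (vderiv w t) + \<omega> (vderiv v t) (w t)) (at t)"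
    by (intro has_vector_derivative smooth_D(1)[OF d(2)] smooth_D(1)[OF d'(2)]) (use d(1) d'(1) in auto)
  moreover have "((\<lambda>s. \<omega> (v s) (w s)) has_vector_derivative 0) (at t)"
  proof (rule has_vector_derivative_transform_within_open[OF has_vector_derivative_const])
    show "open (ball t d \<inter> ball t d' \<inter> I)" using I by auto
    show "t \<in> ball t d \<inter> ball t d' \<inter> I" using d d' t by auto
    show "0 = \<omega> (v s) (w s)" if "s \<in> ball t d \<inter> ball t d' \<inter> I" for s
      using that d(3) d'(3) curve_lagrangian[of s] by (auto simp: lagrangian_def)
  qed
  ultimately have "\<omega> (v t) (vderiv w t) + \<omega> (vderiv v t) (w t) = 0" by (rule vector_derivative_unique_at)
  then show ?thesis using symplectic_skew[OF \<omega>, of "w t"] by simp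
qed

text \<open>G is the Gram matrix of the velocity form in a local frame f. A kernel vector of G would
  be a nonzero vector on which the velocity form vanishes, and definiteness excludes it.\<close>

lemma gram_frame:
  assumes I: "open I" and t0: "t0 \<in> I"
  obtains e and f :: "real \<Rightarrow> 'n \<Rightarrow> 'w" and G :: "real \<Rightarrow> real^'n^'n" where "e > 0" "ball t0 e \<subseteq> I"
    "\<And>i. smooth_on_line (\<lambda>t. f t i) (ball t0 e)" "\<And>t. t \<in> ball t0 e \<Longrightarrow> basis_of (f t) (\<Gamma> t)"
    "\<And>t i j. G t $ i $ j = \<omega> (f t i) (vderiv (\<lambda>s. f s j) t)"
    "\<And>t c. t \<in> ball t0 e \<Longrightarrow> local_section \<Gamma> t (\<lambda>s. lincomb (f s) c)"
    "\<And>t c. t \<in> ball t0 e \<Longrightarrow> vderiv (\<lambda>s. lincomb (f s) c) t = lincomb (\<lambda>j. vderiv (\<lambda>s. f s j) t) c"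
    "\<And>t i j. t \<in> ball t0 e \<Longrightarrow> G t $ i $ j = G t $ j $ i"
    "\<And>t c. t \<in> ball t0 e \<Longrightarrow> velocity_form \<omega> \<Gamma> t (lincomb (f t) c) = c \<bullet> (G t *v c)"
    "\<And>t. t \<in> ball t0 e \<Longrightarrow> det (G t) \<noteq> 0" "smooth_on_line G (ball t0 e)"
proof -
  note bil = bilinear_lincomb[OF symplectic_bilinear[OF \<omega>]]
  obtain e and f :: "real \<Rightarrow> 'n \<Rightarrow> 'w" where e: "e > 0" "ball t0 e \<subseteq> I"
    and sf: "\<And>i. smooth_on_line (\<lambda>t. f t i) (ball t0 e)" and bf: "\<And>t. t \<in> ball t0 e \<Longrightarrow> basis_of (f t) (\<Gamma> t)"
    using smooth_curve_local_frame[OF dim sm t0] by metis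
  define G :: "real \<Rightarrow> real^'n^'n" where "G t = (\<chi> i j. \<omega> (f t i) (vderiv (\<lambda>s. f s j) t))" for t
  have G: "G t $ i $ j = \<omega> (f t i) (vderiv (\<lambda>s. f s j) t)" for t i j by (simp add: G_def)
  have sub_ball: "\<exists>d>0. ball t d \<subseteq> ball t0 e" if "t \<in> ball t0 e" for t
    using open_ball that open_contains_ball by metis
  have sec: "local_section \<Gamma> t (\<lambda>s. lincomb (f s) c)" if t: "t \<in> ball t0 e" for t c
  proof -
    obtain d where d: "d > 0" "ball t d \<subseteq> ball t0 e" using sub_ball[OF t] by blast
    have "smooth_on_line (\<lambda>s. lincomb (f s) c) (ball t d)"
      by (intro smooth_lincomb smooth_const open_ball smooth_subset[OF sf d(2)])
    moreover have "\<forall>s\<in>ball t d. lincomb (f s) c \<in> \<Gamma> s" using basis_of_in(2)[OF bf] d(2) by blast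
    ultimately show ?thesis using d(1) by (auto simp: local_section_def)
  qed
  have dl: "vderiv (\<lambda>s. lincomb (f s) c) t = lincomb (\<lambda>j. vderiv (\<lambda>s. f s j) t) c" if t: "t \<in> ball t0 e" for t c
    using vderiv_eqI[OF has_vector_derivative_lincomb[OF smooth_D(1)[OF sf t] has_vector_derivative_const]]
    by (simp add: lincomb_linear)
  have sec1: "local_section \<Gamma> t (\<lambda>s. f s i)" if t: "t \<in> ball t0 e" for t i
    using sec[OF t, of "axis i 1"] by simp
  have sym: "G t $ i $ j = G t $ j $ i" if t: "t \<in> ball t0 e" for t i j
    unfolding G using section_pairing[OF _ sec1[OF t] sec1[OF t] I] e(2) t by blast
  have vel: "velocity_form \<omega> \<Gamma> t (lincomb (f t) c) = c \<bullet> (G t *v c)" if t: "t \<in> ball t0 e" for t c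
  proof -
    obtain d where d: "d > 0" "ball t d \<subseteq> ball t0 e" using sub_ball[OF t] by blast
    have "velocity_form \<omega> \<Gamma> t (lincomb (f t) c) =
      (\<Sum>j\<in>UNIV. c $ j * \<omega> (lincomb (f t) c) (vderiv (\<lambda>s. f s j) t))"
    proof (rule velocity_form_frame[OF \<omega> d(1)])
      show "smooth_on_line (\<lambda>t. f t i) (ball t d)" for i by (rule smooth_subset[OF sf d(2)])
      show "\<omega> u v = 0" if "s \<in> ball t d" "u \<in> \<Gamma> s" "v \<in> \<Gamma> s" for s u v
      proof -
        have "s \<in> I" using that(1) d(2) e(2) by blast
        then show ?thesis using curve_lagrangian that(2,3) by (simp add: lagrangian_def)
      qed
      show "span (range (f s)) = \<Gamma> s" if "s \<in> ball t d" for s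
        using bf[of s] that d(2) by (auto simp: basis_of_def)
    qed
    also have "\<dots> = (\<Sum>j\<in>UNIV. c $ j * (\<Sum>i\<in>UNIV. c $ i * G t $ j $ i))"
      by (simp add: bil G[symmetric] sym[OF t])
    finally show ?thesis by (simp add: inner_vec_def matrix_vector_mult_def mult.commute)
  qed
  have det: "det (G t) \<noteq> 0" if t: "t \<in> ball t0 e" for t
    unfolding det_nonzero_iff_kernel
  proof (intro allI impI, rule ccontr)
    fix c assume c: "G t *v c = 0" "c \<noteq> 0"
    have "lincomb (f t) c \<noteq> 0" using basis_of_lincomb_zero[OF bf[OF t]] c(2) by blast
    moreover have "lincomb (f t) c \<in> \<Gamma> t" by (rule basis_of_in(2)[OF bf[OF t]])
    moreover have "velocity_form \<omega> \<Gamma> t (lincomb (f t) c) = 0" using vel[OF t] c(1) by simp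
    ultimately show False
      using definite t e(2) unfolding positive_definite_on_def negative_definite_on_def by (metis less_irrefl subsetD)
  qed
  have sG: "smooth_on_line G (ball t0 e)" unfolding G_def
    by (intro smooth_vec_lambda smooth_bilinear[OF symplectic_bilinear[OF \<omega>]] open_ball sf smooth_D(2))
  show ?thesis by (rule that[OF e sf bf G sec dl sym vel det sG])
qed

text \<open>T w is the element f a of \<Gamma> with G a equal to the vector of pairings \<omega> (f
  j) w. For w in \<Gamma> these pairings vanish; for the velocity of a section v,
  \<open>section_pairing\<close> identifies a with the coordinates of v.\<close>

lemma vertical_endo_local:
  assumes I: "open I" and t0: "t0 \<in> I"
  obtains e T where "e > 0" "ball t0 e \<subseteq> I" "smooth_on_line T (ball t0 e)"
    "\<And>t. t \<in> ball t0 e \<Longrightarrow> vertical_endo \<Gamma> t (T t)"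
proof -
  interpret bounded_bilinear \<omega> by (rule symplectic_bilinear[OF \<omega>])
  note bil = bilinear_lincomb[OF symplectic_bilinear[OF \<omega>]]
  obtain e and f :: "real \<Rightarrow> 'n \<Rightarrow> 'w" and G :: "real \<Rightarrow> real^'n^'n" where e: "e > 0" "ball t0 e \<subseteq> I"
    and sf: "\<And>i. smooth_on_line (\<lambda>t. f t i) (ball t0 e)" and bf: "\<And>t. t \<in> ball t0 e \<Longrightarrow> basis_of (f t) (\<Gamma> t)"
    and G: "\<And>t i j. G t $ i $ j = \<omega> (f t i) (vderiv (\<lambda>s. f s j) t)"
    and sec: "\<And>t c. t \<in> ball t0 e \<Longrightarrow> local_section \<Gamma> t (\<lambda>s. lincomb (f s) c)"
    and dl: "\<And>t c. t \<in> ball t0 e \<Longrightarrow> vderiv (\<lambda>s. lincomb (f s) c) t = lincomb (\<lambda>j. vderiv (\<lambda>s. f s j) t) c"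
    and sym: "\<And>t i j. t \<in> ball t0 e \<Longrightarrow> G t $ i $ j = G t $ j $ i"
    and vel: "\<And>t c. t \<in> ball t0 e \<Longrightarrow> velocity_form \<omega> \<Gamma> t (lincomb (f t) c) = c \<bullet> (G t *v c)"
    and det: "\<And>t. t \<in> ball t0 e \<Longrightarrow> det (G t) \<noteq> 0" and sG: "smooth_on_line G (ball t0 e)"
    by (rule gram_frame[OF I t0], rule that)
  have "\<exists>c. smooth_on_line c (ball t0 e) \<and> (\<forall>t\<in>ball t0 e. G t *v c t = (\<chi> j. \<omega> (f t j) b))" for b
  proof -
    have "smooth_on_line (\<lambda>t. \<chi> j. \<omega> (f t j) b) (ball t0 e)"
      by (intro smooth_vec_lambda smooth_linear[OF bounded_linear_left] open_ball sf)
    from smooth_linear_solve[OF open_ball sG this det] show ?thesis by metis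
  qed
  then obtain c where sc: "\<And>b. smooth_on_line (c b) (ball t0 e)"
    and c: "\<And>b t. t \<in> ball t0 e \<Longrightarrow> G t *v c b t = (\<chi> j. \<omega> (f t j) b)" by metis
  have bb: "bounded_bilinear (\<lambda>(x::'w) w. (w \<bullet> b) *\<^sub>R x)" for b :: 'w
    unfolding bilinear_conv_bounded_bilinear[symmetric] bilinear_def
    by (auto intro!: linearI simp: algebra_simps inner_add_left)
  \<comment> \<open>The system is solved smoothly for each fixed basis vector b of W and the
    solutions are assembled linearly; this makes T smooth as a curve of operators.\<close>
  define T :: "real \<Rightarrow> 'w \<Rightarrow>\<^sub>L 'w" where
    "T t = (\<Sum>b\<in>Basis. Blinfun (\<lambda>w. (w \<bullet> b) *\<^sub>R lincomb (f t) (c b t)))" for t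
  have sT: "smooth_on_line T (ball t0 e)" unfolding T_def
    by (intro smooth_sum open_ball smooth_linear[OF bounded_linear_Blinfun_of_bilinear(1)[OF bb]] smooth_lincomb sf sc)
  have Tw: "T t w = lincomb (f t) a" if t: "t \<in> ball t0 e" and a: "G t *v a = (\<chi> j. \<omega> (f t j) w)" for t w a
  proof -
    let ?a = "\<Sum>b\<in>Basis. (w \<bullet> b) *\<^sub>R c b t"
    have "linear (\<lambda>c. lincomb (f t) c)" by (rule linearI) (simp_all add: lincomb_linear)
    then have "T t w = lincomb (f t) ?a"
      by (simp add: T_def blinfun.sum_left bounded_linear_Blinfun_of_bilinear(2)[OF bb] linear_sum lincomb_linear)
    moreover have "G t *v ?a = (\<chi> j. \<omega> (f t j) w)"
    proof -
      have "G t *v ?a = (\<Sum>b\<in>Basis. (w \<bullet> b) *\<^sub>R (\<chi> j. \<omega> (f t j) b))"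
        by (simp add: linear_sum[OF matrix_vector_mul_linear] matrix_vector_mult_scaleR c[OF t])
      also have "\<dots> = (\<chi> j. \<omega> (f t j) (\<Sum>b\<in>Basis. (w \<bullet> b) *\<^sub>R b))"
        by (simp add: vec_eq_iff sum_right scaleR_right)
      finally show ?thesis by (simp add: euclidean_representation)
    qed
    then have "G t *v (?a - a) = 0" using a by (simp add: matrix_vector_mult_diff_distrib)
    then have "?a = a" using det[OF t] unfolding det_nonzero_iff_kernel by auto
    ultimately show ?thesis by simp
  qed
  have "vertical_endo \<Gamma> t (T t)" if t: "t \<in> ball t0 e" for t
    unfolding vertical_endo_def
  proof (intro conjI ballI allI impI)
    have tI: "t \<in> I" using e(2) t by blast
    show "T t u = 0" if "u \<in> \<Gamma> t" for u
    proof -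
      have "\<omega> (f t j) u = 0" for j
        using curve_lagrangian[OF tI] basis_of_in(1)[OF bf[OF t]] that by (auto simp: lagrangian_def)
      then have "G t *v 0 = (\<chi> j. \<omega> (f t j) u)" by (simp add: vec_eq_iff)
      from Tw[OF t this] show ?thesis by (simp add: lincomb_linear)
    qed
    fix v assume v: "local_section \<Gamma> t v"
    then have "v t \<in> \<Gamma> t" by (auto simp: local_section_def)
    then obtain a where a: "v t = lincomb (f t) a" using basis_of_coords[OF bf[OF t]] by blast
    have "G t *v a = (\<chi> j. \<omega> (f t j) (vderiv v t))"
    proof -
      have "\<omega> (f t j) (vderiv v t) = \<omega> (v t) (vderiv (\<lambda>s. f s j) t)" for j
        using section_pairing[OF tI v sec[OF t, of "axis j 1"] I] by simp
      then show ?thesis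
        by (simp add: vec_eq_iff a bil matrix_vector_mult_def G[symmetric] sym[OF t] mult.commute)
    qed
    from Tw[OF t this] show "T t (vderiv v t) = v t" using a by simp
  qed
  then show ?thesis using that[OF e sT] by blast
qed

text \<open>Choosing a with G a equal to the pairings of w makes w - v' orthogonal to \<Gamma> under
  \<omega>, hence an element of \<Gamma>. The section v has constant coordinates in a frame, so v t
  = 0 makes it vanish identically near t; this clause identifies the kernel of the vertical
  endomorphism with \<Gamma>.\<close>

lemma velocity_decomposition:
  assumes I: "open I" and t: "t \<in> I"
  obtains u v where "u \<in> \<Gamma> t" "local_section \<Gamma> t v" "w = u + vderiv v t" "v t = 0 \<Longrightarrow> vderiv v t = 0"
proof -
  interpret bounded_bilinear \<omega> by (rule symplectic_bilinear[OF \<omega>])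
  note bil = bilinear_lincomb[OF symplectic_bilinear[OF \<omega>]]
  obtain e and f :: "real \<Rightarrow> 'n \<Rightarrow> 'w" and G :: "real \<Rightarrow> real^'n^'n" where e: "e > 0" "ball t e \<subseteq> I"
    and "\<And>i. smooth_on_line (\<lambda>t. f t i) (ball t e)" and bf: "\<And>s. s \<in> ball t e \<Longrightarrow> basis_of (f s) (\<Gamma> s)"
    and G: "\<And>t i j. G t $ i $ j = \<omega> (f t i) (vderiv (\<lambda>s. f s j) t)"
    and sec: "\<And>s c. s \<in> ball t e \<Longrightarrow> local_section \<Gamma> s (\<lambda>s. lincomb (f s) c)"
    and dl: "\<And>s c. s \<in> ball t e \<Longrightarrow> vderiv (\<lambda>s. lincomb (f s) c) s = lincomb (\<lambda>j. vderiv (\<lambda>s. f s j) s) c"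
    and "\<And>s i j. s \<in> ball t e \<Longrightarrow> G s $ i $ j = G s $ j $ i"
    and "\<And>s c. s \<in> ball t e \<Longrightarrow> velocity_form \<omega> \<Gamma> s (lincomb (f s) c) = c \<bullet> (G s *v c)"
    and det: "\<And>s. s \<in> ball t e \<Longrightarrow> det (G s) \<noteq> 0" and "smooth_on_line G (ball t e)"
    by (rule gram_frame[OF I t], rule that)
  have tb: "t \<in> ball t e" using e by simp
  obtain a where a: "G t *v a = (\<chi> j. \<omega> (f t j) w)"
    using cramer[OF det[OF tb]] by blast
  let ?v = "\<lambda>s. lincomb (f s) a"
  have "w - vderiv ?v t \<in> \<Gamma> t"
  proof (rule lagrangian_maximal[OF \<omega> curve_lagrangian[OF t]])
    fix d assume "d \<in> \<Gamma> t"
    then obtain b where b: "d = lincomb (f t) b" using basis_of_coords[OF bf[OF tb]] by blast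
    have "\<omega> (f t j) (w - vderiv ?v t) = 0" for j
    proof -
      have "\<omega> (f t j) (vderiv ?v t) = (G t *v a) $ j"
        by (simp add: dl[OF tb] bil matrix_vector_mult_def G mult.commute)
      then show ?thesis using a by (simp add: diff_right)
    qed
    then have "\<omega> d (w - vderiv ?v t) = 0" by (simp add: b bil)
    then show "\<omega> (w - vderiv ?v t) d = 0" using symplectic_skew[OF \<omega>, of d] by simp
  qed
  moreover have "vderiv ?v t = 0" if "?v t = 0"
  proof -
    have "a = 0" using basis_of_lincomb_zero[OF bf[OF tb] that] .
    then show ?thesis using dl[OF tb, of a] by (simp add: lincomb_linear)
  qed
  ultimately show ?thesis using that[of "w - vderiv ?v t" ?v] sec[OF tb] by simp
qed

lemma vertical_endo_unique:
  assumes I: "open I" and t: "t \<in> I" and T: "vertical_endo \<Gamma> t T" "vertical_endo \<Gamma> t T'"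
  shows "T = T'"
proof (rule blinfun_eqI)
  fix w
  obtain u v where uv: "u \<in> \<Gamma> t" "local_section \<Gamma> t v" "w = u + vderiv v t"
    using velocity_decomposition[OF I t] by metis
  then show "T w = T' w" using T by (simp add: vertical_endo_def blinfun.add_right)
qed

text \<open>Uniqueness makes the pointwise choice agree with every local smooth solution, so no
  gluing is necessary.\<close>

lemma vertical_endo_field:
  assumes I: "open I"
  obtains V where "smooth_on_line V I" "\<And>t. t \<in> I \<Longrightarrow> vertical_endo \<Gamma> t (V t)"
proof -
  define V where "V t = (SOME T. vertical_endo \<Gamma> t T)" for t
  have V: "vertical_endo \<Gamma> t (V t)" if t: "t \<in> I" for t
  proof -
    obtain e T where "e > 0" "\<And>s. s \<in> ball t e \<Longrightarrow> vertical_endo \<Gamma> s (T s)"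
      using vertical_endo_local[OF I t] by metis
    then have "vertical_endo \<Gamma> t (T t)" by simp
    then show ?thesis unfolding V_def by (rule someI)
  qed
  have "smooth_on_line V I"
  proof (rule smooth_locally)
    fix t assume t: "t \<in> I"
    obtain e T where e: "e > 0" "ball t e \<subseteq> I" "smooth_on_line T (ball t e)"
      "\<And>s. s \<in> ball t e \<Longrightarrow> vertical_endo \<Gamma> s (T s)"
      using vertical_endo_local[OF I t] by metis
    have "smooth_on_line V (ball t e)"
      by (rule smooth_cong[OF open_ball _ e(3)]) (use vertical_endo_unique[OF I] V e(2,4) in blast)
    then show "\<exists>e>0. smooth_on_line V (ball t e)" using e(1) by blast
  qed
  then show ?thesis using that V by blast
qed

end


text \<open>The reflection \<open>V1\<close> is -1 exactly on \<Gamma>. The transport equation keeps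
  x in this eigenspace and puts y = x' into the eigenspace 1; then V x'' = x' - \<open>V1\<close> x'
  = 0, so x'' lies in the kernel of V, which is \<Gamma>. The symplectic relations between x and y
  follow by differentiating isotropy.\<close>

lemma normal_frame_exists:
  fixes \<omega> :: "'w::euclidean_space \<Rightarrow> 'w \<Rightarrow> real"
  assumes \<omega>: "symplectic_form \<omega>" and dim: "DIM('w) = 2 * CARD('n::finite)"
    and sm: "smooth_lagrangian_curve \<omega> \<Gamma> I"
    and definite: "\<forall>t\<in>I. positive_definite_on (\<Gamma> t) (velocity_form \<omega> \<Gamma> t) \<or>
             negative_definite_on (\<Gamma> t) (velocity_form \<omega> \<Gamma> t)"
    and I: "open I" "is_interval I" "I \<noteq> {}"
  obtains \<sigma> and F :: "real \<Rightarrow> 'n::finite + 'n::finite \<Rightarrow> 'w" and K where "\<sigma> = 1 \<or> \<sigma> = -1"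
    "cartan_frame (\<lambda>u v. \<sigma> * \<omega> u v) \<Gamma> I F (\<lambda>t. 0) K"
    "\<And>t i j. t \<in> I \<Longrightarrow> K t $ i $ j = K t $ j $ i"
proof -
  interpret bounded_bilinear \<omega> by (rule symplectic_bilinear[OF \<omega>])
  note bil = bilinear_lincomb[OF symplectic_bilinear[OF \<omega>]]
  note ctx = \<omega> dim sm definite
  note lag = curve_lagrangian[OF ctx]
  obtain V where sV: "smooth_on_line V I" and V: "\<And>t. t \<in> I \<Longrightarrow> vertical_endo \<Gamma> t (V t)"
    using vertical_endo_field[OF ctx I(1)] by metis
  define V1 where "V1 = vderiv V"
  define V2 where "V2 = vderiv V1"
  have sV1: "smooth_on_line V1 I" and sV2: "smooth_on_line V2 I"
    unfolding V1_def V2_def by (intro smooth_D(2) sV)+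
  have dV: "(V has_vector_derivative V1 t) (at t)" and dV1: "(V1 has_vector_derivative V2 t) (at t)" if "t \<in> I" for t
    using smooth_D(1)[OF sV that] smooth_D(1)[OF sV1 that] by (simp_all add: V1_def V2_def)
  have apply_deriv: "((\<lambda>s. B s (x s)) has_vector_derivative B t x' + B' (x t)) (at t)"
    if "(B has_vector_derivative B') (at t)" "(x has_vector_derivative x') (at t)"
    for B :: "real \<Rightarrow> 'w \<Rightarrow>\<^sub>L 'w" and B' x x' t
    using bounded_bilinear.has_vector_derivative[OF bounded_bilinear_blinfun_apply that] by simp
  have VG: "V t u = 0" if "t \<in> I" "u \<in> \<Gamma> t" for t u using V[OF that(1)] that(2) by (simp add: vertical_endo_def)
  have Vd: "V t (vderiv v t) = v t" if "t \<in> I" "local_section \<Gamma> t v" for t v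
    using V[OF that(1)] that(2) by (simp add: vertical_endo_def)
  have near: "\<exists>d>0. smooth_on_line v (ball t d) \<and> ball t d \<subseteq> I \<and> (\<forall>s\<in>ball t d. v s \<in> \<Gamma> s \<and> local_section \<Gamma> s v)"
    if t: "t \<in> I" and v: "local_section \<Gamma> t v" for t v
  proof -
    obtain d where d: "d > 0" "smooth_on_line v (ball t d)" "\<forall>s\<in>ball t d. v s \<in> \<Gamma> s"
      using v by (auto simp: local_section_def)
    obtain d' where d': "d' > 0" "ball t d' \<subseteq> I" using I(1) t open_contains_ball by metis
    let ?m = "min d d'"
    have sub: "ball t ?m \<subseteq> ball t d" "ball t ?m \<subseteq> ball t d'" by auto
    have "local_section \<Gamma> s v" if "s \<in> ball t ?m" for s
    proof -
      have "s \<in> ball t d" using that sub(1) by blast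
      then obtain r where "r > 0" "ball s r \<subseteq> ball t d"
        using open_contains_ball[THEN iffD1, OF open_ball[of t d]] by blast
      then show ?thesis using d smooth_subset[OF d(2)] unfolding local_section_def by blast
    qed
    then show ?thesis using d d' sub smooth_subset[OF d(2) sub(1)] by (intro exI[of _ ?m]) auto
  qed
  \<comment> \<open>Differentiate V v = 0 along a section and use V v' = v.\<close>
  have V1sec: "V1 t (v t) = - v t" if t: "t \<in> I" and v: "local_section \<Gamma> t v" for t v
  proof -
    obtain d where d: "d > 0" "smooth_on_line v (ball t d)" "ball t d \<subseteq> I" "\<forall>s\<in>ball t d. v s \<in> \<Gamma> s \<and> local_section \<Gamma> s v"
      using near[OF t v] by blast
    have "((\<lambda>s. V s (v s)) has_vector_derivative V t (vderiv v t) + V1 t (v t)) (at t)"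
      by (rule apply_deriv[OF dV[OF t] smooth_D(1)[OF d(2)]]) (use d(1) in simp)
    moreover have "((\<lambda>s. V s (v s)) has_vector_derivative 0) (at t)"
      by (rule has_vector_derivative_transform_within_open[OF has_vector_derivative_const, of "ball t d"])
         (use d VG in \<open>auto simp: subset_eq\<close>)
    ultimately have "V t (vderiv v t) + V1 t (v t) = 0" by (rule vector_derivative_unique_at)
    then show ?thesis using Vd[OF t v] by (simp add: eq_neg_iff_add_eq_0 add.commute)
  qed
  \<comment> \<open>Differentiate V v' = v, which holds at all points near t.\<close>
  have V1vel: "V1 t (vderiv v t) + V t (vderiv (vderiv v) t) = vderiv v t"
    if t: "t \<in> I" and v: "local_section \<Gamma> t v" for t v
  proof -
    obtain d where d: "d > 0" "smooth_on_line v (ball t d)" "ball t d \<subseteq> I" "\<forall>s\<in>ball t d. v s \<in> \<Gamma> s \<and> local_section \<Gamma> s v"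
      using near[OF t v] by blast
    have td: "t \<in> ball t d" using d(1) by simp
    have "((\<lambda>s. V s (vderiv v s)) has_vector_derivative V t (vderiv (vderiv v) t) + V1 t (vderiv v t)) (at t)"
      by (rule apply_deriv[OF dV[OF t] smooth_D(1)[OF smooth_D(2)[OF d(2)] td]])
    moreover have "((\<lambda>s. V s (vderiv v s)) has_vector_derivative vderiv v t) (at t)"
      by (rule has_vector_derivative_transform_within_open[OF smooth_D(1)[OF d(2) td] open_ball td])
         (use d Vd in \<open>auto simp: subset_eq\<close>)
    ultimately have "V t (vderiv (vderiv v) t) + V1 t (vderiv v t) = vderiv v t" by (rule vector_derivative_unique_at)
    then show ?thesis by (simp add: add.commute)
  qed
  have secG: "v t \<in> \<Gamma> t" if "local_section \<Gamma> t v" for v t using that by (auto simp: local_section_def)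
  have sec_ex: "\<exists>v. local_section \<Gamma> t v \<and> v t = u" if t: "t \<in> I" and u: "u \<in> \<Gamma> t" for t u
  proof -
    obtain e and f :: "real \<Rightarrow> 'n \<Rightarrow> 'w" where e: "e > 0" "ball t e \<subseteq> I"
      "\<And>i. smooth_on_line (\<lambda>t. f t i) (ball t e)" "\<And>s. s \<in> ball t e \<Longrightarrow> basis_of (f s) (\<Gamma> s)"
      using smooth_curve_local_frame[OF dim sm t] by metis
    obtain c where c: "u = lincomb (f t) c" using basis_of_coords[OF e(4) u] e(1) by auto
    have "smooth_on_line (\<lambda>s. lincomb (f s) c) (ball t e)"
      by (intro smooth_lincomb smooth_const open_ball e(3))
    then have "local_section \<Gamma> t (\<lambda>s. lincomb (f s) c)"
      using e(1) basis_of_in(2)[OF e(4)] unfolding local_section_def by blast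
    then show ?thesis using c by blast
  qed
  have V1G: "V1 t u = - u" if "t \<in> I" "u \<in> \<Gamma> t" for t u
    using sec_ex[OF that] V1sec[OF that(1)] by blast
  have VrG: "V t w \<in> \<Gamma> t" and Vker: "V t w = 0 \<Longrightarrow> w \<in> \<Gamma> t" and V11: "V1 t (V1 t w) = w" if t: "t \<in> I" for t w
  proof -
    have sub: "subspace (\<Gamma> t)" using lag[OF t] by (simp add: lagrangian_def)
    have VrG: "V t w \<in> \<Gamma> t" for w
    proof -
      obtain u v where uv: "u \<in> \<Gamma> t" "local_section \<Gamma> t v" "w = u + vderiv v t"
        using velocity_decomposition[OF ctx I(1) t] by metis
      then show ?thesis using VG[OF t] Vd[OF t] secG by (simp add: blinfun.add_right)
    qed
    obtain u v where uv: "u \<in> \<Gamma> t" "local_section \<Gamma> t v" "w = u + vderiv v t" "v t = 0 \<Longrightarrow> vderiv v t = 0"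
      by (rule velocity_decomposition[OF ctx I(1) t, of w], rule that)
    have Vw: "V t w = v t" using uv VG[OF t] Vd[OF t] by (simp add: blinfun.add_right)
    show "V t w \<in> \<Gamma> t" by (rule VrG)
    show "w \<in> \<Gamma> t" if "V t w = 0" using uv that Vw by simp
    \<comment> \<open>On a velocity, \<open>V1\<close> differs from the identity by V v'', an
      element of \<Gamma>, where \<open>V1\<close> is -1; the two corrections cancel in the
      square.\<close>
    have "V1 t (V1 t (vderiv v t)) = vderiv v t"
    proof -
      have a: "V1 t (vderiv v t) = vderiv v t - V t (vderiv (vderiv v) t)"
        using V1vel[OF t uv(2)] by (simp add: eq_diff_eq)
      have "V1 t (V1 t (vderiv v t)) = V1 t (vderiv v t) - V1 t (V t (vderiv (vderiv v) t))"
        by (subst a) (simp add: blinfun.diff_right)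
      also have "\<dots> = vderiv v t" using V1G[OF t VrG] a by simp
      finally show ?thesis .
    qed
    then show "V1 t (V1 t w) = w" using uv(1,3) V1G[OF t] by (simp add: blinfun.add_right blinfun.minus_right blinfun.diff_right)
  qed
  \<comment> \<open>Differentiating \<open>V1\<close> squared = 1 shows that \<open>V1\<close> and
    \<open>V2\<close> anticommute.\<close>
  have V12: "V1 t (V2 t w) + V2 t (V1 t w) = 0" if t: "t \<in> I" for t w
  proof -
    have "((\<lambda>s. V1 s (V1 s w)) has_vector_derivative V1 t (V2 t w) + V2 t (V1 t w)) (at t)"
      using apply_deriv[OF dV1[OF t] apply_deriv[OF dV1[OF t] has_vector_derivative_const]]
      by (simp add: blinfun.zero_right)
    moreover have "((\<lambda>s. V1 s (V1 s w)) has_vector_derivative 0) (at t)"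
      by (rule has_vector_derivative_transform_within_open[OF has_vector_derivative_const I(1) t]) (simp add: V11)
    ultimately show ?thesis by (rule vector_derivative_unique_at)
  qed
  \<comment> \<open>V maps into \<Gamma> and kills \<Gamma>, so V V = 0, and differentiation gives V
    \<open>V1\<close> + \<open>V1\<close> V = 0. On an eigenvector of \<open>V1\<close> for -1 both
    terms equal -V w.\<close>
  have V1ker: "w \<in> \<Gamma> t" if t: "t \<in> I" and w: "V1 t w = - w" for t w
  proof -
    have "((\<lambda>s. V s (V s w)) has_vector_derivative V t (V1 t w) + V1 t (V t w)) (at t)"
      using apply_deriv[OF dV[OF t] apply_deriv[OF dV[OF t] has_vector_derivative_const]]
      by (simp add: blinfun.zero_right)
    moreover have "((\<lambda>s. V s (V s w)) has_vector_derivative 0) (at t)"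
      by (rule has_vector_derivative_transform_within_open[OF has_vector_derivative_const I(1) t])
         (simp add: VG[OF _ VrG])
    ultimately have "V t (V1 t w) + V1 t (V t w) = 0" by (rule vector_derivative_unique_at)
    then have "- V t w = V t w" using w V1G[OF t VrG[OF t]] by (simp add: blinfun.minus_right)
    then have "2 *\<^sub>R V t w = 0" by (metis scaleR_2 right_minus)
    then have "V t w = 0" by simp
    then show ?thesis by (rule Vker[OF t])
  qed
  \<comment> \<open>If \<open>V1\<close> x = -x and \<open>V1\<close> x' = x', differentiating the
    first relation gives \<open>V2\<close> x = -2 x'.\<close>
  let ?A = "\<lambda>t. (-1/2) *\<^sub>R V2 t"
  have sA: "smooth_on_line ?A I" by (intro smooth_scaleR smooth_const I sV2)
  obtain t0 where t0: "t0 \<in> I" using I(3) by blast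
  obtain e and f :: "real \<Rightarrow> 'n \<Rightarrow> 'w" and G :: "real \<Rightarrow> real^'n^'n" where e: "e > 0" "ball t0 e \<subseteq> I"
    and "\<And>i. smooth_on_line (\<lambda>t. f t i) (ball t0 e)" and bf: "\<And>s. s \<in> ball t0 e \<Longrightarrow> basis_of (f s) (\<Gamma> s)"
    and G: "\<And>t i j. G t $ i $ j = \<omega> (f t i) (vderiv (\<lambda>s. f s j) t)"
    and sec: "\<And>s c. s \<in> ball t0 e \<Longrightarrow> local_section \<Gamma> s (\<lambda>s. lincomb (f s) c)"
    and dl: "\<And>s c. s \<in> ball t0 e \<Longrightarrow> vderiv (\<lambda>s. lincomb (f s) c) s = lincomb (\<lambda>j. vderiv (\<lambda>s. f s j) s) c"
    and sym: "\<And>s i j. s \<in> ball t0 e \<Longrightarrow> G s $ i $ j = G s $ j $ i"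
    and vel: "\<And>s c. s \<in> ball t0 e \<Longrightarrow> velocity_form \<omega> \<Gamma> s (lincomb (f s) c) = c \<bullet> (G s *v c)"
    and "\<And>s. s \<in> ball t0 e \<Longrightarrow> det (G s) \<noteq> 0" and "smooth_on_line G (ball t0 e)"
    by (rule gram_frame[OF ctx I(1) t0], rule that)
  have tb: "t0 \<in> ball t0 e" using e by simp
  \<comment> \<open>The sign is needed at t0 only: the pairings of x and y will turn out constant,
    so it persists on the interval.\<close>
  have "\<exists>\<sigma>. (\<sigma> = 1 \<or> \<sigma> = -1) \<and> (\<forall>c. c \<noteq> 0 \<longrightarrow> \<sigma> * (c \<bullet> (G t0 *v c)) > 0)"
  proof -
    have nz: "lincomb (f t0) c \<noteq> 0" if "c \<noteq> 0" for c using basis_of_lincomb_zero[OF bf[OF tb]] that by blast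
    have inG: "lincomb (f t0) c \<in> \<Gamma> t0" for c by (rule basis_of_in(2)[OF bf[OF tb]])
    from bspec[OF definite t0] show ?thesis
    proof
      assume "positive_definite_on (\<Gamma> t0) (velocity_form \<omega> \<Gamma> t0)"
      then have "\<forall>c. c \<noteq> 0 \<longrightarrow> 1 * (c \<bullet> (G t0 *v c)) > 0"
        using nz inG vel[OF tb] unfolding positive_definite_on_def by fastforce
      then show ?thesis by blast
    next
      assume "negative_definite_on (\<Gamma> t0) (velocity_form \<omega> \<Gamma> t0)"
      then have "\<forall>c. c \<noteq> 0 \<longrightarrow> (-1) * (c \<bullet> (G t0 *v c)) > 0"
        using nz inG vel[OF tb] unfolding negative_definite_on_def by fastforce
      then show ?thesis by blast
    qed
  qed
  then obtain \<sigma> where \<sigma>: "\<sigma> = 1 \<or> \<sigma> = -1" and pos: "\<And>c. c \<noteq> 0 \<Longrightarrow> \<sigma> * (c \<bullet> (G t0 *v c)) > 0" by blast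
  have \<sigma>nz: "\<sigma> \<noteq> 0" and \<sigma>2: "\<sigma> * \<sigma> = 1" using \<sigma> by auto
  have "bounded_bilinear (\<lambda>x y. \<sigma> * (x \<bullet> (G t0 *v y)))"
    unfolding bilinear_conv_bounded_bilinear[symmetric] bilinear_def
    by (auto intro!: linearI simp: inner_add_left inner_add_right matrix_vector_right_distrib
        matrix_vector_mult_scaleR distrib_left)
  moreover have "\<sigma> * (x \<bullet> (G t0 *v y)) = \<sigma> * (y \<bullet> (G t0 *v x))" for x y
  proof -
    have "transpose (G t0) = G t0" using sym[OF tb] by (simp add: transpose_def vec_eq_iff)
    then show ?thesis by (metis dot_lmul_matrix inner_commute vector_transpose_matrix)
  qed
  \<comment> \<open>An orthonormal start at t0 for \<sigma> times the velocity form; constancy of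
    the pairings propagates it.\<close>
  ultimately obtain a :: "'n \<Rightarrow> real^'n" where a: "\<And>i j. \<sigma> * (a i \<bullet> (G t0 *v a j)) = (if i = j then 1 else 0)"
    using orthonormal_family_exists[of "\<lambda>x y. \<sigma> * (x \<bullet> (G t0 *v y))"] pos by metis
  have "\<forall>i. \<exists>x. x t0 = lincomb (f t0) (a i) \<and> (\<forall>t\<in>I. (x has_vector_derivative ?A t (x t)) (at t))"
  proof
    fix i
    show "\<exists>x. x t0 = lincomb (f t0) (a i) \<and> (\<forall>t\<in>I. (x has_vector_derivative ?A t (x t)) (at t))"
      by (rule linear_ode_existence[OF I(1,2) t0 smooth_continuous_on[OF sA], of "lincomb (f t0) (a i)"]) blast
  qed
  then obtain x where x0: "\<And>i. x i t0 = lincomb (f t0) (a i)"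
    and dx: "\<And>i t. t \<in> I \<Longrightarrow> (x i has_vector_derivative ?A t (x i t)) (at t)" by metis
  have sx: "smooth_on_line (x i) I" for i by (rule linear_ode_smooth[OF I(1) sA dx])
  define y where "y i = vderiv (x i)" for i
  define z where "z i = vderiv (y i)" for i
  have sy: "smooth_on_line (y i) I" and sz: "smooth_on_line (z i) I" for i
    unfolding y_def z_def by (intro smooth_D(2) sx)+
  have dxy: "(x i has_vector_derivative y i t) (at t)" and dyz: "(y i has_vector_derivative z i t) (at t)" if "t \<in> I" for i t
    using smooth_D(1)[OF sx that] smooth_D(1)[OF sy that] by (simp_all add: y_def z_def)
  have yA: "y i t = (-1/2) *\<^sub>R V2 t (x i t)" if "t \<in> I" for i t
    using vderiv_eqI[OF dx[OF that]] by (simp add: y_def blinfun.bilinear_simps)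
  have V1x: "V1 t (x i t) = - x i t" if t: "t \<in> I" for i t
  proof -
    \<comment> \<open>The sum x + \<open>V1\<close> x vanishes at t0. By anticommutation it
      satisfies a homogeneous linear equation with coefficient \<open>V2\<close> / 2.\<close>
    have "x i t + V1 t (x i t) = 0"
    proof (rule linear_ode_zero[OF I(1,2) t0, where A = "\<lambda>t. (1/2) *\<^sub>R V2 t"])
      show "continuous_on I (\<lambda>t. (1/2) *\<^sub>R V2 t)" by (intro continuous_intros smooth_continuous_on sV2)
      show "x i t0 + V1 t0 (x i t0) = 0"
        using V1G[OF t0 basis_of_in(2)[OF bf[OF tb]]] by (simp add: x0)
      fix t assume t: "t \<in> I"
      have "((\<lambda>t. x i t + V1 t (x i t)) has_vector_derivative y i t + (V1 t (y i t) + V2 t (x i t))) (at t)"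
        by (intro has_vector_derivative_add apply_deriv dxy dV1 t)
      moreover have "y i t + (V1 t (y i t) + V2 t (x i t)) = ((1/2) *\<^sub>R V2 t) (x i t + V1 t (x i t))"
      proof -
        have "V1 t (V2 t (x i t)) = - V2 t (V1 t (x i t))" using V12[OF t] by (simp add: eq_neg_iff_add_eq_0)
        then have "V1 t (y i t) = (1/2) *\<^sub>R V2 t (V1 t (x i t))" by (simp add: yA[OF t] blinfun.bilinear_simps)
        moreover have "y i t + V2 t (x i t) = (1/2) *\<^sub>R V2 t (x i t)"
        proof -
          have "y i t + V2 t (x i t) = ((-1/2) + 1) *\<^sub>R V2 t (x i t)" unfolding scaleR_add_left by (simp add: yA[OF t])
          then show ?thesis by simp
        qed
        ultimately show ?thesis by (simp add: blinfun.bilinear_simps scaleR_add_right)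
      qed
      ultimately show "((\<lambda>t. x i t + V1 t (x i t)) has_vector_derivative ((1/2) *\<^sub>R V2 t) (x i t + V1 t (x i t))) (at t)"
        by metis
    qed (rule t)
    then show ?thesis by (simp add: eq_neg_iff_add_eq_0 add.commute)
  qed
  have xG: "x i t \<in> \<Gamma> t" if "t \<in> I" for i t by (rule V1ker[OF that V1x[OF that]])
  have xsec: "local_section \<Gamma> t (x i)" if t: "t \<in> I" for i t
  proof -
    obtain d where "d > 0" "ball t d \<subseteq> I" using I(1) t open_contains_ball by metis
    then show ?thesis using smooth_subset[OF sx] xG unfolding local_section_def by blast
  qed
  have V1y: "V1 t (y i t) = y i t" if t: "t \<in> I" for i t
  proof -
    have "V1 t (V2 t (x i t)) = - V2 t (V1 t (x i t))" using V12[OF t] by (simp add: eq_neg_iff_add_eq_0)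
    then show ?thesis by (simp add: yA[OF t] blinfun.bilinear_simps V1x[OF t])
  qed
  have zG: "z i t \<in> \<Gamma> t" if t: "t \<in> I" for i t
  proof (rule Vker[OF t])
    show "V t (z i t) = 0" using V1vel[OF t xsec[OF t, of i]] V1y[OF t, of i] by (simp add: y_def z_def)
  qed
  have xx: "\<omega> (x i t) (x j t) = 0" and xz: "\<omega> (x i t) (z j t) = 0" if "t \<in> I" for i j t
    using lag[OF that] xG[OF that] zG[OF that] by (auto simp: lagrangian_def)
  have xysym: "\<omega> (x i t) (y j t) = \<omega> (x j t) (y i t)" if t: "t \<in> I" for i j t
    using section_pairing[OF ctx t xsec[OF t] xsec[OF t] I(1)] by (simp add: y_def)
  have dxyw: "((\<lambda>t. \<omega> (x i t) (y j t)) has_vector_derivative \<omega> (y i t) (y j t)) (at t)" if t: "t \<in> I" for i j t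
    using has_vector_derivative[OF dxy[OF t] dyz[OF t], of i j] by (simp add: xz[OF t])
  \<comment> \<open>The derivative of \<omega> (x i) (y j) is \<omega> (y i) (y j), since x and z =
    x'' both lie in \<Gamma>. By \<open>xysym\<close> it is symmetric in i and j, and it is skew as
    a value of \<omega>; hence it vanishes.\<close>
  have yy: "\<omega> (y i t) (y j t) = 0" if t: "t \<in> I" for i j t
  proof -
    have "((\<lambda>t. \<omega> (x i t) (y j t)) has_vector_derivative \<omega> (y j t) (y i t)) (at t)"
      by (rule has_vector_derivative_transform_within_open[OF dxyw[OF t] I(1) t]) (rule xysym)
    then have "\<omega> (y i t) (y j t) = \<omega> (y j t) (y i t)" using dxyw[OF t] vector_derivative_unique_at by blast
    then show ?thesis using symplectic_skew[OF \<omega>, of "y i t" "y j t"] by simp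
  qed
  have xy: "\<sigma> * \<omega> (x i t) (y j t) = (if i = j then 1 else 0)" if t: "t \<in> I" for i j t
  proof -
    have "\<omega> (x i t) (y j t) = \<omega> (x i t0) (y j t0)"
      by (rule has_vector_derivative_zero_imp_eq[OF I(2) _ t t0]) (use dxyw yy in metis)
    also have "\<dots> = a j \<bullet> (G t0 *v a i)"
    proof -
      have "\<omega> (x i t0) (y j t0) = \<omega> (x j t0) (lincomb (\<lambda>k. vderiv (\<lambda>s. f s k) t0) (a i))"
        using section_pairing[OF ctx t0 xsec[OF t0, of j] sec[OF tb, of "a i"] I(1)]
        by (simp add: x0 y_def dl[OF tb])
      also have "\<dots> = (\<Sum>k\<in>UNIV. a i $ k * (\<Sum>l\<in>UNIV. a j $ l * G t0 $ l $ k))"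
        by (simp add: x0 bil G)
      also have "\<dots> = a j \<bullet> (G t0 *v a i)"
        by (simp add: inner_vec_def matrix_vector_mult_def sum_distrib_left mult_ac) (rule sum.swap)
      finally show ?thesis .
    qed
    finally show ?thesis using a[of j i] by auto
  qed
  define F where "F t p = (case p of Inl i \<Rightarrow> x i t | Inr i \<Rightarrow> y i t)" for t p
  \<comment> \<open>The coordinates of z j = y j' in the basis x, read off by pairing with
    y.\<close>
  define K :: "real \<Rightarrow> real^'n^'n" where "K t = (\<chi> i j. \<sigma> * \<omega> (z j t) (y i t))" for t
  let ?w = "\<lambda>u v. \<sigma> * \<omega> u v"
  note w = symplectic_scale[OF \<omega> \<sigma>nz]
  have sb: "symplectic_basis ?w (F t)" if t: "t \<in> I" for t
    by (rule symplectic_basisI[OF w dim]) (simp_all add: F_def xx[OF t] yy[OF t] xy[OF t])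
  have sp: "span (range (\<lambda>i. F t (Inl i))) = \<Gamma> t" if t: "t \<in> I" for t
  proof (rule subspace_dim_equal)
    show "subspace (\<Gamma> t)" using lag[OF t] by (simp add: lagrangian_def)
    then show "span (range (\<lambda>i. F t (Inl i))) \<subseteq> \<Gamma> t"
      by (intro span_minimal) (use xG[OF t] in \<open>auto simp: F_def\<close>)
    have "dim (span (range (\<lambda>i. F t (Inl i)))) = CARD('n)"
      by (rule basis_of_dim[OF basis_of_sum_type_halves(1)[OF symplectic_basisD(1)[OF sb[OF t]]]])
    then show "dim (\<Gamma> t) \<le> dim (span (range (\<lambda>i. F t (Inl i))))"
      using lag[OF t] dim by (simp add: lagrangian_def)
  qed (rule subspace_span)
  have zK: "z i t = lincomb (\<lambda>j. F t (Inl j)) (column i (K t))" if t: "t \<in> I" for i t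
  proof -
    obtain c where c: "z i t = lincomb (\<lambda>j. F t (Inl j)) c"
      using zG[OF t, of i] unfolding sp[OF t, symmetric] span_range_lincomb by blast
    have "c $ j = \<sigma> * \<omega> (z i t) (y j t)" for j
      using symplectic_coords(1)[OF w, of "F t" c 0 j] symplectic_basisD[OF sb[OF t]]
      by (simp add: lincomb_linear c F_def)
    then have "c = column i (K t)" by (simp add: vec_eq_iff K_def column_def)
    then show ?thesis using c by simp
  qed
  have c0: "column i (0 :: real^'n^'n) = 0" for i by (simp add: column_def vec_eq_iff)
  have "cartan_frame ?w \<Gamma> I F (\<lambda>t. 0) K"
    unfolding cartan_frame_def
  proof (intro conjI ballI allI I(1) sb sp smooth_const)
    show "smooth_on_line (\<lambda>t. F t p) I" for p
    proof (cases p)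
      case (Inl i)
      then show ?thesis using sx[of i] by (simp add: F_def)
    next
      case (Inr i)
      then show ?thesis using sy[of i] by (simp add: F_def)
    qed
    show "smooth_on_line K I" unfolding K_def
      by (intro smooth_vec_lambda smooth_mult smooth_const smooth_bilinear[OF symplectic_bilinear[OF \<omega>]] sz sy I(1))
    fix t i assume t: "t \<in> I"
    show "((\<lambda>s. F s (Inl i)) has_vector_derivative F t (Inr i) + lincomb (\<lambda>j. F t (Inl j)) (column i 0)) (at t)"
      using dxy[OF t, of i] by (simp add: F_def c0 lincomb_linear)
    show "((\<lambda>s. F s (Inr i)) has_vector_derivative lincomb (\<lambda>j. F t (Inl j)) (column i (K t)) +
        lincomb (\<lambda>j. F t (Inr j)) (column i 0)) (at t)"
      using dyz[OF t, of i] unfolding zK[OF t] by (simp add: F_def c0 lincomb_linear)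
  qed
  \<comment> \<open>Symmetry of K is the derivative of the relation \<omega> (y j) (y i) =
    0.\<close>
  moreover have "K t $ i $ j = K t $ j $ i" if t: "t \<in> I" for t i j
  proof -
    have "((\<lambda>t. \<omega> (y j t) (y i t)) has_vector_derivative \<omega> (y j t) (z i t) + \<omega> (z j t) (y i t)) (at t)"
      by (intro has_vector_derivative dyz t)
    moreover have "((\<lambda>t. \<omega> (y j t) (y i t)) has_vector_derivative 0) (at t)"
      by (rule has_vector_derivative_transform_within_open[OF has_vector_derivative_const I(1) t]) (simp add: yy)
    ultimately have "\<omega> (y j t) (z i t) + \<omega> (z j t) (y i t) = 0" by (rule vector_derivative_unique_at)
    then have "\<omega> (z j t) (y i t) = \<omega> (z i t) (y j t)" using symplectic_skew[OF \<omega>, of "y j t" "z i t"] by simp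
    then show ?thesis by (simp add: K_def)
  qed
  ultimately show ?thesis using that[OF \<sigma>] by blast
qed

text \<open>A normal frame is rotated by orthonormal eigenvectors of its symmetric matrix Q. The
  same orthogonal matrix acts on both halves, so the symplectic relations survive, and Q becomes
  diagonal with increasing entries.\<close>

lemma jacobi_diagonal_frame:
  fixes \<omega> :: "'w::euclidean_space \<Rightarrow> 'w \<Rightarrow> real"
  assumes \<omega>: "symplectic_form \<omega>" and dim: "DIM('w) = 2 * CARD('n::{finite,linorder})"
    and jac: "jacobi_curve TYPE('n::{finite,linorder}) \<omega> \<Gamma> I"
  obtains \<sigma> and F :: "real \<Rightarrow> 'n::{finite,linorder} + 'n::{finite,linorder} \<Rightarrow> 'w" and S K
  where "\<sigma> = 1 \<or> \<sigma> = -1" "diagonal_frame (\<lambda>u v. \<sigma> * \<omega> u v) \<Gamma> I F S K"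
proof -
  have I: "open I" "is_interval I" "I \<noteq> {}" and sm: "smooth_lagrangian_curve \<omega> \<Gamma> I"
    and def: "\<forall>t\<in>I. positive_definite_on (\<Gamma> t) (velocity_form \<omega> \<Gamma> t) \<or>
             negative_definite_on (\<Gamma> t) (velocity_form \<omega> \<Gamma> t)"
    and card: "\<And>t. t \<in> I \<Longrightarrow> card (eigenvalues_on (\<Gamma> t) (ricci \<omega> \<Gamma> t)) = CARD('n)"
    using jac by (auto simp: jacobi_curve_def open_interval_def)
  obtain \<sigma> and F0 :: "real \<Rightarrow> 'n + 'n \<Rightarrow> 'w" and Q where \<sigma>: "\<sigma> = 1 \<or> \<sigma> = -1"
    and fr: "cartan_frame (\<lambda>u v. \<sigma> * \<omega> u v) \<Gamma> I F0 (\<lambda>t. 0) Q"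
    and sym: "\<And>t i j. t \<in> I \<Longrightarrow> Q t $ i $ j = Q t $ j $ i"
    using normal_frame_exists[OF \<omega> dim sm def I] by metis
  have \<sigma>nz: "\<sigma> \<noteq> 0" using \<sigma> by auto
  note w = symplectic_scale[OF \<omega> \<sigma>nz]
  note bm = bounded_linear_Blinfun_of_bilinear[OF bounded_bilinear_matrix_vector]
  define B where "B t = Blinfun ((*v) (Q t))" for t
  have Bap: "blinfun_apply (B t) c = Q t *v c" for t c by (simp add: B_def bm(2))
  have sB: "smooth_on_line B I" unfolding B_def by (rule smooth_linear[OF bm(1) I(1) frame_smooth(3)[OF w fr]])
  have adj: "B t x \<bullet> y = x \<bullet> B t y" if t: "t \<in> I" for t x y
  proof -
    have "transpose (Q t) = Q t" using sym[OF t] by (simp add: transpose_def vec_eq_iff)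
    then show ?thesis unfolding Bap by (metis dot_lmul_matrix vector_transpose_matrix)
  qed
  have card': "card {l. \<exists>u. u \<noteq> 0 \<and> B t u = l *\<^sub>R u} = CARD('n)" if t: "t \<in> I" for t
  proof -
    note b = frame_basis_of[OF w fr t]
    have ric: "ricci \<omega> \<Gamma> t (lincomb (\<lambda>i. F0 t (Inl i)) c) = lincomb (\<lambda>i. F0 t (Inl i)) ((-2) *\<^sub>R (Q t *v c))" for c
      using frame_ricci[OF w fr t, of c] ricci_scale[OF \<sigma>nz, of \<omega> \<Gamma>] by metis
    \<comment> \<open>The Ricci operator is -2 Q in frame coordinates, so the assumption of n
      distinct eigenvalues passes to Q.\<close>
    have "eigenvalues_on (\<Gamma> t) (ricci \<omega> \<Gamma> t) = (\<lambda>l. -2 * l) ` {l. \<exists>u. u \<noteq> 0 \<and> B t u = l *\<^sub>R u}"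
    proof (intro equalityI subsetI)
      fix m assume "m \<in> eigenvalues_on (\<Gamma> t) (ricci \<omega> \<Gamma> t)"
      then obtain u where u: "u \<in> \<Gamma> t" "u \<noteq> 0" "ricci \<omega> \<Gamma> t u = m *\<^sub>R u" by (auto simp: eigenvalues_on_def)
      obtain c where c: "u = lincomb (\<lambda>i. F0 t (Inl i)) c" using basis_of_coords[OF b u(1)] by blast
      have c0: "c \<noteq> 0" using u(2) c by (auto simp: lincomb_linear)
      have "lincomb (\<lambda>i. F0 t (Inl i)) ((-2) *\<^sub>R (Q t *v c)) = lincomb (\<lambda>i. F0 t (Inl i)) (m *\<^sub>R c)"
        using u(3) unfolding c ric by (simp add: lincomb_linear)
      then have "(-2) *\<^sub>R (Q t *v c) = m *\<^sub>R c" by (rule basis_of_lincomb_eq[OF b])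
      then have "(-1/2) *\<^sub>R ((-2) *\<^sub>R (Q t *v c)) = (-1/2) *\<^sub>R (m *\<^sub>R c)" by simp
      then have "B t c = (- m / 2) *\<^sub>R c" by (simp add: Bap)
      then show "m \<in> (\<lambda>l. -2 * l) ` {l. \<exists>u. u \<noteq> 0 \<and> B t u = l *\<^sub>R u}"
        using c0 by (intro image_eqI[of _ _ "- m / 2"]) auto
    next
      fix m assume "m \<in> (\<lambda>l. -2 * l) ` {l. \<exists>u. u \<noteq> 0 \<and> B t u = l *\<^sub>R u}"
      then obtain l c where l: "m = -2 * l" "c \<noteq> 0" "Q t *v c = l *\<^sub>R c" by (auto simp: Bap)
      have "lincomb (\<lambda>i. F0 t (Inl i)) c \<noteq> 0" using basis_of_lincomb_zero[OF b] l(2) by blast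
      moreover have "ricci \<omega> \<Gamma> t (lincomb (\<lambda>i. F0 t (Inl i)) c) = m *\<^sub>R lincomb (\<lambda>i. F0 t (Inl i)) c"
        unfolding ric l by (simp add: lincomb_linear)
      ultimately show "m \<in> eigenvalues_on (\<Gamma> t) (ricci \<omega> \<Gamma> t)"
        using basis_of_in(2)[OF b] unfolding eigenvalues_on_def by blast
    qed
    moreover have "inj (\<lambda>l::real. -2 * l)" by (rule injI) simp
    ultimately show ?thesis using card[OF t] by (simp add: card_image inj_on_subset)
  qed
  obtain k :: "real \<Rightarrow> 'n \<Rightarrow> real" and v :: "real \<Rightarrow> 'n \<Rightarrow> _" where
    sk: "\<And>i. smooth_on_line (\<lambda>t. k t i) I" and sv: "\<And>i. smooth_on_line (\<lambda>t. v t i) I"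
    and mono: "\<And>t. t \<in> I \<Longrightarrow> strict_mono (k t)" and ev: "\<And>t i. t \<in> I \<Longrightarrow> B t (v t i) = k t i *\<^sub>R v t i"
    and on: "\<And>t i j. t \<in> I \<Longrightarrow> v t i \<bullet> v t j = (if i = j then 1 else 0)"
    by (rule smooth_diagonalisation[OF I sB adj card'], assumption, assumption, rule that)
  define F where "F t p = (case p of Inl i \<Rightarrow> lincomb (\<lambda>j. F0 t (Inl j)) (v t i)
       | Inr i \<Rightarrow> lincomb (\<lambda>j. F0 t (Inr j)) (v t i))" for t p
  \<comment> \<open>The matrix of v' in the orthonormal basis v: the rotation's own angular
    velocity, which accounts for all of S because the normal frame has none.\<close>
  define S where "S t = (\<chi> j i. v t j \<bullet> vderiv (\<lambda>s. v s i) t)" for t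
  define K where "K t = (\<chi> i j. if i = j then k t i else 0)" for t
  show ?thesis
  proof (rule that[OF \<sigma>, of F S K])
    have "cartan_frame (\<lambda>u v. \<sigma> * \<omega> u v) \<Gamma> I F S K"
      unfolding cartan_frame_def
    proof (intro conjI ballI allI I(1))
      show "smooth_on_line (\<lambda>t. F t p) I" for p
      proof (cases p)
        case (Inl i)
        have "smooth_on_line (\<lambda>t. lincomb (\<lambda>j. F0 t (Inl j)) (v t i)) I"
          by (intro smooth_lincomb I(1) sv frame_smooth(1)[OF w fr])
        then show ?thesis by (simp add: Inl F_def)
      next
        case (Inr i)
        have "smooth_on_line (\<lambda>t. lincomb (\<lambda>j. F0 t (Inr j)) (v t i)) I"
          by (intro smooth_lincomb I(1) sv frame_smooth(1)[OF w fr])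
        then show ?thesis by (simp add: Inr F_def)
      qed
      show "smooth_on_line S I" unfolding S_def
        by (intro smooth_vec_lambda smooth_bilinear[OF bounded_bilinear_inner] I(1) sv smooth_D(2))
      show "smooth_on_line K I" unfolding K_def
      proof (intro smooth_vec_lambda I(1))
        show "smooth_on_line (\<lambda>t. if i = j then k t i else 0) I" for i j :: 'n
          using sk[of i] smooth_const[OF I(1), of 0] by (cases "i = j") auto
      qed
      fix t assume t: "t \<in> I"
      note sb = symplectic_basisD[OF frame_basis[OF w fr t]]
      note bil = bilinear_lincomb[OF symplectic_bilinear[OF \<omega>]]
      have b1: "\<omega> (F0 t (Inl i)) (F0 t (Inl j)) = 0" "\<omega> (F0 t (Inr i)) (F0 t (Inr j)) = 0" for i j
        using sb(2,3)[of i j] \<sigma>nz by auto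
      show sbF: "symplectic_basis (\<lambda>u v. \<sigma> * \<omega> u v) (F t)"
      proof (rule symplectic_basisI[OF w dim])
        show "\<sigma> * \<omega> (F t (Inl i)) (F t (Inl j)) = 0" for i j by (simp add: F_def bil b1)
        show "\<sigma> * \<omega> (F t (Inr i)) (F t (Inr j)) = 0" for i j by (simp add: F_def bil b1)
        show "\<sigma> * \<omega> (F t (Inl i)) (F t (Inr j)) = (if i = j then 1 else 0)" for i j
        proof -
          have "\<sigma> * \<omega> (F t (Inl i)) (F t (Inr j)) =
             (\<Sum>l\<in>UNIV. v t j $ l * (\<sigma> * \<omega> (lincomb (\<lambda>j. F0 t (Inl j)) (v t i)) (F0 t (Inr l))))"
            by (simp add: F_def bil(2) sum_distrib_left mult_ac)
          also have "\<dots> = (\<Sum>l\<in>UNIV. v t j $ l * v t i $ l)"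
            using symplectic_coords(1)[OF w, of "F0 t" "v t i" 0] sb by (simp add: lincomb_linear)
          finally show ?thesis using on[OF t, of i j] by (simp add: inner_vec_def mult.commute)
        qed
      qed
      show "span (range (\<lambda>i. F t (Inl i))) = \<Gamma> t"
      proof (rule subspace_dim_equal)
        note b0 = frame_basis_of[OF w fr t]
        show sub: "subspace (\<Gamma> t)" by (rule basis_of_subspace[OF b0])
        show "span (range (\<lambda>i. F t (Inl i))) \<subseteq> \<Gamma> t"
          by (rule span_minimal[OF _ sub]) (use basis_of_in(2)[OF b0] in \<open>auto simp: F_def\<close>)
        show "dim (\<Gamma> t) \<le> dim (span (range (\<lambda>i. F t (Inl i))))"
          using basis_of_dim[OF basis_of_sum_type_halves(1)[OF symplectic_basisD(1)[OF sbF]]] basis_of_dim[OF b0] by simp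
      qed (rule subspace_span)
      fix i
      let ?d = "vderiv (\<lambda>s. v s i) t"
      have dv: "((\<lambda>s. v s i) has_vector_derivative ?d) (at t)" by (rule smooth_D(1)[OF sv t])
      have expand: "lincomb (\<lambda>j. lincomb b (v t j)) (column i (S t)) = lincomb b ?d" for b :: "'n \<Rightarrow> 'w"
      proof -
        have lin: "linear (lincomb b)" by (rule linearI) (simp_all add: lincomb_linear)
        have "?d = (\<Sum>j\<in>UNIV. (v t j \<bullet> ?d) *\<^sub>R v t j)" by (rule orthonormal_expansion[OF on[OF t]])
        then have "lincomb b ?d = lincomb b (\<Sum>j\<in>UNIV. (v t j \<bullet> ?d) *\<^sub>R v t j)" by simp
        also have "\<dots> = (\<Sum>j\<in>UNIV. (v t j \<bullet> ?d) *\<^sub>R lincomb b (v t j))"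
          by (simp add: linear_sum[OF lin] linear_scale[OF lin])
        also have "\<dots> = lincomb (\<lambda>j. lincomb b (v t j)) (column i (S t))"
          by (simp add: lincomb_def[of "\<lambda>j. lincomb b (v t j)"] S_def column_def)
        finally show ?thesis by simp
      qed
      have FL: "(\<lambda>j. F s (Inl j)) = (\<lambda>j. lincomb (\<lambda>l. F0 s (Inl l)) (v s j))"
        "(\<lambda>j. F s (Inr j)) = (\<lambda>j. lincomb (\<lambda>l. F0 s (Inr l)) (v s j))" for s
        by (simp_all add: F_def)
      have z: "((\<lambda>s. 0 :: real^('n::{finite,linorder})) has_vector_derivative 0) (at t)"
        by (rule has_vector_derivative_const)
      note frame_derivative_rule[OF w fr t dv z]
      then show "((\<lambda>s. F s (Inl i)) has_vector_derivative F t (Inr i) + lincomb (\<lambda>j. F t (Inl j)) (column i (S t))) (at t)"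
        unfolding FL expand by (simp add: F_def lincomb_linear add.commute)
      note frame_derivative_rule[OF w fr t z dv]
      moreover have "Q t *v v t i = k t i *\<^sub>R v t i" using ev[OF t, of i] by (simp add: Bap)
      moreover have "column i (K t) = k t i *\<^sub>R axis i 1" by (auto simp: vec_eq_iff column_def K_def axis_def)
      ultimately show "((\<lambda>s. F s (Inr i)) has_vector_derivative
          lincomb (\<lambda>j. F t (Inl j)) (column i (K t)) + lincomb (\<lambda>j. F t (Inr j)) (column i (S t))) (at t)"
        unfolding FL expand by (simp add: F_def lincomb_linear)
    qed
    moreover have "diagonal_matrix (K t) \<and> (\<forall>i j. i < j \<longrightarrow> K t $ i $ i < K t $ j $ j)" if "t \<in> I" for t
      using mono[OF that] by (auto simp: diagonal_matrix_def K_def strict_mono_def)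
    ultimately show "diagonal_frame (\<lambda>u v. \<sigma> * \<omega> u v) \<Gamma> I F S K" by (simp add: diagonal_frame_def)
  qed
qed


section \<open>Congruence of curves with the same structure equations\<close>

text \<open>At each t some linear map M t takes the first frame to the second. Both frames satisfy
  the same structure equation, so the derivative of M kills every frame vector, and M is
  constant.\<close>

lemma frame_intertwiner:
  fixes G1 G2 :: "real \<Rightarrow> 'n::finite + 'n \<Rightarrow> 'w::euclidean_space" and A :: "real \<Rightarrow> real^('n + 'n)^('n + 'n)"
  assumes \<omega>: "symplectic_form \<omega>" and I: "open I" "is_interval I" and t0: "t0 \<in> I"
    and sb: "\<And>t. t \<in> I \<Longrightarrow> symplectic_basis \<omega> (G1 t)"
    and d1: "\<And>t x. t \<in> I \<Longrightarrow> ((\<lambda>s. G1 s x) has_vector_derivative lincomb (G1 t) (column x (A t))) (at t)"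
    and d2: "\<And>t x. t \<in> I \<Longrightarrow> ((\<lambda>s. G2 s x) has_vector_derivative lincomb (G2 t) (column x (A t))) (at t)"
  obtains a where "linear a" "\<And>t x. t \<in> I \<Longrightarrow> a (G1 t x) = G2 t x"
proof -
  interpret bounded_bilinear \<omega> by (rule symplectic_bilinear[OF \<omega>])
  \<comment> \<open>The coordinates of w in \<open>G1\<close> are pairings with \<open>G1\<close>,
    so M is an explicit expression that can be differentiated without inverting a matrix.\<close>
  define M where "M t w = (\<Sum>i\<in>UNIV. \<omega> w (G1 t (Inr i)) *\<^sub>R G2 t (Inl i) - \<omega> w (G1 t (Inl i)) *\<^sub>R G2 t (Inr i))" for t w
  define D1 where "D1 t x = lincomb (G1 t) (column x (A t))" for t x
  define D2 where "D2 t x = lincomb (G2 t) (column x (A t))" for t x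
  define D where "D t w = (\<Sum>i\<in>UNIV. (\<omega> w (G1 t (Inr i)) *\<^sub>R D2 t (Inl i) + \<omega> w (D1 t (Inr i)) *\<^sub>R G2 t (Inl i)) -
      (\<omega> w (G1 t (Inl i)) *\<^sub>R D2 t (Inr i) + \<omega> w (D1 t (Inl i)) *\<^sub>R G2 t (Inr i)))" for t w
  have linM: "linear (M t)" and linD: "linear (D t)" for t
    by (rule linearI; simp add: M_def D_def add_left scaleR_left scaleR_add_left scaleR_add_right
        scaleR_diff_right scaleR_sum_right sum.distrib sum_subtractf algebra_simps)+
  have MG: "M t (G1 t x) = G2 t x" if t: "t \<in> I" for t x
  proof -
    note b = symplectic_basisD[OF sb[OF t]]
    have b5: "\<omega> (G1 t (Inr i)) (G1 t (Inl j)) = (if i = j then -1 else 0)" for i j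
      using symplectic_skew[OF \<omega>, of "G1 t (Inr i)" "G1 t (Inl j)"] b(4)[of j i] by auto
    show ?thesis
      by (cases x) (simp_all add: M_def b b5 if_distrib[of "\<lambda>r. r *\<^sub>R _"] sum_negf cong: if_cong)
  qed
  have dM: "((\<lambda>s. M s (u s)) has_vector_derivative D t (u t) + M t u') (at t)"
    if t: "t \<in> I" and u: "(u has_vector_derivative u') (at t)" for t u u'
  proof -
    have tm: "((\<lambda>s. \<omega> (u s) (G1 s x) *\<^sub>R G2 s y) has_vector_derivative
       (\<omega> (u t) (G1 t x) *\<^sub>R D2 t y + (\<omega> (u t) (D1 t x) + \<omega> u' (G1 t x)) *\<^sub>R G2 t y)) (at t)" for x y
    proof (rule has_vector_derivative_scaleR)
      show "((\<lambda>s. \<omega> (u s) (G1 s x)) has_real_derivative \<omega> (u t) (D1 t x) + \<omega> u' (G1 t x)) (at t)"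
        unfolding has_real_derivative_iff_has_vector_derivative D1_def
        by (rule has_vector_derivative[OF u d1[OF t]])
      show "((\<lambda>s. G2 s y) has_vector_derivative D2 t y) (at t)" unfolding D2_def by (rule d2[OF t])
    qed
    have "((\<lambda>s. M s (u s)) has_vector_derivative (\<Sum>i\<in>UNIV.
        (\<omega> (u t) (G1 t (Inr i)) *\<^sub>R D2 t (Inl i) + (\<omega> (u t) (D1 t (Inr i)) + \<omega> u' (G1 t (Inr i))) *\<^sub>R G2 t (Inl i)) -
        (\<omega> (u t) (G1 t (Inl i)) *\<^sub>R D2 t (Inr i) + (\<omega> (u t) (D1 t (Inl i)) + \<omega> u' (G1 t (Inl i))) *\<^sub>R G2 t (Inr i)))) (at t)"
      unfolding M_def by (intro has_vector_derivative_sum has_vector_derivative_diff tm)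
    moreover have "(\<Sum>i\<in>UNIV.
        (\<omega> (u t) (G1 t (Inr i)) *\<^sub>R D2 t (Inl i) + (\<omega> (u t) (D1 t (Inr i)) + \<omega> u' (G1 t (Inr i))) *\<^sub>R G2 t (Inl i)) -
        (\<omega> (u t) (G1 t (Inl i)) *\<^sub>R D2 t (Inr i) + (\<omega> (u t) (D1 t (Inl i)) + \<omega> u' (G1 t (Inl i))) *\<^sub>R G2 t (Inr i))) =
        D t (u t) + M t u'"
      unfolding D_def M_def sum.distrib[symmetric]
      by (intro sum.cong refl) (simp add: scaleR_add_left)
    ultimately show ?thesis by metis
  qed
  have D0: "D t w = 0" if t: "t \<in> I" for t w
  proof -
    have DG: "D t (G1 t x) = 0" for x
    proof -
      have "((\<lambda>s. M s (G1 s x)) has_vector_derivative D t (G1 t x) + M t (D1 t x)) (at t)"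
        unfolding D1_def by (rule dM[OF t d1[OF t]])
      moreover have "((\<lambda>s. M s (G1 s x)) has_vector_derivative D2 t x) (at t)"
        unfolding D2_def by (rule has_vector_derivative_transform_within_open[OF d2[OF t] I(1) t]) (simp add: MG)
      ultimately have "D t (G1 t x) + M t (D1 t x) = D2 t x" by (rule vector_derivative_unique_at)
      moreover have "M t (D1 t x) = D2 t x"
        unfolding D1_def D2_def by (simp add: lincomb_image[OF linM] MG[OF t])
      ultimately show ?thesis by simp
    qed
    obtain c where "w = lincomb (G1 t) c"
      using basis_of_coords[OF symplectic_basisD(1)[OF sb[OF t]], of w] by blast
    then show ?thesis by (simp add: lincomb_image[OF linD] DG) (simp add: lincomb_def)
  qed
  have const: "M t w = M t0 w" if t: "t \<in> I" for t w
  proof (rule has_vector_derivative_zero_imp_eq[OF I(2) _ t t0])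
    fix s assume s: "s \<in> I"
    show "((\<lambda>s. M s w) has_vector_derivative 0) (at s)"
      using dM[OF s has_vector_derivative_const, of w] D0[OF s] linear_0[OF linM] by simp
  qed
  show ?thesis by (rule that[OF linM[of t0]]) (metis const MG)
qed

text \<open>The conformal factor of the map is the product of the two signs; it is -1 when the
  curves have velocities of opposite sign.\<close>

lemma symplectic_basis_map_CSp:
  fixes \<omega> :: "'w::euclidean_space \<Rightarrow> 'w \<Rightarrow> real" and b1 b2 :: "'n::finite + 'n \<Rightarrow> 'w"
  assumes \<omega>: "symplectic_form \<omega>" and \<sigma>: "\<sigma>1 = 1 \<or> \<sigma>1 = -1" "\<sigma>2 = 1 \<or> \<sigma>2 = -1"
    and b: "symplectic_basis (\<lambda>u v. \<sigma>1 * \<omega> u v) b1" "symplectic_basis (\<lambda>u v. \<sigma>2 * \<omega> u v) b2"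
    and a: "linear a" "\<And>x. a (b1 x) = b2 x"
  shows "a \<in> CSp \<omega>"
proof -
  interpret bounded_bilinear \<omega> by (rule symplectic_bilinear[OF \<omega>])
  note bil = bilinear_lincomb[OF symplectic_bilinear[OF \<omega>]]
  note b1 = symplectic_basisD[OF b(1)] and b2 = symplectic_basisD[OF b(2)]
  have eq: "\<sigma>2 * \<omega> (b2 x) (b2 y) = \<sigma>1 * \<omega> (b1 x) (b1 y)" for x y
  proof (cases x; cases y)
    fix i j assume "x = Inr i" "y = Inl j"
    then show ?thesis
      using b1(4)[of j i] b2(4)[of j i] symplectic_skew[OF \<omega>, of "b1 x" "b1 y"] symplectic_skew[OF \<omega>, of "b2 x" "b2 y"] by simp
  qed (simp_all only: b1 b2)
  have expand: "\<omega> (lincomb b c) (lincomb b d) = (\<Sum>x\<in>UNIV. c $ x * (\<Sum>y\<in>UNIV. d $ y * \<omega> (b x) (b y)))"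
    for b :: "'n + 'n \<Rightarrow> 'w" and c d
    by (subst bil(1)) (simp only: bil(2))
  have inv: "\<sigma>2 * \<omega> (a u) (a v) = \<sigma>1 * \<omega> u v" for u v
  proof -
    obtain c where c: "u = lincomb b1 c" using basis_of_coords[OF b1(1), of u] by blast
    obtain d where d: "v = lincomb b1 d" using basis_of_coords[OF b1(1), of v] by blast
    have "\<sigma>2 * \<omega> (a u) (a v) = (\<Sum>x\<in>UNIV. c $ x * (\<Sum>y\<in>UNIV. d $ y * (\<sigma>2 * \<omega> (b2 x) (b2 y))))"
      by (simp add: c d lincomb_image[OF a(1)] a(2) expand sum_distrib_left mult_ac)
    also have "\<dots> = \<sigma>1 * \<omega> u v"
      unfolding eq by (simp add: c d expand sum_distrib_left mult_ac)
    finally show ?thesis .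
  qed
  have nz: "\<sigma>1 \<noteq> 0" "\<sigma>2 \<noteq> 0" "\<sigma>2 * \<sigma>2 = 1" using \<sigma> by auto
  have "inj a"
    unfolding linear_injective_0[OF a(1)]
  proof (intro allI impI)
    fix u assume "a u = 0"
    then have "\<omega> u v = 0" for v using inv[of u v] nz by (simp add: zero_left)
    then show "u = 0" using \<omega> by (simp add: symplectic_form_def)
  qed
  then have "bij a" using linear_injective_imp_surjective[OF a(1)] by (simp add: bij_def)
  moreover have "\<omega> (a u) (a v) = (\<sigma>2 * \<sigma>1) * \<omega> u v" for u v
    using inv[of u v] nz(3) by (metis mult.assoc mult_1)
  ultimately show ?thesis
    unfolding CSp_def using a(1) nz(1,2) by (intro CollectI conjI exI[of _ "\<sigma>2 * \<sigma>1"]) auto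
qed

section \<open>From equivalent reduced Cartan matrices to congruent curves\<close>

lemma oriented_form_sign:
  obtains \<sigma> where "\<sigma> = 1 \<or> \<sigma> = -1" "oriented_form \<omega> \<Gamma> I = (\<lambda>u v. \<sigma> * \<omega> u v)"
proof (cases "\<forall>t\<in>I. negative_definite_on (\<Gamma> t) (velocity_form \<omega> \<Gamma> t)")
  case True
  then show ?thesis by (intro that[of "-1"]) (simp_all add: oriented_form_def)
next
  case False
  then show ?thesis by (intro that[of 1]) (simp_all add: oriented_form_def if_not_P)
qed

lemma jacobi_arc_density_pos:
  "jacobi_curve TYPE('n::{finite,linorder}) \<omega> \<Gamma> I \<Longrightarrow> t \<in> I \<Longrightarrow> arc_density TYPE('n) \<omega> \<Gamma> t > 0"
  by (simp add: arc_density_def jacobi_curve_def)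

lemma pos_derivative_inj_on:
  fixes \<phi> :: "real \<Rightarrow> real"
  assumes "is_interval I" "\<And>t. t \<in> I \<Longrightarrow> (\<phi> has_real_derivative \<zeta> t) (at t)" "\<And>t. t \<in> I \<Longrightarrow> \<zeta> t > 0"
  shows "inj_on \<phi> I"
proof (rule inj_onI)
  have less: "\<phi> s < \<phi> t" if "s \<in> I" "t \<in> I" "s < t" for s t
  proof (rule DERIV_pos_imp_increasing[OF that(3)])
    fix r assume "s \<le> r" "r \<le> t"
    then have "r \<in> I" using assms(1) that unfolding is_interval_1 by blast
    then show "\<exists>y. DERIV \<phi> r :> y \<and> y > 0" using assms(2,3) by blast
  qed
  fix s t assume "s \<in> I" "t \<in> I" "\<phi> s = \<phi> t"
  then show "s = t" using less[of s t] less[of t s] by (cases s t rule: linorder_cases) auto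
qed

text \<open>The Frenet frame of the curve in arc parameter is pulled back to t; the chain rule
  multiplies the structure matrix by the arc density. In this form two curves with the same density
  are compared without reference to their arc parameters.\<close>

lemma reduced_cartan_moving_frame:
  fixes \<omega> :: "'w::euclidean_space \<Rightarrow> 'w \<Rightarrow> real" and C :: "real \<Rightarrow> real^('n::{finite,linorder} + 'n)^('n + 'n)"
  assumes jac: "jacobi_curve TYPE('n::{finite,linorder}) \<omega> \<Gamma> I" and red: "reduced_cartan_matrix \<omega> \<Gamma> I C"
  obtains \<sigma> and G :: "real \<Rightarrow> 'n::{finite,linorder} + 'n::{finite,linorder} \<Rightarrow> 'w" where "\<sigma> = 1 \<or> \<sigma> = -1"
    "\<And>t. t \<in> I \<Longrightarrow> symplectic_basis (\<lambda>u v. \<sigma> * \<omega> u v) (G t)"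
    "\<And>t. t \<in> I \<Longrightarrow> basis_of (\<lambda>i. G t (Inl i)) (\<Gamma> t)"
    "\<And>t x. t \<in> I \<Longrightarrow> ((\<lambda>s. G s x) has_vector_derivative
        lincomb (G t) (column x (arc_density TYPE('n) \<omega> \<Gamma> t *\<^sub>R C t))) (at t)"
proof -
  let ?\<zeta> = "arc_density TYPE('n) \<omega> \<Gamma>"
  obtain \<phi> where d\<phi>: "\<And>t. t \<in> I \<Longrightarrow> (\<phi> has_real_derivative ?\<zeta> t) (at t)"
    and arc: "arc_cartan_matrix \<omega> (\<Gamma> \<circ> inv_into I \<phi>) (\<phi> ` I) (C \<circ> inv_into I \<phi>)"
    using red by (auto simp: reduced_cartan_matrix_def)
  have I: "is_interval I" using jac by (simp add: jacobi_curve_def open_interval_def)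
  have inj: "inj_on \<phi> I" by (rule pos_derivative_inj_on[OF I d\<phi> jacobi_arc_density_pos[OF jac]])
  obtain \<sigma> where \<sigma>: "\<sigma> = 1 \<or> \<sigma> = -1"
    "oriented_form \<omega> (\<Gamma> \<circ> inv_into I \<phi>) (\<phi> ` I) = (\<lambda>u v. \<sigma> * \<omega> u v)" by (rule oriented_form_sign)
  obtain F :: "real \<Rightarrow> 'n + 'n \<Rightarrow> 'w" where
    F: "frenet_frame (\<lambda>u v. \<sigma> * \<omega> u v) (\<Gamma> \<circ> inv_into I \<phi>) (\<phi> ` I) F" and
    dF: "\<And>\<tau> j. \<tau> \<in> \<phi> ` I \<Longrightarrow> ((\<lambda>s. F s j) has_vector_derivative
       (\<Sum>i\<in>UNIV. (C \<circ> inv_into I \<phi>) \<tau> $ i $ j *\<^sub>R F \<tau> i)) (at \<tau>)"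
    using arc unfolding arc_cartan_matrix_def \<sigma>(2) by blast
  show ?thesis
  proof (rule that[OF \<sigma>(1), of "\<lambda>t. F (\<phi> t)"])
    fix t assume t: "t \<in> I"
    show "symplectic_basis (\<lambda>u v. \<sigma> * \<omega> u v) (F (\<phi> t))" using F t by (auto simp: frenet_frame_def)
    show "basis_of (\<lambda>i. F (\<phi> t) (Inl i)) (\<Gamma> t)" using F t inj by (auto simp: frenet_frame_def)
    fix x
    have "(\<phi> has_vector_derivative ?\<zeta> t) (at t)"
      using d\<phi>[OF t] by (simp add: has_real_derivative_iff_has_vector_derivative)
    from vector_diff_chain_at[OF this dF[of "\<phi> t" x]] t inj
    have "((\<lambda>s. F (\<phi> s) x) has_vector_derivative ?\<zeta> t *\<^sub>R (\<Sum>i\<in>UNIV. C t $ i $ x *\<^sub>R F (\<phi> t) i)) (at t)"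
      by (simp add: o_def)
    then show "((\<lambda>s. F (\<phi> s) x) has_vector_derivative lincomb (F (\<phi> t)) (column x (?\<zeta> t *\<^sub>R C t))) (at t)"
      by (simp add: column_linear lincomb_linear) (simp add: lincomb_def column_def)
  qed
qed

lemma diagonal_matrix_conjugate:
  fixes P A :: "real^'n^'n"
  assumes "diagonal_matrix P" shows "(P ** A ** P) $ i $ j = P $ i $ i * A $ i $ j * P $ j $ j"
proof -
  have l: "(P ** B) $ i $ j = P $ i $ i * B $ i $ j" for B :: "real^'n^'n" and i j
  proof -
    have "(\<Sum>k\<in>UNIV. P $ i $ k * B $ k $ j) = (\<Sum>k\<in>UNIV. if k = i then P $ i $ i * B $ i $ j else 0)"
      using assms by (intro sum.cong) (auto simp: diagonal_matrix_def)
    then show ?thesis by (simp add: matrix_matrix_mult_def)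
  qed
  have "(B ** P) $ i $ j = B $ i $ j * P $ j $ j" for B :: "real^'n^'n" and i j
  proof -
    have "(\<Sum>k\<in>UNIV. B $ i $ k * P $ k $ j) = (\<Sum>k\<in>UNIV. if k = j then B $ i $ j * P $ j $ j else 0)"
      using assms by (intro sum.cong) (auto simp: diagonal_matrix_def)
    then show ?thesis by (simp add: matrix_matrix_mult_def)
  qed
  then show ?thesis using l by simp
qed

text \<open>Changing the signs of the second frame by the constant matrix P gives it the structure
  equation of the first, and the intertwining map is the required conformal map.\<close>

lemma equivalent_cartan_imp_congruent:
  fixes \<omega> :: "'w::euclidean_space \<Rightarrow> 'w \<Rightarrow> real" and C C' :: "real \<Rightarrow> real^('n::{finite,linorder} + 'n)^('n + 'n)"
  assumes \<omega>: "symplectic_form \<omega>" and jac: "jacobi_curve TYPE('n::{finite,linorder}) \<omega> \<Gamma> I" "jacobi_curve TYPE('n) \<omega> \<Gamma>' I"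
    and arc: "\<forall>t\<in>I. arc_density TYPE('n) \<omega> \<Gamma> t = arc_density TYPE('n) \<omega> \<Gamma>' t"
    and red: "reduced_cartan_matrix \<omega> \<Gamma> I C" "reduced_cartan_matrix \<omega> \<Gamma>' I C'"
    and eqv: "cartan_equivalent I C C'"
  shows "CSp_congruent \<omega> \<Gamma> \<Gamma>' I"
proof -
  let ?\<zeta> = "arc_density TYPE('n) \<omega> \<Gamma>"
  have I: "open I" "is_interval I" "I \<noteq> {}" using jac(1) by (auto simp: jacobi_curve_def open_interval_def)
  obtain \<sigma>1 and G1 :: "real \<Rightarrow> 'n + 'n \<Rightarrow> 'w" where \<sigma>1: "\<sigma>1 = 1 \<or> \<sigma>1 = -1"
    and sb1: "\<And>t. t \<in> I \<Longrightarrow> symplectic_basis (\<lambda>u v. \<sigma>1 * \<omega> u v) (G1 t)"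
    and b1: "\<And>t. t \<in> I \<Longrightarrow> basis_of (\<lambda>i. G1 t (Inl i)) (\<Gamma> t)"
    and d1: "\<And>t x. t \<in> I \<Longrightarrow> ((\<lambda>s. G1 s x) has_vector_derivative lincomb (G1 t) (column x (?\<zeta> t *\<^sub>R C t))) (at t)"
    by (rule reduced_cartan_moving_frame[OF jac(1) red(1)], rule that)
  obtain \<sigma>2 and G2 :: "real \<Rightarrow> 'n + 'n \<Rightarrow> 'w" where \<sigma>2: "\<sigma>2 = 1 \<or> \<sigma>2 = -1"
    and sb2: "\<And>t. t \<in> I \<Longrightarrow> symplectic_basis (\<lambda>u v. \<sigma>2 * \<omega> u v) (G2 t)"
    and b2: "\<And>t. t \<in> I \<Longrightarrow> basis_of (\<lambda>i. G2 t (Inl i)) (\<Gamma>' t)"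
    and d2: "\<And>t x. t \<in> I \<Longrightarrow> ((\<lambda>s. G2 s x) has_vector_derivative
        lincomb (G2 t) (column x (arc_density TYPE('n) \<omega> \<Gamma>' t *\<^sub>R C' t))) (at t)"
    by (rule reduced_cartan_moving_frame[OF jac(2) red(2)], rule that)
  obtain P S K S' K' where P: "diagonal_matrix P" "\<And>i. P $ i $ i = 1 \<or> P $ i $ i = -1"
    and blk: "\<And>t. t \<in> I \<Longrightarrow> C t = cartan_block (S t) (K t)" "\<And>t. t \<in> I \<Longrightarrow> C' t = cartan_block (S' t) (K' t)"
      "\<And>t. t \<in> I \<Longrightarrow> K' t = P ** K t ** P" "\<And>t. t \<in> I \<Longrightarrow> S' t = P ** S t ** P"
    using eqv unfolding cartan_equivalent_def by metis
  \<comment> \<open>P acts with the same sign on f i and on its partner h i, which preserves the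
    symplectic pairing and, as P^2 = 1, the identity block.\<close>
  define p where "p x = (case x of Inl i \<Rightarrow> P $ i $ i | Inr i \<Rightarrow> P $ i $ i)" for x
  have p2: "P $ i $ i * P $ i $ i = 1" for i using P(2)[of i] by auto
  have pp: "p x * p x = 1" for x by (cases x) (simp_all add: p_def p2)
  have CC: "C' t $ x $ y = p x * C t $ x $ y * p y" if t: "t \<in> I" for t x y
    by (cases x; cases y)
       (auto simp: blk[OF t] cartan_block_def p_def diagonal_matrix_conjugate[OF P(1)] mat_def p2)
  define G3 where "G3 t x = p x *\<^sub>R G2 t x" for t x
  have \<sigma>nz: "\<sigma>1 \<noteq> 0" using \<sigma>1 by auto
  note w1 = symplectic_scale[OF \<omega> \<sigma>nz]
  have d3: "((\<lambda>s. G3 s x) has_vector_derivative lincomb (G3 t) (column x (?\<zeta> t *\<^sub>R C t))) (at t)" if t: "t \<in> I" for t x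
  proof -
    have "((\<lambda>s. G3 s x) has_vector_derivative p x *\<^sub>R lincomb (G2 t) (column x (?\<zeta> t *\<^sub>R C' t))) (at t)"
      unfolding G3_def using bounded_linear.has_vector_derivative[OF bounded_linear_scaleR_right d2[OF t]] arc t by simp
    moreover have "p x *\<^sub>R lincomb (G2 t) (column x (?\<zeta> t *\<^sub>R C' t)) = lincomb (G3 t) (column x (?\<zeta> t *\<^sub>R C t))"
    proof -
      have e: "p x * (?\<zeta> t * (p y * C t $ y $ x * p x)) = ?\<zeta> t * C t $ y $ x * p y" for y
        using pp[of x] by (simp add: mult_ac)
      show ?thesis
        by (simp add: lincomb_def column_def G3_def CC[OF t] scaleR_sum_right e)
    qed
    ultimately show ?thesis by metis
  qed
  obtain t0 where t0: "t0 \<in> I" using I(3) by blast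
  obtain a where a: "linear a" "\<And>t x. t \<in> I \<Longrightarrow> a (G1 t x) = G3 t x"
    by (rule frame_intertwiner[OF w1 I(1,2) t0 sb1 d1 d3], assumption, assumption, assumption, rule that)
  have sb3: "symplectic_basis (\<lambda>u v. \<sigma>2 * \<omega> u v) (G3 t0)"
  proof -
    interpret bounded_bilinear \<omega> by (rule symplectic_bilinear[OF \<omega>])
    have "\<sigma>2 \<noteq> 0" using \<sigma>2 by auto
    note w2 = symplectic_scale[OF \<omega> this]
    note s = symplectic_basisD[OF sb2[OF t0]]
    have dimw: "DIM('w) = 2 * CARD('n)" using basis_of_dim[OF s(1)] by (simp add: card_UNIV_sum)
    have s': "\<omega> (G2 t0 (Inl i)) (G2 t0 (Inl j)) = 0" "\<omega> (G2 t0 (Inr i)) (G2 t0 (Inr j)) = 0" for i j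
      using s(2,3)[of i j] \<open>\<sigma>2 \<noteq> 0\<close> by auto
    show ?thesis
    proof (rule symplectic_basisI[OF w2 dimw])
      show "\<sigma>2 * \<omega> (G3 t0 (Inl i)) (G3 t0 (Inl j)) = 0" "\<sigma>2 * \<omega> (G3 t0 (Inr i)) (G3 t0 (Inr j)) = 0" for i j
        by (simp_all add: G3_def scaleR_left scaleR_right s')
      show "\<sigma>2 * \<omega> (G3 t0 (Inl i)) (G3 t0 (Inr j)) = (if i = j then 1 else 0)" for i j
      proof -
        have "\<sigma>2 * \<omega> (G3 t0 (Inl i)) (G3 t0 (Inr j)) = P $ i $ i * P $ j $ j * (\<sigma>2 * \<omega> (G2 t0 (Inl i)) (G2 t0 (Inr j)))"
          by (simp add: G3_def p_def scaleR_left scaleR_right mult_ac)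
        then show ?thesis unfolding s(4) by (simp add: p2)
      qed
    qed
  qed
  have aCSp: "a \<in> CSp \<omega>"
    by (rule symplectic_basis_map_CSp[OF \<omega> \<sigma>1 \<sigma>2 sb1[OF t0] sb3 a(1)]) (rule a(2)[OF t0])
  have "a ` \<Gamma> t = \<Gamma>' t" if t: "t \<in> I" for t
  proof (rule subspace_dim_equal)
    show "subspace (a ` \<Gamma> t)" by (rule linear_subspace_image[OF a(1) basis_of_subspace[OF b1[OF t]]])
    show sub: "subspace (\<Gamma>' t)" by (rule basis_of_subspace[OF b2[OF t]])
    show "a ` \<Gamma> t \<subseteq> \<Gamma>' t"
    proof
      fix y assume "y \<in> a ` \<Gamma> t"
      then obtain c where "y = a (lincomb (\<lambda>i. G1 t (Inl i)) c)" using basis_of_span[OF b1[OF t]] by auto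
      then have "y = lincomb (\<lambda>i. G3 t (Inl i)) c" by (simp add: lincomb_image[OF a(1)] a(2)[OF t])
      then show "y \<in> \<Gamma>' t"
        unfolding lincomb_def G3_def
        using basis_of_in(1)[OF b2[OF t]] by (auto intro!: subspace_sum[OF sub] subspace_scale[OF sub])
    qed
    have "inj a" using aCSp by (auto simp: CSp_def bij_def)
    then have "dim (a ` \<Gamma> t) = dim (\<Gamma> t)" by (intro dim_image_eq[OF a(1)]) (auto intro: inj_on_subset)
    then show "dim (\<Gamma>' t) \<le> dim (a ` \<Gamma> t)" using basis_of_dim[OF b1[OF t]] basis_of_dim[OF b2[OF t]] by simp
  qed
  then show ?thesis using aCSp by (auto simp: CSp_congruent_def)
qed


section \<open>Arc parameters\<close>

lemma smooth_antiderivative: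
  assumes "open S" "\<And>t. t \<in> S \<Longrightarrow> (f has_vector_derivative f' t) (at t)" "smooth_on_line f' S"
  shows "smooth_on_line f S"
proof -
  have "ksmooth k f S" for k
    using ksmooth_SucI[OF assms(1,2)] assms(3) ksmooth_SucD(3) unfolding smooth_iff_ksmooth by blast
  then show ?thesis by (simp add: smooth_iff_ksmooth)
qed

lemma smooth_abs_powr:
  fixes f :: "real \<Rightarrow> real"
  assumes "open S" "smooth_on_line f S" "\<And>t. t \<in> S \<Longrightarrow> f t \<noteq> 0"
  shows "smooth_on_line (\<lambda>t. \<bar>f t\<bar> powr a) S"
proof (rule smooth_cong[OF assms(1)])
  \<comment> \<open>The absolute value is avoided by taking a power of the square, which is positive
    and smooth.\<close>
  show "(f t * f t) powr (a / 2) = \<bar>f t\<bar> powr a" if "t \<in> S" for t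
  proof -
    have e: "f t * f t = \<bar>f t\<bar> powr 2" using assms(3)[OF that] by (simp add: power2_eq_square)
    show ?thesis unfolding e powr_powr by simp
  qed
  show "smooth_on_line (\<lambda>t. (f t * f t) powr (a / 2)) S"
    by (intro smooth_powr smooth_mult assms) (use assms(3) not_real_square_gt_zero in blast)
qed

lemma arc_parameter:
  fixes \<zeta> :: "real \<Rightarrow> real"
  assumes I: "open_interval I" and \<zeta>: "smooth_on_line \<zeta> I" "\<And>t. t \<in> I \<Longrightarrow> \<zeta> t > 0"
  obtains \<phi> where "\<And>t. t \<in> I \<Longrightarrow> (\<phi> has_real_derivative \<zeta> t) (at t)" "smooth_on_line \<phi> I"
    "inj_on \<phi> I" "open_interval (\<phi> ` I)" "smooth_on_line (inv_into I \<phi>) (\<phi> ` I)"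
    "\<And>\<tau>. \<tau> \<in> \<phi> ` I \<Longrightarrow> vderiv (inv_into I \<phi>) \<tau> > 0"
proof -
  have I': "open I" "is_interval I" "I \<noteq> {}" using I by (auto simp: open_interval_def)
  obtain t0 where t0: "t0 \<in> I" using I'(3) by blast
  obtain \<phi> where \<phi>: "\<And>t. t \<in> I \<Longrightarrow> (\<phi> has_vector_derivative \<zeta> t) (at t)"
    using antiderivative_open_interval[OF I'(1,2) smooth_continuous_on[OF \<zeta>(1)] t0] by metis
  have d: "(\<phi> has_real_derivative \<zeta> t) (at t)" if "t \<in> I" for t
    using \<phi>[OF that] by (simp add: has_real_derivative_iff_has_vector_derivative)
  have s: "smooth_on_line \<phi> I" by (rule smooth_antiderivative[OF I'(1) \<phi> \<zeta>(1)])
  have inj: "inj_on \<phi> I" by (rule pos_derivative_inj_on[OF I'(2) d \<zeta>(2)])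
  have vd: "vderiv \<phi> t = \<zeta> t" if "t \<in> I" for t using vderiv_eqI[OF \<phi>[OF that]] .
  have nz: "vderiv \<phi> t \<noteq> 0" if "t \<in> I" for t using vd[OF that] \<zeta>(2)[OF that] by simp
  note inv = smooth_inv_into[OF I'(1) s inj nz]
  have "connected (\<phi> ` I)"
    using connected_continuous_image[OF smooth_continuous_on[OF s]] I'(2) is_interval_connected by blast
  then have "open_interval (\<phi> ` I)"
    using inv(1) I'(3) by (simp add: open_interval_def is_interval_connected_1)
  moreover have "vderiv (inv_into I \<phi>) \<tau> > 0" if "\<tau> \<in> \<phi> ` I" for \<tau>
    using that inv(3) vd \<zeta>(2) by auto
  ultimately show ?thesis using that[OF d s inj] inv(2) by blast
qed

section \<open>Invariance under reparametrisation and conformal maps\<close>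

text \<open>A multiple of the identity shifts every entry and the mean alike, so the Schwarzian term
  of a reparametrisation drops out. The factor r = \<phi>'^2 contributes \<phi>'^(2n), whose root of
  order 2n is the |\<phi>'| by which the arc density has to change.\<close>

lemma deviation_product_affine:
  fixes A :: "real^'n^'n"
  shows "deviation_product (r *\<^sub>R A + \<rho> *\<^sub>R mat 1) = r ^ CARD('n) * deviation_product A"
proof -
  have "(\<Sum>j\<in>UNIV. (r *\<^sub>R A + \<rho> *\<^sub>R mat 1) $ j $ j) / real CARD('n) =
      r * ((\<Sum>j\<in>UNIV. A $ j $ j) / real CARD('n)) + \<rho>"
    by (simp add: mat_def sum.distrib sum_distrib_left[symmetric] add_divide_distrib)
  then have "2 * ((r *\<^sub>R A + \<rho> *\<^sub>R mat 1) $ i $ i - (\<Sum>j\<in>UNIV. (r *\<^sub>R A + \<rho> *\<^sub>R mat 1) $ j $ j) / real CARD('n)) =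
      r * (2 * (A $ i $ i - (\<Sum>j\<in>UNIV. A $ j $ j) / real CARD('n)))" for i
    by (simp add: mat_def algebra_simps)
  then show ?thesis unfolding deviation_product_def by (simp only: prod.distrib prod_constant card_UNIV)
qed

lemma diagonal_frame_reparam:
  fixes F :: "real \<Rightarrow> 'n::{finite,linorder} + 'n \<Rightarrow> 'w::euclidean_space"
  assumes \<omega>: "symplectic_form \<omega>" and dim: "DIM('w) = 2 * CARD('n::{finite,linorder})"
    and df: "diagonal_frame \<omega> \<Gamma> I F S K"
    and J: "open J" and \<phi>: "smooth_on_line \<phi> J" "\<And>t. t \<in> J \<Longrightarrow> \<phi> t \<in> I"
    and \<sigma>: "\<sigma> = 1 \<or> \<sigma> = -1" "\<And>t. t \<in> J \<Longrightarrow> \<sigma> * vderiv \<phi> t > 0"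
  obtains F' :: "real \<Rightarrow> 'n::{finite,linorder} + 'n::{finite,linorder} \<Rightarrow> 'w" and S' K' where "diagonal_frame (\<lambda>u v. \<sigma> * \<omega> u v) (\<Gamma> \<circ> \<phi>) J F' S' K'"
    "\<And>t. t \<in> J \<Longrightarrow> deviation_product (K' t) = ((vderiv \<phi> t)\<^sup>2) ^ CARD('n) * deviation_product (K (\<phi> t))"
proof -
  have fr: "cartan_frame \<omega> \<Gamma> I F S K" using df by (simp add: diagonal_frame_def)
  obtain F' :: "real \<Rightarrow> 'n + 'n \<Rightarrow> 'w" and \<rho> where
    fr': "cartan_frame (\<lambda>u v. \<sigma> * \<omega> u v) (\<Gamma> \<circ> \<phi>) J F' (\<lambda>t. vderiv \<phi> t *\<^sub>R S (\<phi> t))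
    (\<lambda>t. (vderiv \<phi> t)\<^sup>2 *\<^sub>R K (\<phi> t) + \<rho> t *\<^sub>R mat 1)"
    by (rule cartan_frame_reparam[OF \<omega> dim fr J \<phi> \<sigma>], assumption, assumption, rule that)
  show ?thesis
  proof (rule that[OF _ deviation_product_affine])
    have "vderiv \<phi> t \<noteq> 0" if "t \<in> J" for t using \<sigma>(2)[OF that] by auto
    then show "diagonal_frame (\<lambda>u v. \<sigma> * \<omega> u v) (\<Gamma> \<circ> \<phi>) J F' (\<lambda>t. vderiv \<phi> t *\<^sub>R S (\<phi> t))
      (\<lambda>t. (vderiv \<phi> t)\<^sup>2 *\<^sub>R K (\<phi> t) + \<rho> t *\<^sub>R mat 1)"
      using fr' df \<phi>(2) by (auto simp: diagonal_frame_def diagonal_matrix_def mat_def)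
  qed
qed

lemma jacobi_deviation_nonzero:
  fixes K :: "real \<Rightarrow> real^('n::{finite,linorder})^('n::{finite,linorder})"
  assumes "symplectic_form \<omega>" "\<sigma> = 1 \<or> \<sigma> = -1" "diagonal_frame (\<lambda>u v. \<sigma> * \<omega> u v) \<Gamma> I F S K"
    and "jacobi_curve TYPE('n::{finite,linorder}) \<omega> \<Gamma> I" "t \<in> I"
  shows "deviation_product (K t) \<noteq> 0"
  using diagonal_frame_traceless_det[OF assms(1-3,5)] assms(4,5) by (auto simp: jacobi_curve_def)

text \<open>A decreasing change of parameter reverses the sign of the velocity form; \<epsilon>
  records this and is absorbed into the sign of the form.\<close>

lemma jacobi_reparam:
  fixes \<omega> :: "'w::euclidean_space \<Rightarrow> 'w \<Rightarrow> real"
  assumes \<omega>: "symplectic_form \<omega>" and dim: "DIM('w) = 2 * CARD('n::{finite,linorder})"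
    and jac: "jacobi_curve TYPE('n::{finite,linorder}) \<omega> \<Gamma> I"
    and J: "open_interval J" and \<phi>: "change_of_parameter \<phi> J I"
  shows "jacobi_curve TYPE('n::{finite,linorder}) \<omega> (\<Gamma> \<circ> \<phi>) J"
proof -
  obtain \<sigma> and F :: "real \<Rightarrow> 'n + 'n \<Rightarrow> 'w" and S K where \<sigma>: "\<sigma> = 1 \<or> \<sigma> = -1"
    and df: "diagonal_frame (\<lambda>u v. \<sigma> * \<omega> u v) \<Gamma> I F S K"
    by (rule jacobi_diagonal_frame[OF \<omega> dim jac])
  have J': "open J" "is_interval J" using J by (auto simp: open_interval_def)
  have s\<phi>: "smooth_on_line \<phi> J" and map: "\<And>t. t \<in> J \<Longrightarrow> \<phi> t \<in> I" and nz: "\<And>t. t \<in> J \<Longrightarrow> vderiv \<phi> t \<noteq> 0"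
    using \<phi> by (auto simp: change_of_parameter_def bij_betw_def)
  obtain \<epsilon> where \<epsilon>: "\<epsilon> = 1 \<or> \<epsilon> = -1" "\<And>t. t \<in> J \<Longrightarrow> \<epsilon> * vderiv \<phi> t > 0"
    using nonzero_continuous_sign[OF J'(2) smooth_continuous_on[OF smooth_D(2)[OF s\<phi>]] nz] by metis
  have "\<sigma> \<noteq> 0" using \<sigma> by auto
  note w = symplectic_scale[OF \<omega> this]
  obtain F' :: "real \<Rightarrow> 'n + 'n \<Rightarrow> 'w" and S' K' where
    df': "diagonal_frame (\<lambda>u v. \<epsilon> * (\<sigma> * \<omega> u v)) (\<Gamma> \<circ> \<phi>) J F' S' K'" and
    dev: "\<And>t. t \<in> J \<Longrightarrow> deviation_product (K' t) = ((vderiv \<phi> t)\<^sup>2) ^ CARD('n) * deviation_product (K (\<phi> t))"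
    by (rule diagonal_frame_reparam[OF w dim df J'(1) s\<phi> map \<epsilon>], assumption, assumption, rule that)
  have "\<epsilon> * \<sigma> = 1 \<or> \<epsilon> * \<sigma> = -1" using \<sigma> \<epsilon>(1) by auto
  then show ?thesis
  proof (rule diagonal_frame_jacobi[OF \<omega> _ _ J])
    show "diagonal_frame (\<lambda>u v. \<epsilon> * \<sigma> * \<omega> u v) (\<Gamma> \<circ> \<phi>) J F' S' K'" using df' by (simp add: mult.assoc)
    show "deviation_product (K' t) \<noteq> 0" if "t \<in> J" for t
      using dev[OF that] nz[OF that] jacobi_deviation_nonzero[OF \<omega> \<sigma> df jac map[OF that]] by simp
  qed
qed

lemma cartan_equivalent_refl: "(\<And>t. t \<in> I \<Longrightarrow> C t = cartan_block (S t) (K t)) \<Longrightarrow> cartan_equivalent I C C"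
  unfolding cartan_equivalent_def
  by (rule exI[of _ "mat 1"], rule exI[of _ S], rule exI[of _ K], rule exI[of _ S], rule exI[of _ K])
     (simp, simp add: diagonal_matrix_def mat_def)

lemma smooth_deviation_product:
  fixes K :: "real \<Rightarrow> real^'n^'n"
  assumes "open I" "smooth_on_line K I"
  shows "smooth_on_line (\<lambda>t. deviation_product (K t)) I"
proof -
  have e: "smooth_on_line (\<lambda>t. K t $ i $ j) I" for i j by (intro smooth_vec_nth assms)
  show ?thesis unfolding deviation_product_def divide_inverse
    by (intro smooth_prod smooth_mult smooth_const smooth_diff smooth_sum assms(1) e)
qed

text \<open>The image of a diagonal frame has the same S and K. Hence the arc densities agree, one
  arc parameter serves both curves, and one and the same matrix C is a reduced Cartan matrix of
  both.\<close>

lemma congruent_imp_equivalent_cartan: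
  fixes \<omega> :: "'w::euclidean_space \<Rightarrow> 'w \<Rightarrow> real"
  assumes \<omega>: "symplectic_form \<omega>" and dim: "DIM('w) = 2 * CARD('n::{finite,linorder})"
    and jac: "jacobi_curve TYPE('n::{finite,linorder}) \<omega> \<Gamma> I" and con: "CSp_congruent \<omega> \<Gamma> \<Gamma>' I"
  shows "\<forall>t\<in>I. arc_density TYPE('n) \<omega> \<Gamma> t = arc_density TYPE('n) \<omega> \<Gamma>' t"
    "equivalent_cartan_matrices TYPE('n) \<omega> \<Gamma> \<Gamma>' I"
proof -
  obtain a l where a: "linear a" and l: "l \<noteq> 0" "\<And>u v. \<omega> (a u) (a v) = l * \<omega> u v"
    and \<Gamma>': "\<And>t. t \<in> I \<Longrightarrow> \<Gamma>' t = a ` \<Gamma> t"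
    using con by (auto simp: CSp_congruent_def CSp_def)
  have oI: "open_interval I" using jac by (simp add: jacobi_curve_def)
  then have I: "open I" "I \<noteq> {}" by (auto simp: open_interval_def)
  obtain \<sigma> and F :: "real \<Rightarrow> 'n + 'n \<Rightarrow> 'w" and S K where \<sigma>: "\<sigma> = 1 \<or> \<sigma> = -1"
    and df: "diagonal_frame (\<lambda>u v. \<sigma> * \<omega> u v) \<Gamma> I F S K"
    by (rule jacobi_diagonal_frame[OF \<omega> dim jac])
  have \<sigma>l: "\<sigma> * sgn l = 1 \<or> \<sigma> * sgn l = -1" using \<sigma> l(1) by (auto simp: sgn_if)
  have image: "\<exists>F'. diagonal_frame (\<lambda>u v. \<sigma> * sgn l * \<omega> u v) \<Delta>' J F' S K"
    if "diagonal_frame (\<lambda>u v. \<sigma> * \<omega> u v) \<Delta> J F S K" "\<And>t. t \<in> J \<Longrightarrow> \<Delta>' t = a ` \<Delta> t"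
    for F :: "real \<Rightarrow> 'n + 'n \<Rightarrow> 'w" and S K \<Delta> \<Delta>' J
  proof -
    have "cartan_frame (\<lambda>u v. \<sigma> * sgn l * \<omega> u v) \<Delta>' J (\<lambda>t x. (1 / sqrt \<bar>l\<bar>) *\<^sub>R a (F t x)) S K"
      by (rule cartan_frame_image[OF \<omega> dim \<sigma> _ a l, where \<Gamma> = \<Delta>]) (use that in \<open>auto simp: diagonal_frame_def\<close>)
    then show ?thesis using that(1) by (auto simp: diagonal_frame_def)
  qed
  obtain F1 where df1: "diagonal_frame (\<lambda>u v. \<sigma> * sgn l * \<omega> u v) \<Gamma>' I F1 S K" using image[OF df \<Gamma>'] by blast
  have arc: "arc_density TYPE('n) \<omega> \<Gamma> t = \<bar>deviation_product (K t)\<bar> powr (1 / (2 * real CARD('n)))"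
    and arc': "arc_density TYPE('n) \<omega> \<Gamma>' t = \<bar>deviation_product (K t)\<bar> powr (1 / (2 * real CARD('n)))"
    if "t \<in> I" for t
    using diagonal_frame_arc_density[OF \<omega> \<sigma> df that] diagonal_frame_arc_density[OF \<omega> \<sigma>l df1 that] by auto
  then show same: "\<forall>t\<in>I. arc_density TYPE('n) \<omega> \<Gamma> t = arc_density TYPE('n) \<omega> \<Gamma>' t" by simp
  have "smooth_on_line K I" using df by (simp add: diagonal_frame_def cartan_frame_def)
  then have "smooth_on_line (\<lambda>t. \<bar>deviation_product (K t)\<bar> powr (1 / (2 * real CARD('n)))) I"
    by (intro smooth_abs_powr I(1) smooth_deviation_product jacobi_deviation_nonzero[OF \<omega> \<sigma> df jac])
  then have s\<zeta>: "smooth_on_line (arc_density TYPE('n) \<omega> \<Gamma>) I"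
    by (rule smooth_cong[OF I(1), rotated]) (simp add: arc)
  obtain \<phi> where d\<phi>: "\<And>t. t \<in> I \<Longrightarrow> (\<phi> has_real_derivative arc_density TYPE('n) \<omega> \<Gamma> t) (at t)"
    and "smooth_on_line \<phi> I" and inj: "inj_on \<phi> I" and J: "open_interval (\<phi> ` I)"
    and s\<psi>: "smooth_on_line (inv_into I \<phi>) (\<phi> ` I)" and d\<psi>: "\<And>\<tau>. \<tau> \<in> \<phi> ` I \<Longrightarrow> vderiv (inv_into I \<phi>) \<tau> > 0"
    by (rule arc_parameter[OF oI s\<zeta> jacobi_arc_density_pos[OF jac]], assumption, rule that)
  let ?\<psi> = "inv_into I \<phi>" and ?J = "\<phi> ` I"
  have "\<sigma> \<noteq> 0" using \<sigma> by auto
  note w = symplectic_scale[OF \<omega> this]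
  have J': "open ?J" "?J \<noteq> {}" using J by (auto simp: open_interval_def)
  have \<psi>I: "?\<psi> \<tau> \<in> I" if "\<tau> \<in> ?J" for \<tau> using that by (rule inv_into_into)
  obtain F2 :: "real \<Rightarrow> 'n + 'n \<Rightarrow> 'w" and S2 K2 where
    df2': "diagonal_frame (\<lambda>u v. 1 * (\<sigma> * \<omega> u v)) (\<Gamma> \<circ> ?\<psi>) ?J F2 S2 K2" and
    "\<And>t. t \<in> ?J \<Longrightarrow> deviation_product (K2 t) = ((vderiv ?\<psi> t)\<^sup>2) ^ CARD('n) * deviation_product (K (?\<psi> t))"
  proof (rule diagonal_frame_reparam[OF w dim df J'(1) s\<psi>, of 1])
    show "?\<psi> t \<in> I" if "t \<in> ?J" for t using \<psi>I that .
    show "1 * vderiv ?\<psi> t > 0" if "t \<in> ?J" for t using d\<psi>[OF that] by simp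
  qed (use that in auto)
  then have df2: "diagonal_frame (\<lambda>u v. \<sigma> * \<omega> u v) (\<Gamma> \<circ> ?\<psi>) ?J F2 S2 K2" by simp
  obtain F3 where df3: "diagonal_frame (\<lambda>u v. \<sigma> * sgn l * \<omega> u v) (\<Gamma>' \<circ> ?\<psi>) ?J F3 S2 K2"
    using image[OF df2, of "\<Gamma>' \<circ> ?\<psi>"] \<Gamma>' \<psi>I by auto
  \<comment> \<open>\<open>S2\<close> and \<open>K2\<close> live on the arc parameter, while a
    reduced Cartan matrix is indexed by the original parameter.\<close>
  define C where "C t = cartan_block (S2 (\<phi> t)) (K2 (\<phi> t))" for t
  have C: "(C \<circ> ?\<psi>) \<tau> = cartan_block (S2 \<tau>) (K2 \<tau>)" if "\<tau> \<in> ?J" for \<tau>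
    using that by (simp add: C_def f_inv_into_f)
  have "reduced_cartan_matrix \<omega> \<Gamma> I C"
    unfolding reduced_cartan_matrix_def
    using d\<phi> diagonal_frame_arc_cartan_matrix[OF \<omega> \<sigma> df2 J'(2) C] by blast
  moreover have "reduced_cartan_matrix \<omega> \<Gamma>' I C"
    unfolding reduced_cartan_matrix_def
  proof (intro exI[of _ \<phi>] conjI ballI)
    show "(\<phi> has_real_derivative arc_density TYPE('n) \<omega> \<Gamma>' t) (at t)" if "t \<in> I" for t
      using d\<phi>[OF that] bspec[OF same that] by simp
    show "arc_cartan_matrix \<omega> (\<Gamma>' \<circ> ?\<psi>) ?J (C \<circ> ?\<psi>)"
      by (rule diagonal_frame_arc_cartan_matrix[OF \<omega> \<sigma>l df3 J'(2) C])
  qed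
  moreover have "cartan_equivalent I C C" by (rule cartan_equivalent_refl) (rule C_def)
  ultimately show "equivalent_cartan_matrices TYPE('n) \<omega> \<Gamma> \<Gamma>' I"
    unfolding equivalent_cartan_matrices_def by blast
qed

lemma congruent_iff:
  fixes \<omega> :: "'w::euclidean_space \<Rightarrow> 'w \<Rightarrow> real"
  assumes \<omega>: "symplectic_form \<omega>" and dim: "DIM('w) = 2 * CARD('n::{finite,linorder})"
    and jac: "jacobi_curve TYPE('n::{finite,linorder}) \<omega> \<Gamma> I" "jacobi_curve TYPE('n) \<omega> \<Gamma>' I"
  shows "CSp_congruent \<omega> \<Gamma> \<Gamma>' I \<longleftrightarrow> (\<forall>t\<in>I. arc_density TYPE('n) \<omega> \<Gamma> t = arc_density TYPE('n) \<omega> \<Gamma>' t) \<and>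
    equivalent_cartan_matrices TYPE('n) \<omega> \<Gamma> \<Gamma>' I"
  using congruent_imp_equivalent_cartan[OF \<omega> dim jac(1)] equivalent_cartan_imp_congruent[OF \<omega> jac]
  unfolding equivalent_cartan_matrices_def by blast

section \<open>Existence of curves with prescribed structure equations\<close>

text \<open>A block matrix with skew S and symmetric K belongs to the Lie algebra of the symplectic
  group of \<open>J0\<close>.\<close>

lemma symplectic_gram_stationary:
  fixes S K :: "real^'n^'n" and J0 :: "real^('n + 'n)^('n + 'n)"
  assumes "transpose S = - S" "transpose K = K"
    and J0: "J0 = (\<chi> x y. case x of Inl i \<Rightarrow> (case y of Inl j \<Rightarrow> 0 | Inr j \<Rightarrow> if i = j then 1 else 0)
      | Inr i \<Rightarrow> (case y of Inl j \<Rightarrow> if i = j then - 1 else 0 | Inr j \<Rightarrow> 0))"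
  shows "transpose (cartan_block S K) ** J0 + J0 ** cartan_block S K = 0"
proof -
  have S: "S $ i $ j = - S $ j $ i" for i j using arg_cong[OF assms(1), of "\<lambda>A. A $ j $ i"] by (simp add: transpose_def)
  have K: "K $ i $ j = K $ j $ i" for i j using arg_cong[OF assms(2), of "\<lambda>A. A $ j $ i"] by (simp add: transpose_def)
  have split: "(\<Sum>z\<in>UNIV. g z) = (\<Sum>i\<in>UNIV. g (Inl i)) + (\<Sum>i\<in>UNIV. g (Inr i))" for g :: "'n + 'n \<Rightarrow> real"
    by (subst UNIV_Plus_UNIV[symmetric], subst sum.Plus) (auto simp: o_def)
  have "(transpose (cartan_block S K) ** J0 + J0 ** cartan_block S K) $ x $ y = 0" for x y
  proof (cases x; cases y)
    fix i j assume "x = Inl i" "y = Inr j"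
    then show ?thesis using S[of i j]
      by (simp add: J0 matrix_matrix_mult_def transpose_def split cartan_block_def mat_def
          if_distrib[of "\<lambda>r. _ * r"] if_distrib[of "\<lambda>r. r * _"] sum_negf cong: if_cong)
  next
    fix i j assume "x = Inr i" "y = Inl j"
    then show ?thesis using S[of i j]
      by (simp add: J0 matrix_matrix_mult_def transpose_def split cartan_block_def mat_def
          if_distrib[of "\<lambda>r. _ * r"] if_distrib[of "\<lambda>r. r * _"] sum_negf cong: if_cong)
  next
    fix i j assume "x = Inr i" "y = Inr j"
    then show ?thesis using K[of i j]
      by (simp add: J0 matrix_matrix_mult_def transpose_def split cartan_block_def mat_def
          if_distrib[of "\<lambda>r. _ * r"] if_distrib[of "\<lambda>r. r * _"] sum_negf cong: if_cong)
  next
    fix i j assume "x = Inl i" "y = Inl j"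
    then show ?thesis
      by (simp add: J0 matrix_matrix_mult_def transpose_def split cartan_block_def mat_def
          if_distrib[of "\<lambda>r. _ * r"] if_distrib[of "\<lambda>r. r * _"] sum_negf cong: if_cong)
  qed
  then show ?thesis by (simp add: vec_eq_iff)
qed

text \<open>The Gram matrix of a solution of F' = F C and the standard one solve the same linear equation.\<close>

lemma cartan_frame_exists:
  fixes \<omega> :: "'w::euclidean_space \<Rightarrow> 'w \<Rightarrow> real" and S K :: "real \<Rightarrow> real^'n^'n"
  assumes \<omega>: "symplectic_form \<omega>" and dim: "DIM('w) = 2 * CARD('n)"
    and J: "open J" "is_interval J" "J \<noteq> {}" and sm: "smooth_on_line S J" "smooth_on_line K J"
    and skew: "\<And>t. t \<in> J \<Longrightarrow> transpose (S t) = - S t" and sym: "\<And>t. t \<in> J \<Longrightarrow> transpose (K t) = K t"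
  obtains F :: "real \<Rightarrow> 'n::finite + 'n \<Rightarrow> 'w" where
    "cartan_frame \<omega> (\<lambda>t. span (range (\<lambda>i. F t (Inl i)))) J F S K"
proof -
  interpret bounded_bilinear \<omega> by (rule symplectic_bilinear[OF \<omega>])
  note bil = bilinear_lincomb[OF symplectic_bilinear[OF \<omega>]]
  obtain t0 where t0: "t0 \<in> J" using J(3) by blast
  obtain e :: "'n + 'n \<Rightarrow> 'w" where e: "symplectic_basis \<omega> e" using symplectic_basis_exists[OF \<omega> dim] .
  define C where "C t = cartan_block (S t) (K t)" for t
  have sC: "smooth_on_line C J" unfolding C_def cartan_block_def
  proof (intro smooth_vec_lambda J(1))
    fix x y :: "'n + 'n"
    show "smooth_on_line (\<lambda>t. case x of Inl a \<Rightarrow> (case y of Inl b \<Rightarrow> S t $ a $ b | Inr b \<Rightarrow> K t $ a $ b)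
        | Inr a \<Rightarrow> (case y of Inl b \<Rightarrow> mat 1 $ a $ b | Inr b \<Rightarrow> S t $ a $ b)) J"
      by (cases x; cases y) (auto intro!: smooth_vec_nth smooth_const J(1) sm)
  qed
  \<comment> \<open>All 2n frame vectors form one element X of a vector space, on which matrices act
    by the right-hand side of F' = F C. Bilinearity of the action turns smooth C into a smooth
    operator coefficient.\<close>
  have bX: "bounded_bilinear (\<lambda>(C :: real^('n + 'n)^('n + 'n)) (X :: 'w^('n + 'n)). \<chi> y. \<Sum>x\<in>UNIV. C $ x $ y *\<^sub>R X $ x)"
    unfolding bilinear_conv_bounded_bilinear[symmetric] bilinear_def
  proof (intro conjI allI; rule linearI)
    fix C C' :: "real^('n + 'n)^('n + 'n)" and X X' :: "'w^('n + 'n)" and r :: real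
    show "(\<chi> y. \<Sum>x\<in>UNIV. C $ x $ y *\<^sub>R (X + X') $ x) =
        (\<chi> y. \<Sum>x\<in>UNIV. C $ x $ y *\<^sub>R X $ x) + (\<chi> y. \<Sum>x\<in>UNIV. C $ x $ y *\<^sub>R X' $ x)"
      by (simp add: vec_eq_iff scaleR_add_right sum.distrib)
    show "(\<chi> y. \<Sum>x\<in>UNIV. C $ x $ y *\<^sub>R (r *\<^sub>R X) $ x) = r *\<^sub>R (\<chi> y. \<Sum>x\<in>UNIV. C $ x $ y *\<^sub>R X $ x)"
      by (simp add: vec_eq_iff scaleR_sum_right mult.commute)
    show "(\<chi> y. \<Sum>x\<in>UNIV. (C + C') $ x $ y *\<^sub>R X $ x) =
        (\<chi> y. \<Sum>x\<in>UNIV. C $ x $ y *\<^sub>R X $ x) + (\<chi> y. \<Sum>x\<in>UNIV. C' $ x $ y *\<^sub>R X $ x)"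
      by (simp add: vec_eq_iff scaleR_add_left sum.distrib)
    show "(\<chi> y. \<Sum>x\<in>UNIV. (r *\<^sub>R C) $ x $ y *\<^sub>R X $ x) = r *\<^sub>R (\<chi> y. \<Sum>x\<in>UNIV. C $ x $ y *\<^sub>R X $ x)"
      by (simp add: vec_eq_iff scaleR_sum_right)
  qed
  note bX' = bounded_linear_Blinfun_of_bilinear[OF bX]
  let ?L = "\<lambda>t. Blinfun (\<lambda>X :: 'w^('n + 'n). \<chi> y. \<Sum>x\<in>UNIV. C t $ x $ y *\<^sub>R X $ x)"
  have sL: "smooth_on_line ?L J" by (rule smooth_linear[OF bX'(1) J(1) sC])
  obtain X where X0: "X t0 = (\<chi> x. e x)" and dX: "\<And>t. t \<in> J \<Longrightarrow> (X has_vector_derivative ?L t (X t)) (at t)"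
    by (rule linear_ode_existence[OF J(1,2) t0 smooth_continuous_on[OF sL], of "\<chi> x. e x"], rule that)
  have sX: "smooth_on_line X J" by (rule linear_ode_smooth[OF J(1) sL dX])
  define F where "F t x = X t $ x" for t x
  have sF: "smooth_on_line (\<lambda>t. F t x) J" for x unfolding F_def by (intro smooth_vec_nth sX J(1))
  have dF: "((\<lambda>s. F s x) has_vector_derivative lincomb (F t) (column x (C t))) (at t)" if t: "t \<in> J" for t x
  proof -
    have "((\<lambda>s. X s $ x) has_vector_derivative ?L t (X t) $ x) (at t)"
      by (rule bounded_linear.has_vector_derivative[OF bounded_linear_vec_nth dX[OF t]])
    then show ?thesis by (simp add: bX'(2) lincomb_def column_def F_def)
  qed
  define J0 :: "real^('n + 'n)^('n + 'n)" where
    "J0 = (\<chi> x y. case x of Inl i \<Rightarrow> (case y of Inl j \<Rightarrow> 0 | Inr j \<Rightarrow> if i = j then 1 else 0)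
      | Inr i \<Rightarrow> (case y of Inl j \<Rightarrow> if i = j then - 1 else 0 | Inr j \<Rightarrow> 0))"
  \<comment> \<open>The defect of the Gram matrix vanishes at t0 and satisfies E' = C^T E + E C,
    because \<open>J0\<close> is a constant solution of the same equation.\<close>
  define E where "E t = (\<chi> x y. \<omega> (F t x) (F t y)) - J0" for t
  have bE: "bounded_bilinear (\<lambda>(C :: real^('n + 'n)^('n + 'n)) (E :: real^('n + 'n)^('n + 'n)). transpose C ** E + E ** C)"
    unfolding bilinear_conv_bounded_bilinear[symmetric] bilinear_def
    by (auto intro!: linearI simp: vec_eq_iff matrix_matrix_mult_def transpose_def algebra_simps sum.distrib sum_distrib_left)
  note bE' = bounded_linear_Blinfun_of_bilinear[OF bE]
  let ?M = "\<lambda>t. Blinfun (\<lambda>E. transpose (C t) ** E + E ** C t)"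
  have sM: "smooth_on_line ?M J" by (rule smooth_linear[OF bE'(1) J(1) sC])
  have E0: "E t = 0" if t: "t \<in> J" for t
  proof (rule linear_ode_zero[OF J(1,2) t0 smooth_continuous_on[OF sM] _ _ t])
    note s = symplectic_basisD[OF e]
    have s5: "\<omega> (e (Inr i)) (e (Inl j)) = (if i = j then -1 else 0)" for i j
      using symplectic_skew[OF \<omega>, of "e (Inr i)" "e (Inl j)"] s(4)[of j i] by auto
    have "\<omega> (e x) (e y) = J0 $ x $ y" for x y
      by (cases x; cases y) (simp_all add: J0_def s s5)
    then show "E t0 = 0" by (simp add: E_def F_def X0 vec_eq_iff)
    fix t assume t: "t \<in> J"
    have "((\<lambda>s. E s $ x $ y) has_vector_derivative (?M t (E t)) $ x $ y) (at t)" for x y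
    proof -
      let ?G = "\<chi> x y. \<omega> (F t x) (F t y)"
      have "((\<lambda>s. \<omega> (F s x) (F s y) - J0 $ x $ y) has_vector_derivative
         (\<omega> (F t x) (lincomb (F t) (column y (C t))) + \<omega> (lincomb (F t) (column x (C t))) (F t y)) - 0) (at t)"
        by (intro has_vector_derivative_diff has_vector_derivative dF t has_vector_derivative_const)
      moreover have "(\<omega> (F t x) (lincomb (F t) (column y (C t))) + \<omega> (lincomb (F t) (column x (C t))) (F t y)) - 0 =
         (transpose (C t) ** ?G + ?G ** C t) $ x $ y"
        by (simp add: bil matrix_matrix_mult_def transpose_def column_def mult.commute)
      moreover have "transpose (C t) ** ?G + ?G ** C t = transpose (C t) ** E t + E t ** C t"
      proof -
        have "transpose (C t) ** J0 + J0 ** C t = 0"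
          unfolding C_def by (rule symplectic_gram_stationary[OF skew[OF t] sym[OF t] J0_def])
        moreover have "?G = E t + J0" by (simp add: E_def)
        ultimately show ?thesis
          using bounded_bilinear.add_right[OF bE, of "C t" "E t" J0] by simp
      qed
      ultimately show ?thesis by (simp add: E_def bE'(2))
    qed
    then have "((\<lambda>s. E s) has_vector_derivative ?M t (E t)) (at t)"
      unfolding has_vector_derivative_def by (subst has_derivative_componentwise_within) (auto simp: Basis_vec_def inner_axis)
    then show "(E has_vector_derivative ?M t (E t)) (at t)" .
  qed
  have rel: "\<omega> (F t x) (F t y) = J0 $ x $ y" if "t \<in> J" for t x y
    using E0[OF that] by (simp add: E_def vec_eq_iff)
  have sb: "symplectic_basis \<omega> (F t)" if t: "t \<in> J" for t
    by (rule symplectic_basisI[OF \<omega> dim]) (simp_all add: rel[OF t] J0_def)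
  have "cartan_frame \<omega> (\<lambda>t. span (range (\<lambda>i. F t (Inl i)))) J F S K"
    unfolding cartan_frame_def
  proof (intro conjI ballI allI J(1) sF sm sb refl)
    fix t i assume t: "t \<in> J"
    have "(\<chi> k. column (Inl i) (C t) $ Inl k) = column i (S t)" "(\<chi> k. column (Inl i) (C t) $ Inr k) = axis i 1"
      "(\<chi> k. column (Inr i) (C t) $ Inl k) = column i (K t)" "(\<chi> k. column (Inr i) (C t) $ Inr k) = column i (S t)"
      by (auto simp: column_def C_def cartan_block_def vec_eq_iff mat_def axis_def)
    note col = this
    show "((\<lambda>s. F s (Inl i)) has_vector_derivative F t (Inr i) + lincomb (\<lambda>j. F t (Inl j)) (column i (S t))) (at t)"
      using dF[OF t, of "Inl i"] unfolding lincomb_sum_type[of "F t"] col by (simp add: add.commute)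
    show "((\<lambda>s. F s (Inr i)) has_vector_derivative
        lincomb (\<lambda>j. F t (Inl j)) (column i (K t)) + lincomb (\<lambda>j. F t (Inr j)) (column i (S t))) (at t)"
      using dF[OF t, of "Inr i"] unfolding lincomb_sum_type[of "F t"] col .
  qed
  then show ?thesis by (rule that)
qed

text \<open>The curve is built in the arc parameter \<phi>, an antiderivative of |\<zeta>|, where S
  and K are prescribed directly, and is then pulled back to t. The frame pulled back by
  \<open>diagonal_frame_reparam\<close> serves for the Jacobi property and the density; the original
  frame gives the Cartan matrix.\<close>

lemma jacobi_curve_exists:
  fixes \<omega> :: "'w::euclidean_space \<Rightarrow> 'w \<Rightarrow> real" and S K :: "real \<Rightarrow> real^('n::{finite,linorder})^('n::{finite,linorder})"
  assumes \<omega>: "symplectic_form \<omega>" and dim: "DIM('w) = 2 * CARD('n::{finite,linorder})"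
    and I: "open_interval I" and sm: "smooth_on_line S I" "smooth_on_line K I"
    and SK: "\<And>t. t \<in> I \<Longrightarrow> transpose (S t) = - S t \<and> diagonal_matrix (K t) \<and>
               (\<forall>i j. i < j \<longrightarrow> K t $ i $ i < K t $ j $ j)"
    and dev: "\<And>t. t \<in> I \<Longrightarrow> \<bar>deviation_product (K t)\<bar> = 1"
    and \<zeta>: "smooth_on_line \<zeta> I" "\<And>t. t \<in> I \<Longrightarrow> \<zeta> t \<noteq> 0"
  obtains \<Gamma> where "jacobi_curve TYPE('n::{finite,linorder}) \<omega> \<Gamma> I"
    "reduced_cartan_matrix \<omega> \<Gamma> I (\<lambda>t. cartan_block (S t) (K t))"
    "\<And>t. t \<in> I \<Longrightarrow> arc_density TYPE('n::{finite,linorder}) \<omega> \<Gamma> t = \<bar>\<zeta> t\<bar>"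
proof -
  have I': "open I" "I \<noteq> {}" using I by (auto simp: open_interval_def)
  \<comment> \<open>A nowhere vanishing smooth function has smooth absolute value, seen here as the
    power with exponent 1.\<close>
  have "smooth_on_line (\<lambda>t. \<bar>\<zeta> t\<bar> powr 1) I" by (rule smooth_abs_powr[OF I'(1) \<zeta>])
  then have s\<zeta>: "smooth_on_line (\<lambda>t. \<bar>\<zeta> t\<bar>) I" by simp
  obtain \<phi> where d\<phi>: "\<And>t. t \<in> I \<Longrightarrow> (\<phi> has_real_derivative \<bar>\<zeta> t\<bar>) (at t)"
    and s\<phi>: "smooth_on_line \<phi> I" and inj: "inj_on \<phi> I" and J: "open_interval (\<phi> ` I)"
    and s\<psi>: "smooth_on_line (inv_into I \<phi>) (\<phi> ` I)" and "\<And>\<tau>. \<tau> \<in> \<phi> ` I \<Longrightarrow> vderiv (inv_into I \<phi>) \<tau> > 0"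
  proof (rule arc_parameter[OF I s\<zeta>])
    show "0 < \<bar>\<zeta> t\<bar>" if "t \<in> I" for t using \<zeta>(2)[OF that] by simp
  qed (rule that)
  let ?\<psi> = "inv_into I \<phi>" and ?J = "\<phi> ` I"
  have J': "open ?J" "is_interval ?J" "?J \<noteq> {}" using J by (auto simp: open_interval_def)
  have \<psi>I: "?\<psi> \<tau> \<in> I" if "\<tau> \<in> ?J" for \<tau> using that by (rule inv_into_into)
  let ?S = "\<lambda>\<tau>. S (?\<psi> \<tau>)" and ?K = "\<lambda>\<tau>. K (?\<psi> \<tau>)"
  have sS: "smooth_on_line ?S ?J" and sK: "smooth_on_line ?K ?J"
    using smooth_compose[OF I'(1) J'(1) \<psi>I sm(1) s\<psi>] smooth_compose[OF I'(1) J'(1) \<psi>I sm(2) s\<psi>] by auto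
  have skew: "transpose (?S \<tau>) = - ?S \<tau>" if "\<tau> \<in> ?J" for \<tau> using SK[OF \<psi>I[OF that]] by blast
  have sym: "transpose (?K \<tau>) = ?K \<tau>" if "\<tau> \<in> ?J" for \<tau>
    using SK[OF \<psi>I[OF that]] by (auto simp: vec_eq_iff transpose_def diagonal_matrix_def) metis
  obtain F :: "real \<Rightarrow> 'n + 'n \<Rightarrow> 'w" where
    fr: "cartan_frame \<omega> (\<lambda>t. span (range (\<lambda>i. F t (Inl i)))) ?J F ?S ?K"
    by (rule cartan_frame_exists[OF \<omega> dim J' sS sK skew sym], assumption, assumption, rule that)
  define \<Gamma>0 where "\<Gamma>0 t = span (range (\<lambda>i. F t (Inl i)))" for t
  have df0: "diagonal_frame \<omega> \<Gamma>0 ?J F ?S ?K"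
    using fr SK[OF \<psi>I] unfolding \<Gamma>0_def diagonal_frame_def by blast
  obtain F' :: "real \<Rightarrow> 'n + 'n \<Rightarrow> 'w" and S' K' where
    df: "diagonal_frame (\<lambda>u v. 1 * \<omega> u v) (\<Gamma>0 \<circ> \<phi>) I F' S' K'" and
    dev': "\<And>t. t \<in> I \<Longrightarrow> deviation_product (K' t) = ((vderiv \<phi> t)\<^sup>2) ^ CARD('n) * deviation_product (?K (\<phi> t))"
  proof (rule diagonal_frame_reparam[OF \<omega> dim df0 I'(1) s\<phi>, of 1])
    show "1 * vderiv \<phi> t > 0" if "t \<in> I" for t
      using vderiv_eqI[OF d\<phi>[OF that, unfolded has_real_derivative_iff_has_vector_derivative]] \<zeta>(2)[OF that] by simp
  qed (use that in auto)
  have vd: "vderiv \<phi> t = \<bar>\<zeta> t\<bar>" if "t \<in> I" for t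
    by (rule vderiv_eqI[OF d\<phi>[OF that, unfolded has_real_derivative_iff_has_vector_derivative]])
  \<comment> \<open>The prescribed K contributes 1 by the normalisation, so only the
    reparametrisation factor remains; its root of order 2n is |\<zeta>|.\<close>
  have devabs: "\<bar>deviation_product (K' t)\<bar> = \<bar>\<zeta> t\<bar> ^ (2 * CARD('n))" if "t \<in> I" for t
    using dev[OF that] inj that by (simp add: dev'[OF that] vd[OF that] abs_mult power_mult power_abs)
  have arc: "arc_density TYPE('n) \<omega> (\<Gamma>0 \<circ> \<phi>) t = \<bar>\<zeta> t\<bar>" if t: "t \<in> I" for t
  proof -
    have z: "\<bar>\<zeta> t\<bar> > 0" using \<zeta>(2)[OF t] by simp
    have "arc_density TYPE('n) \<omega> (\<Gamma>0 \<circ> \<phi>) t = (\<bar>\<zeta> t\<bar> ^ (2 * CARD('n))) powr (1 / (2 * real CARD('n)))"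
      using diagonal_frame_arc_density[OF \<omega> _ df t] devabs[OF t] by simp
    also have "\<dots> = (\<bar>\<zeta> t\<bar> powr real (2 * CARD('n))) powr (1 / (2 * real CARD('n)))"
      using powr_realpow[OF z, of "2 * CARD('n)"] by simp
    also have "\<dots> = \<bar>\<zeta> t\<bar>" using z unfolding powr_powr by simp
    finally show ?thesis .
  qed
  have "jacobi_curve TYPE('n) \<omega> (\<Gamma>0 \<circ> \<phi>) I"
  proof (rule diagonal_frame_jacobi[OF \<omega> _ df I])
    show "deviation_product (K' t) \<noteq> 0" if "t \<in> I" for t
      using devabs[OF that] \<zeta>(2)[OF that] by auto
  qed simp
  moreover have "reduced_cartan_matrix \<omega> (\<Gamma>0 \<circ> \<phi>) I (\<lambda>t. cartan_block (S t) (K t))"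
    unfolding reduced_cartan_matrix_def
  proof (intro exI[of _ \<phi>] conjI ballI)
    show "(\<phi> has_real_derivative arc_density TYPE('n) \<omega> (\<Gamma>0 \<circ> \<phi>) t) (at t)" if "t \<in> I" for t
      using d\<phi>[OF that] arc[OF that] by simp
    \<comment> \<open>Going to t and back to the arc parameter restores the original curve on the
      image of \<phi>, so its frame can be used again with the prescribed S and K.\<close>
    have "diagonal_frame (\<lambda>u v. 1 * \<omega> u v) (\<Gamma>0 \<circ> \<phi> \<circ> ?\<psi>) ?J F ?S ?K"
      using df0 by (simp add: diagonal_frame_def cartan_frame_def f_inv_into_f)
    then show "arc_cartan_matrix \<omega> (\<Gamma>0 \<circ> \<phi> \<circ> ?\<psi>) ?J ((\<lambda>t. cartan_block (S t) (K t)) \<circ> ?\<psi>)"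
      by (rule diagonal_frame_arc_cartan_matrix[OF \<omega> _ _ J'(3), rotated]) auto
  qed
  ultimately show ?thesis using that arc by blast
qed


text \<open>Equivalence of curves with separate parameters is stated through a change of parameter,
  and congruence for curves already on the same interval. As R = -2 K, unit arc density means that
  the product of the |2 (k_i - \<bar>k)| is 1, with \<bar>k the mean, rather than the product
  without the factor 2. The arc density is positive, so the prescribed form enters through
  |\<zeta>|.\<close>

theorem theorem4:
  fixes \<omega> :: "'w::euclidean_space \<Rightarrow> 'w \<Rightarrow> real"
  assumes "symplectic_form \<omega>"
    and "DIM('w) = 2 * CARD('n::{finite,linorder})"
  shows
    "(\<forall>\<Gamma> I \<Gamma>' J.
        jacobi_curve TYPE('n) \<omega> \<Gamma> I \<and> geometric_arc TYPE('n) \<omega> \<Gamma> I \<and>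
        jacobi_curve TYPE('n) \<omega> \<Gamma>' J \<and> geometric_arc TYPE('n) \<omega> \<Gamma>' J \<longrightarrow>
        (CSp_equivalent \<omega> \<Gamma> I \<Gamma>' J \<longleftrightarrow>
          (\<exists>\<phi>. change_of_parameter \<phi> J I \<and> geometric_arc TYPE('n) \<omega> (\<Gamma> \<circ> \<phi>) J \<and>
               equivalent_cartan_matrices TYPE('n) \<omega> (\<Gamma> \<circ> \<phi>) \<Gamma>' J)) \<and>
        (I = J \<longrightarrow>
          (CSp_congruent \<omega> \<Gamma> \<Gamma>' I \<longleftrightarrow> equivalent_cartan_matrices TYPE('n) \<omega> \<Gamma> \<Gamma>' I)))
     \<and>
     (\<forall>\<Gamma> I \<Gamma>' J.
        jacobi_curve TYPE('n) \<omega> \<Gamma> I \<and> jacobi_curve TYPE('n) \<omega> \<Gamma>' J \<longrightarrow>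
        (CSp_equivalent \<omega> \<Gamma> I \<Gamma>' J \<longleftrightarrow>
          (\<exists>\<phi>. change_of_parameter \<phi> J I \<and>
               (\<forall>t\<in>J. arc_density TYPE('n) \<omega> (\<Gamma> \<circ> \<phi>) t = arc_density TYPE('n) \<omega> \<Gamma>' t) \<and>
               equivalent_cartan_matrices TYPE('n) \<omega> (\<Gamma> \<circ> \<phi>) \<Gamma>' J)) \<and>
        (I = J \<longrightarrow>
          (CSp_congruent \<omega> \<Gamma> \<Gamma>' I \<longleftrightarrow>
            (\<forall>t\<in>I. arc_density TYPE('n) \<omega> \<Gamma> t = arc_density TYPE('n) \<omega> \<Gamma>' t) \<and>
            equivalent_cartan_matrices TYPE('n) \<omega> \<Gamma> \<Gamma>' I)))
     \<and>
     (\<forall>I (S :: real \<Rightarrow> real^('n::{finite,linorder})^('n::{finite,linorder}))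
        (K :: real \<Rightarrow> real^('n::{finite,linorder})^('n::{finite,linorder})) (\<zeta> :: real \<Rightarrow> real).
        open_interval I \<and> smooth_on_line S I \<and> smooth_on_line K I \<and>
        (\<forall>t\<in>I. transpose (S t) = - S t \<and> diagonal_matrix (K t) \<and>
               (\<forall>i j. i < j \<longrightarrow> K t $ i $ i < K t $ j $ j) \<and>
               (\<Prod>i\<in>UNIV. \<bar>2 * (K t $ i $ i - (\<Sum>j\<in>UNIV. K t $ j $ j) / real CARD('n))\<bar>) = 1) \<and>
        smooth_on_line \<zeta> I \<and> (\<forall>t\<in>I. \<zeta> t \<noteq> 0) \<longrightarrow>
        (\<exists>\<Gamma>. jacobi_curve TYPE('n) \<omega> \<Gamma> I \<and>
             reduced_cartan_matrix \<omega> \<Gamma> I (\<lambda>t. cartan_block (S t) (K t)) \<and>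
             (\<forall>t\<in>I. arc_density TYPE('n) \<omega> \<Gamma> t = \<bar>\<zeta> t\<bar>) \<and>
             (\<forall>\<Gamma>'. jacobi_curve TYPE('n) \<omega> \<Gamma>' I \<and>
                   reduced_cartan_matrix \<omega> \<Gamma>' I (\<lambda>t. cartan_block (S t) (K t)) \<and>
                   (\<forall>t\<in>I. arc_density TYPE('n) \<omega> \<Gamma>' t = \<bar>\<zeta> t\<bar>) \<longrightarrow>
                   CSp_congruent \<omega> \<Gamma> \<Gamma>' I)))"
proof -
  have cong: "CSp_congruent \<omega> \<Gamma> \<Gamma>' I \<longleftrightarrow> (\<forall>t\<in>I. arc_density TYPE('n) \<omega> \<Gamma> t = arc_density TYPE('n) \<omega> \<Gamma>' t) \<and>
      equivalent_cartan_matrices TYPE('n) \<omega> \<Gamma> \<Gamma>' I"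
    if "jacobi_curve TYPE('n) \<omega> \<Gamma> I" "jacobi_curve TYPE('n) \<omega> \<Gamma>' I" for \<Gamma> \<Gamma>' I
    by (rule congruent_iff[OF assms that])
  have eqv: "CSp_equivalent \<omega> \<Gamma> I \<Gamma>' J \<longleftrightarrow> (\<exists>\<phi>. change_of_parameter \<phi> J I \<and>
      (\<forall>t\<in>J. arc_density TYPE('n) \<omega> (\<Gamma> \<circ> \<phi>) t = arc_density TYPE('n) \<omega> \<Gamma>' t) \<and>
      equivalent_cartan_matrices TYPE('n) \<omega> (\<Gamma> \<circ> \<phi>) \<Gamma>' J)"
    if jac: "jacobi_curve TYPE('n) \<omega> \<Gamma> I" "jacobi_curve TYPE('n) \<omega> \<Gamma>' J" for \<Gamma> I \<Gamma>' J
  proof -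
    have "open_interval J" using jac(2) by (simp add: jacobi_curve_def)
    then have "jacobi_curve TYPE('n) \<omega> (\<Gamma> \<circ> \<phi>) J" if "change_of_parameter \<phi> J I" for \<phi>
      using jacobi_reparam[OF assms jac(1) _ that] by blast
    then show ?thesis unfolding CSp_equivalent_def using cong[OF _ jac(2)] by blast
  qed
  \<comment> \<open>In part (1) the density of the second curve is 1, so equality of densities says
    that the first curve is in geometric arc as well.\<close>
  have arc: "geometric_arc TYPE('n) \<omega> \<Gamma> J \<longleftrightarrow> (\<forall>t\<in>J. arc_density TYPE('n) \<omega> \<Gamma> t = arc_density TYPE('n) \<omega> \<Gamma>' t)"
    if "geometric_arc TYPE('n) \<omega> \<Gamma>' J" for \<Gamma> \<Gamma>' J
    using that by (simp add: geometric_arc_def)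
  have part3: "\<exists>\<Gamma>. jacobi_curve TYPE('n) \<omega> \<Gamma> I \<and>
             reduced_cartan_matrix \<omega> \<Gamma> I (\<lambda>t. cartan_block (S t) (K t)) \<and>
             (\<forall>t\<in>I. arc_density TYPE('n) \<omega> \<Gamma> t = \<bar>\<zeta> t\<bar>) \<and>
             (\<forall>\<Gamma>'. jacobi_curve TYPE('n) \<omega> \<Gamma>' I \<and>
                   reduced_cartan_matrix \<omega> \<Gamma>' I (\<lambda>t. cartan_block (S t) (K t)) \<and>
                   (\<forall>t\<in>I. arc_density TYPE('n) \<omega> \<Gamma>' t = \<bar>\<zeta> t\<bar>) \<longrightarrow>
                   CSp_congruent \<omega> \<Gamma> \<Gamma>' I)"
    if I: "open_interval I" and sm: "smooth_on_line S I" "smooth_on_line K I"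
      and SK: "\<forall>t\<in>I. transpose (S t) = - S t \<and> diagonal_matrix (K t) \<and>
               (\<forall>i j. i < j \<longrightarrow> K t $ i $ i < K t $ j $ j) \<and>
               (\<Prod>i\<in>UNIV. \<bar>2 * (K t $ i $ i - (\<Sum>j\<in>UNIV. K t $ j $ j) / real CARD('n))\<bar>) = 1"
      and \<zeta>: "smooth_on_line \<zeta> I" "\<forall>t\<in>I. \<zeta> t \<noteq> 0"
    for I and S K :: "real \<Rightarrow> real^('n::{finite,linorder})^('n::{finite,linorder})" and \<zeta> :: "real \<Rightarrow> real"
  proof -
    have dev: "\<bar>deviation_product (K t)\<bar> = 1" if "t \<in> I" for t
      using bspec[OF SK that] by (simp only: deviation_product_def abs_prod)
    obtain \<Gamma> where \<Gamma>: "jacobi_curve TYPE('n) \<omega> \<Gamma> I"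
      "reduced_cartan_matrix \<omega> \<Gamma> I (\<lambda>t. cartan_block (S t) (K t))"
      "\<And>t. t \<in> I \<Longrightarrow> arc_density TYPE('n) \<omega> \<Gamma> t = \<bar>\<zeta> t\<bar>"
      by (rule jacobi_curve_exists[OF assms I sm _ dev \<zeta>(1)]) (use SK \<zeta>(2) that in blast)+
    have refl: "cartan_equivalent I (\<lambda>t. cartan_block (S t) (K t)) (\<lambda>t. cartan_block (S t) (K t))"
      by (rule cartan_equivalent_refl) (rule refl)
    show ?thesis
    proof (intro exI[of _ \<Gamma>] conjI allI impI ballI \<Gamma>)
      fix \<Gamma>' assume \<Gamma>': "jacobi_curve TYPE('n) \<omega> \<Gamma>' I \<and>
                   reduced_cartan_matrix \<omega> \<Gamma>' I (\<lambda>t. cartan_block (S t) (K t)) \<and>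
                   (\<forall>t\<in>I. arc_density TYPE('n) \<omega> \<Gamma>' t = \<bar>\<zeta> t\<bar>)"
      then have "\<forall>t\<in>I. arc_density TYPE('n) \<omega> \<Gamma> t = arc_density TYPE('n) \<omega> \<Gamma>' t" using \<Gamma>(3) by simp
      then show "CSp_congruent \<omega> \<Gamma> \<Gamma>' I"
        using equivalent_cartan_imp_congruent[OF assms(1) \<Gamma>(1) _ _ \<Gamma>(2) _ refl] \<Gamma>' by blast
    qed
  qed
  show ?thesis
  proof ((intro conjI allI impI; elim conjE), goal_cases)
    case (1 \<Gamma> I \<Gamma>' J)
    then show ?case using eqv[of \<Gamma> I \<Gamma>' J] arc[of \<Gamma>' J] by simp
  next
    case (2 \<Gamma> I \<Gamma>' J)
    then show ?case using cong[of \<Gamma> I \<Gamma>'] arc[of \<Gamma>' J \<Gamma>] by simp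
  next
    case (3 \<Gamma> I \<Gamma>' J)
    then show ?case using eqv by blast
  next
    case (4 \<Gamma> I \<Gamma>' J)
    then show ?case using cong by blast
  next
    case (5 I S K \<zeta>)
    then show ?case using part3 by blast
  qed
qed

end
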